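(* (Inversion Formula) Let $n=2$, $X=X_2$, $K=GL_2(\mathcal O)$. For any $\varphi\in\mathcal S(K\backslash X)$, $$\varphi(x)=\frac{1}{v(K\cdot x)}\,\langle F(\varphi),F(ch_x)\rangle\qquad(x\in X),$$ where $ch_x\in\mathcal S(K\backslash X)$ is the characteristic function of $K\cdot x$, $v(K\cdot x)$ is its volume, and $\langle\ ,\ \rangle$ is the inner product on $\mathbb C[q^{x},q^{-x},q^y+q^{-y}]$ defined in the context.
   Context: $k$ is a $\mathfrak p$-adic field of odd residual characteristic with ring of integers $\mathfrak o$, prime element $\pi$, $q=\#(\mathfrak o/\pi\mathfrak o)$, absolute value $|\cdot|$ with $|\pi|=q^{-1}$. $D$ is the division quaternion algebra over $k$ with canonical involution $*$ and maximal order $\mathcal O$; $N_{rd}$ is the reduced norm. For $A=(a_{ij})$, $A^*=(a_{ji}^* )$. $G=GL_2(D)$, $X_2=\{A\in G:A^*=A\}$, $g\cdot A=gAg^*$. $dx$ on $X$ is the $G$-invariant measure with $v(K\cdot1_2)=1$, $v$ denoting volume. $\mathcal S(K\backslash X)$ is the space of left $K$-invariant compactly supported functions $X\to\mathbb C$. For $x\in X$, $x^{(i)}$ is the upper left $i\times i$ block, $N_{rd}(x^{(i)})$ is a square in $k$, and $d_i(x)\in k$ satisfies $d_i(x)^2=N_{rd}(x^{(i)})$ $(i=1,2)$. $\omega(x;s)=\int_K|\mathbf d(k\cdot x)|^s\,dk$, where $|\mathbf d(y)|^s=\prod_i|d_i(y)|^{s_i}$ if all $d_i(y)\ne0$ and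 $0$ otherwise ($dk$ Haar, total mass 1), continued to a rational function of $q^{s_1},q^{s_2}$. Put $s_1=-z_1+z_2-2$, $s_2=-z_2+1$, $\omega(x;z)=\omega(x;s)$, $\Psi(x;z)=(q^{z_2}-q^{z_1+1})\omega(x;z)\in\mathbb C[q^{\pm z_1},q^{\pm z_2}]^{S_2}$, and $F(\varphi)(z)=\int_X\varphi(x)\Psi(x^{-1};z)\,dx$. Inner product: with complex variables $x=\frac{z_2+z_1}2,\ y=\frac{z_2-z_1}2$ (so $q^{z_1}=q^{x-y}$, $q^{z_2}=q^{x+y}$), $F(\varphi)\in\mathbb C[q^x,q^{-x},q^y+q^{-y}]$ and $$\langle f,g\rangle=\int_Tdx\int_Uf\,\overline g\,w(y)\,dy,\qquad w(y)=\frac{1-q^{2y}}{(1-q^{2y+1})(1-q^{2y-2})}\cdot\frac{1-q^{-2y}}{(1-q^{-2y+1})(1-q^{-2y-2})}.$$ Here $T=\{\sqrt{-1}t:0\le t\le2\pi/\log q\}$ with $dx$ a positive multiple of Lebesgue measure in $t$; with $Y=q^y$, integration over $U$ is a positive multiple of $\frac1{2\pi\sqrt{-1}}\oint\cdots\frac{dY}{Y}$ over a closed contour obtained by deforming the counterclockwise unit circle so that it has winding number $1$ around $0,\pm q^{-1},\pm\sqrt q$ and winding number $0$ around $\pm q,\pm\sqrt q^{-1}$ (i.e. integrate over the unit circle, add the residues at $\pm\sqrt q$, subtract those at $\pm\sqrt q^{-1}$); the normalization is $\int_{T\times U}dx\,dy=\frac{(1+q^{-2})^2}{2(1-q^{-1})}$.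 On the contour, $\overline g$ is the Laurent polynomial obtained from $g$ by conjugating coefficients and replacing $q^x,q^y$ by $q^{-x},q^{-y}$ (the complex conjugate of $g$ when $x,y$ are purely imaginary). *)

theory Defs
  imports
    "HOL-Complex_Analysis.Complex_Analysis"
    "HOL-Algebra.Algebraic_Closure_Type"
    "HOL-Library.Poly_Mapping"
begin

text \<open>
  A \<open>\<pp>\<close>-adic field is a field of characteristic 0 (class \<open>field_char_0\<close>) that is complete with
  respect to a nontrivial discrete non-archimedean absolute value with finite residue field.
  The absolute value is an explicit parameter \<open>av\<close>, and \<open>\<pi>\<close> is the prime element.
\<close>

definition valring :: "('k::field_char_0 \<Rightarrow> real) \<Rightarrow> 'k set" where
  "valring av = {x. av x \<le> 1}"

definition residue_rel :: "('k::field_char_0 \<Rightarrow> real) \<Rightarrow> 'k \<Rightarrow> ('k \<times> 'k) set" where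
  "residue_rel av \<pi> =
     {(x, y). x \<in> valring av \<and> y \<in> valring av \<and> (\<exists>z\<in>valring av. x - y = \<pi> * z)}"

definition residue_card :: "('k::field_char_0 \<Rightarrow> real) \<Rightarrow> 'k \<Rightarrow> nat" where
  "residue_card av \<pi> = card (valring av // residue_rel av \<pi>)"

definition residue_char :: "('k::field_char_0 \<Rightarrow> real) \<Rightarrow> nat" where
  "residue_char av = (LEAST p. 0 < p \<and> av (of_nat p) < 1)"

definition padic_field :: "('k::field_char_0 \<Rightarrow> real) \<Rightarrow> 'k \<Rightarrow> bool" where
  "padic_field av \<pi> \<longleftrightarrow>
     (\<forall>x. 0 \<le> av x) \<and> (\<forall>x. av x = 0 \<longleftrightarrow> x = 0) \<and>
     (\<forall>x y. av (x * y) = av x * av y) \<and>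
     (\<forall>x y. av (x + y) \<le> max (av x) (av y)) \<and>
     (\<forall>s :: nat \<Rightarrow> 'k.
        (\<forall>e>0. \<exists>N. \<forall>m\<ge>N. \<forall>n\<ge>N. av (s m - s n) < e) \<longrightarrow>
        (\<exists>l. \<forall>e>0. \<exists>N. \<forall>n\<ge>N. av (s n - l) < e)) \<and>
     \<pi> \<noteq> 0 \<and> {x. av x < 1} = {\<pi> * z |z. z \<in> valring av} \<and>
     finite (valring av // residue_rel av \<pi>) \<and>
     av \<pi> = 1 / real (residue_card av \<pi>)"

text \<open>
  The algebra is a division ring \<open>'d\<close> with a structure map \<open>\<iota> :: 'k \<Rightarrow> 'd\<close>;
  a quaternion algebra over \<open>k\<close> is a central simple algebra of dimension 4.
\<close>

definition division_quaternion_algebra :: "('k::field_char_0 \<Rightarrow> 'd::division_ring) \<Rightarrow> bool" where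
  "division_quaternion_algebra \<iota> \<longleftrightarrow>
     \<iota> 1 = 1 \<and> (\<forall>a b. \<iota> (a + b) = \<iota> a + \<iota> b) \<and> (\<forall>a b. \<iota> (a * b) = \<iota> a * \<iota> b) \<and>
     range \<iota> = {z. \<forall>d. z * d = d * z} \<and>
     vector_space.dim (\<lambda>c d. \<iota> c * d) (UNIV :: 'd set) = 4"

text \<open>The canonical involution is the only anti-involution with these properties.\<close>

definition canonical_involution ::
    "('k::field_char_0 \<Rightarrow> 'd::division_ring) \<Rightarrow> ('d \<Rightarrow> 'd) \<Rightarrow> bool" where
  "canonical_involution \<iota> star \<longleftrightarrow>
     (\<forall>x y. star (x + y) = star x + star y) \<and> (\<forall>c. star (\<iota> c) = \<iota> c) \<and>
     (\<forall>x y. star (x * y) = star y * star x) \<and> (\<forall>x. star (star x) = x) \<and>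
     (\<forall>x. x + star x \<in> range \<iota>) \<and> (\<forall>x. x * star x \<in> range \<iota>)"

definition is_order ::
    "('k::field_char_0 \<Rightarrow> real) \<Rightarrow> ('k \<Rightarrow> 'd::division_ring) \<Rightarrow> 'd set \<Rightarrow> bool" where
  "is_order av \<iota> R \<longleftrightarrow>
     1 \<in> R \<and> (\<forall>x\<in>R. \<forall>y\<in>R. x - y \<in> R \<and> x * y \<in> R) \<and>
     (\<exists>B. finite B \<and> module.span (\<lambda>c d. \<iota> c * d) B = UNIV \<and>
          R = {(\<Sum>b\<in>B. \<iota> (c b) * b) |c. \<forall>b\<in>B. c b \<in> valring av})"

definition maximal_order ::
    "('k::field_char_0 \<Rightarrow> real) \<Rightarrow> ('k \<Rightarrow> 'd::division_ring) \<Rightarrow> 'd set \<Rightarrow> bool" where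
  "maximal_order av \<iota> R \<longleftrightarrow>
     is_order av \<iota> R \<and> (\<forall>R'. is_order av \<iota> R' \<and> R \<subseteq> R' \<longrightarrow> R' = R)"

text \<open>
  Reduced norm on \<open>M\<^sub>n(D)\<close>: split \<open>D\<close> over the algebraic closure of \<open>k\<close> by a \<open>k\<close>-algebra
  homomorphism to the 2 by 2 matrices, and take the determinant of the resulting block matrix.
  It does not depend on the splitting and lies in \<open>k\<close>.
\<close>

definition splitting ::
    "('k::field_char_0 \<Rightarrow> 'd::division_ring) \<Rightarrow> ('d \<Rightarrow> 'k alg_closure ^ 2 ^ 2) \<Rightarrow> bool" where
  "splitting \<iota> \<phi> \<longleftrightarrow>
     (\<forall>x y. \<phi> (x + y) = \<phi> x + \<phi> y) \<and> (\<forall>x y. \<phi> (x * y) = \<phi> x ** \<phi> y) \<and>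
     (\<forall>c. \<phi> (\<iota> c) = mat (to_ac c))"

definition nrd :: "('k::field_char_0 \<Rightarrow> 'd::division_ring) \<Rightarrow> 'd ^ 'n ^ 'n \<Rightarrow> 'k" where
  "nrd \<iota> A = (THE c. \<forall>\<phi>. splitting \<iota> \<phi> \<longrightarrow>
     to_ac c = det (\<chi> p r. \<phi> (A $ fst p $ fst r) $ snd p $ snd r :: 'k alg_closure ^ ('n \<times> 2) ^ ('n \<times> 2)))"

text \<open>
  The topology of \<open>D\<close> is carried by the class \<open>metric_space\<close>; the following ties it to the
  absolute value \<open>d \<mapsto> \<bar>nrd d\<bar>\<^sup>1\<^sup>/\<^sup>2\<close>, which extends that of \<open>k\<close>.  Matrices over \<open>D\<close> then
  carry the product topology.
\<close>

definition nrd_metric ::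
    "('k::field_char_0 \<Rightarrow> real) \<Rightarrow> ('k \<Rightarrow> 'd::{division_ring, metric_space}) \<Rightarrow> bool" where
  "nrd_metric av \<iota> \<longleftrightarrow>
     (\<forall>x y. dist x y = sqrt (av (nrd \<iota> ((\<chi> i j. x - y) :: 'd ^ 1 ^ 1))))"

definition adj :: "('d \<Rightarrow> 'd) \<Rightarrow> 'd::division_ring ^ 'n ^ 'n \<Rightarrow> 'd ^ 'n ^ 'n" where
  "adj star A = (\<chi> i j. star (A $ j $ i))"

definition herm :: "('d \<Rightarrow> 'd) \<Rightarrow> ('d::division_ring ^ 2 ^ 2) set" where
  "herm star = {A. invertible A \<and> adj star A = A}"

definition act :: "('d \<Rightarrow> 'd) \<Rightarrow> 'd::division_ring ^ 2 ^ 2 \<Rightarrow> 'd ^ 2 ^ 2 \<Rightarrow> 'd ^ 2 ^ 2" where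
  "act star g A = g ** A ** adj star g"

definition GL2 :: "'d::division_ring set \<Rightarrow> ('d ^ 2 ^ 2) set" where
  "GL2 R = {A. (\<forall>i j. A $ i $ j \<in> R) \<and>
     (\<exists>B. (\<forall>i j. B $ i $ j \<in> R) \<and> A ** B = mat 1 \<and> B ** A = mat 1)}"

definition orbit :: "('d \<Rightarrow> 'd) \<Rightarrow> 'd::division_ring set \<Rightarrow> 'd ^ 2 ^ 2 \<Rightarrow> ('d ^ 2 ^ 2) set" where
  "orbit star R x = (\<lambda>g. act star g x) ` GL2 R"

definition normalized_haar :: "'d::{division_ring, metric_space} set \<Rightarrow> ('d ^ 2 ^ 2) measure \<Rightarrow> bool" where
  "normalized_haar R \<kappa> \<longleftrightarrow>
     sets \<kappa> = sets (restrict_space borel (GL2 R)) \<and> emeasure \<kappa> (GL2 R) = 1 \<and>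
     (\<forall>g\<in>GL2 R. \<forall>S\<in>sets \<kappa>. emeasure \<kappa> ((\<lambda>h. g ** h) ` S) = emeasure \<kappa> S)"

text \<open>Finiteness on compact sets is implied: \<open>X\<close> is covered by the open sets \<open>g K \<cdot> 1\<close>, of volume 1.\<close>

definition normalized_invariant ::
    "('d \<Rightarrow> 'd) \<Rightarrow> 'd::{division_ring, metric_space} set \<Rightarrow> ('d ^ 2 ^ 2) measure \<Rightarrow> bool" where
  "normalized_invariant star R \<mu> \<longleftrightarrow>
     sets \<mu> = sets (restrict_space borel (herm star)) \<and>
     (\<forall>g. invertible g \<longrightarrow> (\<forall>S\<in>sets \<mu>. emeasure \<mu> (act star g ` S) = emeasure \<mu> S)) \<and>
     emeasure \<mu> (orbit star R (mat 1)) = 1"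

text \<open>Functions on \<open>X\<close> are represented by functions on all matrices; values off \<open>X\<close> are irrelevant.\<close>

definition schwartz_functions ::
    "('d \<Rightarrow> 'd) \<Rightarrow> 'd::{division_ring, metric_space} set \<Rightarrow> ('d ^ 2 ^ 2 \<Rightarrow> complex) set" where
  "schwartz_functions star R =
     {\<phi>. (\<forall>g\<in>GL2 R. \<forall>x\<in>herm star. \<phi> (act star g x) = \<phi> x) \<and>
          compact (herm star \<inter> closure {x \<in> herm star. \<phi> x \<noteq> 0})}"

type_synonym laurent2 = "(int \<times> int) \<Rightarrow>\<^sub>0 complex"

definition leval :: "laurent2 \<Rightarrow> complex \<Rightarrow> complex \<Rightarrow> complex" where
  "leval P u v =
     (\<Sum>(i, j)\<in>Poly_Mapping.keys P. Poly_Mapping.lookup P (i, j) * u powi i * v powi j)"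

definition lconj :: "laurent2 \<Rightarrow> laurent2" where
  "lconj P = Poly_Mapping.map cnj (Poly_Mapping.map_key uminus P)"

definition d1 :: "('k::field_char_0 \<Rightarrow> 'd::division_ring) \<Rightarrow> 'd ^ 2 ^ 2 \<Rightarrow> 'k" where
  "d1 \<iota> x = (SOME d. d\<^sup>2 = nrd \<iota> ((\<chi> i j. x $ 1 $ 1) :: 'd ^ 1 ^ 1))"

definition d2 :: "('k::field_char_0 \<Rightarrow> 'd::division_ring) \<Rightarrow> 'd ^ 2 ^ 2 \<Rightarrow> 'k" where
  "d2 \<iota> x = (SOME d. d\<^sup>2 = nrd \<iota> x)"

definition dpow ::
    "('k::field_char_0 \<Rightarrow> real) \<Rightarrow> ('k \<Rightarrow> 'd::division_ring) \<Rightarrow> 'd ^ 2 ^ 2 \<Rightarrow> complex \<Rightarrow> complex \<Rightarrow> complex" where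
  "dpow av \<iota> y s1 s2 =
     (if d1 \<iota> y \<noteq> 0 \<and> d2 \<iota> y \<noteq> 0
      then of_real (av (d1 \<iota> y)) powr s1 * of_real (av (d2 \<iota> y)) powr s2 else 0)"

definition omega_int ::
    "('k::field_char_0 \<Rightarrow> real) \<Rightarrow> ('k \<Rightarrow> 'd::division_ring) \<Rightarrow> ('d \<Rightarrow> 'd) \<Rightarrow> ('d ^ 2 ^ 2) measure \<Rightarrow>
     'd ^ 2 ^ 2 \<Rightarrow> complex \<Rightarrow> complex \<Rightarrow> complex" where
  "omega_int av \<iota> star \<kappa> x s1 s2 = (\<integral>g. dpow av \<iota> (act star g x) s1 s2 \<partial>\<kappa>)"

text \<open>
  \<open>P/Q\<close> represents \<open>\<omega>(x;s)\<close> as a rational function of \<open>q\<^bsup>s\<^sub>1\<^esup>\<close>, \<open>q\<^bsup>s\<^sub>2\<^esup>\<close>.  On the closed region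
  \<open>Re s\<^sub>1, Re s\<^sub>2 \<ge> 0\<close> the integrand is bounded, so the integral converges absolutely there.
\<close>

definition omega_fraction ::
    "('k::field_char_0 \<Rightarrow> real) \<Rightarrow> 'k \<Rightarrow> ('k \<Rightarrow> 'd::division_ring) \<Rightarrow> ('d \<Rightarrow> 'd) \<Rightarrow> ('d ^ 2 ^ 2) measure \<Rightarrow>
     'd ^ 2 ^ 2 \<Rightarrow> laurent2 \<Rightarrow> laurent2 \<Rightarrow> bool" where
  "omega_fraction av \<pi> \<iota> star \<kappa> x P Q \<longleftrightarrow> Q \<noteq> 0 \<and>
     (let q = of_nat (residue_card av \<pi>) :: complex in
      \<forall>s1 s2. 0 \<le> Re s1 \<and> 0 \<le> Re s2 \<longrightarrow>
        leval Q (q powr s1) (q powr s2) * omega_int av \<iota> star \<kappa> x s1 s2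
          = leval P (q powr s1) (q powr s2))"

definition omega_regular ::
    "('k::field_char_0 \<Rightarrow> real) \<Rightarrow> 'k \<Rightarrow> ('k \<Rightarrow> 'd::division_ring) \<Rightarrow> ('d \<Rightarrow> 'd) \<Rightarrow> ('d ^ 2 ^ 2) measure \<Rightarrow>
     'd ^ 2 ^ 2 \<Rightarrow> complex \<Rightarrow> complex \<Rightarrow> bool" where
  "omega_regular av \<pi> \<iota> star \<kappa> x s1 s2 \<longleftrightarrow>
     (let q = of_nat (residue_card av \<pi>) :: complex in
      \<exists>P Q. omega_fraction av \<pi> \<iota> star \<kappa> x P Q \<and> leval Q (q powr s1) (q powr s2) \<noteq> 0)"

text \<open>The continued function, at points where it is regular.\<close>

definition omega ::
    "('k::field_char_0 \<Rightarrow> real) \<Rightarrow> 'k \<Rightarrow> ('k \<Rightarrow> 'd::division_ring) \<Rightarrow> ('d \<Rightarrow> 'd) \<Rightarrow> ('d ^ 2 ^ 2) measure \<Rightarrow>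
     'd ^ 2 ^ 2 \<Rightarrow> complex \<Rightarrow> complex \<Rightarrow> complex" where
  "omega av \<pi> \<iota> star \<kappa> x s1 s2 =
     (let q = of_nat (residue_card av \<pi>) :: complex in
      THE w. \<exists>P Q. omega_fraction av \<pi> \<iota> star \<kappa> x P Q \<and> leval Q (q powr s1) (q powr s2) \<noteq> 0 \<and>
        w = leval P (q powr s1) (q powr s2) / leval Q (q powr s1) (q powr s2))"

text \<open>
  \<open>\<Psi>(x;z)\<close> as a Laurent polynomial in \<open>q\<^bsup>z\<^sub>1\<^esup>\<close>, \<open>q\<^bsup>z\<^sub>2\<^esup>\<close>; as such it also has values at the poles
  of \<open>\<omega>(x;z)\<close>.
\<close>

definition Psi ::
    "('k::field_char_0 \<Rightarrow> real) \<Rightarrow> 'k \<Rightarrow> ('k \<Rightarrow> 'd::division_ring) \<Rightarrow> ('d \<Rightarrow> 'd) \<Rightarrow> ('d ^ 2 ^ 2) measure \<Rightarrow>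
     'd ^ 2 ^ 2 \<Rightarrow> laurent2" where
  "Psi av \<pi> \<iota> star \<kappa> x =
     (let q = of_nat (residue_card av \<pi>) :: complex in
      THE L. \<forall>z1 z2. omega_regular av \<pi> \<iota> star \<kappa> x (- z1 + z2 - 2) (- z2 + 1) \<longrightarrow>
        leval L (q powr z1) (q powr z2) =
          (q powr z2 - q powr (z1 + 1)) * omega av \<pi> \<iota> star \<kappa> x (- z1 + z2 - 2) (- z2 + 1))"

definition spherical_integral ::
    "('k::field_char_0 \<Rightarrow> real) \<Rightarrow> 'k \<Rightarrow> ('k \<Rightarrow> 'd::division_ring) \<Rightarrow> ('d \<Rightarrow> 'd) \<Rightarrow> ('d ^ 2 ^ 2) measure \<Rightarrow>
     ('d ^ 2 ^ 2) measure \<Rightarrow> ('d ^ 2 ^ 2 \<Rightarrow> complex) \<Rightarrow> complex \<Rightarrow> complex \<Rightarrow> complex" where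
  "spherical_integral av \<pi> \<iota> star \<kappa> \<mu> \<phi> z1 z2 =
     (let q = of_nat (residue_card av \<pi>) :: complex in
      \<integral>u. \<phi> u * leval (Psi av \<pi> \<iota> star \<kappa> (matrix_inv u)) (q powr z1) (q powr z2) \<partial>\<mu>)"

text \<open>
  \<open>F(\<phi>)\<close> as a Laurent polynomial in \<open>q\<^sup>x\<close>, \<open>q\<^sup>y\<close>, where \<open>z\<^sub>1 = x - y\<close> and \<open>z\<^sub>2 = x + y\<close>.
\<close>

definition spherical_transform ::
    "('k::field_char_0 \<Rightarrow> real) \<Rightarrow> 'k \<Rightarrow> ('k \<Rightarrow> 'd::division_ring) \<Rightarrow> ('d \<Rightarrow> 'd) \<Rightarrow> ('d ^ 2 ^ 2) measure \<Rightarrow>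
     ('d ^ 2 ^ 2) measure \<Rightarrow> ('d ^ 2 ^ 2 \<Rightarrow> complex) \<Rightarrow> laurent2" where
  "spherical_transform av \<pi> \<iota> star \<kappa> \<mu> \<phi> =
     (let q = of_nat (residue_card av \<pi>) :: complex in
      THE L. \<forall>x y. leval L (q powr x) (q powr y) =
        spherical_integral av \<pi> \<iota> star \<kappa> \<mu> \<phi> (x - y) (x + y))"

text \<open>The weight \<open>w(y)\<close> in terms of \<open>Y = q\<^sup>y\<close>.\<close>

definition weight :: "nat \<Rightarrow> complex \<Rightarrow> complex" where
  "weight q Y =
     (1 - Y powi 2) / ((1 - of_nat q * Y powi 2) * (1 - of_nat q powi (-2) * Y powi 2)) *
     ((1 - Y powi (-2)) / ((1 - of_nat q * Y powi (-2)) * (1 - of_nat q powi (-2) * Y powi (-2))))"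

text \<open>
  The integral of \<open>h(Y)\<close> against \<open>dY / (2pi \<i> Y)\<close> over the deformed unit circle; \<open>h\<close> has at most
  the poles \<open>0\<close>, \<open>\<plusminus>q\<close>, \<open>\<plusminus>q\<^sup>-\<^sup>1\<close>, \<open>\<plusminus>\<surd>q\<close>, \<open>\<plusminus>1/\<surd>q\<close> of the weight and of Laurent polynomials.
\<close>

definition U_integral :: "nat \<Rightarrow> (complex \<Rightarrow> complex) \<Rightarrow> complex" where
  "U_integral q h =
     (let f = (\<lambda>Y. h Y / Y); r = complex_of_real (sqrt (real q)) in
      1 / (2 * of_real pi * \<i>) * contour_integral (circlepath 0 1) f
        + residue f r + residue f (- r) - residue f (1 / r) - residue f (- (1 / r)))"

text \<open>
  Integration over \<open>T\<close>, normalized to total mass 1, is \<open>(log q / 2pi)\<close> times Lebesgue measure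
  in \<open>t\<close>, and \<open>U_integral q (\<lambda>_. 1) = 1\<close>; the first factor is the prescribed total mass of
  \<open>T \<times> U\<close>.
\<close>

definition inner_product :: "nat \<Rightarrow> laurent2 \<Rightarrow> laurent2 \<Rightarrow> complex" where
  "inner_product q f g =
     of_real ((1 + real q powi (-2))\<^sup>2 / (2 * (1 - real q powi (-1))) * (ln (real q) / (2 * pi))) *
     integral {0..2 * pi / ln (real q)} (\<lambda>t.
       let u = of_nat q powr (\<i> * of_real t) in
       U_integral q (\<lambda>Y. leval f u Y * leval (lconj g) u Y * weight q Y))"

end

theory Submission
  imports Defs
begin

text \<open>
  An orbit of \<open>K\<close> on \<open>X\<close> is determined by the largest norm of an entry and by the absolute value of
  the hermitian determinant \<open>a d - N(b)\<close>. The representatives are the diagonal matrices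
  \<open>diag(\<pi>\<^sup>\<alpha>, \<pi>\<^sup>\<alpha>\<^sup>+\<^sup>\<delta>)\<close> and, for odd size, the matrices with zero diagonal. Volumes of orbits follow from
  translation identities for the invariant measure, which relate finitely many cells to each other,
  and the spherical function follows from the distribution of \<open>|d\<^sub>1(k \<cdot> x)|\<close>, which depends on the top
  row of \<open>k\<close> only and satisfies similar identities under right translations of \<open>K\<close>.

  In the variables \<open>u = q\<^sup>x\<close>, \<open>Y = q\<^sup>y\<close> this makes \<open>\<Psi>\<close> a monomial in \<open>u\<close> times a constant or a
  member \<open>P\<^sub>\<delta>(Y)\<close> of a family with a three-term recursion. Writing the weight as
  \<open>h(Y) h(1/Y)\<close>, one has \<open>P\<^sub>\<delta>(Y) h(Y) h(1/Y) = Y\<^sup>\<delta>\<^sup>+\<^sup>1 h(Y) + Y\<^sup>-\<^sup>\<delta>\<^sup>-\<^sup>1 h(1/Y)\<close>, and by residues the integral of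
  \<open>Y\<^sup>k h(Y)\<close> over the deformed contour is \<open>1\<close> for \<open>k = 0\<close> and \<open>0\<close> for \<open>k > 0\<close>. Hence the transforms of
  the characteristic functions of orbits are orthogonal, and their norms turn out to be the volumes.
  A function with compact support is a finite combination of such characteristic functions.
\<close>

text \<open>The algebra is given abstractly, so its arithmetic has to be built. Anticommuting
  elements \<open>qi\<close> and \<open>qj\<close>, one of unit norm and one of uniformizing norm,
  turn the absolute value of the norm form into a maximum over coordinates. This yields the
  ultrametric inequality, identifies every maximal order with the unit ball of \<open>nr\<close>,
  and provides the splitting that makes the reduced norm computable. Neither measure has a density
  here; the substitute is counting. If a set is the disjoint union of the preimages of a second set
  under N group elements, its measure is N times that of the second. The resulting linear relations
  and the normalization determine all volumes and probabilities. On \<open>K\<close> only left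
  translations are assumed to preserve the measure, but it is right translations that move the top
  row linearly; this is why congruence cosets are counted. The orbits of odd size contribute the
  constant function of Y, which is not in the family \<open>P\<^sub>\<delta>\<close>; its norm
  requires an identity of its own, \<open>U_integral_weight\<close>. The power of u records the
  determinant of an orbit, the function of Y the remaining invariant.\<close>

no_notation fps_nth (infixl "$" 75)

section \<open>The absolute value\<close>

locale padic =
  fixes av :: "'k::field_char_0 \<Rightarrow> real" and \<pi> :: 'k
  assumes padic: "padic_field av \<pi>" and odd_residue_char: "odd (residue_char av)"
begin

definition q :: real where "q = real (residue_card av \<pi>)"

lemma av_nonneg [simp]: "0 \<le> av x"
  using padic by (simp add: padic_field_def)

lemma av_eq_0_iff [simp]: "av x = 0 \<longleftrightarrow> x = 0"
  using padic by (simp add: padic_field_def)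

lemma av_mult: "av (x * y) = av x * av y"
  using padic by (simp add: padic_field_def)

lemma av_ultra: "av (x + y) \<le> max (av x) (av y)"
  using padic by (simp add: padic_field_def)

lemma av_complete:
  fixes s :: "nat \<Rightarrow> 'k"
  assumes "\<And>e. e > 0 \<Longrightarrow> \<exists>N. \<forall>m\<ge>N. \<forall>n\<ge>N. av (s m - s n) < e"
  shows "\<exists>l. \<forall>e>0. \<exists>N. \<forall>n\<ge>N. av (s n - l) < e"
proof -
  have *: "\<forall>s :: nat \<Rightarrow> 'k.
        (\<forall>e>0. \<exists>N. \<forall>m\<ge>N. \<forall>n\<ge>N. av (s m - s n) < e) \<longrightarrow>
        (\<exists>l. \<forall>e>0. \<exists>N. \<forall>n\<ge>N. av (s n - l) < e)"
    using padic unfolding padic_field_def by (elim conjE)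
  show ?thesis by (rule mp[OF spec[OF *, of s]]) (use assms in simp)
qed

lemma pi_nonzero [simp]: "\<pi> \<noteq> 0"
  using padic by (simp add: padic_field_def)

lemma av_less_1_iff: "av x < 1 \<longleftrightarrow> (\<exists>z. av z \<le> 1 \<and> x = \<pi> * z)"
proof -
  have "{x. av x < 1} = {\<pi> * z |z. z \<in> valring av}"
    using padic by (simp add: padic_field_def)
  then have "x \<in> {x. av x < 1} \<longleftrightarrow> x \<in> {\<pi> * z |z. z \<in> valring av}" by simp
  then show ?thesis by (auto simp: valring_def)
qed

lemma av_pi: "av \<pi> = 1 / q"
  using padic by (simp add: padic_field_def q_def)

lemma finite_residue: "finite (valring av // residue_rel av \<pi>)"
  using padic by (simp add: padic_field_def)

lemma av_0 [simp]: "av 0 = 0" by simp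

lemma av_le_0_iff [simp]: "av x \<le> 0 \<longleftrightarrow> x = 0"
  by (metis av_eq_0_iff av_nonneg order_antisym order_refl)

lemma av_pos_iff [simp]: "0 < av x \<longleftrightarrow> x \<noteq> 0"
  by (simp add: less_le)

lemma av_1 [simp]: "av 1 = 1"
  using av_mult[of 1 1] av_eq_0_iff[of 1] by (metis mult_cancel_left1 mult_1 zero_neq_one)

lemma av_minus [simp]: "av (- x) = av x"
proof -
  have "av (-1) * av (-1) = 1" using av_mult[of "-1" "-1"] by simp
  then have "av (-1) = 1" using av_nonneg[of "-1"]
    by (metis abs_of_nonneg abs_mult_self_eq abs_square_eq_1 power2_eq_square)
  then show ?thesis using av_mult[of "-1" x] by simp
qed

lemma av_diff: "av (x - y) \<le> max (av x) (av y)"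
  using av_ultra[of x "-y"] by simp

lemma av_commute: "av (x - y) = av (y - x)"
  using av_minus[of "x - y"] by simp

lemma av_power: "av (x ^ n) = av x ^ n"
  by (induction n) (auto simp: av_mult)

lemma av_inverse: "av (inverse x) = inverse (av x)"
proof (cases "x = 0")
  case False
  then have "av (inverse x) * av x = 1" by (simp flip: av_mult)
  then show ?thesis by (metis inverse_unique mult.commute)
qed simp

lemma av_divide: "av (x / y) = av x / av y"
  by (simp add: divide_inverse av_mult av_inverse)

lemma av_powi: "av (x powi n) = av x powi n"
  by (cases "n \<ge> 0") (auto simp: power_int_def av_power av_inverse)

lemma av_add_eq:
  assumes "av x < av y" shows "av (x + y) = av y" "av (y + x) = av y"
proof -
  have "av (x + y) \<le> av y" using av_ultra[of x y] assms by simp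
  moreover have "av y \<le> max (av (x + y)) (av x)" using av_diff[of "x+y" x] by simp
  ultimately show "av (x + y) = av y" using assms by (auto simp: max_def split: if_splits)
  then show "av (y + x) = av y" by (simp add: add.commute)
qed

lemma av_diff_eq:
  assumes "av x < av y" shows "av (x - y) = av y" "av (y - x) = av y"
  using av_add_eq[of x "-y"] av_add_eq[of "-x" y] assms by (auto simp: add.commute)

lemma av_close_eq:
  assumes "av (x - y) < av y" shows "av x = av y"
  using av_add_eq(1)[of "x - y" y] assms by simp

lemma q_gt_1: "q > 1"
proof -
  have "av \<pi> < 1" unfolding av_less_1_iff by (rule exI[of _ 1]) simp
  moreover have "av \<pi> > 0" by (simp add: less_le)
  ultimately show ?thesis unfolding av_pi by (auto simp: field_simps split: if_splits)
qed

lemma q_pos [simp]: "q > 0" "q \<noteq> 0" "q \<ge> 0" "q \<noteq> 1"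
  using q_gt_1 by auto

lemma av_less_1_imp: "av x < 1 \<Longrightarrow> av x \<le> 1 / q"
  by (auto simp: av_less_1_iff av_mult av_pi field_simps)

lemma powi_q_less_iff: "q powi m < q powi n \<longleftrightarrow> m < n"
  using q_gt_1 by (metis power_int_strict_increasing linorder_neqE order.asym)

lemma powi_q_le_iff: "q powi m \<le> q powi n \<longleftrightarrow> m \<le> n"
  using powi_q_less_iff[of n m] by linarith

lemma powi_q_eq_iff: "q powi m = q powi n \<longleftrightarrow> m = n"
  using powi_q_less_iff[of n m] powi_q_less_iff[of m n] by linarith

lemma powi_q_pos [simp]: "q powi m > 0" by simp

text \<open>Multiplying by a power of \<open>\<pi>\<close> moves the absolute value above
  \<open>1 / q\<close> and to at most 1. The only value in that range is 1, because a smaller one is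
  at most \<open>1 / q\<close>.\<close>

lemma av_discrete:
  assumes "x \<noteq> 0" obtains n where "av x = q powi (- n)"
proof -
  have x: "av x > 0" using assms by (simp add: less_le)
  define n where "n = \<lceil>log q (av x)\<rceil>"
  have "log q (av x) \<le> n" "n < log q (av x) + 1" unfolding n_def by linarith+
  then have "av x \<le> q powr n" "q powr (n - 1) < av x"
    using x q_gt_1 by (simp_all add: log_le_iff flip: less_log_iff)
  then have n: "av x \<le> q powi n" "q powi (n - 1) < av x"
    using powr_real_of_int'[of q n] powr_real_of_int'[of q "n - 1"] by auto
  define y where "y = x * \<pi> powi n"
  have avy: "av y = av x / q powi n"
    by (simp add: y_def av_mult av_powi av_pi power_int_divide_distrib)
  have "av y \<le> 1" using n(1) by (simp add: avy field_simps)
  moreover have "av y > 1 / q" using n(2) by (simp add: avy field_simps power_int_diff)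
  ultimately have "av y = 1" using av_less_1_imp[of y] by linarith
  then have "av x = q powi n" by (simp add: avy field_simps)
  then show ?thesis using that[of "- n"] by simp
qed

text \<open>This is where the odd residual characteristic enters: 2 would otherwise be the least
  positive integer of absolute value below 1. From here on halving is an isometry of the
  field.\<close>

lemma av_2: "av 2 = 1"
proof (rule ccontr)
  assume ne: "av 2 \<noteq> 1"
  have "av 2 \<le> 1" using av_ultra[of 1 1] by simp
  with ne have "av 2 < 1" by simp
  then have "residue_char av = 2" unfolding residue_char_def
  proof (intro Least_equality)
    fix p :: nat assume p: "0 < p \<and> av (of_nat p) < 1"
    show "2 \<le> p" proof (rule ccontr)
      assume "\<not> 2 \<le> p" then have "p = 1" using p by simp
      then show False using p by simp
    qed
  qed auto
  then show False using odd_residue_char by simp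
qed

text \<open>Hensel's lemma for squares: \<open>(1 + u)\<^sup>2 = 1 + z\<close> holds exactly if
  \<open>u\<close> is a fixed point of \<open>u \<mapsto> (z - u\<^sup>2) / 2\<close>, and on the
  disc of radius \<open>av z\<close> this map contracts by the factor \<open>av z\<close>.\<close>

lemma sqrt_one_plus:
  assumes z: "av z < 1"
  obtains s where "s\<^sup>2 = 1 + z" "av (s - 1) < 1" "av s = 1"
proof -
  define t where "t = rec_nat 0 (\<lambda>_ u. (z - u\<^sup>2) / 2)"
  have t0: "t 0 = 0" and tS: "t (Suc n) = (z - (t n)\<^sup>2) / 2" for n by (simp_all add: t_def)
  have half: "av (u / 2) = av u" for u by (simp add: av_divide av_2)
  define r where "r = av z"
  have r: "0 \<le> r" "r < 1" using z by (auto simp: r_def)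
  have tr: "av (t n) \<le> r" for n
  proof (induction n)
    case (Suc n)
    have "av ((t n)\<^sup>2) \<le> r * 1" unfolding power2_eq_square av_mult
      by (intro mult_mono) (use Suc r in auto)
    then show ?case unfolding tS half using av_diff[of z "(t n)\<^sup>2"] by (simp add: r_def)
  qed (simp add: t0 r)
  have contr: "av ((z - u\<^sup>2) / 2 - (z - v\<^sup>2) / 2) \<le> r * av (u - v)" if "av u \<le> r" "av v \<le> r" for u v
  proof -
    have "(z - u\<^sup>2) / 2 - (z - v\<^sup>2) / 2 = ((v + u) * (v - u)) / 2"
      by (simp add: field_simps power2_eq_square)
    then have "av ((z - u\<^sup>2) / 2 - (z - v\<^sup>2) / 2) = av (v + u) * av (v - u)"
      by (simp only: half av_mult)
    also have "\<dots> \<le> r * av (v - u)"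
      using av_ultra[of v u] that by (intro mult_right_mono) auto
    finally show ?thesis by (simp add: av_commute)
  qed
  have step: "av (t (Suc n) - t n) \<le> r ^ Suc n" for n
  proof (induction n)
    case 0 then show ?case using tr[of 1] by (simp add: t0)
  next
    case (Suc n)
    have "av (t (Suc (Suc n)) - t (Suc n)) \<le> r * av (t (Suc n) - t n)"
      using contr[OF tr tr, of "Suc n" n] by (simp add: tS)
    also have "\<dots> \<le> r * r ^ Suc n" using Suc r by (intro mult_left_mono) auto
    finally show ?case by simp
  qed
  \<comment> \<open>In an ultrametric a sum of increments is bounded by the largest of their bounds,
    which is the first one.\<close>
  have cau: "av (t (n + k) - t n) \<le> r ^ Suc n" for n k
  proof (induction k)
    case 0 then show ?case using r by simp
  next
    case (Suc k)
    have "av (t (n + Suc k) - t n) \<le> max (av (t (Suc (n + k)) - t (n + k))) (av (t (n + k) - t n))"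
      using av_ultra[of "t (Suc (n + k)) - t (n + k)" "t (n + k) - t n"] by simp
    moreover have "r ^ Suc (n + k) \<le> r ^ Suc n" using r by (intro power_decreasing) auto
    ultimately show ?case using Suc step[of "n + k"] by linarith
  qed
  have pw: "\<exists>N. \<forall>n\<ge>N. r ^ Suc n < e" if "e > 0" for e
  proof -
    have "(\<lambda>n. r ^ Suc n) \<longlonglongrightarrow> 0" using r by (intro LIMSEQ_Suc LIMSEQ_power_zero) auto
    then have "eventually (\<lambda>n. r ^ Suc n < e) sequentially"
      using that by (rule order_tendstoD)
    then show ?thesis by (simp add: eventually_sequentially)
  qed
  have "\<exists>l. \<forall>e>0. \<exists>N. \<forall>n\<ge>N. av (t n - l) < e"
  proof (rule av_complete)
    fix e :: real assume "e > 0"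
    then obtain N where N: "\<And>n. n \<ge> N \<Longrightarrow> r ^ Suc n < e" using pw by blast
    have "av (t m - t n) < e" if "m \<ge> N" "n \<ge> N" for m n
    proof (cases "m \<ge> n")
      case True
      then show ?thesis using cau[of n "m - n"] N[of n] that by simp
    next
      case False
      then show ?thesis using cau[of m "n - m"] N[of m] that by (simp add: av_commute)
    qed
    then show "\<exists>N. \<forall>m\<ge>N. \<forall>n\<ge>N. av (t m - t n) < e" by blast
  qed
  then obtain l where l: "\<And>e. e > 0 \<Longrightarrow> \<exists>N. \<forall>n\<ge>N. av (t n - l) < e" by blast
  have lr: "av l < 1"
  proof -
    obtain N where "av (t N - l) < 1" using l[of 1] by auto
    then show ?thesis using av_diff[of "t N" "t N - l"] tr[of N] r by auto
  qed
  have "av (l - (z - l\<^sup>2) / 2) < e" if e: "e > 0" for e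
  proof -
    obtain N where N: "\<And>n. n \<ge> N \<Longrightarrow> av (t n - l) < e" using l[OF e] by blast
    \<comment> \<open>The defect of \<open>l\<close> is expressed through two late iterates, both
      close to \<open>l\<close>.\<close>
    have eq: "l - (z - l\<^sup>2) / 2 = - (t (Suc N) - l) + ((l + t N) * (l - t N)) / 2"
      by (simp add: tS field_simps power2_eq_square)
    have "av (l + t N) \<le> 1" using av_ultra[of l "t N"] lr tr[of N] r by auto
    then have "av ((l + t N) * (l - t N) / 2) \<le> 1 * av (l - t N)"
      unfolding half av_mult by (intro mult_right_mono) auto
    then have "av ((l + t N) * (l - t N) / 2) < e" using N[of N] by (simp add: av_commute)
    moreover have "av (- (t (Suc N) - l)) < e" using N[of "Suc N"] unfolding av_minus by simp
    ultimately show ?thesis unfolding eq using av_ultra by (meson le_less_trans max_less_iff_conj)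
  qed
  then have "av (l - (z - l\<^sup>2) / 2) = 0" by (metis av_nonneg less_irrefl less_le)
  then have "l = (z - l\<^sup>2) / 2" by simp
  then have "(1 + l)\<^sup>2 = 1 + z" by (simp add: field_simps power2_eq_square)
  moreover have "av (1 + l) = 1" using av_add_eq(2)[of l 1] lr by simp
  ultimately show ?thesis using that[of "1 + l"] lr by simp
qed

section \<open>Residue representatives and quadratic forms modulo \<open>\<pi>\<close>\<close>

lemma residue_rel_iff: "(x, y) \<in> residue_rel av \<pi> \<longleftrightarrow> av x \<le> 1 \<and> av y \<le> 1 \<and> av (x - y) < 1"
  by (auto simp: residue_rel_def valring_def av_less_1_iff)

lemma equiv_residue_rel: "equiv (valring av) (residue_rel av \<pi>)"
proof (rule equivI)
  show "residue_rel av \<pi> \<subseteq> valring av \<times> valring av" by (auto simp: residue_rel_def)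
  show "refl_on (valring av) (residue_rel av \<pi>)"
    by (auto simp: refl_on_def residue_rel_iff valring_def)
  show "sym (residue_rel av \<pi>)" by (auto simp: sym_def residue_rel_iff av_commute)
  show "trans (residue_rel av \<pi>)"
  proof (rule transI)
    fix x y z assume "(x, y) \<in> residue_rel av \<pi>" "(y, z) \<in> residue_rel av \<pi>"
    then show "(x, z) \<in> residue_rel av \<pi>"
      using av_ultra[of "x - y" "y - z"] by (auto simp: residue_rel_iff)
  qed
qed

lemma residue_system_exists:
  "\<exists>R. finite R \<and> card R = residue_card av \<pi> \<and> 0 \<in> R \<and> (\<forall>t\<in>R. av t \<le> 1) \<and>
     (\<forall>x. av x \<le> 1 \<longrightarrow> (\<exists>!t. t \<in> R \<and> av (x - t) < 1))"
proof -
  define Q where "Q = valring av // residue_rel av \<pi>"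
  \<comment> \<open>Zero represents its own class, so that all other representatives are
    units.\<close>
  define f where "f C = (if 0 \<in> C then 0 else SOME x. x \<in> C)" for C :: "'k set"
  have fC: "f C \<in> C" if "C \<in> Q" for C
  proof -
    have "C \<noteq> {}" using that in_quotient_imp_non_empty[OF equiv_residue_rel] by (auto simp: Q_def)
    then show ?thesis by (auto simp: f_def some_in_eq)
  qed
  have sub: "C \<subseteq> valring av" if "C \<in> Q" for C
    using that in_quotient_imp_subset[OF equiv_residue_rel] by (auto simp: Q_def)
  have inQ: "residue_rel av \<pi> `` {x} \<in> Q" if "av x \<le> 1" for x
    using that by (auto simp: Q_def quotient_def valring_def)
  have same: "C = D" if "C \<in> Q" "D \<in> Q" "x \<in> C" "y \<in> D" "av (x - y) < 1" for C D x y
    using that sub quotient_eqI[OF equiv_residue_rel, of C D x y]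
    by (auto simp: Q_def residue_rel_iff valring_def subset_iff)
  have inj: "inj_on f Q" by (rule inj_onI) (metis fC same av_0 diff_self zero_less_one)
  have ex: "\<exists>!t. t \<in> f ` Q \<and> av (x - t) < 1" if x: "av x \<le> 1" for x
  proof -
    let ?C = "residue_rel av \<pi> `` {x}"
    have C: "?C \<in> Q" and xC: "x \<in> ?C" using inQ[OF x] x by (auto simp: residue_rel_iff)
    show ?thesis
    proof (rule ex1I[of _ "f ?C"])
      show "f ?C \<in> f ` Q \<and> av (x - f ?C) < 1"
        using C fC[OF C] by (auto simp: residue_rel_iff)
      fix t assume "t \<in> f ` Q \<and> av (x - t) < 1"
      then obtain D where "D \<in> Q" "t = f D" "av (x - t) < 1" by auto
      then show "t = f ?C" using same[OF C \<open>D \<in> Q\<close> xC fC] by metis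
    qed
  qed
  have z: "0 \<in> f ` Q"
  proof -
    have "0 \<in> residue_rel av \<pi> `` {0}" by (auto simp: residue_rel_iff)
    then have "f (residue_rel av \<pi> `` {0}) = 0" by (simp add: f_def)
    then show ?thesis using inQ[of 0] by force
  qed
  have "finite Q" using finite_residue by (simp add: Q_def)
  moreover have "card (f ` Q) = residue_card av \<pi>"
    using card_image[OF inj] by (simp add: residue_card_def Q_def)
  moreover have "\<forall>t\<in>f ` Q. av t \<le> 1" using fC sub by (auto simp: valring_def)
  ultimately show ?thesis using ex z by blast
qed

definition resys :: "'k set" where
  "resys = (SOME R. finite R \<and> card R = residue_card av \<pi> \<and> 0 \<in> R \<and> (\<forall>t\<in>R. av t \<le> 1) \<and>
     (\<forall>x. av x \<le> 1 \<longrightarrow> (\<exists>!t. t \<in> R \<and> av (x - t) < 1)))"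

lemma resys:
  shows finite_resys: "finite resys" and card_resys: "card resys = residue_card av \<pi>"
    and zero_in_resys: "0 \<in> resys" and resys_integral: "t \<in> resys \<Longrightarrow> av t \<le> 1"
    and resys_ex1: "av x \<le> 1 \<Longrightarrow> \<exists>!t. t \<in> resys \<and> av (x - t) < 1"
  using someI_ex[OF residue_system_exists] unfolding resys_def by blast+

lemma resys_eqI: "s \<in> resys \<Longrightarrow> t \<in> resys \<Longrightarrow> av (s - t) < 1 \<Longrightarrow> s = t"
  using resys_ex1[of s] resys_integral[of s] by auto

lemma resys_unit: "t \<in> resys \<Longrightarrow> t \<noteq> 0 \<Longrightarrow> av t = 1"
  using resys_eqI[of t 0] resys_integral[of t] zero_in_resys by fastforce

definition rep :: "'k \<Rightarrow> 'k" where "rep x = (THE t. t \<in> resys \<and> av (x - t) < 1)"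

lemma rep: assumes "av x \<le> 1" shows "rep x \<in> resys" "av (x - rep x) < 1"
  using theI'[OF resys_ex1[OF assms]] by (auto simp: rep_def)

lemma rep_eq_iff:
  assumes "av x \<le> 1" "av y \<le> 1" shows "rep x = rep y \<longleftrightarrow> av (x - y) < 1"
proof
  assume "rep x = rep y"
  then have "x - y = (x - rep x) - (y - rep y)" by simp
  then show "av (x - y) < 1"
    using av_diff[of "x - rep x" "y - rep y"] rep[OF assms(1)] rep[OF assms(2)] by simp
next
  assume "av (x - y) < 1"
  moreover have "rep x - rep y = (x - y) - (x - rep x) + (y - rep y)" by simp
  ultimately have "av (rep x - rep y) < 1"
    using av_diff[of "x - y" "x - rep x"] av_ultra[of "x - y - (x - rep x)" "y - rep y"]
      rep(2)[OF assms(1)] rep(2)[OF assms(2)] by simp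
  then show "rep x = rep y" using resys_eqI rep assms by blast
qed

text \<open>A fibre contains at most \<open>t\<close> and the representative of \<open>- t\<close>,
  and the fibre through 0 contains 0 alone. Hence the \<open>q - 1\<close> nonzero residues give at
  least \<open>(q - 1) / 2\<close> further values.\<close>

lemma quadratic_image_card:
  assumes a: "av a = 1" and c: "av c \<le> 1"
  shows "residue_card av \<pi> + 1 \<le> 2 * card ((\<lambda>x. rep (c + a * x\<^sup>2)) ` resys)"
proof -
  define f where "f x = rep (c + a * x\<^sup>2)" for x
  have int: "av (c + a * x\<^sup>2) \<le> 1" if "x \<in> resys" for x
  proof -
    have "av (a * x\<^sup>2) \<le> 1" using resys_integral[OF that] a
      by (simp add: av_mult av_power power_le_one)
    then show ?thesis using av_ultra[of c "a * x\<^sup>2"] c by simp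
  qed
  have fib: "s = t \<or> s = rep (- t)" if "s \<in> resys" "t \<in> resys" "f s = f t" for s t
  proof -
    have "av ((c + a * s\<^sup>2) - (c + a * t\<^sup>2)) < 1"
      using that int by (simp add: f_def rep_eq_iff)
    moreover have "(c + a * s\<^sup>2) - (c + a * t\<^sup>2) = a * ((s - t) * (s - (- t)))"
      by (simp add: algebra_simps power2_eq_square)
    ultimately have "av (s - t) * av (s - (- t)) < 1" using a by (simp add: av_mult)
    then have "av (s - t) < 1 \<or> av (s - (-t)) < 1"
      by (metis linorder_not_less mult_mono one_le_numeral mult_1 av_nonneg zero_le_one)
    then show ?thesis
    proof
      assume "av (s - t) < 1" then show ?thesis using that resys_eqI by blast
    next
      assume l: "av (s - (- t)) < 1"
      have "rep s = rep (- t)" using l that resys_integral by (subst rep_eq_iff) auto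
      moreover have "rep s = s" using rep[of s] resys_eqI[of "rep s" s] that resys_integral
        by (simp add: av_commute)
      ultimately show ?thesis by simp
    qed
  qed
  have rep0: "rep 0 = 0" using rep[of 0] resys_eqI[of "rep 0" 0] zero_in_resys by simp
  have "resys - {0} \<subseteq> (\<Union>y\<in>f ` resys - {f 0}. {t \<in> resys. f t = y})"
  proof
    fix t assume t: "t \<in> resys - {0}"
    then have "f t \<noteq> f 0" using fib[of t 0] rep0 zero_in_resys by auto
    then show "t \<in> (\<Union>y\<in>f ` resys - {f 0}. {t \<in> resys. f t = y})" using t by auto
  qed
  then have "card (resys - {0}) \<le> card (\<Union>y\<in>f ` resys - {f 0}. {t \<in> resys. f t = y})"
    using finite_resys by (intro card_mono) auto
  also have "\<dots> \<le> (\<Sum>y\<in>f ` resys - {f 0}. card {t \<in> resys. f t = y})"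
    using finite_resys by (intro card_UN_le) auto
  also have "\<dots> \<le> (\<Sum>y\<in>f ` resys - {f 0}. 2)"
  proof (intro sum_mono)
    fix y assume "y \<in> f ` resys - {f 0}"
    then obtain t where t: "t \<in> resys" "y = f t" by auto
    then have "{s \<in> resys. f s = y} \<subseteq> {t, rep (- t)}" using fib by auto
    then have "card {s \<in> resys. f s = y} \<le> card {t, rep (-t)}" by (intro card_mono) auto
    also have "\<dots> \<le> 2" by (simp add: card_insert_if)
    finally show "card {t \<in> resys. f t = y} \<le> 2" .
  qed
  also have "\<dots> = 2 * (card (f ` resys) - 1)"
    using finite_resys zero_in_resys by simp
  finally have "card resys - 1 \<le> 2 * (card (f ` resys) - 1)"
    using finite_resys zero_in_resys by simp
  moreover have "card (f ` resys) > 0" "card resys > 0"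
    using finite_resys zero_in_resys card_gt_0_iff by blast+
  ultimately show ?thesis by (simp add: card_resys f_def)
qed

text \<open>Pigeonhole: the residues of \<open>x\<^sup>2\<close> and those of
  \<open>b + a * y\<^sup>2\<close> each fill more than half of the residue field, so the two sets
  meet.\<close>

lemma norm_form_residue_surj:
  assumes a: "av a = 1" and b: "av b = 1"
  obtains x y where "av x \<le> 1" "av y \<le> 1" "av (x\<^sup>2 - a * y\<^sup>2 - b) < 1"
proof -
  let ?A = "(\<lambda>x. rep (0 + 1 * x\<^sup>2)) ` resys" and ?B = "(\<lambda>x. rep (b + a * x\<^sup>2)) ` resys"
  have int: "av (c + d * x\<^sup>2) \<le> 1" if "x \<in> resys" "av c \<le> 1" "av d \<le> 1" for c d x
  proof -
    have "av (d * x\<^sup>2) \<le> 1" using resys_integral[OF that(1)] that(3)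
      by (simp add: av_mult av_power power_le_one mult_le_one)
    then show ?thesis using av_ultra[of c "d * x\<^sup>2"] that by simp
  qed
  have AB: "?A \<subseteq> resys" "?B \<subseteq> resys" using int[of _ 0 1] int[of _ b a] a b by (auto intro!: rep(1))
  have "?A \<inter> ?B \<noteq> {}"
  proof
    assume "?A \<inter> ?B = {}"
    then have "card (?A \<union> ?B) = card ?A + card ?B" using finite_resys by (simp add: card_Un_disjoint)
    moreover have "card (?A \<union> ?B) \<le> card resys" using AB finite_resys by (intro card_mono) auto
    ultimately show False
      using quadratic_image_card[of 1 0] quadratic_image_card[of a b] a b by (simp add: card_resys)
  qed
  then obtain x y where xy: "x \<in> resys" "y \<in> resys" "rep (0 + 1 * x\<^sup>2) = rep (b + a * y\<^sup>2)" by auto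
  then have "av ((0 + 1 * x\<^sup>2) - (b + a * y\<^sup>2)) < 1"
    using int[of x 0 1] int[of y b a] a b by (subst (asm) rep_eq_iff) auto
  then show ?thesis using that[of x y] xy resys_integral by (simp add: algebra_simps)
qed

end

section \<open>The quaternion algebra and its norm form\<close>

locale quaternion = padic av \<pi> for av :: "'k::field_char_0 \<Rightarrow> real" and \<pi> :: 'k +
  fixes \<iota> :: "'k \<Rightarrow> 'd::division_ring" and star :: "'d \<Rightarrow> 'd"
  assumes quat: "division_quaternion_algebra \<iota>" and invol: "canonical_involution \<iota> star"
begin

lemma iota_1 [simp]: "\<iota> 1 = 1" and iota_add: "\<iota> (a + b) = \<iota> a + \<iota> b"
  and iota_mult: "\<iota> (a * b) = \<iota> a * \<iota> b"
  using quat by (auto simp: division_quaternion_algebra_def)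

lemma range_iota: "range \<iota> = {z. \<forall>d. z * d = d * z}"
  using quat by (auto simp: division_quaternion_algebra_def)

lemma iota_0 [simp]: "\<iota> 0 = 0"
  using iota_add[of 0 0] by simp

lemma iota_minus: "\<iota> (- a) = - \<iota> a"
  by (rule minus_unique[symmetric]) (simp flip: iota_add)

lemma iota_diff: "\<iota> (a - b) = \<iota> a - \<iota> b"
  unfolding diff_conv_add_uminus iota_add iota_minus ..

lemma iota_comm: "d * \<iota> c = \<iota> c * d"
proof -
  have "\<iota> c \<in> {z. \<forall>d. z * d = d * z}" unfolding range_iota[symmetric] by simp
  then show ?thesis by simp
qed

lemma iota_arrange: "\<iota> a * \<iota> b = \<iota> (a * b)" "\<iota> a * (\<iota> b * x) = \<iota> (a * b) * x"
  by (simp_all add: iota_mult mult.assoc)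

lemma iota_left_comm: "d * (\<iota> c * e) = \<iota> c * (d * e)"
  by (metis iota_comm mult.assoc)

lemma iota_eq_0_iff [simp]: "\<iota> c = 0 \<longleftrightarrow> c = 0"
proof
  assume "\<iota> c = 0"
  show "c = 0"
  proof (rule ccontr)
    assume "c \<noteq> 0"
    then have "\<iota> c * \<iota> (inverse c) = 1" by (simp flip: iota_mult)
    then show False using \<open>\<iota> c = 0\<close> by simp
  qed
qed simp

lemma iota_inj: "\<iota> a = \<iota> b \<longleftrightarrow> a = b"
  using iota_eq_0_iff[of "a - b"] by (simp add: iota_diff del: iota_eq_0_iff)

lemma iota_eqI: "\<iota> a = \<iota> b \<Longrightarrow> a = b"
  by (simp add: iota_inj)

lemma iota_2: "\<iota> 2 = 2"
  using iota_add[of 1 1] by simp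

lemma iota_half: "\<iota> (1 / 2) * (\<iota> 2 * x) = x"
  by (simp flip: mult.assoc iota_mult)

lemma star_add: "star (x + y) = star x + star y" and star_iota [simp]: "star (\<iota> c) = \<iota> c"
  and star_mult: "star (x * y) = star y * star x" and star_star [simp]: "star (star x) = x"
  using invol by (auto simp: canonical_involution_def)

lemma star_iota_mult: "star (\<iota> c * x) = \<iota> c * star x"
  by (simp add: star_mult iota_comm[of "star x"])

lemma star_0 [simp]: "star 0 = 0" and star_1 [simp]: "star 1 = 1"
  using star_iota[of 0] star_iota[of 1] by auto

lemma star_minus: "star (- x) = - star x"
  by (rule minus_unique[symmetric]) (simp flip: star_add)

lemma star_diff: "star (x - y) = star x - star y"
  unfolding diff_conv_add_uminus star_add star_minus ..

lemma star_eq_0_iff [simp]: "star x = 0 \<longleftrightarrow> x = 0"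
  by (metis star_0 star_star)

section \<open>Reduced trace and norm of an element\<close>

definition tr :: "'d \<Rightarrow> 'k" where "tr x = (THE c. \<iota> c = x + star x)"
definition nm :: "'d \<Rightarrow> 'k" where "nm x = (THE c. \<iota> c = x * star x)"

lemma iota_tr: "\<iota> (tr x) = x + star x"
proof -
  have "x + star x \<in> range \<iota>" using invol by (auto simp: canonical_involution_def)
  then obtain c where "\<iota> c = x + star x" by auto
  then show ?thesis unfolding tr_def by (rule theI) (metis \<open>\<iota> c = x + star x\<close> iota_inj)
qed

lemma iota_nm: "\<iota> (nm x) = x * star x"
proof -
  have "x * star x \<in> range \<iota>" using invol by (auto simp: canonical_involution_def)
  then obtain c where "\<iota> c = x * star x" by auto
  then show ?thesis unfolding nm_def by (rule theI) (metis \<open>\<iota> c = x * star x\<close> iota_inj)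
qed

text \<open>An element commutes with its central trace and therefore with its conjugate.\<close>

lemma iota_nm': "\<iota> (nm x) = star x * x"
proof -
  have "x * \<iota> (tr x) = \<iota> (tr x) * x" by (rule iota_comm)
  then show ?thesis by (simp add: iota_tr iota_nm algebra_simps)
qed

lemma star_eq: "star x = \<iota> (tr x) - x"
  by (simp add: iota_tr)

lemma square_eq: "x * x = \<iota> (tr x) * x - \<iota> (nm x)"
  unfolding iota_nm' iota_tr by (simp add: algebra_simps)

lemma nm_mult: "nm (x * y) = nm x * nm y"
proof -
  have "\<iota> (nm (x * y)) = x * \<iota> (nm y) * star x" by (simp add: iota_nm star_mult mult.assoc)
  also have "\<dots> = \<iota> (nm x) * \<iota> (nm y)"
    by (simp only: mult.assoc iota_comm[of "star x", symmetric]) (simp only: iota_nm[of x] mult.assoc[symmetric])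
  also have "\<dots> = \<iota> (nm x * nm y)" by (simp add: iota_mult)
  finally show ?thesis by (simp add: iota_inj)
qed

lemma nm_star [simp]: "nm (star x) = nm x"
  by (rule iota_eqI) (simp only: iota_nm[of "star x"] iota_nm'[of x] star_star)

lemma nm_iota [simp]: "nm (\<iota> c) = c\<^sup>2"
  using iota_nm[of "\<iota> c"] by (simp add: power2_eq_square iota_inj flip: iota_mult)

lemma nm_0 [simp]: "nm 0 = 0" using nm_iota[of 0] by simp
lemma nm_1 [simp]: "nm 1 = 1" using nm_iota[of 1] by simp

lemma nm_eq_0_iff [simp]: "nm x = 0 \<longleftrightarrow> x = 0"
  using iota_nm[of x] by (metis iota_eq_0_iff mult_eq_0_iff star_eq_0_iff)

lemma nm_add: "nm (x + y) = nm x + nm y + tr (x * star y)"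
proof -
  have "\<iota> (nm (x + y)) = \<iota> (nm x + nm y + tr (x * star y))"
    by (simp add: iota_nm iota_add iota_tr star_add star_mult algebra_simps)
  then show ?thesis by (simp add: iota_inj)
qed

lemma nm_minus [simp]: "nm (- x) = nm x"
  by (rule iota_eqI) (simp add: iota_nm star_minus)

lemma tr_add: "tr (x + y) = tr x + tr y"
proof -
  have "\<iota> (tr (x + y)) = \<iota> (tr x + tr y)" by (simp add: iota_tr iota_add star_add algebra_simps)
  then show ?thesis by (simp add: iota_inj)
qed

lemma tr_star [simp]: "tr (star x) = tr x"
  by (rule iota_eqI) (simp add: iota_tr add.commute)

lemma tr_iota_mult: "tr (\<iota> c * x) = c * tr x"
proof -
  have "\<iota> (tr (\<iota> c * x)) = \<iota> (c * tr x)"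
    by (simp add: iota_tr iota_mult star_mult iota_comm distrib_left)
  then show ?thesis by (simp add: iota_inj)
qed

lemma tr_iota [simp]: "tr (\<iota> c) = 2 * c"
  using iota_tr[of "\<iota> c"] by (simp add: iota_inj flip: iota_add)

text \<open>Polarization of the invariance of the norm under conjugation.\<close>

lemma tr_comm: "tr (x * y) = tr (y * x)"
proof -
  have "nm (star y + x) = nm (y + star x)"
    using nm_star[of "y + star x"] by (simp add: star_add)
  then show ?thesis using nm_add[of x "star y"] nm_add[of "star x" y] nm_star
    by (metis add.commute add_left_imp_eq nm_star star_star tr_star star_mult)
qed

lemma tr_minus: "tr (- x) = - tr x"
  using tr_iota_mult[of "-1" x] by (simp add: iota_minus)

lemma star_fixed_imp: "star x = x \<Longrightarrow> \<exists>c. x = \<iota> c"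
proof -
  assume "star x = x"
  then have "\<iota> (tr x) = \<iota> 2 * x" by (simp add: iota_tr iota_2 mult_2)
  then have "x = \<iota> (1 / 2 * tr x)" using iota_half[of x] by (simp only: iota_mult)
  then show ?thesis by blast
qed

text \<open>If everything were central, the element 1 would span the algebra, whose dimension is
  4.\<close>

lemma exists_noncentral: "\<exists>x. x \<notin> range \<iota>"
proof (rule ccontr)
  assume "\<nexists>x. x \<notin> range \<iota>"
  then have U: "(UNIV :: 'd set) = range \<iota>" by auto
  interpret V: vector_space "\<lambda>c d. \<iota> c * d"
    by unfold_locales (auto simp: iota_add iota_mult algebra_simps)
  have "V.dim (UNIV :: 'd set) = card {1 :: 'd}"
  proof (rule V.dim_unique)
    show "V.independent {1 :: 'd}" by simp
    show "UNIV \<subseteq> V.span {1 :: 'd}" unfolding V.span_singleton using U by auto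
  qed auto
  then show False using quat by (simp add: division_quaternion_algebra_def)
qed

section \<open>Pure quaternions and anticommuting pairs\<close>

lemma pure_square: "star x = - x \<Longrightarrow> x * x = \<iota> (- nm x)"
  by (simp add: iota_minus iota_nm)

lemma pure_anticommute: "star x = - x \<Longrightarrow> star y = - y \<Longrightarrow> \<exists>c. x * y + y * x = \<iota> c"
  by (rule star_fixed_imp) (simp add: star_add star_mult add.commute)

text \<open>The difference of a noncentral element and its conjugate is a pure \<open>i\<close>, and
  any commutator \<open>i * y - y * i\<close> anticommutes with \<open>i\<close> because
  \<open>i * i\<close> is central. Such a pair takes the place of a presentation of the abstractly
  given algebra.\<close>

lemma anticommuting_pair_exists:
  "\<exists>i j. i \<noteq> 0 \<and> j \<noteq> 0 \<and> star i = - i \<and> star j = - j \<and> i * j = - (j * i)"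
proof -
  obtain x where x: "x \<notin> range \<iota>" using exists_noncentral by blast
  define i where "i = x - star x"
  have si: "star i = - i" by (simp add: i_def star_diff)
  have i0: "i \<noteq> 0" using x star_fixed_imp[of x] by (auto simp: i_def)
  have "i \<notin> range \<iota>"
  proof
    assume "i \<in> range \<iota>"
    then have "star i = i" by auto
    then have "i + i = 0" using si by (metis add.right_inverse)
    then have "\<iota> 2 * i = 0" by (simp add: iota_2 mult_2)
    then show False using i0 by simp
  qed
  then obtain y where y: "i * y \<noteq> y * i" by (auto simp: range_iota)
  define j where "j = i * y - y * i"
  have "star j = - j"
    unfolding j_def star_diff star_mult si star_eq[of y] by (simp add: algebra_simps iota_comm)
  moreover have "i * j = - (j * i)"
  proof -
    have "i * (i * y) = y * (i * i)" using pure_square[OF si] iota_comm by (metis mult.assoc)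
    then show ?thesis by (simp add: j_def algebra_simps)
  qed
  moreover have "j \<noteq> 0" using y by (simp add: j_def)
  ultimately show ?thesis using i0 si by blast
qed

lemma av_pi_powi: "av (\<pi> powi n) = q powi (- n)"
  by (simp add: av_powi av_pi power_int_divide_distrib power_int_minus inverse_eq_divide)

text \<open>A central factor \<open>\<pi> powi n\<close> shifts the order of the norm by
  \<open>2 * n\<close>, so the order can be reduced to 0 or 1.\<close>

lemma scale_pure:
  assumes i: "i \<noteq> 0" "star i = - i"
  obtains c where "c \<noteq> 0" "av (nm (\<iota> c * i)) = 1 \<or> av (nm (\<iota> c * i)) = 1 / q"
    "star (\<iota> c * i) = - (\<iota> c * i)" "\<iota> c * i \<noteq> 0"
proof -
  obtain n where n: "av (nm i) = q powi (- n)" using av_discrete[of "nm i"] i by auto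
  define c where "c = \<pi> powi (- (n div 2))"
  have "av (nm (\<iota> c * i)) = q powi (2 * (n div 2)) * q powi (- n)"
    by (simp add: nm_mult av_mult n c_def av_power av_pi_powi power2_eq_square flip: power_int_add)
  also have "\<dots> = q powi (- (n mod 2))"
  proof -
    have "2 * (n div 2) + - n = - (n mod 2)" by presburger
    then show ?thesis by (metis power_int_add q_pos(2))
  qed
  finally have "av (nm (\<iota> c * i)) = q powi (- (n mod 2))" .
  moreover have "n mod 2 = 0 \<or> n mod 2 = 1" by auto
  ultimately have "av (nm (\<iota> c * i)) = 1 \<or> av (nm (\<iota> c * i)) = 1 / q"
    by (auto simp: power_int_minus inverse_eq_divide)
  moreover have "c \<noteq> 0" by (simp add: c_def)
  ultimately show ?thesis using that[of c] i by (simp add: star_iota_mult)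
qed

lemma anticommute_scale: "i * j = - (j * i) \<Longrightarrow> (\<iota> b * i) * (\<iota> c * j) = - ((\<iota> c * j) * (\<iota> b * i))"
proof -
  assume *: "i * j = - (j * i)"
  have "(\<iota> b * i) * (\<iota> c * j) = \<iota> (b * c) * (i * j)"
    by (simp add: mult.assoc iota_left_comm[of i] iota_mult)
  also have "\<dots> = - (\<iota> (c * b) * (j * i))" by (simp add: * mult.commute)
  also have "\<dots> = - ((\<iota> c * j) * (\<iota> b * i))" by (simp add: mult.assoc iota_left_comm[of j] iota_mult)
  finally show ?thesis .
qed

text \<open>If both norms have order 1, then \<open>i * j\<close> divided by \<open>\<pi>\<close>
  has unit norm and still anticommutes with \<open>i\<close>, so these two form the required
  pair.\<close>

lemma unramified_pair_exists:
  "\<exists>i j. i \<noteq> 0 \<and> j \<noteq> 0 \<and> star i = - i \<and> star j = - j \<and> i * j = - (j * i) \<and> av (nm i) = 1 \<and>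
     (av (nm j) = 1 \<or> av (nm j) = 1 / q)"
proof -
  obtain i0 j0 where a0: "i0 \<noteq> 0" "j0 \<noteq> 0" "star i0 = - i0" "star j0 = - j0" "i0 * j0 = - (j0 * i0)"
    using anticommuting_pair_exists by blast
  obtain b where b: "b \<noteq> 0" "av (nm (\<iota> b * i0)) = 1 \<or> av (nm (\<iota> b * i0)) = 1 / q"
    "star (\<iota> b * i0) = - (\<iota> b * i0)" "\<iota> b * i0 \<noteq> 0" using scale_pure[OF a0(1,3)] .
  obtain c where c: "c \<noteq> 0" "av (nm (\<iota> c * j0)) = 1 \<or> av (nm (\<iota> c * j0)) = 1 / q"
    "star (\<iota> c * j0) = - (\<iota> c * j0)" "\<iota> c * j0 \<noteq> 0" using scale_pure[OF a0(2,4)] .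
  define i j where "i = \<iota> b * i0" and "j = \<iota> c * j0"
  have ij: "i * j = - (j * i)" unfolding i_def j_def by (rule anticommute_scale) (rule a0)
  note bc = b(2-4)[folded i_def] c(2-4)[folded j_def]
  consider "av (nm i) = 1" | "av (nm j) = 1" | "av (nm i) = 1 / q" "av (nm j) = 1 / q" using bc by blast
  then show ?thesis
  proof cases
    case 1 then show ?thesis using bc ij by blast
  next
    case 2
    have "j * i = - (i * j)" using ij by simp
    then show ?thesis using bc 2 by blast
  next
    case 3
    define l where "l = \<iota> (inverse \<pi>) * (i * j)"
    have "av (nm l) = 1" using 3 by (simp add: l_def nm_mult av_mult av_power av_inverse av_pi power2_eq_square)
    moreover have "star (i * j) = j * i" by (simp add: star_mult bc)
    then have "star (i * j) = - (i * j)" using ij by simp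
    then have "star l = - l" by (simp add: l_def star_iota_mult)
    moreover have "l \<noteq> 0" using bc by (simp add: l_def)
    moreover have "l * i = - (i * l)"
    proof -
      have "j * i = - (i * j)" using ij by simp
      then have "i * j * i = - (i * (i * j))" by (simp add: mult.assoc)
      then show ?thesis by (simp add: l_def mult.assoc iota_left_comm[of i])
    qed
    ultimately show ?thesis using bc 3 by blast
  qed
qed

text \<open>The centralizer of a pure element is the quadratic field it generates: for the pure
  element \<open>p = x - star x\<close>, the product \<open>p * i\<close> is half of the central
  element \<open>p * i + i * p\<close>, so \<open>p\<close> is a central multiple of
  \<open>i\<close>.\<close>

lemma commutes_with_pure:
  assumes i: "i \<noteq> 0" "star i = - i" and x: "x * i = i * x"
  shows "\<exists>a b. x = \<iota> a + \<iota> b * i"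
proof -
  define p where "p = x - star x"
  have p: "star p = - p" by (simp add: p_def star_diff)
  have "star x * i = i * star x"
    using arg_cong[OF x, of star] i by (simp add: star_mult)
  then have pi: "p * i = i * p" using x by (simp add: p_def algebra_simps)
  obtain c where c: "p * i + i * p = \<iota> c" using pure_anticommute[OF p i(2)] by blast
  have n: "nm i \<noteq> 0" using i by simp
  have "p * \<iota> (- nm i) = p * i * i" by (simp add: pure_square[OF i(2)] mult.assoc)
  also have "\<dots> = \<iota> (c / 2) * i"
  proof -
    have "\<iota> 2 * (p * i) = \<iota> c" using c pi by (simp add: iota_2 mult_2)
    then have "p * i = \<iota> (1 / 2 * c)" using iota_half[of "p * i"] by (simp only: iota_mult)
    then show ?thesis by simp
  qed
  finally have "\<iota> (- nm i) * p = \<iota> (c / 2) * i" by (simp add: iota_comm[of p])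
  then have "\<iota> (inverse (- nm i)) * (\<iota> (- nm i) * p) = \<iota> (inverse (- nm i)) * (\<iota> (c / 2) * i)" by simp
  then have p2: "p = \<iota> (inverse (- nm i) * (c / 2)) * i" using n by (simp flip: mult.assoc iota_mult)
  have "\<iota> 2 * x = \<iota> (tr x) + p" by (simp add: p_def iota_tr iota_2 mult_2)
  then have "x = \<iota> (1 / 2) * (\<iota> (tr x) + p)" using iota_half[of x] by simp
  then have "x = \<iota> (1 / 2 * tr x) + \<iota> (1 / 2 * (inverse (- nm i) * (c / 2))) * i"
    by (subst (asm) p2) (simp only: distrib_left iota_mult mult.assoc)
  then show ?thesis by blast
qed

text \<open>Conjugation by \<open>i\<close> is an involution since \<open>i * i\<close> is central.
  The even part of \<open>x\<close> commutes with \<open>i\<close>, and the odd part does so after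
  division by \<open>j\<close>; both are then covered by \<open>commutes_with_pure\<close>.\<close>

lemma quaternion_basis:
  assumes i: "i \<noteq> 0" "star i = - i" and j: "j \<noteq> 0" and ij: "i * j = - (j * i)"
  shows "\<exists>a b c d. x = \<iota> a + \<iota> b * i + (\<iota> c + \<iota> d * i) * j"
proof -
  define y where "y = i * x * inverse i"
  have yi: "y * i = i * x" using i by (simp add: y_def mult.assoc)
  have iy: "i * y = x * i"
  proof -
    have "i * y = i * i * x * inverse i" by (simp add: y_def mult.assoc)
    also have "i * i * x = x * i * i" using pure_square[OF i(2)] iota_comm by (metis mult.assoc)
    finally show ?thesis using i by (simp add: mult.assoc)
  qed
  define x1 x2 where "x1 = \<iota> (1 / 2) * (x + y)" and "x2 = \<iota> (1 / 2) * (x - y)"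
  have "x1 * i = i * x1" by (simp add: x1_def mult.assoc iota_left_comm[of i] distrib_left distrib_right yi iy add.commute)
  then obtain a b where ab: "x1 = \<iota> a + \<iota> b * i" using commutes_with_pure[OF i] by blast
  have x2: "x2 * i = - (i * x2)"
    by (simp add: x2_def mult.assoc iota_left_comm[of i] left_diff_distrib right_diff_distrib yi iy)
  have ji: "i * inverse j = - (inverse j * i)"
  proof -
    have "i * inverse j = inverse j * (j * i) * inverse j" using j by (simp flip: mult.assoc)
    also have "j * i = - (i * j)" using ij by simp
    finally show ?thesis using j by (simp add: mult.assoc)
  qed
  have "(x2 * inverse j) * i = i * (x2 * inverse j)"
  proof -
    have "(x2 * inverse j) * i = - (x2 * (i * inverse j))" by (simp add: ji mult.assoc)
    also have "\<dots> = - (x2 * i * inverse j)" by (simp add: mult.assoc)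
    finally show ?thesis by (simp add: x2 mult.assoc)
  qed
  then obtain c d where cd: "x2 * inverse j = \<iota> c + \<iota> d * i" using commutes_with_pure[OF i] by blast
  have "x2 = (\<iota> c + \<iota> d * i) * j" using j by (simp add: mult.assoc flip: cd)
  moreover have "x = x1 + x2"
  proof -
    have "x1 + x2 = \<iota> (1 / 2) * (\<iota> 2 * x)" by (simp add: x1_def x2_def iota_2 mult_2 algebra_simps)
    also have "\<dots> = x" by (simp flip: mult.assoc iota_mult)
    finally show ?thesis by simp
  qed
  ultimately show ?thesis using ab by metis
qed

lemma nm_quadratic: "star i = - i \<Longrightarrow> nm (\<iota> x + \<iota> y * i) = x\<^sup>2 + nm i * y\<^sup>2"
proof -
  assume i: "star i = - i"
  then have "tr i = 0" using iota_tr[of i] by simp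
  then show ?thesis
    by (simp add: nm_add nm_mult star_iota_mult tr_iota_mult tr_minus i mult.commute)
qed

text \<open>The binary form stays anisotropic modulo \<open>\<pi>\<close>: by
  \<open>sqrt_one_plus\<close> a nontrivial zero modulo \<open>\<pi>\<close> would lift to a genuine
  one, whereas nonzero quaternions have nonzero norm. Hence the two squares never cancel.\<close>

lemma pure_unit_norm_form:
  assumes i: "i \<noteq> 0" "star i = - i" "av (nm i) = 1"
  shows "av (x\<^sup>2 + nm i * y\<^sup>2) = max (av x) (av y) ^ 2"
proof -
  note neq = nm_quadratic[OF i(2)]
  have key: False if "av x \<le> 1" "av y = 1" "av (x\<^sup>2 + nm i * y\<^sup>2) < 1" for x y
  proof -
    have y0: "y \<noteq> 0" using that by auto
    have "av (x\<^sup>2) = 1"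
    proof -
      have "av (- (nm i * y\<^sup>2)) = 1" using that i by (simp add: av_mult av_power)
      moreover have "av (x\<^sup>2 - (- (nm i * y\<^sup>2))) < 1" using that by simp
      ultimately show ?thesis using av_close_eq by metis
    qed
    then have x0: "x \<noteq> 0" by auto
    define w where "w = - ((x\<^sup>2 + nm i * y\<^sup>2) / x\<^sup>2)"
    have "av w < 1" using that \<open>av (x\<^sup>2) = 1\<close> unfolding w_def av_minus av_divide by simp
    then obtain s where s: "s\<^sup>2 = 1 + w" using sqrt_one_plus by metis
    have "(s * x)\<^sup>2 + nm i * y\<^sup>2 = 0" using x0 by (simp add: power_mult_distrib s w_def field_simps)
    then have "nm (\<iota> (s * x) + \<iota> y * i) = 0" by (simp add: neq)
    then have "\<iota> (s * x) + \<iota> y * i = 0" by simp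
    then have "star (\<iota> (s * x) + \<iota> y * i) = 0" by simp
    then have "\<iota> (s * x) - \<iota> y * i = 0" using i by (simp add: star_add star_iota_mult)
    with \<open>\<iota> (s * x) + \<iota> y * i = 0\<close> have "\<iota> 2 * (\<iota> y * i) = 0"
      by (simp add: iota_2 mult_2)
    then show False using y0 i by simp
  qed
  have unit: "av (x\<^sup>2 + nm i * y\<^sup>2) = 1" if "av x \<le> 1" "av y \<le> 1" "av x = 1 \<or> av y = 1" for x y
  proof (rule ccontr)
    assume ne: "av (x\<^sup>2 + nm i * y\<^sup>2) \<noteq> 1"
    have "av (x\<^sup>2 + nm i * y\<^sup>2) \<le> 1"
      using av_ultra[of "x\<^sup>2" "nm i * y\<^sup>2"] that i by (auto simp: av_mult av_power power_le_one max_def split: if_splits intro: order_trans)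
    with ne have l: "av (x\<^sup>2 + nm i * y\<^sup>2) < 1" by simp
    have "av y = 1"
    proof (rule ccontr)
      assume "av y \<noteq> 1"
      then have "av x = 1" "av y < 1" using that by auto
      then have "av (nm i * y\<^sup>2) < av (x\<^sup>2)" using i by (simp add: av_mult av_power power_less_one_iff)
      then show False using av_add_eq(2) ne \<open>av x = 1\<close> by (metis av_power power_one)
    qed
    then show False using key that l by blast
  qed
  show ?thesis
  proof (cases "x = 0 \<and> y = 0")
    case False
    \<comment> \<open>Division by the larger coordinate reduces to a maximum equal to 1.\<close>
    define m where "m = (if av x \<ge> av y then x else y)"
    have m: "m \<noteq> 0" "av m = max (av x) (av y)" using False by (auto simp: m_def max_def)
    have m_le: "av x \<le> av m" "av y \<le> av m" "av x = av m \<or> av y = av m" by (auto simp: m_def)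
    have "av m > 0" using m(1) by simp
    then have "av ((x/m)\<^sup>2 + nm i * (y/m)\<^sup>2) = 1"
      using m_le by (intro unit) (auto simp: av_divide)
    moreover have "x\<^sup>2 + nm i * y\<^sup>2 = m\<^sup>2 * ((x/m)\<^sup>2 + nm i * (y/m)\<^sup>2)" using m by (simp add: field_simps power2_eq_square)
    ultimately show ?thesis by (simp add: av_mult av_power m)
  qed simp
qed

text \<open>\<open>i\<close> generates the unramified quadratic extension, and \<open>j\<close> is a
  uniformizer of the algebra that normalizes it.\<close>

definition std_pair :: "'d \<Rightarrow> 'd \<Rightarrow> bool" where
  "std_pair i j \<longleftrightarrow> i \<noteq> 0 \<and> j \<noteq> 0 \<and> star i = - i \<and> star j = - j \<and> i * j = - (j * i) \<and>
     av (nm i) = 1 \<and> av (nm j) = 1 / q"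

text \<open>If \<open>nm j\<close> were a unit, \<open>- nm j\<close> would be the norm of some
  \<open>f\<close> in the field generated by \<open>i\<close>. Then \<open>inverse f * j\<close> has
  square 1, so \<open>j\<close> is \<open>f\<close> or \<open>- f\<close> and commutes with
  \<open>i\<close>, a contradiction.\<close>

lemma std_pair_exists: "\<exists>i j. std_pair i j"
proof -
  obtain i j where ij: "i \<noteq> 0" "j \<noteq> 0" "star i = - i" "star j = - j" "i * j = - (j * i)"
    "av (nm i) = 1" "av (nm j) = 1 \<or> av (nm j) = 1 / q" using unramified_pair_exists by blast
  have "av (nm j) \<noteq> 1"
  proof
    assume n1: "av (nm j) = 1"
    obtain x y where xy: "av x \<le> 1" "av y \<le> 1" "av (x\<^sup>2 - (- nm i) * y\<^sup>2 - (- nm j)) < 1"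
      using norm_form_residue_surj[of "- nm i" "- nm j"] n1 ij by auto
    define e where "e = \<iota> x + \<iota> y * i"
    have se: "star e = \<iota> x - \<iota> y * i" using ij by (simp add: e_def star_add star_iota_mult)
    have ne: "nm e = x\<^sup>2 + nm i * y\<^sup>2" unfolding e_def by (rule nm_quadratic) (rule ij)
    have close: "av (nm e - (- nm j)) < 1" using xy by (simp add: ne)
    then have ave: "av (nm e) = 1" using n1 av_close_eq[of "nm e" "- nm j"] by simp
    then have e0: "e \<noteq> 0" by auto
    define z where "z = (- nm j - nm e) / nm e"
    have "av z < 1" using close by (simp add: z_def av_divide ave av_commute)
    then obtain s where s: "s\<^sup>2 = 1 + z" using sqrt_one_plus by metis
    \<comment> \<open>The central factor \<open>s\<close> turns the congruence between
      \<open>nm e\<close> and \<open>- nm j\<close> into an equality.\<close>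
    define f where "f = \<iota> s * e"
    have nf: "nm f = - nm j" using e0 by (simp add: f_def nm_mult s z_def field_simps)
    have f0: "f \<noteq> 0" using nf ij by auto
    have sf: "star f = \<iota> s * (\<iota> x - \<iota> y * i)" by (simp add: f_def star_iota_mult se)
    have jf: "j * f = star f * j"
    proof -
      have "j * e = (\<iota> x - \<iota> y * i) * j"
        using ij by (simp add: e_def distrib_left left_diff_distrib iota_comm[of j] mult.assoc iota_left_comm[of j])
      then show ?thesis unfolding sf by (simp add: f_def iota_left_comm[of j] mult.assoc)
    qed
    define g where "g = inverse f * j"
    have jinv: "j * inverse f = inverse (star f) * j"
    proof -
      have "j * inverse f = inverse (star f) * (star f * j) * inverse f" using f0 by (simp flip: mult.assoc)
      also have "\<dots> = inverse (star f) * (j * f) * inverse f" by (simp only: jf)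
      also have "\<dots> = inverse (star f) * j" using f0 by (simp add: mult.assoc)
      finally show ?thesis .
    qed
    have "g * g = inverse f * inverse (star f) * (j * j)"
      unfolding g_def by (simp add: mult.assoc) (simp add: jinv flip: mult.assoc)
    also have "inverse f * inverse (star f) = inverse (star f * f)" using f0 by (simp add: nonzero_inverse_mult_distrib)
    also have "star f * f = \<iota> (nm f)" by (simp add: iota_nm')
    also have "j * j = \<iota> (nm f)" by (simp add: nf pure_square ij)
    finally have gg: "g * g = 1" using f0 by simp
    have "(g - 1) * (g + 1) = 0" by (simp add: algebra_simps gg)
    then have "g = 1 \<or> g = -1" by (auto simp: eq_neg_iff_add_eq_0)
    then have "j = f \<or> j = - f" using f0 by (auto simp: g_def) (metis mult.right_neutral mult_minus_right mult.assoc right_inverse mult_1)+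
    then have "i * j = j * i"
    proof -
      have "i * f = f * i" by (simp add: f_def e_def algebra_simps iota_left_comm[of i] iota_comm[of i])
      then show ?thesis using \<open>j = f \<or> j = - f\<close> by auto
    qed
    then have "i * j + i * j = 0" using ij(5) by (metis add.right_inverse)
    then have "\<iota> 2 * (i * j) = 0" by (simp add: iota_2 mult_2)
    then show False using ij by simp
  qed
  then show ?thesis using ij by (auto simp: std_pair_def)
qed

end

section \<open>The maximal order\<close>

context quaternion begin

definition qi :: 'd where "qi = (SOME i. \<exists>j. std_pair i j)"
definition qj :: 'd where "qj = (SOME j. std_pair qi j)"

lemma std_pair: "std_pair qi qj"
proof -
  have "\<exists>j. std_pair qi j" unfolding qi_def by (rule someI_ex) (rule std_pair_exists)
  then show ?thesis unfolding qj_def by (rule someI_ex)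
qed

lemma qi_qj [simp]: "qi \<noteq> 0" "qj \<noteq> 0" "star qi = - qi" "star qj = - qj" "av (nm qi) = 1" "av (nm qj) = 1 / q"
  and qj_qi: "qj * qi = - (qi * qj)"
  using std_pair by (auto simp: std_pair_def)

lemma qi_squared: "qi * qi = \<iota> (- nm qi)" and qj_squared: "qj * qj = \<iota> (- nm qj)"
  by (auto intro: pure_square)

section \<open>The multiplicative ultrametric norm and its residue field\<close>

definition nr :: "'d \<Rightarrow> real" where "nr x = av (nm x)"

lemma nr_nonneg [simp]: "0 \<le> nr x" by (simp add: nr_def)
lemma nr_eq_0_iff [simp]: "nr x = 0 \<longleftrightarrow> x = 0" by (simp add: nr_def)
lemma nr_0 [simp]: "nr 0 = 0" by simp
lemma nr_mult: "nr (x * y) = nr x * nr y" by (simp add: nr_def nm_mult av_mult)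
lemma nr_iota: "nr (\<iota> c) = (av c)\<^sup>2" by (simp add: nr_def av_power)
lemma nr_star [simp]: "nr (star x) = nr x" by (simp add: nr_def)
lemma nr_minus [simp]: "nr (- x) = nr x" by (simp add: nr_def)
lemma nr_1 [simp]: "nr 1 = 1" by (simp add: nr_def)
lemma nr_qi [simp]: "nr qi = 1" and nr_qj [simp]: "nr qj = 1 / q" by (simp_all add: nr_def)
lemma nr_commute: "nr (x - y) = nr (y - x)" using nr_minus[of "x - y"] by simp

lemma nr_inverse: "nr (inverse x) = inverse (nr x)"
proof (cases "x = 0")
  case False
  then have "nr (inverse x) * nr x = 1" by (simp flip: nr_mult)
  then show ?thesis by (metis inverse_unique mult.commute)
qed simp

lemma nr_power: "nr (x ^ n) = nr x ^ n"
  by (induction n) (auto simp: nr_mult)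

definition coord :: "'k \<Rightarrow> 'k \<Rightarrow> 'k \<Rightarrow> 'k \<Rightarrow> 'd" where
  "coord a b c d = \<iota> a + \<iota> b * qi + (\<iota> c + \<iota> d * qi) * qj"

lemma coord_exists: "\<exists>a b c d. x = coord a b c d"
  unfolding coord_def by (rule quaternion_basis) (auto simp: qj_qi)

lemma coord_add: "coord a b c d + coord a' b' c' d' = coord (a + a') (b + b') (c + c') (d + d')"
  by (simp add: coord_def iota_add algebra_simps)

lemma coord_minus: "- coord a b c d = coord (- a) (- b) (- c) (- d)"
  by (simp add: coord_def iota_minus algebra_simps)

lemma coord_mult:
  "coord a b c d * coord a' b' c' d' =
     coord (a * a' - nm qi * b * b' - nm qj * (c * c' + nm qi * d * d'))
           (a * b' + b * a' - nm qj * (d * c' - c * d'))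
           (a * c' - nm qi * b * d' + c * a' + nm qi * d * b')
           (a * d' + b * c' + d * a' - c * b')"
proof -
  have qiqi: "qi * (qi * x) = \<iota> (- nm qi) * x" for x by (simp add: qi_squared flip: mult.assoc)
  have qjqj: "qj * (qj * x) = \<iota> (- nm qj) * x" for x by (simp add: qj_squared flip: mult.assoc)
  have qjqi: "qj * (qi * x) = - (qi * (qj * x))" for x by (simp add: qj_qi flip: mult.assoc)
  show ?thesis
    unfolding coord_def
    by (simp add: distrib_left distrib_right mult.assoc qj_qi qjqi qiqi qjqj qi_squared qj_squared
        iota_comm[of qi] iota_comm[of qj] iota_left_comm[of qi] iota_left_comm[of qj] iota_arrange
        iota_add iota_diff iota_minus left_diff_distrib right_diff_distrib)
      (simp add: algebra_simps iota_arrange)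
qed

lemma star_coord: "star (coord a b c d) = coord a (- b) (- c) (- d)"
proof -
  have "star (qi * qj) = - (qi * qj)" by (simp add: star_mult qj_qi)
  then have "star (\<iota> c * qj + \<iota> d * (qi * qj)) = - (\<iota> c * qj + \<iota> d * (qi * qj))"
    by (simp add: star_add star_iota_mult)
  then show ?thesis
    by (simp add: coord_def star_add star_iota_mult distrib_right left_diff_distrib mult.assoc iota_minus)
qed

lemma nm_coord_eq: "nm (coord a b c d) = (a\<^sup>2 + nm qi * b\<^sup>2) + nm qj * (c\<^sup>2 + nm qi * d\<^sup>2)"
proof -
  have "\<iota> (nm (coord a b c d)) = coord ((a\<^sup>2 + nm qi * b\<^sup>2) + nm qj * (c\<^sup>2 + nm qi * d\<^sup>2)) 0 0 0"
    unfolding iota_nm star_coord coord_mult by (simp add: algebra_simps power2_eq_square)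
  then show ?thesis by (auto simp: coord_def intro: iota_eqI)
qed

text \<open>The norms of the two blocks have even and odd order respectively, so they never cancel
  and the larger one decides.\<close>

lemma nr_coord: "nr (coord a b c d) = max ((max (av a) (av b))\<^sup>2) ((max (av c) (av d))\<^sup>2 / q)"
proof -
  define m m' where "m = (if av a \<ge> av b then a else b)" and "m' = (if av c \<ge> av d then c else d)"
  have mm: "max (av a) (av b) = av m" "max (av c) (av d) = av m'" by (auto simp: m_def m'_def)
  define A B where "A = a\<^sup>2 + nm qi * b\<^sup>2" and "B = nm qj * (c\<^sup>2 + nm qi * d\<^sup>2)"
  have A: "av A = (av m)\<^sup>2" unfolding A_def by (subst pure_unit_norm_form) (auto simp: mm)
  have B: "av B = (av m')\<^sup>2 / q" unfolding B_def av_mult by (subst pure_unit_norm_form) (auto simp: mm)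
  have "av (A + B) = max (av A) (av B)"
  proof (cases "m = 0 \<or> m' = 0")
    case True
    then have "A = 0 \<or> B = 0" using A B by auto
    then show ?thesis by auto
  next
    case False
    obtain n n' where n: "av m = q powi (- n)" "av m' = q powi (- n')" using av_discrete False by metis
    have "av A = q powi (- 2 * n)" "av B = q powi (- 2 * n' - 1)"
      unfolding A B n by (simp_all add: power2_eq_square power_int_diff flip: power_int_add)
    moreover have "- 2 * n \<noteq> - 2 * n' - 1" by presburger
    ultimately have "av A \<noteq> av B" by (metis powi_q_eq_iff)
    then show ?thesis using av_add_eq[of A B] av_add_eq[of B A] by (auto simp: max_def not_le)
  qed
  then show ?thesis unfolding nr_def nm_coord_eq by (simp add: A_def[symmetric] B_def[symmetric] A B mm)
qed

lemma nr_coord_le_iff: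
  assumes "R \<ge> 0"
  shows "nr (coord a b c d) \<le> R \<longleftrightarrow> (av a)\<^sup>2 \<le> R \<and> (av b)\<^sup>2 \<le> R \<and> (av c)\<^sup>2 \<le> q * R \<and> (av d)\<^sup>2 \<le> q * R"
proof -
  have sq: "(max u v)\<^sup>2 = max (u\<^sup>2) (v\<^sup>2)" if "u \<ge> 0" "v \<ge> 0" for u v :: real
    using that by (auto simp: max_def power_mono_iff)
  show ?thesis unfolding nr_coord by (simp add: sq pos_divide_le_eq mult.commute conj_assoc)
qed

lemma coord_inj:
  assumes "coord a b c d = coord a' b' c' d'" shows "a = a' \<and> b = b' \<and> c = c' \<and> d = d'"
proof -
  have "nr (coord a b c d + - coord a' b' c' d') \<le> 0" using assms by simp
  then show ?thesis unfolding coord_minus coord_add nr_coord_le_iff[OF order_refl] by simp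
qed

text \<open>Coordinates are additive, and by \<open>nr_coord_le_iff\<close> a ball of
  \<open>nr\<close> is a product of balls of the coordinates.\<close>

lemma nr_ultra: "nr (x + y) \<le> max (nr x) (nr y)"
proof -
  obtain a b c d where x: "x = coord a b c d" using coord_exists by blast
  obtain a' b' c' d' where y: "y = coord a' b' c' d'" using coord_exists by blast
  define R where "R = max (nr x) (nr y)"
  have R: "R \<ge> 0" "nr x \<le> R" "nr y \<le> R" by (auto simp: R_def le_max_iff_disj)
  have sq: "(av (s + t))\<^sup>2 \<le> S" if "(av s)\<^sup>2 \<le> S" "(av t)\<^sup>2 \<le> S" for s t S
  proof -
    have "av (s + t) \<le> av s \<or> av (s + t) \<le> av t" using av_ultra[of s t] by (auto simp: max_def split: if_splits)
    then have "(av (s + t))\<^sup>2 \<le> (av s)\<^sup>2 \<or> (av (s + t))\<^sup>2 \<le> (av t)\<^sup>2" by simp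
    then show ?thesis using that by linarith
  qed
  show ?thesis using R unfolding R_def[symmetric] unfolding x y coord_add nr_coord_le_iff[OF R(1)] by (auto intro!: sq)
qed

lemma nr_diff: "nr (x - y) \<le> max (nr x) (nr y)"
  using nr_ultra[of x "-y"] by simp

lemma nr_add_le: "nr x \<le> r \<Longrightarrow> nr y \<le> r \<Longrightarrow> nr (x + y) \<le> r"
  using nr_ultra[of x y] by simp

lemma nr_diff_le: "nr x \<le> r \<Longrightarrow> nr y \<le> r \<Longrightarrow> nr (x - y) \<le> r"
  using nr_diff[of x y] by simp

lemma nr_add_less: "nr x < r \<Longrightarrow> nr y < r \<Longrightarrow> nr (x + y) < r"
  using nr_ultra[of x y] by simp

lemma nr_diff_less: "nr x < r \<Longrightarrow> nr y < r \<Longrightarrow> nr (x - y) < r"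
  using nr_diff[of x y] by simp

lemma nr_add_eq:
  assumes "nr x < nr y" shows "nr (x + y) = nr y" "nr (y + x) = nr y"
proof -
  have "nr (x + y) \<le> nr y" using nr_ultra[of x y] assms by simp
  moreover have "nr y \<le> max (nr (x + y)) (nr x)" using nr_diff[of "x+y" x] by simp
  ultimately show "nr (x + y) = nr y" using assms by (auto simp: max_def split: if_splits)
  then show "nr (y + x) = nr y" by (simp add: add.commute)
qed

lemma nr_close_eq: "nr (x - y) < nr y \<Longrightarrow> nr x = nr y"
  using nr_add_eq(1)[of "x - y" y] by simp

lemma nr_discrete:
  assumes "x \<noteq> 0" obtains n where "nr x = q powi (- n)"
  using av_discrete[of "nm x"] assms by (auto simp: nr_def)

lemma nr_less_iff: "nr x < q powi n \<longleftrightarrow> nr x \<le> q powi (n - 1)"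
proof (cases "x = 0")
  case False
  then obtain m where "nr x = q powi (- m)" by (rule nr_discrete)
  then show ?thesis by (simp add: powi_q_less_iff powi_q_le_iff)
qed (simp add: less_imp_le)

lemma nr_less_1_iff: "nr x < 1 \<longleftrightarrow> nr x \<le> 1 / q"
  using nr_less_iff[of x 0] by (simp add: power_int_minus inverse_eq_divide)

lemma av_less_iff: "av x < q powi n \<longleftrightarrow> av x \<le> q powi (n - 1)"
proof (cases "x = 0")
  case False
  then obtain m where "av x = q powi (- m)" by (rule av_discrete)
  then show ?thesis by (simp add: powi_q_less_iff powi_q_le_iff)
qed (simp add: less_imp_le)

text \<open>Absolute values jump from 1 to \<open>q\<close>, whose square exceeds \<open>q\<close>.
  This makes the coordinates of an integral element along \<open>qj\<close> integral.\<close>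

lemma av_le_1:
  assumes "(av z)\<^sup>2 \<le> q" shows "av z \<le> 1"
proof (rule ccontr)
  assume "\<not> av z \<le> 1"
  then have "av z \<ge> q" using av_less_iff[of z 1] by (auto simp: not_less)
  then have "q\<^sup>2 \<le> (av z)\<^sup>2" by (intro power_mono) auto
  moreover have "q < q\<^sup>2" using q_gt_1 by (simp add: power2_eq_square)
  ultimately show False using assms by linarith
qed

text \<open>The trace is twice the first coordinate, and 2 is a unit.\<close>

lemma av_tr_le: "(av (tr x))\<^sup>2 \<le> nr x"
proof -
  obtain a b c d where x: "x = coord a b c d" using coord_exists by blast
  have "\<iota> (tr x) = \<iota> (2 * a)" unfolding iota_tr unfolding x star_coord coord_add by (simp add: coord_def)
  then have "tr x = 2 * a" by (rule iota_eqI)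
  moreover have "(av a)\<^sup>2 \<le> nr x" using nr_coord_le_iff[of "nr x" a b c d] by (simp add: x)
  ultimately show ?thesis by (simp add: av_mult av_2)
qed

text \<open>Norms from the unramified extension already reach every unit: modulo
  \<open>\<pi>\<close> by counting residues, and exactly after adjusting by a square root.\<close>

lemma nm_unit_surj:
  assumes t: "av t = 1" obtains c where "nm c = t" "nr c = 1"
proof -
  obtain x y where xy: "av (x\<^sup>2 - (- nm qi) * y\<^sup>2 - t) < 1"
    using norm_form_residue_surj[of "- nm qi" t] t by (metis av_minus qi_qj(5))
  define e where "e = \<iota> x + \<iota> y * qi"
  have e: "nm e = x\<^sup>2 + nm qi * y\<^sup>2" unfolding e_def by (rule nm_quadratic) simp
  have close: "av (nm e - t) < 1" using xy by (simp add: e)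
  then have ave: "av (nm e) = 1" using t av_close_eq by metis
  then have e0: "nm e \<noteq> 0" by auto
  have "av ((t - nm e) / nm e) < 1" using close by (simp add: av_divide ave av_commute)
  then obtain s where "s\<^sup>2 = 1 + (t - nm e) / nm e" using sqrt_one_plus by metis
  then have "nm (\<iota> s * e) = t" using e0 by (simp add: nm_mult field_simps)
  then show ?thesis using that t by (auto simp: nr_def)
qed

lemma nm_power: "nm (x ^ n) = nm x ^ n"
  by (induction n) (auto simp: nm_mult)

lemma nm_inverse: "nm (inverse x) = inverse (nm x)"
proof (cases "x = 0")
  case False
  then have "nm (inverse x) * nm x = 1" by (simp flip: nm_mult)
  then show ?thesis by (metis inverse_unique mult.commute)
qed simp

lemma nm_powi: "nm (x powi n) = nm x powi n"
  by (cases "n \<ge> 0") (auto simp: power_int_def nm_power nm_inverse)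

lemma nr_powi: "nr (x powi n) = nr x powi n"
  by (simp add: nr_def nm_powi av_powi)

lemma nr_qj_powi: "nr (qj powi n) = q powi (- n)"
  by (simp add: nr_powi power_int_divide_distrib power_int_minus inverse_eq_divide)

text \<open>The residue field of the algebra is generated by \<open>qi\<close> over that of the
  centre; \<open>qj\<close> lies in the maximal ideal and contributes nothing.\<close>

definition resysD :: "'d set" where "resysD = (\<lambda>(s, t). \<iota> s + \<iota> t * qi) ` (resys \<times> resys)"

lemma nr_quadratic: "nr (\<iota> s + \<iota> t * qi) = (max (av s) (av t))\<^sup>2"
  using nr_coord[of s t 0 0] by (simp add: coord_def)

lemma nr_quadratic_less_1: "nr (\<iota> s + \<iota> t * qi) < 1 \<longleftrightarrow> av s < 1 \<and> av t < 1"
  by (auto simp: nr_quadratic max_def power_less_one_iff)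

lemma resysD:
  shows finite_resysD: "finite resysD" and zero_in_resysD: "0 \<in> resysD"
    and card_resysD: "real (card resysD) = q\<^sup>2"
    and resysD_integral: "t \<in> resysD \<Longrightarrow> nr t \<le> 1"
    and resysD_ex1: "nr x \<le> 1 \<Longrightarrow> \<exists>!t. t \<in> resysD \<and> nr (x - t) < 1"
proof -
  show "finite resysD" by (simp add: resysD_def finite_resys)
  show "0 \<in> resysD" unfolding resysD_def using zero_in_resys by (intro image_eqI[of _ _ "(0, 0)"]) auto
  have diff: "(\<iota> s + \<iota> t * qi) - (\<iota> s' + \<iota> t' * qi) = \<iota> (s - s') + \<iota> (t - t') * qi" for s t s' t'
    by (simp add: iota_diff algebra_simps)
  have inj: "inj_on (\<lambda>(s, t). \<iota> s + \<iota> t * qi) (resys \<times> resys)"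
  proof (rule inj_onI, clarify)
    fix s t s' t' assume st: "s \<in> resys" "t \<in> resys" "s' \<in> resys" "t' \<in> resys"
      and "\<iota> s + \<iota> t * qi = \<iota> s' + \<iota> t' * qi"
    then have "nr (\<iota> (s - s') + \<iota> (t - t') * qi) < 1" by (simp flip: diff)
    then show "s = s' \<and> t = t'" using st resys_eqI by (auto simp: nr_quadratic_less_1)
  qed
  then show "real (card resysD) = q\<^sup>2"
    unfolding resysD_def by (simp add: card_image card_cartesian_product card_resys q_def power2_eq_square)
  show int: "nr t \<le> 1" if "t \<in> resysD" for t
    using that resys_integral by (auto simp: resysD_def nr_quadratic max_def power_le_one)
  show "\<exists>!t. t \<in> resysD \<and> nr (x - t) < 1" if nx: "nr x \<le> 1"
  proof -
    obtain a b c d where x: "x = coord a b c d" using coord_exists by blast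
    have ab: "av a \<le> 1" "av b \<le> 1" and cd: "(av c)\<^sup>2 \<le> q" "(av d)\<^sup>2 \<le> q"
      using nx unfolding x nr_coord_le_iff[OF zero_le_one] by (auto simp: abs_square_le_1)
    have *: "nr (x - (\<iota> s + \<iota> t * qi)) < 1 \<longleftrightarrow> av (a - s) < 1 \<and> av (b - t) < 1" for s t
    proof -
      have eq: "x - (\<iota> s + \<iota> t * qi) = coord (a - s) (b - t) c d"
        by (simp add: x coord_def iota_diff algebra_simps)
      have "(max (av c) (av d))\<^sup>2 \<le> 1"
        using av_le_1[OF cd(1)] av_le_1[OF cd(2)] by (intro power_le_one) (auto simp: le_max_iff_disj)
      then have "(max (av c) (av d))\<^sup>2 / q < 1" using q_gt_1 by (simp add: pos_divide_less_eq)
      then show ?thesis unfolding eq nr_coord max_less_iff_conj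
        using nr_quadratic_less_1[of "a - s" "b - t"] by (simp add: nr_quadratic)
    qed
    show ?thesis
    proof (rule ex1I[of _ "\<iota> (rep a) + \<iota> (rep b) * qi"])
      show "\<iota> (rep a) + \<iota> (rep b) * qi \<in> resysD \<and> nr (x - (\<iota> (rep a) + \<iota> (rep b) * qi)) < 1"
        using rep[OF ab(1)] rep[OF ab(2)] * by (auto simp: resysD_def)
      fix t assume "t \<in> resysD \<and> nr (x - t) < 1"
      then obtain s s' where t: "t = \<iota> s + \<iota> s' * qi" "s \<in> resys" "s' \<in> resys" "av (a - s) < 1" "av (b - s') < 1"
        using * by (auto simp: resysD_def)
      then have "s = rep a" "s' = rep b" using resys_ex1 rep ab by blast+
      then show "t = \<iota> (rep a) + \<iota> (rep b) * qi" using t by simp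
    qed
  qed
qed

lemma resysD_unit: "t \<in> resysD \<Longrightarrow> t \<noteq> 0 \<Longrightarrow> nr t = 1"
  using resysD_ex1[of t] resysD_integral[of t] zero_in_resysD by fastforce

text \<open>The unit ball is the lattice spanned by \<open>1\<close>, \<open>qi\<close>,
  \<open>qj\<close>, \<open>qi * qj\<close>: on the last two coordinates the weaker bound
  \<open>(av c)\<^sup>2 \<le> q\<close> still forces integrality.\<close>

lemma integers_is_order: "is_order av \<iota> {x. nr x \<le> 1}"
proof -
  interpret V: vector_space "\<lambda>c d. \<iota> c * d"
    by unfold_locales (auto simp: iota_add iota_mult algebra_simps)
  define B where "B = {1, qi, qj, qi * qj}"
  have B: "1 = coord 1 0 0 0" "qi = coord 0 1 0 0" "qj = coord 0 0 1 0" "qi * qj = coord 0 0 0 1"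
    by (simp_all add: coord_def)
  have dist: "1 \<noteq> qi" "1 \<noteq> qj" "1 \<noteq> qi * qj" "qi \<noteq> qj" "qi \<noteq> qi * qj" "qj \<noteq> qi * qj"
    by (metis B coord_inj zero_neq_one)+
  have sumB: "(\<Sum>b\<in>B. \<iota> (f b) * b) = coord (f 1) (f qi) (f qj) (f (qi * qj))" for f
    using dist by (simp add: B_def coord_def algebra_simps)
  have span: "V.span B = UNIV"
  proof -
    have "x \<in> V.span B" for x
    proof -
      obtain a b c d where x: "x = coord a b c d" using coord_exists by blast
      have "\<iota> a * 1 + \<iota> b * qi + \<iota> c * qj + \<iota> d * (qi * qj) \<in> V.span B"
        by (intro V.span_add V.span_scale V.span_base) (auto simp: B_def)
      then show ?thesis by (simp add: x coord_def algebra_simps)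
    qed
    then show ?thesis by blast
  qed
  have eq: "{x. nr x \<le> 1} = {(\<Sum>b\<in>B. \<iota> (c b) * b) |c. \<forall>b\<in>B. c b \<in> valring av}"
  proof (intro equalityI subsetI)
    fix x assume "x \<in> {x. nr x \<le> 1}"
    then have nx: "nr x \<le> 1" by simp
    obtain a b c d where x: "x = coord a b c d" using coord_exists by blast
    have ab: "(av a)\<^sup>2 \<le> 1" "(av b)\<^sup>2 \<le> 1" and cd: "(av c)\<^sup>2 \<le> q" "(av d)\<^sup>2 \<le> q"
      using nx unfolding x nr_coord_le_iff[OF zero_le_one] by auto
    define f where "f = (\<lambda>_. d)(1 := a, qi := b, qj := c)"
    have f: "f 1 = a" "f qi = b" "f qj = c" "f (qi * qj) = d" using dist by (auto simp: f_def)
    have "(\<Sum>b\<in>B. \<iota> (f b) * b) = x" unfolding sumB f x ..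
    moreover have "\<forall>b\<in>B. f b \<in> valring av"
      using av_le_1 ab cd q_gt_1 by (auto simp: B_def f valring_def)
    ultimately show "x \<in> {(\<Sum>b\<in>B. \<iota> (c b) * b) |c. \<forall>b\<in>B. c b \<in> valring av}" by blast
  next
    fix x assume "x \<in> {(\<Sum>b\<in>B. \<iota> (c b) * b) |c. \<forall>b\<in>B. c b \<in> valring av}"
    then obtain f where f: "x = (\<Sum>b\<in>B. \<iota> (f b) * b)" "\<forall>b\<in>B. av (f b) \<le> 1" by (auto simp: valring_def)
    have le: "(av (f b))\<^sup>2 \<le> 1" "(av (f b))\<^sup>2 \<le> q" if "b \<in> B" for b
      using f(2) that q_gt_1 power_le_one[of "av (f b)" 2] by auto
    then show "x \<in> {x. nr x \<le> 1}" unfolding f(1) sumB mem_Collect_eq nr_coord_le_iff[OF zero_le_one]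
      by (auto simp: B_def)
  qed
  show ?thesis unfolding is_order_def
  proof (intro conjI ballI)
    show "\<exists>B. finite B \<and> V.span B = UNIV \<and> {x. nr x \<le> 1} = {(\<Sum>b\<in>B. \<iota> (c b) * b) |c. \<forall>b\<in>B. c b \<in> valring av}"
      by (rule exI[of _ B]) (use span eq in \<open>auto simp: B_def\<close>)
  qed (auto simp: nr_diff_le nr_mult mult_le_one)
qed

text \<open>An order is a bounded lattice that contains all powers of its elements, and the powers
  of an element with \<open>nr x > 1\<close> are unbounded.\<close>

lemma order_integral:
  assumes R: "is_order av \<iota> R" and x: "x \<in> R" shows "nr x \<le> 1"
proof (rule ccontr)
  assume "\<not> nr x \<le> 1"
  obtain B where B: "finite B" "R = {(\<Sum>b\<in>B. \<iota> (c b) * b) |c. \<forall>b\<in>B. c b \<in> valring av}"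
    using R by (auto simp: is_order_def)
  define M where "M = Max (insert 0 (nr ` B))"
  have M: "M \<ge> 0" "\<And>b. b \<in> B \<Longrightarrow> nr b \<le> M" using B(1) by (auto simp: M_def)
  have bound: "nr y \<le> M" if "y \<in> R" for y
  proof -
    obtain c where y: "y = (\<Sum>b\<in>B. \<iota> (c b) * b)" "\<forall>b\<in>B. av (c b) \<le> 1" using \<open>y \<in> R\<close> B(2) by (auto simp: valring_def)
    have "nr (\<Sum>b\<in>C. \<iota> (c b) * b) \<le> M" if "finite C" "C \<subseteq> B" for C
      using that
    proof (induction C rule: finite_induct)
      case (insert b C)
      have "nr (\<iota> (c b) * b) \<le> 1 * M" unfolding nr_mult nr_iota
        by (intro mult_mono) (use insert y M in \<open>auto simp: power_le_one\<close>)
      then show ?case using insert by (simp add: nr_add_le)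
    qed (use M in auto)
    then show ?thesis using B(1) y(1) by simp
  qed
  have "x ^ n \<in> R" for n using R x by (induction n) (auto simp: is_order_def)
  then have "nr x ^ n \<le> M" for n using bound by (simp flip: nr_power)
  moreover obtain n where "M < nr x ^ n" using real_arch_pow[of "nr x" M] \<open>\<not> nr x \<le> 1\<close> by auto
  ultimately show False by (meson not_le)
qed

lemma maximal_order_eq: "maximal_order av \<iota> R \<Longrightarrow> R = {x. nr x \<le> 1}"
  using order_integral[of R] integers_is_order by (force simp: maximal_order_def)

end

section \<open>Reduced norms of matrices\<close>

lemma matrix_2_eq_iff:
  fixes A B :: "'a ^ 2 ^ 2"
  shows "A = B \<longleftrightarrow> A $ 1 $ 1 = B $ 1 $ 1 \<and> A $ 1 $ 2 = B $ 1 $ 2 \<and> A $ 2 $ 1 = B $ 2 $ 1 \<and> A $ 2 $ 2 = B $ 2 $ 2"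
  by (auto simp: vec_eq_iff forall_2)

lemma matrix_2_mult_entries:
  fixes A B :: "'a::semiring_1 ^ 2 ^ 2"
  shows "(A ** B) $ i $ j = A $ i $ 1 * B $ 1 $ j + A $ i $ 2 * B $ 2 $ j"
  by (simp add: matrix_matrix_mult_def sum_2)

lemma mat_2_entries:
  "(mat a :: 'a::zero ^ 2 ^ 2) $ 1 $ 1 = a" "(mat a :: 'a::zero ^ 2 ^ 2) $ 2 $ 2 = a"
  "(mat a :: 'a::zero ^ 2 ^ 2) $ 1 $ 2 = 0" "(mat a :: 'a::zero ^ 2 ^ 2) $ 2 $ 1 = 0"
  by (simp_all add: mat_def)

lemma UNIV_1_times_2: "(UNIV :: (1 \<times> 2) set) = {(1, 1), (1, 2)}"
  unfolding UNIV_Times_UNIV[symmetric] UNIV_2 by auto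

lemma UNIV_2_times_2: "(UNIV :: (2 \<times> 2) set) = {(1, 1), (1, 2), (2, 1), (2, 2)}"
  unfolding UNIV_Times_UNIV[symmetric] UNIV_2 by auto

lemma det_1_times_2:
  fixes A :: "'a::comm_ring_1 ^ (1 \<times> 2) ^ (1 \<times> 2)"
  shows "det A = A $ (1, 1) $ (1, 1) * A $ (1, 2) $ (1, 2) - A $ (1, 1) $ (1, 2) * A $ (1, 2) $ (1, 1)"
proof -
  have f12: "finite {(1, 2) :: 1 \<times> 2}" "(1, 1) \<notin> {(1, 2) :: 1 \<times> 2}" by auto
  show ?thesis
    unfolding det_def UNIV_1_times_2
    unfolding sum_over_permutations_insert[OF f12]
    unfolding permutes_sing
    by (simp add: sign_swap_id permutation_swap_id sign_compose sign_id swap_id_eq)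
qed

text \<open>The assumptions describe a block matrix with scalar diagonal blocks whose lower left
  block is the adjugate of the upper right one. Images of hermitian matrices under a splitting have
  this shape.\<close>

lemma det_2_times_2:
  fixes A :: "'a::comm_ring_1 ^ (2 \<times> 2) ^ (2 \<times> 2)" and e1 e2 e3 e4 :: "2 \<times> 2"
  assumes e: "e1 = (1, 1)" "e2 = (1, 2)" "e3 = (2, 1)" "e4 = (2, 2)"
    and A: "A $ e1 $ e2 = 0" "A $ e2 $ e1 = 0" "A $ e3 $ e4 = 0" "A $ e4 $ e3 = 0"
    "A $ e2 $ e2 = A $ e1 $ e1" "A $ e4 $ e4 = A $ e3 $ e3"
    "A $ e3 $ e1 = A $ e2 $ e4" "A $ e3 $ e2 = - A $ e1 $ e4"
    "A $ e4 $ e1 = - A $ e2 $ e3" "A $ e4 $ e2 = A $ e1 $ e3"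
  shows "det A = (A $ e1 $ e1 * A $ e3 $ e3 - (A $ e1 $ e3 * A $ e2 $ e4 - A $ e1 $ e4 * A $ e2 $ e3))\<^sup>2"
proof -
  have ne: "e1 \<noteq> e2" "e1 \<noteq> e3" "e1 \<noteq> e4" "e2 \<noteq> e3" "e2 \<noteq> e4" "e3 \<noteq> e4"
    by (auto simp: e)
  have U: "UNIV = {e1, e2, e3, e4}" unfolding UNIV_2_times_2 by (simp add: e)
  have f1: "finite {e2, e3, e4}" "e1 \<notin> {e2, e3, e4}" using ne by auto
  have f2: "finite {e3, e4}" "e2 \<notin> {e3, e4}" using ne by auto
  have f3: "finite {e4}" "e3 \<notin> {e4}" using ne by auto
  show ?thesis
    unfolding det_def U
    unfolding sum_over_permutations_insert[OF f1]
    unfolding sum_over_permutations_insert[OF f2]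
    unfolding sum_over_permutations_insert[OF f3]
    unfolding permutes_sing
    using ne ne[symmetric]
    by (simp add: sign_swap_id permutation_swap_id sign_compose sign_id swap_id_eq permutation_compose transpose_def A)
      (simp add: A algebra_simps power2_eq_square)
qed

context quaternion begin

section \<open>Splittings and the reduced norm of hermitian matrices\<close>

lemma splitting_one: "splitting \<iota> \<phi> \<Longrightarrow> \<phi> 1 = mat 1"
  using iota_1 by (metis splitting_def to_ac_1)

lemma splitting_simps:
  assumes "splitting \<iota> \<phi>"
  shows "\<phi> (x + y) = \<phi> x + \<phi> y" "\<phi> (x * y) = \<phi> x ** \<phi> y" "\<phi> (\<iota> c) = mat (to_ac c)"
    "\<phi> 0 = 0" "\<phi> (x - y) = \<phi> x - \<phi> y"
proof -
  show *: "\<phi> (x + y) = \<phi> x + \<phi> y" "\<phi> (x * y) = \<phi> x ** \<phi> y" "\<phi> (\<iota> c) = mat (to_ac c)" for x y c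
    using assms by (auto simp: splitting_def)
  show "\<phi> 0 = 0" using *(1)[of 0 0] by simp
  show "\<phi> (x - y) = \<phi> x - \<phi> y" using *(1)[of "x - y" y] by (simp add: eq_diff_eq)
qed

text \<open>A noncentral element has a nonscalar image, because nonzero elements are invertible and
  cannot map to 0. The quadratic equation of \<open>x\<close> is therefore the characteristic
  equation of its image, and trace and determinant can be read off.\<close>

lemma splitting_trace_det:
  assumes s: "splitting \<iota> \<phi>"
  shows "\<phi> x $ 1 $ 1 + \<phi> x $ 2 $ 2 = to_ac (tr x)"
    and "\<phi> x $ 1 $ 1 * \<phi> x $ 2 $ 2 - \<phi> x $ 1 $ 2 * \<phi> x $ 2 $ 1 = to_ac (nm x)"
proof -
  define a b c d where abcd: "a = \<phi> x $ 1 $ 1" "b = \<phi> x $ 1 $ 2" "c = \<phi> x $ 2 $ 1" "d = \<phi> x $ 2 $ 2"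
  define t n where tn: "t = to_ac (tr x)" "n = to_ac (nm x)"
  have "a + d = t \<and> a * d - b * c = n"
  proof (cases "x \<in> range \<iota>")
    case True
    then obtain z where "x = \<iota> z" by auto
    then show ?thesis
      by (simp add: abcd tn splitting_simps[OF s] mat_2_entries power2_eq_square)
  next
    case False
    then obtain e where e: "x * e \<noteq> e * x" by (auto simp: range_iota)
    have nonscalar: "\<not> (b = 0 \<and> c = 0 \<and> a = d)"
    proof
      assume h: "b = 0 \<and> c = 0 \<and> a = d"
      have "\<phi> x ** \<phi> e = \<phi> e ** \<phi> x"
        using h by (simp add: matrix_2_eq_iff matrix_2_mult_entries mult.commute flip: abcd)
      then have z: "\<phi> (x * e - e * x) = 0" by (simp add: splitting_simps[OF s])
      define y where "y = x * e - e * x"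
      have "\<phi> 1 = \<phi> y ** \<phi> (inverse y)" using e by (simp add: y_def flip: splitting_simps(2)[OF s])
      also have "\<dots> = 0" using z by (simp add: y_def matrix_2_eq_iff matrix_2_mult_entries)
      finally show False unfolding splitting_one[OF s] by (simp add: matrix_2_eq_iff mat_2_entries)
    qed
    have "\<phi> x ** \<phi> x = mat t ** \<phi> x - mat n"
      using arg_cong[OF square_eq[of x], of \<phi>] by (simp add: splitting_simps[OF s] tn)
    then have eqs: "a * a + b * c = t * a - n" "a * b + b * d = t * b" "c * a + d * c = t * c" "c * b + d * d = t * d - n"
      by (simp_all add: matrix_2_eq_iff matrix_2_mult_entries mat_2_entries flip: abcd)
    have "a + d = t"
    proof (rule ccontr)
      assume ne: "a + d \<noteq> t"
      have "b * (a + d - t) = 0" "c * (a + d - t) = 0" using eqs(2,3) by (simp_all add: algebra_simps)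
      then have bc: "b = 0" "c = 0" using ne by auto
      have "(a - d) * (a + d - t) = (a * a - t * a) - (d * d - t * d)" by (simp add: algebra_simps)
      also have "\<dots> = 0" using eqs(1,4) bc by simp
      finally have "(a - d) * (a + d - t) = 0" .
      then show False using ne bc nonscalar by auto
    qed
    moreover from this have "a * d - b * c = n" using eqs(1) by (simp add: algebra_simps flip: \<open>a + d = t\<close>)
    ultimately show ?thesis by blast
  qed
  then show "\<phi> x $ 1 $ 1 + \<phi> x $ 2 $ 2 = to_ac (tr x)"
    "\<phi> x $ 1 $ 1 * \<phi> x $ 2 $ 2 - \<phi> x $ 1 $ 2 * \<phi> x $ 2 $ 1 = to_ac (nm x)"
    by (simp_all add: abcd tn)
qed

lemma splitting_exists: "\<exists>\<phi>. splitting \<iota> \<phi>"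
proof -
  obtain \<alpha> :: "'k alg_closure" where \<alpha>: "\<alpha> ^ 2 = to_ac (- nm qi)" using nth_root_exists[of 2] by auto
  define \<beta> where "\<beta> = to_ac (- nm qj)"
  have aa: "\<alpha> * \<alpha> = - to_ac (nm qi)" "\<alpha> * (\<alpha> * z) = - to_ac (nm qi) * z" for z
    using \<alpha> by (simp_all add: power2_eq_square flip: mult.assoc)
  \<comment> \<open>The images of \<open>qi\<close> and \<open>qj\<close> are the diagonal matrix
    with entries \<open>\<alpha>\<close>, \<open>- \<alpha>\<close> and the antidiagonal matrix with
    entries \<open>\<beta>\<close>, 1; their squares are the scalars \<open>- nm qi\<close> and
    \<open>- nm qj\<close>.\<close>
  define M where "M a b c d = (vector [vector [to_ac a + to_ac b * \<alpha>, (to_ac c + to_ac d * \<alpha>) * \<beta>],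
      vector [to_ac c - to_ac d * \<alpha>, to_ac a - to_ac b * \<alpha>]] :: 'k alg_closure ^ 2 ^ 2)" for a b c d
  have ent: "M a b c d $ 1 $ 1 = to_ac a + to_ac b * \<alpha>" "M a b c d $ 1 $ 2 = (to_ac c + to_ac d * \<alpha>) * \<beta>"
    "M a b c d $ 2 $ 1 = to_ac c - to_ac d * \<alpha>" "M a b c d $ 2 $ 2 = to_ac a - to_ac b * \<alpha>" for a b c d
    by (simp_all add: M_def vector_2)
  define \<phi> where "\<phi> x = (SOME m. \<exists>a b c d. x = coord a b c d \<and> m = M a b c d)" for x
  have phi: "\<phi> (coord a b c d) = M a b c d" for a b c d
    unfolding \<phi>_def by (rule some_equality) (auto dest: coord_inj)
  have "splitting \<iota> \<phi>" unfolding splitting_def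
  proof (intro conjI allI)
    fix x y
    obtain a b c d where x: "x = coord a b c d" using coord_exists by blast
    obtain a' b' c' d' where y: "y = coord a' b' c' d'" using coord_exists by blast
    show "\<phi> (x + y) = \<phi> x + \<phi> y"
      unfolding x y coord_add phi by (simp add: matrix_2_eq_iff ent algebra_simps)
    show "\<phi> (x * y) = \<phi> x ** \<phi> y"
      unfolding x y coord_mult phi
      by (simp add: matrix_2_eq_iff matrix_2_mult_entries ent \<beta>_def)
        (simp add: algebra_simps aa)
  next
    fix c
    have "\<iota> c = coord c 0 0 0" by (simp add: coord_def)
    then show "\<phi> (\<iota> c) = mat (to_ac c)" by (simp add: phi matrix_2_eq_iff ent mat_2_entries)
  qed
  then show ?thesis by blast
qed

text \<open>A splitting has to exist for the description that defines \<open>nrd\<close> to have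
  only one solution.\<close>

lemma nrd_eqI:
  assumes "\<And>\<phi>. splitting \<iota> \<phi> \<Longrightarrow> to_ac c = det (\<chi> p r. \<phi> (A $ fst p $ fst r) $ snd p $ snd r :: 'k alg_closure ^ ('n \<times> 2) ^ ('n \<times> 2))"
  shows "nrd \<iota> (A :: 'd ^ 'n ^ 'n) = c"
  unfolding nrd_def
proof (rule the_equality)
  obtain \<phi> where \<phi>: "splitting \<iota> \<phi>" using splitting_exists by blast
  fix c' assume "\<forall>\<phi>. splitting \<iota> \<phi> \<longrightarrow>
     to_ac c' = det (\<chi> p r. \<phi> (A $ fst p $ fst r) $ snd p $ snd r :: 'k alg_closure ^ ('n \<times> 2) ^ ('n \<times> 2))"
  then have "to_ac c' = to_ac c" using assms[OF \<phi>] \<phi> by simp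
  then show "c' = c" by simp
qed (use assms in blast)

lemma nrd_1: "nrd \<iota> ((\<chi> i j. x) :: 'd ^ 1 ^ 1) = nm x"
  by (rule nrd_eqI) (simp add: det_1_times_2 splitting_trace_det(2))

text \<open>Conjugation becomes the adjugate, since \<open>star b\<close> is the trace of
  \<open>b\<close> minus \<open>b\<close>. This puts the block matrix into the form required by
  \<open>det_2_times_2\<close>.\<close>

lemma nrd_hermitian:
  assumes A: "(A :: 'd ^ 2 ^ 2) $ 1 $ 1 = \<iota> a" "A $ 2 $ 2 = \<iota> d" "A $ 2 $ 1 = star (A $ 1 $ 2)"
  shows "nrd \<iota> A = (a * d - nm (A $ 1 $ 2))\<^sup>2"
proof (rule nrd_eqI)
  fix \<phi> assume s: "splitting \<iota> \<phi>"
  define b where "b = A $ 1 $ 2"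
  define t where "t = to_ac (tr b)"
  have sb: "\<phi> (star b) = mat t - \<phi> b" by (simp add: star_eq splitting_simps[OF s] t_def)
  have t: "t = \<phi> b $ 1 $ 1 + \<phi> b $ 2 $ 2" using splitting_trace_det(1)[OF s, of b] by (simp add: t_def)
  have n: "to_ac (nm b) = \<phi> b $ 1 $ 1 * \<phi> b $ 2 $ 2 - \<phi> b $ 1 $ 2 * \<phi> b $ 2 $ 1"
    using splitting_trace_det(2)[OF s, of b] by simp
  have A': "A $ 1 $ 2 = b" "A $ 2 $ 1 = star b" using A by (simp_all add: b_def)
  show "to_ac ((a * d - nm (A $ 1 $ 2))\<^sup>2) =
    det (\<chi> p r. \<phi> (A $ fst p $ fst r) $ snd p $ snd r :: 'k alg_closure ^ (2 \<times> 2) ^ (2 \<times> 2))"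
    by (subst det_2_times_2[OF refl refl refl refl])
      (simp_all add: A(1,2) A' sb splitting_simps[OF s] mat_2_entries t n)
qed

end

section \<open>Hermitian matrices and their orbits\<close>

context quaternion begin

definition mm :: "'d \<Rightarrow> 'd \<Rightarrow> 'd \<Rightarrow> 'd \<Rightarrow> 'd ^ 2 ^ 2" where
  "mm a b c d = vector [vector [a, b], vector [c, d]]"

lemma mm_entries [simp]: "mm a b c d $ 1 $ 1 = a" "mm a b c d $ 1 $ 2 = b" "mm a b c d $ 2 $ 1 = c" "mm a b c d $ 2 $ 2 = d"
  by (simp_all add: mm_def vector_2)

lemma mm_eq_iff: "mm a b c d = mm a' b' c' d' \<longleftrightarrow> a = a' \<and> b = b' \<and> c = c' \<and> d = d'"
  by (simp add: matrix_2_eq_iff)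

lemma mm_exists: "\<exists>a b c d. A = mm a b c d"
  by (rule exI[of _ "A $ 1 $ 1"], rule exI[of _ "A $ 1 $ 2"], rule exI[of _ "A $ 2 $ 1"], rule exI[of _ "A $ 2 $ 2"])
    (simp add: matrix_2_eq_iff)

lemma mm_mult: "mm a b c d ** mm a' b' c' d' = mm (a * a' + b * c') (a * b' + b * d') (c * a' + d * c') (c * b' + d * d')"
  by (simp add: matrix_2_eq_iff matrix_2_mult_entries)

lemma adj_mm: "adj star (mm a b c d) = mm (star a) (star c) (star b) (star d)"
  by (simp add: adj_def matrix_2_eq_iff)

lemma mat_1_mm: "mat 1 = mm 1 0 0 1"
  by (simp add: matrix_2_eq_iff mat_2_entries)

definition hm :: "'k \<Rightarrow> 'd \<Rightarrow> 'k \<Rightarrow> 'd ^ 2 ^ 2" where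
  "hm a b d = mm (\<iota> a) b (star b) (\<iota> d)"

lemma hm_entries [simp]: "hm a b d $ 1 $ 1 = \<iota> a" "hm a b d $ 1 $ 2 = b" "hm a b d $ 2 $ 1 = star b" "hm a b d $ 2 $ 2 = \<iota> d"
  by (simp_all add: hm_def)

lemma hm_eq_iff: "hm a b d = hm a' b' d' \<longleftrightarrow> a = a' \<and> b = b' \<and> d = d'"
  by (auto simp: hm_def mm_eq_iff iota_inj)

lemma adj_hm [simp]: "adj star (hm a b d) = hm a b d"
  by (simp add: hm_def adj_mm)

lemma hermitian_exists: assumes "adj star A = A" shows "\<exists>a b d. A = hm a b d"
proof -
  obtain x b c y where A: "A = mm x b c y" using mm_exists by blast
  then have "star x = x" "c = star b" "star y = y" using assms by (auto simp: adj_mm mm_eq_iff)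
  then show ?thesis using A star_fixed_imp[of x] star_fixed_imp[of y] by (auto simp: hm_def)
qed

section \<open>The action on hermitian matrices and the hermitian determinant\<close>

lemma adj_mult:
  fixes A B :: "'d ^ 2 ^ 2" shows "adj star (A ** B) = adj star B ** adj star A"
  by (simp add: adj_def matrix_2_eq_iff matrix_2_mult_entries star_add star_mult)

lemma adj_adj [simp]: "adj star (adj star A) = (A :: 'd ^ 2 ^ 2)"
  by (simp add: adj_def matrix_2_eq_iff)

lemma adj_mat_1 [simp]: "adj star (mat 1 :: 'd ^ 2 ^ 2) = mat 1"
  by (simp add: mat_1_mm adj_mm)

lemma act_act: "act star g (act star h A) = act star (g ** h) A"
  by (simp add: act_def adj_mult matrix_mul_assoc)

lemma act_mat_1 [simp]: "act star (mat 1) A = A"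
  by (simp add: act_def)

lemma adj_act: "adj star A = A \<Longrightarrow> adj star (act star g A) = act star g A"
  by (simp add: act_def adj_mult matrix_mul_assoc)

lemma act_mm_hm:
  "act star (mm g u r s) (hm a b d) =
    hm (a * nm g + d * nm u + tr (g * b * star u))
       (\<iota> a * (g * star r) + \<iota> d * (u * star s) + g * b * star s + u * star b * star r)
       (a * nm r + d * nm s + tr (r * b * star s))"
proof -
  define A where "A = act star (mm g u r s) (hm a b d)"
  have "adj star A = A" unfolding A_def by (rule adj_act) simp
  then obtain a' b' d' where A': "A = hm a' b' d'" using hermitian_exists by blast
  have "\<iota> a' = A $ 1 $ 1" "b' = A $ 1 $ 2" "\<iota> d' = A $ 2 $ 2" by (simp_all add: A')
  then have "\<iota> a' = \<iota> (a * nm g + d * nm u + tr (g * b * star u))"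
    "b' = \<iota> a * (g * star r) + \<iota> d * (u * star s) + g * b * star s + u * star b * star r"
    "\<iota> d' = \<iota> (a * nm r + d * nm s + tr (r * b * star s))"
    by (simp_all add: A_def act_def hm_def mm_mult adj_mm iota_add iota_mult iota_nm iota_tr star_mult
       distrib_left distrib_right mult.assoc iota_left_comm[of g] iota_left_comm[of u] iota_left_comm[of r] iota_left_comm[of s]
       add.commute add.left_commute)
  then show ?thesis by (simp add: A_def[symmetric] A' hm_eq_iff iota_inj)
qed

text \<open>Half the trace recovers \<open>a\<close> from a diagonal entry \<open>\<iota> a\<close>.
  On hermitian matrices this is a square root of the reduced norm that depends polynomially on the
  entries.\<close>

definition hdet :: "'d ^ 2 ^ 2 \<Rightarrow> 'k" where
  "hdet A = (tr (A $ 1 $ 1) / 2) * (tr (A $ 2 $ 2) / 2) - nm (A $ 1 $ 2)"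

lemma hdet_hm [simp]: "hdet (hm a b d) = a * d - nm b"
  by (simp add: hdet_def)

lemma tr_conj: "tr (g * x * star g) = nm g * tr x"
proof -
  have "tr (g * x * star g) = tr (star g * g * x)" using tr_comm[of "g * x" "star g"] by (simp add: mult.assoc)
  then show ?thesis by (simp add: tr_iota_mult flip: iota_nm')
qed

lemma tr_rotate: "tr (x * y * z) = tr (y * z * x)"
  using tr_comm[of x "y * z"] by (simp add: mult.assoc)

text \<open>Direct expansion: the new off-diagonal entry is a sum of four terms, and its norm is
  polarized into four norms and six traces. Only the trace \<open>c34\<close> of the last pair is
  not a single product.\<close>

lemma hdet_act_mm_hm:
  "hdet (act star (mm g u r s) (hm a b d)) =
     (nm g * nm s + nm u * nm r - tr (g * star r * s * star u)) * (a * d - nm b)"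
proof -
  define T1 T2 T3 where "T1 = tr (g * b * star u)" and "T2 = tr (r * b * star s)"
    and "T3 = tr (g * star r * s * star u)"
  define x1 x2 x3 x4 where "x1 = \<iota> a * (g * star r)" and "x2 = \<iota> d * (u * star s)"
    and "x3 = g * b * star s" and "x4 = u * star b * star r"
  have T2': "T2 = tr (star s * r * b)" unfolding T2_def using tr_rotate[of "star s" r b] by simp
  have T1': "tr (u * star b * star g) = T1"
    using tr_star[of "g * b * star u"] by (simp add: T1_def star_mult mult.assoc)
  have T2'': "tr (star r * s * star b) = T2"
    using tr_star[of "b * star s * r"] tr_rotate[of b "star s" r] by (simp add: T2' star_mult mult.assoc)
  have n1: "nm x1 = a\<^sup>2 * nm g * nm r" and n2: "nm x2 = d\<^sup>2 * nm u * nm s"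
    and n3: "nm x3 = nm g * nm b * nm s" and n4: "nm x4 = nm u * nm b * nm r"
    by (simp_all add: x1_def x2_def x3_def x4_def nm_mult)
  have c12: "tr (x1 * star x2) = a * d * T3"
  proof -
    have "x1 * star x2 = \<iota> (a * d) * (g * star r * s * star u)"
      by (simp add: x1_def x2_def star_iota_mult star_mult iota_mult mult.assoc iota_comm[of "star u"] iota_left_comm[of s] iota_left_comm[of g] iota_left_comm[of "star r"])
    then show ?thesis by (simp add: tr_iota_mult T3_def)
  qed
  have c13: "tr (x1 * star x3) = a * nm g * T2"
  proof -
    have "x1 * star x3 = \<iota> a * (g * (star r * s * star b) * star g)"
      by (simp add: x1_def x3_def star_mult mult.assoc)
    then show ?thesis by (simp only: tr_iota_mult tr_conj T2'') simp
  qed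
  have c14: "tr (x1 * star x4) = a * nm r * T1"
  proof -
    have "x1 * star x4 = \<iota> a * (g * (star r * r) * (b * star u))"
      by (simp add: x1_def x4_def star_mult mult.assoc)
    also have "\<dots> = \<iota> a * (\<iota> (nm r) * (g * b * star u))"
      by (simp add: iota_nm'[symmetric] mult.assoc iota_left_comm[of g])
    finally show ?thesis by (simp add: tr_iota_mult T1_def)
  qed
  have c23: "tr (x2 * star x3) = d * nm s * T1"
  proof -
    have "x2 * star x3 = \<iota> d * (u * (star s * s) * (star b * star g))"
      by (simp add: x2_def x3_def star_mult mult.assoc)
    also have "\<dots> = \<iota> d * (\<iota> (nm s) * (u * star b * star g))"
      by (simp add: iota_nm'[symmetric] mult.assoc iota_left_comm[of u])
    finally show ?thesis by (simp add: tr_iota_mult T1')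
  qed
  have c24: "tr (x2 * star x4) = d * nm u * T2"
  proof -
    have "x2 * star x4 = \<iota> d * (u * (star s * r * b) * star u)"
      by (simp add: x2_def x4_def star_mult mult.assoc)
    then show ?thesis by (simp only: tr_iota_mult tr_conj T2'[symmetric]) simp
  qed
  \<comment> \<open>The product of the two traces arises by inserting the central element
    \<open>\<iota> T2\<close>, written as a sum of an element and its conjugate, between
    \<open>b\<close> and \<open>star u\<close>.\<close>
  have c34: "tr (x3 * star x4) = T1 * T2 - nm b * T3"
  proof -
    have "\<iota> T2 * (g * b * star u) = g * b * \<iota> T2 * star u"
      by (simp add: mult.assoc iota_left_comm[of g] iota_left_comm[of b])
    also have "\<dots> = g * b * (star s * r * b + star b * (star r * s)) * star u"
      by (simp add: T2' iota_tr star_mult)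
    also have "\<dots> = x3 * star x4 + g * (b * star b) * (star r * s * star u)"
      by (simp add: x3_def x4_def star_mult mult.assoc distrib_left distrib_right)
    also have "g * (b * star b) * (star r * s * star u) = \<iota> (nm b) * (g * star r * s * star u)"
      by (simp add: iota_nm[symmetric] mult.assoc iota_left_comm[of g])
    finally have "tr (\<iota> T2 * (g * b * star u)) = tr (x3 * star x4) + nm b * T3"
      by (simp add: tr_add tr_iota_mult T3_def)
    then show ?thesis by (simp add: tr_iota_mult T1_def algebra_simps)
  qed
  have nmB: "nm (x1 + x2 + x3 + x4) = nm x1 + nm x2 + nm x3 + nm x4 + tr (x1 * star x2) + tr (x1 * star x3)
     + tr (x1 * star x4) + tr (x2 * star x3) + tr (x2 * star x4) + tr (x3 * star x4)"
    by (simp add: nm_add distrib_right tr_add)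
  show ?thesis
    unfolding act_mm_hm hdet_hm x1_def[symmetric] x2_def[symmetric] x3_def[symmetric] x4_def[symmetric]
      T1_def[symmetric] T2_def[symmetric] T3_def[symmetric] nmB c12 c13 c14 c23 c24 c34 n1 n2 n3 n4
    by (simp add: algebra_simps power2_eq_square)
qed

text \<open>This is the reduced norm of \<open>g\<close>. Reading it off from the action on 1 makes
  multiplicativity a consequence of \<open>hdet_act\<close>.\<close>

definition gdet :: "'d ^ 2 ^ 2 \<Rightarrow> 'k" where "gdet g = hdet (act star g (mat 1))"

lemma mat_1_hm: "mat 1 = hm 1 0 1"
  by (simp add: mat_1_mm hm_def)

lemma hdet_act: "adj star A = A \<Longrightarrow> hdet (act star g A) = gdet g * hdet A"
proof -
  assume "adj star A = A"
  then obtain a b d where A: "A = hm a b d" using hermitian_exists by blast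
  obtain x u r s where g: "g = mm x u r s" using mm_exists by blast
  show ?thesis by (simp add: gdet_def A g mat_1_hm hdet_act_mm_hm)
qed

lemma gdet_mult: "gdet (g ** h) = gdet g * gdet h"
proof -
  have "adj star (act star h (mat 1)) = act star h (mat 1)" by (rule adj_act) simp
  from hdet_act[OF this, of g] show ?thesis by (simp add: gdet_def act_act)
qed

lemma gdet_1 [simp]: "gdet (mat 1) = 1"
  by (simp add: gdet_def) (simp add: mat_1_hm)

section \<open>The size of a matrix and the integral group\<close>

definition msize :: "'d ^ 2 ^ 2 \<Rightarrow> real" where
  "msize A = max (max (nr (A $ 1 $ 1)) (nr (A $ 1 $ 2))) (max (nr (A $ 2 $ 1)) (nr (A $ 2 $ 2)))"

lemma msize_le_iff: "msize A \<le> r \<longleftrightarrow> (\<forall>i j. nr (A $ i $ j) \<le> r)"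
  by (auto simp: msize_def forall_2)

lemma nr_entry_le: "nr (A $ i $ j) \<le> msize A"
  using msize_le_iff[of A "msize A"] by simp

lemma msize_nonneg [simp]: "0 \<le> msize A"
  using nr_entry_le[of A 1 1] nr_nonneg order_trans by blast

lemma msize_mult: "msize (A ** B) \<le> msize A * msize B"
  unfolding msize_le_iff matrix_2_mult_entries
  by (intro allI nr_add_le) (auto simp: nr_mult intro!: mult_mono nr_entry_le)

lemma msize_adj [simp]: "msize (adj star A) = msize A"
  by (auto simp: msize_def adj_def max_def)

lemma msize_add_le: "msize A \<le> r \<Longrightarrow> msize B \<le> r \<Longrightarrow> msize (A + B) \<le> r"
  by (auto simp: msize_le_iff intro!: nr_add_le)

lemma msize_act_le: "msize (act star g A) \<le> msize g * msize A * msize g"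
proof -
  have "msize (act star g A) \<le> msize (g ** A) * msize g"
    unfolding act_def using msize_mult[of "g ** A" "adj star g"] by simp
  also have "\<dots> \<le> msize g * msize A * msize g"
    by (intro mult_right_mono msize_mult) simp
  finally show ?thesis .
qed

lemma msize_hm: "msize (hm a b d) = max (max ((av a)\<^sup>2) (nr b)) ((av d)\<^sup>2)"
  by (simp add: msize_def nr_iota max.assoc)

text \<open>The size bounds the squares of \<open>av a\<close> and \<open>av d\<close>, hence it
  bounds \<open>av (a * d)\<close> itself, just as it bounds \<open>nr b\<close>.\<close>

lemma av_hdet_le: assumes "adj star A = A" shows "av (hdet A) \<le> msize A"
proof -
  obtain a b d where A: "A = hm a b d" using hermitian_exists assms by blast
  define m where "m = msize A"
  have m: "(av a)\<^sup>2 \<le> m" "nr b \<le> m" "(av d)\<^sup>2 \<le> m" by (simp_all add: m_def A msize_hm)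
  have m0: "0 \<le> m" by (simp add: m_def)
  have "(av (a * d))\<^sup>2 \<le> m * m" unfolding av_mult power_mult_distrib using m m0 by (intro mult_mono) auto
  then have "av (a * d) \<le> m" using m0 by (metis power2_eq_square power2_le_imp_le)
  then have "av (a * d - nm b) \<le> m" using av_diff[of "a * d" "nm b"] m(2) by (simp add: nr_def)
  then show ?thesis by (simp add: A m_def)
qed

definition Omat :: "('d ^ 2 ^ 2) set" where "Omat = GL2 {x. nr x \<le> 1}"

lemma Omat_iff: "g \<in> Omat \<longleftrightarrow> msize g \<le> 1 \<and> (\<exists>h. msize h \<le> 1 \<and> g ** h = mat 1 \<and> h ** g = mat 1)"
  by (auto simp: Omat_def GL2_def msize_le_iff)

lemma Omat_msize: "g \<in> Omat \<Longrightarrow> msize g \<le> 1"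
  by (simp add: Omat_iff)

lemma Omat_entry: "g \<in> Omat \<Longrightarrow> nr (g $ i $ j) \<le> 1"
  using Omat_msize nr_entry_le order_trans by blast

lemma Omat_inverse: assumes "g \<in> Omat" obtains h where "h \<in> Omat" "g ** h = mat 1" "h ** g = mat 1"
  using assms unfolding Omat_iff by blast

lemma Omat_invertible: "g \<in> Omat \<Longrightarrow> invertible g"
  by (auto simp: Omat_iff invertible_def)

lemma Omat_mult: assumes "g \<in> Omat" "h \<in> Omat" shows "g ** h \<in> Omat"
proof -
  obtain g' h' where g': "g' \<in> Omat" "g ** g' = mat 1" "g' ** g = mat 1" and h': "h' \<in> Omat" "h ** h' = mat 1" "h' ** h = mat 1"
    using Omat_inverse assms by metis
  have le: "msize (a ** b) \<le> 1" if "a \<in> Omat" "b \<in> Omat" for a b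
    using msize_mult[of a b] Omat_msize[OF that(1)] Omat_msize[OF that(2)] mult_le_one[of "msize a" "msize b"] by simp
  have "(g ** h) ** (h' ** g') = g ** (h ** h') ** g'" by (simp only: matrix_mul_assoc)
  moreover have "(h' ** g') ** (g ** h) = h' ** (g' ** g) ** h" by (simp only: matrix_mul_assoc)
  ultimately show ?thesis unfolding Omat_iff using le assms g' h' by (intro conjI exI[of _ "h' ** g'"]) auto
qed

lemma Omat_mmI:
  assumes "nr a \<le> 1" "nr b \<le> 1" "nr c \<le> 1" "nr d \<le> 1" "nr a' \<le> 1" "nr b' \<le> 1" "nr c' \<le> 1" "nr d' \<le> 1"
    "mm a b c d ** mm a' b' c' d' = mat 1" "mm a' b' c' d' ** mm a b c d = mat 1"
  shows "mm a b c d \<in> Omat"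
  unfolding Omat_iff using assms by (intro conjI exI[of _ "mm a' b' c' d'"]) (auto simp: msize_def)

lemma Omat_lower: "nr r \<le> 1 \<Longrightarrow> mm 1 0 r 1 \<in> Omat"
  by (rule Omat_mmI[of _ _ _ _ 1 0 "-r" 1]) (auto simp: mm_mult mat_1_mm)

lemma Omat_upper: "nr r \<le> 1 \<Longrightarrow> mm 1 r 0 1 \<in> Omat"
  by (rule Omat_mmI[of _ _ _ _ 1 "-r" 0 1]) (auto simp: mm_mult mat_1_mm)

lemma Omat_diag: assumes "nr a = 1" "nr d = 1" shows "mm a 0 0 d \<in> Omat"
proof -
  have "a \<noteq> 0" "d \<noteq> 0" using assms by auto
  then show ?thesis using assms
    by (intro Omat_mmI[of _ _ _ _ "inverse a" 0 0 "inverse d"]) (auto simp: mm_mult mat_1_mm mm_eq_iff nr_inverse)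
qed

lemma Omat_swap: "mm 0 1 1 0 \<in> Omat"
  by (rule Omat_mmI[of _ _ _ _ 0 1 1 0]) (auto simp: mm_mult mat_1_mm)

text \<open>Integrality bounds \<open>gdet\<close> by 1 for \<open>g\<close> and for its inverse,
  and the two values multiply to 1.\<close>

lemma av_gdet_Omat: assumes "g \<in> Omat" shows "av (gdet g) = 1"
proof -
  obtain h where h: "h \<in> Omat" "g ** h = mat 1" using Omat_inverse[OF assms] by blast
  have le: "av (gdet x) \<le> 1" if x: "x \<in> Omat" for x
  proof -
    have "msize (act star x (mat 1)) \<le> msize x * 1 * msize x"
      using msize_act_le[of x "mat 1"] by (simp add: msize_def mat_2_entries)
    also have "\<dots> \<le> 1" using Omat_msize[OF x] by (simp add: mult_le_one)
    finally show ?thesis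
      using av_hdet_le[of "act star x (mat 1)"] adj_act[of "mat 1" x] by (simp add: gdet_def)
  qed
  have "av (gdet g) * av (gdet h) = 1" using gdet_mult[of g h] h(2) by (simp flip: av_mult)
  moreover have "av (gdet g) * av (gdet h) \<le> av (gdet g) * 1" using le[OF h(1)] by (intro mult_left_mono) auto
  ultimately show ?thesis using le[OF assms] by simp
qed

lemma msize_act_Omat: assumes "g \<in> Omat" shows "msize (act star g A) = msize A"
proof -
  obtain h where h: "h \<in> Omat" "h ** g = mat 1" using Omat_inverse[OF assms] by blast
  have le: "msize (act star x A) \<le> msize A" if x: "x \<in> Omat" for x A
  proof -
    have "msize x * msize A * msize x \<le> 1 * msize A * 1"
      using Omat_msize[OF x] by (intro mult_mono) auto
    then show ?thesis using msize_act_le[of x A] by simp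
  qed
  have "msize A \<le> msize (act star g A)" using le[OF h(1), of "act star g A"] by (simp add: act_act h)
  then show ?thesis using le[OF assms, of A] by simp
qed

text \<open>The adjugate formula survives over the noncommutative algebra because
  \<open>\<iota> a\<close>, \<open>\<iota> d\<close>, \<open>b * star b\<close> and
  \<open>star b * b\<close> are all central.\<close>

lemma hermitian_inverse: 
  assumes "a * d - nm b \<noteq> 0"
  defines "h \<equiv> inverse (a * d - nm b)"
  shows "hm a b d ** hm (h * d) (- \<iota> h * b) (h * a) = mat 1" "hm (h * d) (- \<iota> h * b) (h * a) ** hm a b d = mat 1"
proof -
  have h: "h * (a * d - nm b) = 1" using assms by simp
  then have *: "\<iota> h * (\<iota> a * \<iota> d - \<iota> (nm b)) = 1" by (metis iota_1 iota_diff iota_mult)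
  have c: "b * (\<iota> h * star b) = \<iota> h * \<iota> (nm b)" "star b * (\<iota> h * b) = \<iota> h * \<iota> (nm b)"
    by (simp_all add: iota_left_comm[of b] iota_left_comm[of "star b"] iota_nm, simp flip: iota_nm iota_nm')
  show "hm a b d ** hm (h * d) (- \<iota> h * b) (h * a) = mat 1" "hm (h * d) (- \<iota> h * b) (h * a) ** hm a b d = mat 1"
    using * c
    by (simp_all add: hm_def mm_mult mat_1_mm mm_eq_iff star_minus star_iota_mult iota_mult algebra_simps
       iota_comm[of b] iota_comm[of "star b"] iota_left_comm[of b] iota_left_comm[of "star b"])
      (simp_all add: iota_arrange ac_simps iota_nm[symmetric] iota_nm'[symmetric])
qed

lemma herm_hm_iff: "hm a b d \<in> herm star \<longleftrightarrow> a * d - nm b \<noteq> 0"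
proof
  assume "hm a b d \<in> herm star"
  then obtain B where B: "B ** hm a b d = mat 1" by (auto simp: herm_def invertible_def)
  show "a * d - nm b \<noteq> 0"
  proof
    assume z: "a * d - nm b = 0"
    then have eq: "\<iota> a * \<iota> d = \<iota> (nm b)" by (simp flip: iota_mult)
    \<comment> \<open>A singular matrix annihilates its adjugate; cancelling the matrix with its
      left inverse \<open>B\<close> makes the adjugate vanish, hence all entries.\<close>
    have "hm a b d ** hm d (- b) a = 0"
      by (simp add: hm_def mm_mult matrix_2_eq_iff star_minus eq iota_nm[symmetric] iota_nm'[symmetric] iota_comm[of b] iota_comm[of "star b"])
        (metis eq iota_comm)
    then have "B ** hm a b d ** hm d (- b) a = B ** 0" by (simp flip: matrix_mul_assoc)
    also have "B ** 0 = 0" by (simp add: matrix_2_eq_iff matrix_2_mult_entries)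
    finally have "hm d (- b) a = 0" by (simp add: B)
    then have "a = 0" "b = 0" "d = 0" by (simp_all add: hm_def matrix_2_eq_iff)
    then have "B ** hm a b d = 0" by (simp add: matrix_2_eq_iff matrix_2_mult_entries)
    then show False using B by (simp add: matrix_2_eq_iff mat_2_entries)
  qed
next
  assume "a * d - nm b \<noteq> 0"
  then have "invertible (hm a b d)" unfolding invertible_def using hermitian_inverse by blast
  then show "hm a b d \<in> herm star" by (simp add: herm_def)
qed

lemma herm_iff: "A \<in> herm star \<longleftrightarrow> adj star A = A \<and> hdet A \<noteq> 0"
proof
  assume "A \<in> herm star"
  then have "adj star A = A" by (simp add: herm_def)
  moreover from this obtain a b d where "A = hm a b d" using hermitian_exists by blast
  ultimately show "adj star A = A \<and> hdet A \<noteq> 0" using \<open>A \<in> herm star\<close> by (simp add: herm_hm_iff)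
next
  assume A: "adj star A = A \<and> hdet A \<noteq> 0"
  then obtain a b d where "A = hm a b d" using hermitian_exists by blast
  then show "A \<in> herm star" using A by (simp add: herm_hm_iff)
qed

lemma herm_exists: assumes "A \<in> herm star" obtains a b d where "A = hm a b d" "a * d - nm b \<noteq> 0"
  using assms hermitian_exists[of A] herm_hm_iff by (auto simp: herm_iff)

lemma gdet_nonzero: "invertible g \<Longrightarrow> gdet g \<noteq> 0"
  using gdet_mult gdet_1 by (metis invertible_def mult_zero_left zero_neq_one)

lemma act_herm: "invertible g \<Longrightarrow> A \<in> herm star \<Longrightarrow> act star g A \<in> herm star"
  by (simp add: herm_iff adj_act hdet_act gdet_nonzero)

lemma av_hdet_act_Omat: "g \<in> Omat \<Longrightarrow> A \<in> herm star \<Longrightarrow> av (hdet (act star g A)) = av (hdet A)"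
  by (simp add: herm_iff hdet_act av_mult av_gdet_Omat)

section \<open>Normal forms under the integral group\<close>

definition Oequiv :: "'d ^ 2 ^ 2 \<Rightarrow> 'd ^ 2 ^ 2 \<Rightarrow> bool" where
  "Oequiv A B \<longleftrightarrow> (\<exists>g\<in>Omat. act star g A = B)"

lemma OequivI: "g \<in> Omat \<Longrightarrow> act star g A = B \<Longrightarrow> Oequiv A B"
  by (auto simp: Oequiv_def)

lemma Oequiv_trans: "Oequiv A B \<Longrightarrow> Oequiv B C \<Longrightarrow> Oequiv A C"
  unfolding Oequiv_def using Omat_mult by (metis act_act)

lemma Oequiv_sym: "Oequiv A B \<Longrightarrow> Oequiv B A"
  unfolding Oequiv_def by (metis Omat_inverse act_act act_mat_1)

lemma Oequiv_invariants:
  assumes "Oequiv A B" "A \<in> herm star"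
  shows "B \<in> herm star" "msize B = msize A" "av (hdet B) = av (hdet A)"
  using assms by (auto simp: Oequiv_def msize_act_Omat av_hdet_act_Omat act_herm Omat_invertible)

lemma tr_0 [simp]: "tr 0 = 0"
  using tr_iota[of 0] by simp

lemma unit_scaling:
  assumes "av a = q powi (- n)" obtains c where "nr c = 1" "a * nm c = \<pi> powi n"
proof -
  have a: "a \<noteq> 0" using assms by auto
  have "av (\<pi> powi n / a) = 1" by (simp add: av_divide av_pi_powi assms)
  then obtain c where "nm c = \<pi> powi n / a" "nr c = 1" by (rule nm_unit_surj)
  then show ?thesis using that[of c] a by simp
qed

text \<open>The corner \<open>a\<close> is a pivot of maximal size, so an integral shear removes
  \<open>b\<close>. The diagonal entries that remain are adjusted by units, every unit being a
  norm.\<close>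

lemma Oequiv_diag_of_dominant:
  assumes h: "hm a b d \<in> herm star" and b: "nr b \<le> (av a)\<^sup>2" and d: "(av d)\<^sup>2 \<le> (av a)\<^sup>2"
    and \<alpha>: "av a = q powi (- \<alpha>)" and \<beta>: "av (hdet (hm a b d)) = q powi (- (\<alpha> + \<beta>))"
  shows "Oequiv (hm a b d) (hm (\<pi> powi \<alpha>) 0 (\<pi> powi \<beta>))"
proof -
  have a: "a \<noteq> 0" using \<alpha> by auto
  define r where "r = - (\<iota> (inverse a) * star b)"
  have "nr r \<le> 1" using b a by (simp add: r_def nr_mult nr_iota av_divide field_simps)
  moreover have sr: "star r = - (\<iota> (inverse a) * b)" by (simp add: r_def star_minus star_iota_mult)
  define d' where "d' = a * nm r + d + tr (r * b)"
  have "act star (mm 1 0 r 1) (hm a b d) = hm a 0 d'"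
    using a by (simp add: act_mm_hm sr d'_def iota_arrange)
  ultimately have eq1: "Oequiv (hm a b d) (hm a 0 d')" using Omat_lower OequivI by blast
  have "av (a * d') = q powi (- (\<alpha> + \<beta>))" using Oequiv_invariants(3)[OF eq1 h] \<beta> by simp
  then have d': "av d' = q powi (- \<beta>)"
    by (simp add: av_mult \<alpha> power_int_diff power_int_add power_int_minus field_simps)
  obtain u where u: "nr u = 1" "a * nm u = \<pi> powi \<alpha>" using unit_scaling[OF \<alpha>] .
  obtain v where v: "nr v = 1" "d' * nm v = \<pi> powi \<beta>" using unit_scaling[OF d'] .
  have "act star (mm u 0 0 v) (hm a 0 d') = hm (\<pi> powi \<alpha>) 0 (\<pi> powi \<beta>)"
    by (simp add: act_mm_hm u v)
  then have "Oequiv (hm a 0 d') (hm (\<pi> powi \<alpha>) 0 (\<pi> powi \<beta>))" using Omat_diag u v OequivI by blast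
  then show ?thesis using eq1 Oequiv_trans by blast
qed

lemma nr_iota_powi: "(av a)\<^sup>2 = q powi (- (2 * n)) \<longleftrightarrow> av a = q powi (- n)"
proof -
  have "q powi (- (2 * n)) = (q powi (- n))\<^sup>2" by (simp add: power2_eq_square flip: power_int_add)
  then show ?thesis by (simp add: power2_eq_iff_nonneg)
qed

text \<open>The essential case has both diagonal entries too small. The order of \<open>nr b\<close>
  is even, so \<open>b\<close> times a suitable unit is a power of \<open>\<pi>\<close>; a shear
  adds the trace of this power to the corner, which becomes a pivot because 2 is a unit.\<close>

lemma Oequiv_diag:
  assumes A: "A \<in> herm star" and m: "msize A = q powi (- (2 * \<alpha>))" and h: "av (hdet A) = q powi (- (\<alpha> + \<beta>))"
  shows "Oequiv A (hm (\<pi> powi \<alpha>) 0 (\<pi> powi \<beta>))"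
proof -
  have case1: "Oequiv (hm a b d) (hm (\<pi> powi \<alpha>) 0 (\<pi> powi \<beta>))"
    if "hm a b d \<in> herm star" "msize (hm a b d) = q powi (- (2 * \<alpha>))"
      "av (hdet (hm a b d)) = q powi (- (\<alpha> + \<beta>))" "av a = q powi (- \<alpha>)" for a b d
  proof (rule Oequiv_diag_of_dominant)
    have "(av a)\<^sup>2 = q powi (- (2 * \<alpha>))" using that(4) nr_iota_powi by blast
    then have "(av a)\<^sup>2 = msize (hm a b d)" using that(2) by (simp only:)
    moreover have "nr b \<le> msize (hm a b d)" "(av d)\<^sup>2 \<le> msize (hm a b d)"
      unfolding msize_hm by (auto simp: le_max_iff_disj)
    ultimately show "nr b \<le> (av a)\<^sup>2" "(av d)\<^sup>2 \<le> (av a)\<^sup>2" by (simp_all only:)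
  qed (use that in auto)
  obtain a b d where Ad: "A = hm a b d" using A herm_exists by metis
  have ms: "(av a)\<^sup>2 \<le> q powi (- (2 * \<alpha>))" "nr b \<le> q powi (- (2 * \<alpha>))" "(av d)\<^sup>2 \<le> q powi (- (2 * \<alpha>))"
    using m by (auto simp: Ad msize_hm)
  consider "av a = q powi (- \<alpha>)" | "av d = q powi (- \<alpha>)"
    | "av a \<noteq> q powi (- \<alpha>)" "av d \<noteq> q powi (- \<alpha>)" by blast
  then show ?thesis
  proof cases
    case 1 then show ?thesis using case1[of a b d] A m h by (simp add: Ad)
  next
    case 2
    have eq: "Oequiv A (hm d (star b) a)" by (rule OequivI[OF Omat_swap]) (simp add: Ad act_mm_hm)
    then show ?thesis using case1[of d "star b" a] Oequiv_invariants[OF eq A] 2 m h Oequiv_trans[OF eq] by simp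
  next
    case 3
    then have lt: "(av a)\<^sup>2 < q powi (- (2 * \<alpha>))" "(av d)\<^sup>2 < q powi (- (2 * \<alpha>))"
      using ms nr_iota_powi[of a \<alpha>] nr_iota_powi[of d \<alpha>] by linarith+
    then have nb: "nr b = q powi (- (2 * \<alpha>))" using m by (auto simp: Ad msize_hm max_def split: if_splits)
    then have b0: "b \<noteq> 0" by auto
    have sq: "q powi (- (2 * \<alpha>)) = (q powi (- \<alpha>))\<^sup>2" by (simp add: power2_eq_square flip: power_int_add)
    \<comment> \<open>Chosen so that \<open>b * star u\<close> is the central element
      \<open>\<pi> powi \<alpha>\<close>, whose trace has full size.\<close>
    define u where "u = star (inverse b * \<iota> (\<pi> powi \<alpha>))"
    have nu: "nr u = 1" by (simp add: u_def nr_mult nr_inverse nb nr_iota av_pi_powi sq)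
    have "b * star u = \<iota> (\<pi> powi \<alpha>)" using b0 by (simp add: u_def flip: mult.assoc)
    then have act: "act star (mm 1 u 0 1) A = hm (a + d * nm u + 2 * \<pi> powi \<alpha>) (\<iota> d * u + b) d"
      by (simp add: Ad act_mm_hm)
    have lt': "av a < q powi (- \<alpha>)" "av d < q powi (- \<alpha>)"
      using lt unfolding sq by (auto intro: power_less_imp_less_base)
    have "av (nm u) = 1" using nu by (simp add: nr_def)
    then have "av (a + d * nm u) < q powi (- \<alpha>)"
      using av_ultra[of a "d * nm u"] lt' by (simp add: av_mult)
    then have "av (a + d * nm u + 2 * \<pi> powi \<alpha>) = q powi (- \<alpha>)"
      using av_add_eq(1)[of "a + d * nm u" "2 * \<pi> powi \<alpha>"] by (simp add: av_mult av_2 av_pi_powi)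
    moreover have eq: "Oequiv A (act star (mm 1 u 0 1) A)" using nu by (intro OequivI[OF Omat_upper[of u]]) auto
    ultimately show ?thesis
      using case1[of "a + d * nm u + 2 * \<pi> powi \<alpha>" "\<iota> d * u + b" d] Oequiv_invariants[OF eq A]
        Oequiv_trans[OF eq] m h by (simp add: act)
  qed
qed

text \<open>Diagonal entries are central, so their norms have even order. An odd size can therefore
  only be attained off the diagonal, and parity improves the bound on the diagonal.\<close>

lemma odd_size_entries:
  assumes m: "msize (hm a b d) = q powi (- (2 * e + 1))"
  shows "nr b = q powi (- (2 * e + 1))" "av a \<le> q powi (- (e + 1))" "av d \<le> q powi (- (e + 1))"
proof -
  have le: "av x \<le> q powi (- (e + 1)) \<and> (av x)\<^sup>2 < q powi (- (2 * e + 1))" if x: "(av x)\<^sup>2 \<le> q powi (- (2 * e + 1))" for x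
  proof (cases "x = 0")
    case False
    then obtain n where n: "av x = q powi (- n)" by (rule av_discrete)
    have "q powi (- (2 * n)) \<le> q powi (- (2 * e + 1))" using x nr_iota_powi[of x n] n by simp
    then have "n \<ge> e + 1" by (simp add: powi_q_le_iff)
    moreover from this have "(av x)\<^sup>2 < q powi (- (2 * e + 1))"
      using nr_iota_powi[of x n] n by (simp add: powi_q_less_iff)
    ultimately show ?thesis by (simp add: n powi_q_le_iff)
  qed auto
  have ms: "(av a)\<^sup>2 \<le> q powi (- (2 * e + 1))" "nr b \<le> q powi (- (2 * e + 1))" "(av d)\<^sup>2 \<le> q powi (- (2 * e + 1))"
    using m by (auto simp: msize_hm)
  show "av a \<le> q powi (- (e + 1))" "av d \<le> q powi (- (e + 1))" using le ms by auto
  show "nr b = q powi (- (2 * e + 1))"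
    using le[OF ms(1)] le[OF ms(3)] m by (auto simp: msize_hm max_def split: if_splits)
qed

text \<open>Here the diagonal is cleared and \<open>b\<close> is kept. A shear by a central multiple
  of the inverse conjugate of \<open>b\<close> changes the corner by a quadratic polynomial whose
  discriminant is, up to the factor 4, a unit close to 1 and hence a square.\<close>

lemma Oequiv_hyperbolic:
  assumes A: "A \<in> herm star" and m: "msize A = q powi (- (2 * e + 1))"
  shows "Oequiv A (hm 0 (\<iota> (\<pi> powi e) * qj) 0)"
proof -
  obtain a b d where Ad: "A = hm a b d" using A herm_exists by metis
  have nb: "nr b = q powi (- (2 * e + 1))" and avs: "av a \<le> q powi (- (e + 1))" "av d \<le> q powi (- (e + 1))"
    using odd_size_entries m by (auto simp: Ad)
  have b0: "b \<noteq> 0" using nb by auto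
  have nmb: "av (nm b) = q powi (- (2 * e + 1))" using nb by (simp add: nr_def)
  have "av (- (a * d / nm b)) \<le> q powi (- (e + 1)) * q powi (- (e + 1)) / q powi (- (2 * e + 1))"
    unfolding av_minus av_divide av_mult nmb using avs by (intro divide_right_mono mult_mono) auto
  also have "\<dots> = q powi (- 1)" unfolding power_int_add[symmetric, OF disjI1[OF q_pos(2)]] power_int_diff[symmetric, OF disjI1[OF q_pos(2)]]
    by simp
  also have "\<dots> < 1" using q_gt_1 by (simp add: power_int_minus inverse_eq_divide)
  finally obtain s where s: "s\<^sup>2 = 1 + - (a * d / nm b)" "av (s - 1) < 1" using sqrt_one_plus by metis
  have s1: "av (1 + s) = 1"
  proof -
    have "av ((s - 1) + 2) = 1" using av_add_eq(1)[of "s - 1" 2] s(2) av_2 by simp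
    then show ?thesis by (simp add: algebra_simps)
  qed
  then have s0: "1 + s \<noteq> 0" by auto
  \<comment> \<open>The root is written without division by \<open>d\<close>, which may vanish; it
    is as small as \<open>a\<close> because \<open>1 + s\<close> is a unit.\<close>
  define x where "x = - (a / (1 + s))"
  have "av x = av a" by (simp add: x_def av_divide s1)
  have root: "a + d * (x\<^sup>2 / nm b) + 2 * x = 0"
  proof -
    have "a * d / nm b = 1 - s\<^sup>2" using s(1) by simp
    have "d * (x\<^sup>2 / nm b) = a * (a * d / nm b) / (1 + s)\<^sup>2" by (simp add: x_def power_divide power2_eq_square ac_simps)
    also have "\<dots> = a * (1 - s) / (1 + s)" unfolding \<open>a * d / nm b = 1 - s\<^sup>2\<close>
      using s0 by (simp add: divide_simps) (simp add: power2_eq_square algebra_simps)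
    finally have E: "d * (x\<^sup>2 / nm b) = a * (1 - s) / (1 + s)" .
    show ?thesis unfolding E unfolding x_def using s0 by (simp add: divide_simps) (simp add: algebra_simps)
  qed
  define u where "u = \<iota> x * star (inverse b)"
  have nmu: "nm u = x\<^sup>2 / nm b" by (simp add: u_def nm_mult nm_inverse divide_inverse)
  have q2: "(q powi (- (e + 1)))\<^sup>2 = q powi (- (2 * e + 2))" by (simp add: power2_eq_square flip: power_int_add)
  have small: "nr (\<iota> y * inverse b) \<le> q powi (- 1)" if "av y \<le> q powi (- (e + 1))" for y
  proof -
    have "(av y)\<^sup>2 \<le> q powi (- (2 * e + 2))" using power_mono[OF that av_nonneg, of 2] unfolding q2 .
    then have "nr (\<iota> y * inverse b) \<le> q powi (- (2 * e + 2)) / q powi (- (2 * e + 1))"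
      by (simp add: nr_mult nr_iota nr_inverse nb divide_inverse mult_right_mono)
    then show ?thesis by (simp flip: power_int_diff)
  qed
  have qm1: "q powi (- 1) < 1" using q_gt_1 by (simp add: power_int_minus inverse_eq_divide)
  have "nr u = nr (\<iota> x * inverse b)" by (simp add: u_def nr_mult)
  then have nu: "nr u < 1" using small[of x] \<open>av x = av a\<close> avs qm1 by simp
  have "b * star u = \<iota> x" using b0 by (simp add: u_def star_iota_mult iota_left_comm[of b])
  then have act1: "act star (mm 1 u 0 1) A = hm 0 (\<iota> d * u + b) d"
    using root by (simp add: Ad act_mm_hm nmu)
  define b' where "b' = \<iota> d * u + b"
  have eq1: "Oequiv A (hm 0 b' d)" using nu by (intro OequivI[OF Omat_upper[of u]]) (auto simp: act1 b'_def)
  have "hm 0 b' d \<in> herm star" and "msize (hm 0 b' d) = q powi (- (2 * e + 1))"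
    using Oequiv_invariants[OF eq1 A] m by auto
  then have nb': "nr b' = q powi (- (2 * e + 1))" using odd_size_entries(1) by blast
  then have b'0: "b' \<noteq> 0" by auto
  \<comment> \<open>Once the corner vanishes, the remaining condition
    \<open>tr (r * b') = - d\<close> is linear in \<open>r\<close>.\<close>
  define r where "r = \<iota> (- (d / 2)) * inverse b'"
  have "nr r = nr (\<iota> (- (d / 2)) * inverse b)" by (simp add: r_def nr_mult nr_inverse nb nb')
  then have nrr: "nr r < 1" using small[of "- (d / 2)"] avs qm1 by (simp add: av_divide av_2)
  have "r * b' = \<iota> (- (d / 2))" using b'0 by (simp add: r_def mult.assoc)
  then have "tr (r * b') = 2 * - (d / 2)" by (simp only: tr_iota)
  then have act2: "act star (mm 1 0 r 1) (hm 0 b' d) = hm 0 b' 0" by (simp add: act_mm_hm)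
  then have eq2: "Oequiv (hm 0 b' d) (hm 0 b' 0)" using nrr act2 by (intro OequivI[OF Omat_lower[of r]]) auto
  define c where "c = \<iota> (\<pi> powi e) * qj * inverse b'"
  have "nr c = q powi (- (2 * e + 1)) / nr b'"
  proof -
    have "(q powi (- e))\<^sup>2 / q = q powi (- (2 * e + 1))"
      by (simp add: power2_eq_square power_int_diff flip: power_int_add)
    then show ?thesis by (simp add: c_def nr_mult nr_inverse nr_iota av_pi_powi divide_inverse)
  qed
  then have nc: "nr c = 1" by (simp add: nb')
  have "c * b' = \<iota> (\<pi> powi e) * qj" using b'0 by (simp add: c_def mult.assoc)
  then have act3: "act star (mm c 0 0 1) (hm 0 b' 0) = hm 0 (\<iota> (\<pi> powi e) * qj) 0" by (simp add: act_mm_hm)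
  then have eq3: "Oequiv (hm 0 b' 0) (hm 0 (\<iota> (\<pi> powi e) * qj) 0)"
    using nc act3 by (intro OequivI[OF Omat_diag[of c 1]]) auto
  show ?thesis using eq1 eq2 eq3 Oequiv_trans by blast
qed

lemma odd_size_hdet:
  assumes A: "A \<in> herm star" and m: "msize A = q powi (- (2 * e + 1))"
  shows "av (hdet A) = q powi (- (2 * e + 1))"
proof -
  have "av (hdet (hm 0 (\<iota> (\<pi> powi e) * qj) 0)) = (q powi (- e))\<^sup>2 / q"
    by (simp add: nm_mult av_mult av_power av_pi_powi)
  also have "\<dots> = q powi (- (2 * e + 1))"
    by (simp add: power2_eq_square power_int_diff flip: power_int_add)
  finally show ?thesis using Oequiv_invariants(3)[OF Oequiv_hyperbolic[OF A m] A] by simp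
qed

lemma msize_discrete: assumes "A \<in> herm star" obtains n where "msize A = q powi (- n)"
proof -
  have "msize A = nr (A $ 1 $ 1) \<or> msize A = nr (A $ 1 $ 2) \<or> msize A = nr (A $ 2 $ 1) \<or> msize A = nr (A $ 2 $ 2)"
    by (auto simp: msize_def max_def)
  then obtain i j where "msize A = nr (A $ i $ j)" by blast
  moreover have "msize A \<noteq> 0"
    using av_hdet_le[of A] assms by (auto simp: herm_iff)
  ultimately show ?thesis using nr_discrete[of "A $ i $ j"] that by (metis nr_0)
qed

text \<open>Integral matrices preserve both invariants, and the invariants determine the normal
  form: for even size the determinant fixes the second exponent, for odd size the form depends on
  the size alone.\<close>

lemma orbit_eq:
  assumes A: "A \<in> herm star"
  shows "orbit star {x. nr x \<le> 1} A = {B \<in> herm star. msize B = msize A \<and> av (hdet B) = av (hdet A)}"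
proof -
  have orb: "orbit star {x. nr x \<le> 1} A = {B. Oequiv A B}"
    by (auto simp: orbit_def Oequiv_def Omat_def)
  have "Oequiv A B" if B: "B \<in> herm star" "msize B = msize A" "av (hdet B) = av (hdet A)" for B
  proof -
    obtain m where m: "msize A = q powi (- m)" using msize_discrete[OF A] .
    obtain n where n: "av (hdet A) = q powi (- n)" using av_discrete[of "hdet A"] A by (auto simp: herm_iff)
    show ?thesis
    proof (cases "even m")
      case True
      then obtain \<alpha> where "m = 2 * \<alpha>" by (auto elim: evenE)
      moreover define \<beta> where "\<beta> = n - \<alpha>"
      ultimately have "Oequiv A (hm (\<pi> powi \<alpha>) 0 (\<pi> powi \<beta>))" "Oequiv B (hm (\<pi> powi \<alpha>) 0 (\<pi> powi \<beta>))"
        using A B m n by (auto intro!: Oequiv_diag)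
      then show ?thesis using Oequiv_trans Oequiv_sym by blast
    next
      case False
      then obtain e where "m = 2 * e + 1" by (auto elim: oddE)
      then have "Oequiv A (hm 0 (\<iota> (\<pi> powi e) * qj) 0)" "Oequiv B (hm 0 (\<iota> (\<pi> powi e) * qj) 0)"
        using A B m by (auto intro!: Oequiv_hyperbolic)
      then show ?thesis using Oequiv_trans Oequiv_sym by blast
    qed
  qed
  then show ?thesis unfolding orb using Oequiv_invariants[OF _ A] by blast
qed

end

section \<open>Volumes of the orbits\<close>

lemma emeasure_equal_partition:
  assumes "finite I" "disjoint_family_on f I" "\<And>t. t \<in> I \<Longrightarrow> f t \<in> sets M" "\<And>t. t \<in> I \<Longrightarrow> emeasure M (f t) = c"
  shows "emeasure M (\<Union>t\<in>I. f t) = of_nat (card I) * c"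
proof -
  have "emeasure M (\<Union>t\<in>I. f t) = (\<Sum>t\<in>I. emeasure M (f t))"
    using assms by (intro sum_emeasure[symmetric]) auto
  then show ?thesis using assms(4) by simp
qed

locale metric_quaternion = quaternion av \<pi> \<iota> star
  for av :: "'k::field_char_0 \<Rightarrow> real" and \<pi> :: 'k
    and \<iota> :: "'k \<Rightarrow> 'd::{division_ring, metric_space}" and star :: "'d \<Rightarrow> 'd" +
  assumes nrd_metric: "nrd_metric av \<iota>"
begin

lemma dist_eq: "dist x y = sqrt (nr (x - y))"
  using nrd_metric by (simp add: nrd_metric_def nrd_1 nr_def)

lemma dist_matrix_nr:
  assumes "dist B A < sqrt e"
  shows "nr (B $ i $ j - A $ i $ j) < e"
proof -
  have "dist (B $ i $ j) (A $ i $ j) \<le> dist B A"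
    using dist_vec_nth_le[of "B $ i" j "A $ i"] dist_vec_nth_le[of B i A] by linarith
  then have "sqrt (nr (B $ i $ j - A $ i $ j)) < sqrt e" using assms unfolding dist_eq by linarith
  then show ?thesis by simp
qed

text \<open>An entrywise ball of \<open>nr\<close> contains a ball of the product metric, so
  entrywise openness implies openness. The open set is the union of all open sets whose trace on
  \<open>Y\<close> lies in \<open>S\<close>.\<close>

lemma relatively_open_exists:
  fixes Y :: "('d ^ 2 ^ 2) set"
  assumes "S \<subseteq> Y" and "\<And>A. A \<in> S \<Longrightarrow> \<exists>e>0. \<forall>B\<in>Y. (\<forall>i j. nr (B $ i $ j - A $ i $ j) < e) \<longrightarrow> B \<in> S"
  shows "\<exists>U. open U \<and> S = Y \<inter> U"
proof (intro exI conjI)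
  let ?U = "\<Union>{W. open W \<and> Y \<inter> W \<subseteq> S}"
  show "open ?U" by auto
  show "S = Y \<inter> ?U"
  proof
    show "S \<subseteq> Y \<inter> ?U"
    proof
      fix A assume A: "A \<in> S"
      then obtain e where e: "e > 0" "\<And>B. B \<in> Y \<Longrightarrow> (\<forall>i j. nr (B $ i $ j - A $ i $ j) < e) \<Longrightarrow> B \<in> S"
        using assms(2) by blast
      have "Y \<inter> ball A (sqrt e) \<subseteq> S"
      proof
        fix B assume B: "B \<in> Y \<inter> ball A (sqrt e)"
        then have "dist B A < sqrt e" by (simp add: dist_commute)
        then show "B \<in> S" using e(2) dist_matrix_nr B by blast
      qed
      moreover have "A \<in> ball A (sqrt e)" using e(1) by simp
      ultimately show "A \<in> Y \<inter> ?U" using A assms(1) by (auto intro!: exI[of _ "ball A (sqrt e)"])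
    qed
  qed auto
qed

lemma relatively_open_measurable:
  fixes Y :: "('d ^ 2 ^ 2) set"
  assumes "S \<subseteq> Y" and "\<And>A. A \<in> S \<Longrightarrow> \<exists>e>0. \<forall>B\<in>Y. (\<forall>i j. nr (B $ i $ j - A $ i $ j) < e) \<longrightarrow> B \<in> S"
  shows "S \<in> sets (restrict_space borel Y)"
proof -
  obtain U where "open U" "S = Y \<inter> U" using relatively_open_exists[OF assms] by blast
  then show ?thesis by (auto simp: sets_restrict_space)
qed

section \<open>Continuity and local constancy in the coordinates of a hermitian matrix\<close>

lemma av_add_less: "av x < r \<Longrightarrow> av y < r \<Longrightarrow> av (x + y) < r"
  using av_ultra[of x y] by simp

text \<open>Squares are taken for \<open>a\<close> and \<open>d\<close> because
  \<open>nr (\<iota> a) = (av a)\<^sup>2\<close>; all three coordinates are then measured like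
  matrix entries.\<close>

definition cont3 :: "('k \<Rightarrow> 'd \<Rightarrow> 'k \<Rightarrow> 'k) \<Rightarrow> bool" where
  "cont3 f \<longleftrightarrow> (\<forall>a b d. \<forall>r>0. \<exists>e>0. \<forall>a' b' d'. (av (a' - a))\<^sup>2 < e \<and> nr (b' - b) < e \<and> (av (d' - d))\<^sup>2 < e \<longrightarrow>
     av (f a' b' d' - f a b d) < r)"

definition loc3 :: "('k \<Rightarrow> 'd \<Rightarrow> 'k \<Rightarrow> bool) \<Rightarrow> bool" where
  "loc3 P \<longleftrightarrow> (\<forall>a b d. \<exists>e>0. \<forall>a' b' d'. (av (a' - a))\<^sup>2 < e \<and> nr (b' - b) < e \<and> (av (d' - d))\<^sup>2 < e \<longrightarrow>
     (P a' b' d' \<longleftrightarrow> P a b d))"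

lemma cont3_const [intro]: "cont3 (\<lambda>a b d. c)"
  by (auto simp: cont3_def intro: exI[of _ 1])

lemma cont3_fst [intro]: "cont3 (\<lambda>a b d. a)" and cont3_snd [intro]: "cont3 (\<lambda>a b d. d)"
proof -
  have *: "(av x)\<^sup>2 < r\<^sup>2 \<Longrightarrow> r > 0 \<Longrightarrow> av x < r" for x r
    by (rule power_less_imp_less_base[of _ 2]) auto
  have ex: "\<exists>e>0. Q e" if "r > 0" "Q (r\<^sup>2)" for r :: real and Q using that by (intro exI[of _ "r\<^sup>2"]) auto
  show "cont3 (\<lambda>a b d. a)" unfolding cont3_def by (intro allI impI, rule ex, assumption) (use * in blast)
  show "cont3 (\<lambda>a b d. d)" unfolding cont3_def by (intro allI impI, rule ex, assumption) (use * in blast)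
qed

lemma cont3_add [intro]:
  assumes "cont3 f" "cont3 g" shows "cont3 (\<lambda>a b d. f a b d + g a b d)"
  unfolding cont3_def
proof (intro allI impI)
  fix a b d and r :: real assume "r > 0"
  then obtain e1 e2 where e: "e1 > 0" "e2 > 0"
    "\<And>a' b' d'. (av (a' - a))\<^sup>2 < e1 \<and> nr (b' - b) < e1 \<and> (av (d' - d))\<^sup>2 < e1 \<Longrightarrow> av (f a' b' d' - f a b d) < r"
    "\<And>a' b' d'. (av (a' - a))\<^sup>2 < e2 \<and> nr (b' - b) < e2 \<and> (av (d' - d))\<^sup>2 < e2 \<Longrightarrow> av (g a' b' d' - g a b d) < r"
    using assms unfolding cont3_def by metis
  show "\<exists>e>0. \<forall>a' b' d'. (av (a' - a))\<^sup>2 < e \<and> nr (b' - b) < e \<and> (av (d' - d))\<^sup>2 < e \<longrightarrow>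
     av (f a' b' d' + g a' b' d' - (f a b d + g a b d)) < r"
  proof (intro exI[of _ "min e1 e2"] conjI allI impI)
    fix a' b' d' assume *: "(av (a' - a))\<^sup>2 < min e1 e2 \<and> nr (b' - b) < min e1 e2 \<and> (av (d' - d))\<^sup>2 < min e1 e2"
    have "av ((f a' b' d' - f a b d) + (g a' b' d' - g a b d)) < r"
      using av_ultra[of "f a' b' d' - f a b d" "g a' b' d' - g a b d"] e(3)[of a' b' d'] e(4)[of a' b' d'] * by simp
    then show "av (f a' b' d' + g a' b' d' - (f a b d + g a b d)) < r" by (simp add: algebra_simps)
  qed (use e in auto)
qed

lemma cont3_mult [intro]:
  assumes "cont3 f" "cont3 g" shows "cont3 (\<lambda>a b d. f a b d * g a b d)"
  unfolding cont3_def
proof (intro allI impI)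
  fix a b d and r :: real assume r: "r > 0"
  define M where "M = 1 + av (f a b d) + av (g a b d)"
  have M: "M > 0" "M \<ge> 1" "av (f a b d) \<le> M" "av (g a b d) \<le> M" by (auto simp: M_def add_pos_nonneg)
  have "min 1 (r / M) > 0" using r M by simp
  then obtain e1 e2 where e: "e1 > 0" "e2 > 0"
    "\<And>a' b' d'. (av (a' - a))\<^sup>2 < e1 \<and> nr (b' - b) < e1 \<and> (av (d' - d))\<^sup>2 < e1 \<Longrightarrow> av (f a' b' d' - f a b d) < min 1 (r / M)"
    "\<And>a' b' d'. (av (a' - a))\<^sup>2 < e2 \<and> nr (b' - b) < e2 \<and> (av (d' - d))\<^sup>2 < e2 \<Longrightarrow> av (g a' b' d' - g a b d) < min 1 (r / M)"
    using assms unfolding cont3_def by metis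
  show "\<exists>e>0. \<forall>a' b' d'. (av (a' - a))\<^sup>2 < e \<and> nr (b' - b) < e \<and> (av (d' - d))\<^sup>2 < e \<longrightarrow>
     av (f a' b' d' * g a' b' d' - (f a b d * g a b d)) < r"
  proof (intro exI[of _ "min e1 e2"] conjI allI impI)
    fix a' b' d' assume *: "(av (a' - a))\<^sup>2 < min e1 e2 \<and> nr (b' - b) < min e1 e2 \<and> (av (d' - d))\<^sup>2 < min e1 e2"
    define u v where "u = f a' b' d' - f a b d" and "v = g a' b' d' - g a b d"
    have uv: "av u < 1" "av u < r / M" "av v < r / M" using e(3)[of a' b' d'] e(4)[of a' b' d'] * by (auto simp: u_def v_def)
    have "av (f a' b' d') \<le> M"
      using av_ultra[of u "f a b d"] uv(1) M by (simp add: u_def)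
    then have "av (f a' b' d' * v) \<le> M * av v" unfolding av_mult by (intro mult_right_mono) auto
    also have "\<dots> < r" using uv(3) M by (simp add: field_simps)
    finally have 1: "av (f a' b' d' * v) < r" .
    have "av (u * g a b d) \<le> av u * M" unfolding av_mult using M by (intro mult_left_mono) auto
    also have "\<dots> < r" using uv(2) M by (simp add: field_simps)
    finally have 2: "av (u * g a b d) < r" .
    have "f a' b' d' * g a' b' d' - (f a b d * g a b d) = f a' b' d' * v + u * g a b d"
      by (simp add: u_def v_def algebra_simps)
    then show "av (f a' b' d' * g a' b' d' - (f a b d * g a b d)) < r"
      using av_ultra[of "f a' b' d' * v" "u * g a b d"] 1 2 by simp
  qed (use e in auto)
qed

lemma cont3_nm [intro]: "cont3 (\<lambda>a b d. nm (b - c))"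
  unfolding cont3_def
proof (intro allI impI)
  fix a b d and r :: real assume r: "r > 0"
  define M where "M = 1 + nr (b - c)"
  have M: "M > 0" "nr (b - c) \<le> M" by (auto simp: M_def add_pos_nonneg)
  show "\<exists>e>0. \<forall>a' b' d'. (av (a' - a))\<^sup>2 < e \<and> nr (b' - b) < e \<and> (av (d' - d))\<^sup>2 < e \<longrightarrow>
     av (nm (b' - c) - nm (b - c)) < r"
  proof (intro exI[of _ "min r (r\<^sup>2 / M)"] conjI allI impI)
    fix a' b' d' assume *: "(av (a' - a))\<^sup>2 < min r (r\<^sup>2 / M) \<and> nr (b' - b) < min r (r\<^sup>2 / M) \<and> (av (d' - d))\<^sup>2 < min r (r\<^sup>2 / M)"
    have "nm (b' - c) = nm ((b - c) + (b' - b))" by simp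
    then have eq: "nm (b' - c) - nm (b - c) = nm (b' - b) + tr ((b - c) * star (b' - b))"
      by (simp only: nm_add) simp
    have "(av (tr ((b - c) * star (b' - b))))\<^sup>2 \<le> nr (b - c) * nr (b' - b)"
      using av_tr_le[of "(b - c) * star (b' - b)"] by (simp add: nr_mult)
    also have "\<dots> \<le> M * nr (b' - b)" using M by (intro mult_right_mono) auto
    also have "\<dots> < r\<^sup>2" using * M by (simp add: field_simps)
    finally have "av (tr ((b - c) * star (b' - b))) < r" using r by (simp add: power_less_imp_less_base)
    moreover have "av (nm (b' - b)) < r" using * by (simp add: nr_def)
    ultimately show "av (nm (b' - c) - nm (b - c)) < r" unfolding eq by (intro av_add_less)
  qed (use r M in auto)
qed

lemma cont3_hdet [intro]: "cont3 (\<lambda>a b d. a * d - nm b)"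
proof -
  have "cont3 (\<lambda>a b d. a * d + (- 1) * nm (b - 0))"
    by (intro cont3_add cont3_mult cont3_nm cont3_fst cont3_snd cont3_const)
  then show ?thesis by simp
qed

lemma loc3_conj [intro]: assumes "loc3 P" "loc3 Q" shows "loc3 (\<lambda>a b d. P a b d \<and> Q a b d)"
  unfolding loc3_def
proof (intro allI)
  fix a b d
  obtain e1 where e1: "e1 > 0"
    "\<And>a' b' d'. (av (a' - a))\<^sup>2 < e1 \<and> nr (b' - b) < e1 \<and> (av (d' - d))\<^sup>2 < e1 \<Longrightarrow> P a' b' d' \<longleftrightarrow> P a b d"
    using assms(1) unfolding loc3_def by metis
  obtain e2 where e2: "e2 > 0"
    "\<And>a' b' d'. (av (a' - a))\<^sup>2 < e2 \<and> nr (b' - b) < e2 \<and> (av (d' - d))\<^sup>2 < e2 \<Longrightarrow> Q a' b' d' \<longleftrightarrow> Q a b d"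
    using assms(2) unfolding loc3_def by metis
  show "\<exists>e>0. \<forall>a' b' d'. (av (a' - a))\<^sup>2 < e \<and> nr (b' - b) < e \<and> (av (d' - d))\<^sup>2 < e \<longrightarrow>
     (P a' b' d' \<and> Q a' b' d' \<longleftrightarrow> P a b d \<and> Q a b d)"
  proof (intro exI[of _ "min e1 e2"] conjI allI impI)
    fix a' b' d' assume *: "(av (a' - a))\<^sup>2 < min e1 e2 \<and> nr (b' - b) < min e1 e2 \<and> (av (d' - d))\<^sup>2 < min e1 e2"
    show "P a' b' d' \<and> Q a' b' d' \<longleftrightarrow> P a b d \<and> Q a b d"
      using e1(2)[of a' b' d'] e2(2)[of a' b' d'] * by simp
  qed (use e1(1) e2(1) in auto)
qed

lemma loc3_not: "loc3 P \<Longrightarrow> loc3 (\<lambda>a b d. \<not> P a b d)"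
  by (simp add: loc3_def)

text \<open>Balls of positive radius in an ultrametric are open and closed, so a comparison of
  absolute values with such a radius is locally constant.\<close>

lemma loc3_less [intro]: assumes f: "cont3 f" and r: "r > 0" shows "loc3 (\<lambda>a b d. av (f a b d) < r)"
  unfolding loc3_def
proof (intro allI)
  fix a b d
  obtain e where e: "e > 0"
    "\<And>a' b' d'. (av (a' - a))\<^sup>2 < e \<and> nr (b' - b) < e \<and> (av (d' - d))\<^sup>2 < e \<Longrightarrow> av (f a' b' d' - f a b d) < r"
    using assms unfolding cont3_def by metis
  have "av x < r \<longleftrightarrow> av y < r" if "av (x - y) < r" for x y
    using av_ultra[of "x - y" y] av_ultra[of "y - x" x] that by (auto simp: av_commute)
  then show "\<exists>e>0. \<forall>a' b' d'. (av (a' - a))\<^sup>2 < e \<and> nr (b' - b) < e \<and> (av (d' - d))\<^sup>2 < e \<longrightarrow>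
     (av (f a' b' d') < r \<longleftrightarrow> av (f a b d) < r)"
    using e by blast
qed

lemma loc3_le [intro]: assumes f: "cont3 f" and r: "r > 0" shows "loc3 (\<lambda>a b d. av (f a b d) \<le> r)"
  unfolding loc3_def
proof (intro allI)
  fix a b d
  obtain e where e: "e > 0"
    "\<And>a' b' d'. (av (a' - a))\<^sup>2 < e \<and> nr (b' - b) < e \<and> (av (d' - d))\<^sup>2 < e \<Longrightarrow> av (f a' b' d' - f a b d) < r"
    using assms unfolding cont3_def by metis
  have "av x \<le> r \<longleftrightarrow> av y \<le> r" if "av (x - y) < r" for x y
    using av_ultra[of "x - y" y] av_ultra[of "y - x" x] that by (auto simp: av_commute)
  then show "\<exists>e>0. \<forall>a' b' d'. (av (a' - a))\<^sup>2 < e \<and> nr (b' - b) < e \<and> (av (d' - d))\<^sup>2 < e \<longrightarrow>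
     (av (f a' b' d') \<le> r \<longleftrightarrow> av (f a b d) \<le> r)"
    using e by blast
qed

lemma loc3_eq [intro]: assumes f: "cont3 f" and r: "r > 0" shows "loc3 (\<lambda>a b d. av (f a b d) = r)"
proof -
  have "loc3 (\<lambda>a b d. av (f a b d) \<le> r \<and> \<not> av (f a b d) < r)" using assms by (intro loc3_conj loc3_not loc3_le loc3_less)
  then show ?thesis by (simp add: loc3_def) (smt (verit))
qed

lemma loc3_nr: assumes "r > 0"
  shows "loc3 (\<lambda>a b d. nr b = r)" "loc3 (\<lambda>a b d. nr b \<le> r)" "loc3 (\<lambda>a b d. nr b < r)" "loc3 (\<lambda>a b d. nr (b - c) < r)"
  using loc3_eq[OF cont3_nm[of 0] assms] loc3_le[OF cont3_nm[of 0] assms] loc3_less[OF cont3_nm[of 0] assms]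
    loc3_less[OF cont3_nm[of c] assms] by (simp_all add: nr_def)

definition hset :: "('k \<Rightarrow> 'd \<Rightarrow> 'k \<Rightarrow> bool) \<Rightarrow> ('d ^ 2 ^ 2) set" where
  "hset P = {A \<in> herm star. \<exists>a b d. A = hm a b d \<and> P a b d}"

lemma hm_in_hset: "hm a b d \<in> hset P \<longleftrightarrow> a * d - nm b \<noteq> 0 \<and> P a b d"
  by (auto simp: hset_def hm_eq_iff herm_hm_iff)

lemma hset_herm: "hset P \<subseteq> herm star"
  by (auto simp: hset_def)

lemma hset_eqI:
  assumes "S \<subseteq> herm star" "\<And>a b d. a * d - nm b \<noteq> 0 \<Longrightarrow> hm a b d \<in> S \<longleftrightarrow> P a b d" shows "S = hset P"
proof (intro equalityI subsetI)
  fix A assume A: "A \<in> S"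
  then obtain a b d where "A = hm a b d" "a * d - nm b \<noteq> 0" using assms(1) herm_exists by (metis subsetD)
  then show "A \<in> hset P" using A assms(2) by (simp add: hm_in_hset)
next
  fix A assume "A \<in> hset P"
  then obtain a b d where "A = hm a b d" "a * d - nm b \<noteq> 0" "P a b d" by (auto simp: hset_def herm_hm_iff)
  then show "A \<in> S" using assms(2) by simp
qed

definition ropen :: "('d ^ 2 ^ 2) set \<Rightarrow> bool" where
  "ropen S \<longleftrightarrow> S \<subseteq> herm star \<and>
     (\<forall>A\<in>S. \<exists>e>0. \<forall>B\<in>herm star. (\<forall>i j. nr (B $ i $ j - A $ i $ j) < e) \<longrightarrow> B \<in> S)"

lemma ropen_hset: assumes "loc3 P" shows "ropen (hset P)"
  unfolding ropen_def
proof (intro conjI ballI hset_herm)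
  fix A assume "A \<in> hset P"
  then obtain a b d where A: "A = hm a b d" "P a b d" by (auto simp: hset_def)
  obtain e where e: "e > 0"
    "\<And>a' b' d'. (av (a' - a))\<^sup>2 < e \<and> nr (b' - b) < e \<and> (av (d' - d))\<^sup>2 < e \<Longrightarrow> P a' b' d' \<longleftrightarrow> P a b d"
    using assms unfolding loc3_def by metis
  show "\<exists>e>0. \<forall>B\<in>herm star. (\<forall>i j. nr (B $ i $ j - A $ i $ j) < e) \<longrightarrow> B \<in> hset P"
  proof (intro exI[of _ e] conjI ballI impI)
    fix B assume B: "B \<in> herm star" and c: "\<forall>i j. nr (B $ i $ j - A $ i $ j) < e"
    obtain a' b' d' where B': "B = hm a' b' d'" using B herm_exists by metis
    have "(av (a' - a))\<^sup>2 < e" "nr (b' - b) < e" "(av (d' - d))\<^sup>2 < e"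
      using c[rule_format, of 1 1] c[rule_format, of 1 2] c[rule_format, of 2 2]
      by (simp_all add: A B' nr_iota flip: iota_diff)
    then have "P a' b' d'" using e(2) A(2) by blast
    then show "B \<in> hset P" using B B' by (auto simp: hset_def)
  qed (use e in auto)
qed

text \<open>The action of \<open>g\<close> stretches entrywise distances by at most
  \<open>msize g * msize g\<close>. The summand 1 in \<open>M\<close> keeps the divisor positive,
  and halving \<open>e\<close> turns a weak bound into a strict one.\<close>

lemma ropen_preimage:
  assumes g: "invertible g" and S: "ropen S" shows "ropen {A \<in> herm star. act star g A \<in> S}"
  unfolding ropen_def
proof (intro conjI ballI)
  fix A assume A: "A \<in> {A \<in> herm star. act star g A \<in> S}"
  then obtain e where e: "e > 0"
    "\<And>B. B \<in> herm star \<Longrightarrow> (\<And>i j. nr (B $ i $ j - act star g A $ i $ j) < e) \<Longrightarrow> B \<in> S"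
    using S unfolding ropen_def by blast
  define M where "M = 1 + msize g * msize g"
  have M: "M > 0" by (simp add: M_def add_pos_nonneg)
  show "\<exists>e>0. \<forall>B\<in>herm star. (\<forall>i j. nr (B $ i $ j - A $ i $ j) < e) \<longrightarrow> B \<in> {A \<in> herm star. act star g A \<in> S}"
  proof (intro exI[of _ "e / 2 / M"] conjI ballI impI)
    fix B assume B: "B \<in> herm star" "\<forall>i j. nr (B $ i $ j - A $ i $ j) < e / 2 / M"
    then have le: "msize (B - A) \<le> e / 2 / M" by (auto simp: msize_le_iff less_imp_le)
    have "act star g B - act star g A = act star g (B - A)"
      by (simp add: act_def matrix_2_eq_iff matrix_2_mult_entries algebra_simps)
    then have "msize (act star g B - act star g A) \<le> msize (B - A) * (msize g * msize g)"
      using msize_act_le[of g "B - A"] by (simp add: ac_simps)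
    also have "\<dots> \<le> (e / 2 / M) * M" using le e(1) M by (intro mult_mono) (auto simp: M_def)
    also have "\<dots> < e" using M e by simp
    finally have "nr ((act star g B - act star g A) $ i $ j) < e" for i j
      using nr_entry_le le_less_trans by blast
    then have "act star g B \<in> S" using e(2) act_herm[OF g B(1)] by simp
    then show "B \<in> {A \<in> herm star. act star g A \<in> S}" using B by simp
  qed (use e M in auto)
qed auto

lemma card_resys_nonzero: "real (card (resys - {0})) = q - 1"
  using finite_resys zero_in_resys q_gt_1 by (simp add: card_resys q_def of_nat_diff)

lemma card_resysD_nonzero: "real (card (resysD - {0})) = q\<^sup>2 - 1"
proof -
  have "card resysD > 0" using finite_resysD zero_in_resysD card_gt_0_iff by blast
  then show ?thesis using finite_resysD zero_in_resysD card_resysD by (simp add: of_nat_diff)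
qed

definition inv_class :: "int \<Rightarrow> int \<Rightarrow> ('d ^ 2 ^ 2) set" where
  "inv_class m n = {A \<in> herm star. msize A = q powi (- m) \<and> av (hdet A) = q powi (- n)}"

end

locale invariant_measure = metric_quaternion av \<pi> \<iota> star
  for av :: "'k::field_char_0 \<Rightarrow> real" and \<pi> :: 'k
    and \<iota> :: "'k \<Rightarrow> 'd::{division_ring, metric_space}" and star :: "'d \<Rightarrow> 'd" +
  fixes \<mu> :: "('d ^ 2 ^ 2) measure"
  assumes inv_measure: "normalized_invariant star {x. nr x \<le> 1} \<mu>"
begin

lemma sets_mu: "sets \<mu> = sets (restrict_space borel (herm star))"
  and mu_invariant: "invertible g \<Longrightarrow> S \<in> sets \<mu> \<Longrightarrow> emeasure \<mu> (act star g ` S) = emeasure \<mu> S"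
  and mu_unit: "emeasure \<mu> (orbit star {x. nr x \<le> 1} (mat 1)) = 1"
  using inv_measure by (auto simp: normalized_invariant_def)

lemma space_mu: "space \<mu> = herm star"
  using sets_eq_imp_space_eq[OF sets_mu] by (simp add: space_restrict_space)

lemma ropen_measurable: "ropen S \<Longrightarrow> S \<in> sets \<mu>"
  unfolding sets_mu ropen_def by (intro relatively_open_measurable) auto

lemma act_preimage:
  assumes g: "invertible g" and S: "ropen S"
  shows "emeasure \<mu> {A \<in> herm star. act star g A \<in> S} = emeasure \<mu> S"
proof -
  obtain h where h: "g ** h = mat 1" "h ** g = mat 1" using g by (auto simp: invertible_def)
  then have ih: "invertible h" by (auto simp: invertible_def)
  have SX: "S \<subseteq> herm star" using S by (simp add: ropen_def)
  have eq: "{A \<in> herm star. act star g A \<in> S} = act star h ` S"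
  proof safe
    fix A assume "act star g A \<in> S"
    moreover have "A = act star h (act star g A)" by (simp add: act_act h)
    ultimately show "A \<in> act star h ` S" by blast
  next
    fix A assume "A \<in> S"
    then show "act star h A \<in> herm star" "act star g (act star h A) \<in> S"
      using SX ih by (auto simp: act_act h act_herm)
  qed
  then show ?thesis using mu_invariant[OF ih ropen_measurable[OF S]] by simp
qed

text \<open>The counting device for the invariant measure: \<open>S\<close> is the disjoint union of
  the preimages of \<open>S0\<close> under the \<open>g t\<close>, and each preimage has the volume
  of \<open>S0\<close>.\<close>

lemma mu_translates:
  assumes I: "finite I" and S0: "ropen S0" and g: "\<And>t. t \<in> I \<Longrightarrow> invertible (g t)"
    and SX: "S \<subseteq> herm star" and ex1: "\<And>A. A \<in> S \<Longrightarrow> \<exists>!t. t \<in> I \<and> act star (g t) A \<in> S0"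
    and bk: "\<And>A t. A \<in> herm star \<Longrightarrow> t \<in> I \<Longrightarrow> act star (g t) A \<in> S0 \<Longrightarrow> A \<in> S"
  shows "emeasure \<mu> S = of_nat (card I) * emeasure \<mu> S0"
proof -
  define f where "f t = {A \<in> herm star. act star (g t) A \<in> S0}" for t
  have "S = (\<Union>t\<in>I. f t)" using SX ex1 bk by (fastforce simp: f_def)
  moreover have "disjoint_family_on f I"
    using ex1 bk unfolding disjoint_family_on_def f_def by blast
  ultimately show ?thesis
    using emeasure_equal_partition[OF I, of f \<mu> "emeasure \<mu> S0"] ropen_measurable[OF ropen_preimage[OF g S0]] act_preimage[OF g S0]
    by (simp add: f_def)
qed

text \<open>Coordinate form of \<open>mu_translates\<close>: \<open>\<alpha>\<close>,
  \<open>\<beta>\<close>, \<open>\<delta>\<close> are the coordinates of the translate, so that each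
  application becomes arithmetic in \<open>a\<close>, \<open>b\<close>, \<open>d\<close>.\<close>

lemma hset_translates:
  assumes I: "finite I" and Q: "loc3 Q" and g: "\<And>t. t \<in> I \<Longrightarrow> invertible (g t)"
    and act: "\<And>t a b d. t \<in> I \<Longrightarrow> act star (g t) (hm a b d) = hm (\<alpha> t a b d) (\<beta> t a b d) (\<delta> t a b d)"
    and ex1: "\<And>a b d. a * d - nm b \<noteq> 0 \<Longrightarrow> P a b d \<Longrightarrow> \<exists>!t. t \<in> I \<and> Q (\<alpha> t a b d) (\<beta> t a b d) (\<delta> t a b d)"
    and bk: "\<And>a b d t. a * d - nm b \<noteq> 0 \<Longrightarrow> t \<in> I \<Longrightarrow> Q (\<alpha> t a b d) (\<beta> t a b d) (\<delta> t a b d) \<Longrightarrow> P a b d"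
  shows "emeasure \<mu> (hset P) = of_nat (card I) * emeasure \<mu> (hset Q)"
proof (rule mu_translates[OF I ropen_hset[OF Q] g hset_herm])
  have mem: "act star (g t) (hm a b d) \<in> hset Q \<longleftrightarrow> Q (\<alpha> t a b d) (\<beta> t a b d) (\<delta> t a b d)"
    if "t \<in> I" "a * d - nm b \<noteq> 0" for t a b d
  proof -
    have "act star (g t) (hm a b d) \<in> herm star" using act_herm[OF g[OF that(1)]] that(2) herm_hm_iff by blast
    then show ?thesis using that by (simp add: act hm_in_hset herm_hm_iff)
  qed
  { fix A assume "A \<in> hset P"
    then obtain a b d where A: "A = hm a b d" "a * d - nm b \<noteq> 0" "P a b d" by (auto simp: hset_def herm_hm_iff)
    have "\<exists>!t. t \<in> I \<and> Q (\<alpha> t a b d) (\<beta> t a b d) (\<delta> t a b d)" using ex1 A by blast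
    then show "\<exists>!t. t \<in> I \<and> act star (g t) A \<in> hset Q" using mem A by (metis (no_types, lifting)) }
  { fix A t assume "A \<in> herm star" "t \<in> I" "act star (g t) A \<in> hset Q"
    then obtain a b d where A: "A = hm a b d" "a * d - nm b \<noteq> 0" using herm_exists by metis
    then show "A \<in> hset P" using mem \<open>t \<in> I\<close> \<open>act star (g t) A \<in> hset Q\<close> bk by (simp add: hm_in_hset) }
qed

lemma invertible_lower: "invertible (mm 1 0 t 1)" and invertible_upper: "invertible (mm 1 t 0 1)"
  unfolding invertible_def
  by (rule exI[of _ "mm 1 0 (- t) 1"], simp add: mm_mult mat_1_mm) (rule exI[of _ "mm 1 (- t) 0 1"], simp add: mm_mult mat_1_mm)

lemma invertible_diag: "a \<noteq> 0 \<Longrightarrow> d \<noteq> 0 \<Longrightarrow> invertible (mm a 0 0 d)"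
  unfolding invertible_def
  by (rule exI[of _ "mm (inverse a) 0 0 (inverse d)"]) (simp add: mm_mult mat_1_mm)

lemma act_lower: "act star (mm 1 0 t 1) (hm a b d) = hm a (\<iota> a * star t + b) (a * nm t + d + tr (t * b))"
  and act_upper: "act star (mm 1 t 0 1) (hm a b d) = hm (a + d * nm t + tr (b * star t)) (\<iota> d * t + b) d"
  and act_diag: "act star (mm g 0 0 s) (hm a b d) = hm (a * nm g) (g * b * star s) (d * nm s)"
  and act_swap: "act star (mm 0 1 1 0) (hm a b d) = hm d (star b) a"
  by (simp_all add: act_mm_hm)

lemma hd_lower: "a * (a * nm t + d + tr (t * b)) - nm (\<iota> a * star t + b) = a * d - nm b"
  and hd_upper: "(a + d * nm t + tr (b * star t)) * d - nm (\<iota> d * t + b) = a * d - nm b"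
  using hdet_act_mm_hm[of 1 0 t 1 a b d] hdet_act_mm_hm[of 1 t 0 1 a b d] by (simp_all add: act_lower act_upper)

lemma nr_lower: "av a = 1 \<Longrightarrow> nr (\<iota> a * star t + b) = nr (- (\<iota> (inverse a) * star b) - t)"
proof -
  assume a: "av a = 1"
  then have "a \<noteq> 0" by auto
  then have "\<iota> a * star t + b = - (\<iota> a * star (- (\<iota> (inverse a) * star b) - t))"
    by (simp add: star_diff star_minus star_iota_mult right_diff_distrib iota_arrange)
  then show ?thesis using a by (simp add: nr_mult nr_iota)
qed

lemma emeasure_swap:
  assumes "loc3 Q" "\<And>a b d. P a b d \<longleftrightarrow> Q d (star b) a"
  shows "emeasure \<mu> (hset P) = emeasure \<mu> (hset Q)"
proof -
  have "emeasure \<mu> (hset P) = of_nat (card {()}) * emeasure \<mu> (hset Q)"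
    by (rule hset_translates[where g = "\<lambda>_. mm 0 1 1 0" and \<alpha> = "\<lambda>_ a b d. d" and \<beta> = "\<lambda>_ a b d. star b" and \<delta> = "\<lambda>_ a b d. a"])
      (use assms Omat_invertible[OF Omat_swap] in \<open>auto simp: act_swap\<close>)
  then show ?thesis by simp
qed

lemmas loc3_intros = loc3_conj loc3_eq loc3_le loc3_less loc3_nr cont3_fst cont3_snd cont3_hdet cont3_const cont3_add cont3_mult

section \<open>Cells with a unit corner\<close>

definition vol_cell :: "int \<Rightarrow> ('d ^ 2 ^ 2) set" where
  "vol_cell \<delta> = hset (\<lambda>a b d. av a = 1 \<and> nr b < 1 \<and> av (a * d - nm b) = q powi (- \<delta>))"

lemma loc3_vol_cell: "loc3 (\<lambda>a b d. av a = 1 \<and> nr b < 1 \<and> av (a * d - nm b) = q powi (- \<delta>))"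
  by (intro loc3_intros) auto

lemma resysD_shift_ex1:
  assumes "av a = 1" "nr b \<le> 1" shows "\<exists>!t. t \<in> resysD \<and> nr (\<iota> a * star t + b) < 1"
  unfolding nr_lower[OF assms(1)]
  by (rule resysD_ex1) (use assms in \<open>simp add: nr_mult nr_iota av_inverse\<close>)

text \<open>A shear changes neither \<open>a\<close> nor the determinant, and exactly one of the
  \<open>q\<^sup>2\<close> residue representatives removes the residue of \<open>b\<close>.\<close>

lemma emeasure_unit_corner:
  "emeasure \<mu> (hset (\<lambda>a b d. av a = 1 \<and> nr b \<le> 1 \<and> av (a * d - nm b) = q powi (- \<delta>)))
     = of_nat (card resysD) * emeasure \<mu> (vol_cell \<delta>)"
  unfolding vol_cell_def
proof (rule hset_translates[where g = "\<lambda>t. mm 1 0 t 1" and \<alpha> = "\<lambda>t a b d. a" and \<beta> = "\<lambda>t a b d. \<iota> a * star t + b"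
      and \<delta> = "\<lambda>t a b d. a * nm t + d + tr (t * b)", OF finite_resysD loc3_vol_cell invertible_lower act_lower])
  fix a b d assume "av a = 1 \<and> nr b \<le> 1 \<and> av (a * d - nm b) = q powi (- \<delta>)"
  then show "\<exists>!t. t \<in> resysD \<and> av a = 1 \<and> nr (\<iota> a * star t + b) < 1 \<and>
      av (a * (a * nm t + d + tr (t * b)) - nm (\<iota> a * star t + b)) = q powi (- \<delta>)"
    using resysD_shift_ex1[of a b] by (simp add: hd_lower)
next
  fix a b d t assume t: "t \<in> resysD" and *: "av a = 1 \<and> nr (\<iota> a * star t + b) < 1 \<and>
      av (a * (a * nm t + d + tr (t * b)) - nm (\<iota> a * star t + b)) = q powi (- \<delta>)"
  have "nr (\<iota> a * star t) \<le> 1" using resysD_integral[OF t] * by (simp add: nr_mult nr_iota)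
  then have "nr (\<iota> a * star t + b - \<iota> a * star t) \<le> 1" using * by (intro nr_diff_le) auto
  then show "av a = 1 \<and> nr b \<le> 1 \<and> av (a * d - nm b) = q powi (- \<delta>)" using * by (simp add: hd_lower)
qed

text \<open>The diagonal matrix with entries 1, \<open>qj\<close> carries the set of
  \<open>emeasure_unit_corner\<close> onto the next cell: it divides \<open>nr b\<close> by
  \<open>q\<close>, which turns the bound \<open>\<le> 1\<close> into \<open>< 1\<close>, and raises
  the order of the determinant by 1.\<close>

lemma emeasure_vol_cell_Suc:
  "emeasure \<mu> (vol_cell (\<delta> + 1)) = of_nat (card resysD) * emeasure \<mu> (vol_cell \<delta>)"
proof -
  have "emeasure \<mu> (hset (\<lambda>a b d. av a = 1 \<and> nr b \<le> 1 \<and> av (a * d - nm b) = q powi (- \<delta>)))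
     = of_nat (card {()}) * emeasure \<mu> (vol_cell (\<delta> + 1))"
    unfolding vol_cell_def
  proof (rule hset_translates[where g = "\<lambda>_. mm 1 0 0 qj" and \<alpha> = "\<lambda>_ a b d. a" and \<beta> = "\<lambda>_ a b d. b * star qj"
      and \<delta> = "\<lambda>_ a b d. d * nm qj"])
    have iff: "av (a * (d * nm qj) - nm (b * star qj)) = q powi (- (\<delta> + 1)) \<longleftrightarrow> av (a * d - nm b) = q powi (- \<delta>)" for a b d
    proof -
      have "a * (d * nm qj) - nm (b * star qj) = (a * d - nm b) * nm qj" by (simp add: nm_mult algebra_simps)
      moreover have "q powi (- (\<delta> + 1)) = q powi (- \<delta>) / q" by (simp add: power_int_diff)
      ultimately show ?thesis by (simp add: av_mult)
    qed
    have iff2: "nr (b * star qj) < 1 \<longleftrightarrow> nr b \<le> 1" for b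
      using nr_less_iff[of b 1] by (simp add: nr_mult)
    { fix a b d assume "av a = 1 \<and> nr b \<le> 1 \<and> av (a * d - nm b) = q powi (- \<delta>)"
      then show "\<exists>!t. t \<in> {()} \<and> av a = 1 \<and> nr (b * star qj) < 1 \<and> av (a * (d * nm qj) - nm (b * star qj)) = q powi (- (\<delta> + 1))"
        unfolding iff iff2 by auto }
    { fix a b d assume "av a = 1 \<and> nr (b * star qj) < 1 \<and> av (a * (d * nm qj) - nm (b * star qj)) = q powi (- (\<delta> + 1))"
      then show "av a = 1 \<and> nr b \<le> 1 \<and> av (a * d - nm b) = q powi (- \<delta>)" unfolding iff iff2 . }
    show "loc3 (\<lambda>a b d. av a = 1 \<and> nr b < 1 \<and> av (a * d - nm b) = q powi (- (\<delta> + 1)))"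
      by (rule loc3_vol_cell)
  qed (auto simp: act_diag intro!: invertible_diag)
  then show ?thesis by (simp add: emeasure_unit_corner)
qed

lemma nm_unit_rep:
  assumes "s \<in> resys - {0}" shows "\<exists>c. nm c = s \<and> nr c = 1"
  using nm_unit_surj[of s] resys_unit assms by auto

lemma av_small_sum: "av x < 1 \<Longrightarrow> (av (x + y) < 1 \<longleftrightarrow> av y < 1)"
  using av_ultra[of x y] av_diff[of "x + y" x] by auto

text \<open>Scaling \<open>d\<close> by elements of norm \<open>s\<close> runs through the nonzero
  residues, and exactly one \<open>s\<close> makes the vector \<open>(t, 1)\<close> isotropic modulo
  \<open>\<pi>\<close>. This cuts the cell into \<open>q - 1\<close> pieces of equal volume.\<close>

lemma emeasure_isotropic_piece:
  assumes t: "nr t = 1"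
  shows "emeasure \<mu> (vol_cell 0) = of_nat (card (resys - {0})) *
     emeasure \<mu> (hset (\<lambda>a b d. av a = 1 \<and> nr b < 1 \<and> av d = 1 \<and> av (a * nm t + d) < 1))"
  unfolding vol_cell_def
proof -
  obtain c where c: "\<And>s. s \<in> resys - {0} \<Longrightarrow> nm (c s) = s \<and> nr (c s) = 1" using nm_unit_rep by metis
  have cnt: "cont3 (\<lambda>a b d. a * nm t + d)" by (intro loc3_intros)
  show "emeasure \<mu> (hset (\<lambda>a b d. av a = 1 \<and> nr b < 1 \<and> av (a * d - nm b) = q powi (- 0))) = of_nat (card (resys - {0})) *
     emeasure \<mu> (hset (\<lambda>a b d. av a = 1 \<and> nr b < 1 \<and> av d = 1 \<and> av (a * nm t + d) < 1))"
  proof (rule hset_translates[where g = "\<lambda>s. mm 1 0 0 (c s)" and \<alpha> = "\<lambda>s a b d. a" and \<beta> = "\<lambda>s a b d. b * star (c s)"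
      and \<delta> = "\<lambda>s a b d. d * s"])
    show "finite (resys - {0})" using finite_resys by simp
    show "loc3 (\<lambda>a b d. av a = 1 \<and> nr b < 1 \<and> av d = 1 \<and> av (a * nm t + d) < 1)"
      by (intro loc3_intros cnt) auto
    show "invertible (mm 1 0 0 (c s))" if "s \<in> resys - {0}" for s
      using c[OF that] by (intro invertible_diag) auto
    show "act star (mm 1 0 0 (c s)) (hm a b d) = hm a (b * star (c s)) (d * s)" if "s \<in> resys - {0}" for s a b d
      using c[OF that] by (simp add: act_diag)
    have avnt: "av (nm t) = 1" using t by (simp add: nr_def)
    { fix a b d assume h: "av a = 1 \<and> nr b < 1 \<and> av (a * d - nm b) = q powi (- 0)"
      then have "av (nm b) < 1" by (simp add: nr_def)
      then have "av (a * d) = 1" using av_add_eq(2)[of "nm b" "a * d - nm b"] h by simp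
      then have d: "av d = 1" "d \<noteq> 0" using h by (auto simp: av_mult)
      define z where "z = - (a * nm t / d)"
      have z: "av z = 1" using h d avnt by (simp add: z_def av_divide av_mult)
      have eq: "av (a * nm t + d * s) = av (z - s)" for s
      proof -
        have "a * nm t + d * s = - (d * (z - s))" using d by (simp add: z_def algebra_simps)
        then show ?thesis by (simp add: av_mult d)
      qed
      obtain s where s: "s \<in> resys" "av (z - s) < 1" "\<And>s'. s' \<in> resys \<Longrightarrow> av (z - s') < 1 \<Longrightarrow> s' = s"
        using resys_ex1[of z] z by auto
      have "s \<noteq> 0"
      proof
        assume "s = 0"
        then show False using s(2) z by simp
      qed
      then have "av s = 1" using resys_unit s by blast
      show "\<exists>!s. s \<in> resys - {0} \<and> av a = 1 \<and> nr (b * star (c s)) < 1 \<and> av (d * s) = 1 \<and> av (a * nm t + d * s) < 1"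
      proof (rule ex1I[of _ s])
        show "s \<in> resys - {0} \<and> av a = 1 \<and> nr (b * star (c s)) < 1 \<and> av (d * s) = 1 \<and> av (a * nm t + d * s) < 1"
          using s(1,2) \<open>s \<noteq> 0\<close> h d \<open>av s = 1\<close> c[of s] unfolding eq by (simp add: nr_mult av_mult)
        fix s' assume "s' \<in> resys - {0} \<and> av a = 1 \<and> nr (b * star (c s')) < 1 \<and> av (d * s') = 1 \<and> av (a * nm t + d * s') < 1"
        then show "s' = s" using s(3)[of s'] by (simp add: eq)
      qed }
    { fix a b d s assume s: "s \<in> resys - {0}"
        and h: "av a = 1 \<and> nr (b * star (c s)) < 1 \<and> av (d * s) = 1 \<and> av (a * nm t + d * s) < 1"
      then have b: "nr b < 1" using c[OF s] by (simp add: nr_mult)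
      moreover have "av d = 1" using h resys_unit[of s] s by (simp add: av_mult)
      ultimately show "av a = 1 \<and> nr b < 1 \<and> av (a * d - nm b) = q powi (- 0)"
        using h av_diff_eq(2)[of "nm b" "a * d"] by (simp add: av_mult nr_def) }
  qed
qed

text \<open>A unit \<open>b\<close> is reduced to a nonunit by a shear for exactly one residue
  \<open>t\<close>, which is nonzero; afterwards \<open>d\<close> is congruent to
  \<open>- a * nm t\<close>, so the matrix lies in the piece of
  \<open>emeasure_isotropic_piece\<close>. The factor \<open>q - 1\<close> stays on the left to
  avoid division of extended reals.\<close>

lemma emeasure_unit_nonunit:
  "of_nat (card (resys - {0})) * emeasure \<mu> (hset (\<lambda>a b d. av a = 1 \<and> av d < 1 \<and> nr b = 1)) =
     of_nat (card (resysD - {0})) * emeasure \<mu> (vol_cell 0)"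
proof -
  define Z where "Z t = hset (\<lambda>a b d. av a = 1 \<and> nr b < 1 \<and> av d = 1 \<and> av (a * nm t + d) < 1)" for t
  define f where "f t = hset (\<lambda>a b d. av a = 1 \<and> av d < 1 \<and> nr b = 1 \<and> nr (\<iota> a * star t + b) < 1)" for t
  have locZ: "loc3 (\<lambda>a b d. av a = 1 \<and> nr b < 1 \<and> av d = 1 \<and> av (a * nm t + d) < 1)" for t
    by (intro loc3_intros) auto
  have fZ: "ropen (f t) \<and> emeasure \<mu> (f t) = emeasure \<mu> (Z t)" if t: "t \<in> resysD - {0}" for t
  proof -
    have nt: "nr t = 1" "av (nm t) = 1" using resysD_unit t by (auto simp: nr_def)
    have "f t = {A \<in> herm star. act star (mm 1 0 t 1) A \<in> Z t}"
    proof (rule hset_eqI[THEN sym, of _ "\<lambda>a b d. av a = 1 \<and> av d < 1 \<and> nr b = 1 \<and> nr (\<iota> a * star t + b) < 1", folded f_def])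
      fix a b d assume nz: "a * d - nm b \<noteq> 0"
      define b' d' where "b' = \<iota> a * star t + b" and "d' = a * nm t + d + tr (t * b)"
      have "act star (mm 1 0 t 1) (hm a b d) \<in> Z t \<longleftrightarrow> av a = 1 \<and> nr b' < 1 \<and> av d' = 1 \<and> av (a * nm t + d') < 1"
        using nz unfolding Z_def act_lower hm_in_hset b'_def d'_def hd_lower by simp
      also have "\<dots> \<longleftrightarrow> av a = 1 \<and> av d < 1 \<and> nr b = 1 \<and> nr b' < 1"
      proof (cases "av a = 1 \<and> nr b' < 1")
        case True
        \<comment> \<open>Up to the small term from \<open>b'\<close>, the trace contributes
          \<open>- 2 * (a * nm t)\<close>. This turns the condition on \<open>d'\<close> into one on
          \<open>d\<close>.\<close>
        have "t * b = t * b' - \<iota> (a * nm t)"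
          by (simp add: b'_def distrib_left iota_left_comm[of t] iota_mult flip: iota_nm)
        then have trb: "tr (t * b) = tr (t * b') - 2 * (a * nm t)"
          using tr_add[of "t * b' - \<iota> (a * nm t)" "\<iota> (a * nm t)"] by simp
        have "(av (tr (t * b')))\<^sup>2 < 1\<^sup>2" using av_tr_le[of "t * b'"] True nt by (simp add: nr_mult)
        then have small: "av (tr (t * b')) < 1" by (rule power_less_imp_less_base) simp
        have 1: "a * nm t + d' = tr (t * b') + d" by (simp add: d'_def trb)
        have nat: "av (a * nm t) = 1" using True nt by (simp add: av_mult)
        have nb: "nr b = 1"
        proof -
          have "nr (\<iota> a * star t) = 1" using True nt by (simp add: nr_mult nr_iota)
          moreover have "b = b' + - (\<iota> a * star t)" by (simp add: b'_def)
          ultimately show ?thesis using nr_add_eq(1)[of b' "- (\<iota> a * star t)"] True by (metis nr_minus)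
        qed
        have "av d' = 1" if "av (a * nm t + d') < 1"
          using av_close_eq[of d' "- (a * nm t)"] that nat by (simp add: add.commute)
        then show ?thesis using True nb av_small_sum[OF small, of d] unfolding 1 by auto
      qed auto
      finally show "hm a b d \<in> {A \<in> herm star. act star (mm 1 0 t 1) A \<in> Z t} \<longleftrightarrow>
          av a = 1 \<and> av d < 1 \<and> nr b = 1 \<and> nr (\<iota> a * star t + b) < 1"
        using nz by (simp add: herm_hm_iff b'_def)
    qed auto
    then show ?thesis unfolding Z_def
      using ropen_preimage[OF invertible_lower ropen_hset[OF locZ]] act_preimage[OF invertible_lower ropen_hset[OF locZ]] by simp
  qed
  have split: "hset (\<lambda>a b d. av a = 1 \<and> av d < 1 \<and> nr b = 1) = (\<Union>t\<in>resysD - {0}. f t)"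
  proof (rule hset_eqI[THEN sym])
    fix a b d assume nz: "a * d - nm b \<noteq> 0"
    have "\<exists>t\<in>resysD - {0}. nr (\<iota> a * star t + b) < 1" if ab: "av a = 1" "nr b = 1"
    proof -
      obtain t where t: "t \<in> resysD" "nr (\<iota> a * star t + b) < 1" using resysD_shift_ex1[of a b] ab by auto
      then have "t \<noteq> 0" using ab by auto
      then show ?thesis using t by blast
    qed
    then show "hm a b d \<in> (\<Union>t\<in>resysD - {0}. f t) \<longleftrightarrow> av a = 1 \<and> av d < 1 \<and> nr b = 1"
      using nz by (auto simp: f_def hm_in_hset)
  qed (auto simp: f_def hset_def)
  have disj: "disjoint_family_on f (resysD - {0})"
    unfolding disjoint_family_on_def
  proof (intro ballI impI)
    fix t t' assume t: "t \<in> resysD - {0}" "t' \<in> resysD - {0}" "t \<noteq> t'"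
    show "f t \<inter> f t' = {}"
    proof (rule ccontr)
      assume "f t \<inter> f t' \<noteq> {}"
      then obtain a b d where "av a = 1" "nr b = 1" "nr (\<iota> a * star t + b) < 1" "nr (\<iota> a * star t' + b) < 1"
        by (auto simp: f_def hset_def hm_eq_iff)
      then show False using resysD_shift_ex1[of a b] t by auto
    qed
  qed
  have "of_nat (card (resys - {0})) * emeasure \<mu> (f t) = emeasure \<mu> (vol_cell 0)" if "t \<in> resysD - {0}" for t
    using fZ[OF that] emeasure_isotropic_piece[of t] resysD_unit[of t] that by (simp add: Z_def)
  then have "(\<Sum>t\<in>resysD - {0}. of_nat (card (resys - {0})) * emeasure \<mu> (f t)) = of_nat (card (resysD - {0})) * emeasure \<mu> (vol_cell 0)"
    by simp
  moreover have "emeasure \<mu> (\<Union>t\<in>resysD - {0}. f t) = (\<Sum>t\<in>resysD - {0}. emeasure \<mu> (f t))"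
    using fZ ropen_measurable disj finite_resysD by (intro sum_emeasure[symmetric]) auto
  ultimately show ?thesis unfolding split by (simp add: sum_distrib_left)
qed

section \<open>Cells with prescribed norm of the off-diagonal entry\<close>

definition hyp_cell :: "int \<Rightarrow> int \<Rightarrow> ('d ^ 2 ^ 2) set" where
  "hyp_cell m k = hset (\<lambda>a b d. av a < 1 \<and> av d \<le> q powi (- k) \<and> nr b = q powi (- m))"

definition hyp_cell' :: "int \<Rightarrow> int \<Rightarrow> ('d ^ 2 ^ 2) set" where
  "hyp_cell' m k = hset (\<lambda>a b d. av a < 1 \<and> av d \<le> q powi (- k) \<and> nr (b - qj powi m) < q powi (- m))"

lemma loc3_hyp_cell:
  "loc3 (\<lambda>a b d. av a < 1 \<and> av d \<le> q powi (- k) \<and> nr b = q powi (- m))"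
  "loc3 (\<lambda>a b d. av a < 1 \<and> av d \<le> q powi (- k) \<and> nr (b - qj powi m) < q powi (- m))"
  by (intro loc3_intros; simp)+

text \<open>Left multiplication of \<open>b\<close> by a unit representative moves its leading digit
  to that of \<open>qj powi m\<close> in exactly one way. With the leading digit fixed, the trace
  term in \<open>emeasure_hyp_cell'_Suc\<close> becomes linear in the shear parameter.\<close>

lemma emeasure_hyp_cell:
  "emeasure \<mu> (hyp_cell m k) = of_nat (card (resysD - {0})) * emeasure \<mu> (hyp_cell' m k)"
  unfolding hyp_cell_def hyp_cell'_def
proof (rule hset_translates[where g = "\<lambda>c. mm c 0 0 1" and \<alpha> = "\<lambda>c a b d. a * nm c" and \<beta> = "\<lambda>c a b d. c * b"
      and \<delta> = "\<lambda>c a b d. d", OF _ loc3_hyp_cell(2)])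
  fix a b d assume *: "av a < 1 \<and> av d \<le> q powi (- k) \<and> nr b = q powi (- m)"
  have b0: "b \<noteq> 0" using * by auto
  define x where "x = qj powi m * inverse b"
  have nx: "nr x = 1" using * by (simp add: x_def nr_mult nr_qj_powi nr_inverse)
  have eq: "nr (c * b - qj powi m) < q powi (- m) \<longleftrightarrow> nr (x - c) < 1" for c
  proof -
    have "c * b - qj powi m = - ((x - c) * b)" using b0 by (simp add: x_def left_diff_distrib mult.assoc)
    then have "nr (c * b - qj powi m) = nr (x - c) * q powi (- m)" using * by (simp add: nr_mult)
    then show ?thesis by simp
  qed
  obtain c where c: "c \<in> resysD" "nr (x - c) < 1" "\<And>c'. c' \<in> resysD \<Longrightarrow> nr (x - c') < 1 \<Longrightarrow> c' = c"
    using resysD_ex1[of x] nx by auto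
  have c0: "c \<noteq> 0"
  proof
    assume "c = 0" then show False using c(2) nx by simp
  qed
  then have "nr c = 1" using resysD_unit c(1) by blast
  then have "av (nm c) = 1" by (simp add: nr_def)
  show "\<exists>!c. c \<in> resysD - {0} \<and> av (a * nm c) < 1 \<and> av d \<le> q powi (- k) \<and> nr (c * b - qj powi m) < q powi (- m)"
  proof (rule ex1I[of _ c])
    show "c \<in> resysD - {0} \<and> av (a * nm c) < 1 \<and> av d \<le> q powi (- k) \<and> nr (c * b - qj powi m) < q powi (- m)"
      using c(1,2) c0 * \<open>av (nm c) = 1\<close> by (simp only: eq av_mult) simp
    fix c' assume "c' \<in> resysD - {0} \<and> av (a * nm c') < 1 \<and> av d \<le> q powi (- k) \<and> nr (c' * b - qj powi m) < q powi (- m)"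
    then show "c' = c" using c(3)[of c'] by (simp only: eq) simp
  qed
next
  fix a b d c assume c: "c \<in> resysD - {0}"
    and *: "av (a * nm c) < 1 \<and> av d \<le> q powi (- k) \<and> nr (c * b - qj powi m) < q powi (- m)"
  have nc: "nr c = 1" "av (nm c) = 1" using resysD_unit c by (auto simp: nr_def)
  have "nr (c * b) = nr (qj powi m)" using * by (intro nr_close_eq) (simp add: nr_qj_powi)
  then show "av a < 1 \<and> av d \<le> q powi (- k) \<and> nr b = q powi (- m)" using * nc by (simp add: nr_mult av_mult nr_qj_powi)
next
  show "invertible (mm c 0 0 1)" if "c \<in> resysD - {0}" for c using that by (intro invertible_diag) auto
qed (auto simp: act_diag finite_resysD)

text \<open>The shear by \<open>r s\<close> moves \<open>d\<close> by
  \<open>s * \<pi> powi k\<close> up to terms of absolute value below \<open>q powi (- k)\<close>,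
  so exactly one \<open>s\<close> clears the digit of \<open>d\<close> at this level.\<close>

lemma emeasure_hyp_cell'_Suc:
  assumes m: "m = 0 \<or> m = 1" and k: "m \<le> k"
  shows "emeasure \<mu> (hyp_cell' m k) = of_nat (card resys) * emeasure \<mu> (hyp_cell' m (k + 1))"
proof -
  \<comment> \<open>Chosen so that \<open>tr (r s * qj powi m)\<close> is
    \<open>s * \<pi> powi k\<close>; the 2 compensates that the trace doubles central
    elements.\<close>
  define r where "r s = \<iota> (s * \<pi> powi k / 2) * inverse (qj powi m)" for s
  have nrr: "nr (r s) \<le> q powi (m - 2 * k)" if "s \<in> resys" for s
  proof -
    have "(av s)\<^sup>2 \<le> 1" using resys_integral[OF that] by (simp add: power_le_one)
    moreover have "nr (r s) = (av s)\<^sup>2 * (q powi (- k))\<^sup>2 * inverse (q powi (- m))"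
      by (simp add: r_def nr_mult nr_iota nr_inverse nr_qj_powi av_divide av_mult av_2 av_pi_powi power_mult_distrib)
    ultimately have "nr (r s) \<le> 1 * (q powi (- k))\<^sup>2 * inverse (q powi (- m))"
      by (simp only:) (intro mult_right_mono, auto)
    also have "inverse (q powi (- m)) = q powi m" by (simp add: power_int_minus)
    also have "1 * (q powi (- k))\<^sup>2 * q powi m = q powi (m - 2 * k)"
      by (simp add: power2_eq_square flip: power_int_add)
    finally show ?thesis .
  qed
  have rq: "r s * qj powi m = \<iota> (s * \<pi> powi k / 2)" for s by (simp add: r_def mult.assoc)
  \<comment> \<open>The shear must not disturb the leading digit of \<open>b\<close>; this requires
    \<open>m \<le> k\<close>.\<close>
  have small_b: "nr (\<iota> a * star (r s)) < q powi (- m)" if "s \<in> resys" "av a < 1" for a s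
  proof -
    have "(av a)\<^sup>2 < 1" using that by (simp add: power_less_one_iff)
    have "nr (\<iota> a * star (r s)) \<le> (av a)\<^sup>2 * q powi (m - 2 * k)"
      unfolding nr_mult nr_iota using nrr[OF that(1)] by (intro mult_left_mono) auto
    also have "\<dots> < 1 * q powi (m - 2 * k)" using \<open>(av a)\<^sup>2 < 1\<close> by (intro mult_strict_right_mono) auto
    also have "\<dots> \<le> q powi (- m)" using k by (simp add: powi_q_le_iff)
    finally show ?thesis .
  qed
  define rest where "rest s a b = a * nm (r s) + tr (r s * (b - qj powi m))" for s a b
  have small: "av (rest s a b) < q powi (- k)" if s: "s \<in> resys" and a: "av a < 1" and b: "nr (b - qj powi m) < q powi (- m)" for s a b
    unfolding rest_def
  proof (rule av_add_less)
    have "av (a * nm (r s)) \<le> (1 / q) * q powi (m - 2 * k)"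
      unfolding av_mult using nrr[OF s] av_less_1_imp[OF a] by (intro mult_mono) (auto simp: nr_def)
    also have "\<dots> = q powi (m - 2 * k - 1)" by (simp add: power_int_diff)
    also have "\<dots> < q powi (- k)" using k m by (auto simp: powi_q_less_iff)
    finally show "av (a * nm (r s)) < q powi (- k)" .
    have "(av (tr (r s * (b - qj powi m))))\<^sup>2 \<le> nr (r s) * nr (b - qj powi m)"
      using av_tr_le[of "r s * (b - qj powi m)"] by (simp add: nr_mult)
    also have "\<dots> \<le> q powi (m - 2 * k) * nr (b - qj powi m)" using nrr[OF s] by (intro mult_right_mono) auto
    also have "\<dots> < q powi (m - 2 * k) * q powi (- m)" using b by (intro mult_strict_left_mono) auto
    also have "\<dots> = (q powi (- k))\<^sup>2" by (simp add: power2_eq_square flip: power_int_add)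
    finally show "av (tr (r s * (b - qj powi m))) < q powi (- k)" by (rule power_less_imp_less_base) simp
  qed
  have d': "a * nm (r s) + d + tr (r s * b) = d + s * \<pi> powi k + rest s a b" for s a b d
  proof -
    have "tr (r s * b) = tr (r s * qj powi m + r s * (b - qj powi m))" by (simp flip: distrib_left)
    also have "\<dots> = s * \<pi> powi k + tr (r s * (b - qj powi m))" unfolding tr_add rq by simp
    finally show ?thesis by (simp add: rest_def)
  qed
  have b': "nr (\<iota> a * star (r s) + b - qj powi m) < q powi (- m) \<longleftrightarrow> nr (b - qj powi m) < q powi (- m)"
    if "s \<in> resys" "av a < 1" for a b s
    using nr_add_less[OF small_b[OF that], of "b - qj powi m"] nr_diff_less[of "\<iota> a * star (r s) + b - qj powi m" _ "\<iota> a * star (r s)"]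
      small_b[OF that] by (auto simp: algebra_simps)
  show ?thesis unfolding hyp_cell'_def
  proof (rule hset_translates[where g = "\<lambda>s. mm 1 0 (r s) 1" and \<alpha> = "\<lambda>s a b d. a" and \<beta> = "\<lambda>s a b d. \<iota> a * star (r s) + b"
      and \<delta> = "\<lambda>s a b d. a * nm (r s) + d + tr (r s * b)", OF finite_resys loc3_hyp_cell(2) invertible_lower act_lower])
    fix a b d assume *: "av a < 1 \<and> av d \<le> q powi (- k) \<and> nr (b - qj powi m) < q powi (- m)"
    define x where "x = - (d / \<pi> powi k)"
    have x: "av x \<le> 1" using * by (simp add: x_def av_divide av_pi_powi)
    have eq: "av (a * nm (r s) + d + tr (r s * b)) \<le> q powi (- (k + 1)) \<longleftrightarrow> av (x - s) < 1" if s: "s \<in> resys" for s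
    proof -
      have eq1: "a * nm (r s) + d + tr (r s * b) = rest s a b + - ((x - s) * \<pi> powi k)"
        unfolding d' by (simp add: x_def algebra_simps)
      have lt: "av (rest s a b) < q powi (- k)" using small s * by blast
      have "av (a * nm (r s) + d + tr (r s * b)) \<le> q powi (- (k + 1)) \<longleftrightarrow> av (a * nm (r s) + d + tr (r s * b)) < q powi (- k)"
        using av_less_iff[of _ "- k"] by simp
      also have "\<dots> \<longleftrightarrow> av (- ((x - s) * \<pi> powi k)) < q powi (- k)"
        unfolding eq1 using av_add_less[OF lt, of "- ((x - s) * \<pi> powi k)"]
          av_diff[of "rest s a b + - ((x - s) * \<pi> powi k)" "rest s a b"] lt by auto
      also have "\<dots> \<longleftrightarrow> av (x - s) < 1" by (simp add: av_mult av_pi_powi del: right_diff_distrib)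
      finally show ?thesis .
    qed
    obtain s where s: "s \<in> resys" "av (x - s) < 1" "\<And>s'. s' \<in> resys \<Longrightarrow> av (x - s') < 1 \<Longrightarrow> s' = s"
      using resys_ex1[OF x] by blast
    show "\<exists>!s. s \<in> resys \<and> av a < 1 \<and> av (a * nm (r s) + d + tr (r s * b)) \<le> q powi (- (k + 1)) \<and>
        nr (\<iota> a * star (r s) + b - qj powi m) < q powi (- m)"
    proof (rule ex1I[of _ s])
      show "s \<in> resys \<and> av a < 1 \<and> av (a * nm (r s) + d + tr (r s * b)) \<le> q powi (- (k + 1)) \<and>
          nr (\<iota> a * star (r s) + b - qj powi m) < q powi (- m)"
        using s(1,2) * eq[OF s(1)] b'[OF s(1)] by blast
      fix s' assume "s' \<in> resys \<and> av a < 1 \<and> av (a * nm (r s') + d + tr (r s' * b)) \<le> q powi (- (k + 1)) \<and>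
          nr (\<iota> a * star (r s') + b - qj powi m) < q powi (- m)"
      then show "s' = s" using s(3)[of s'] eq[of s'] by blast
    qed
  next
    fix a b d s assume s: "s \<in> resys" and *: "av a < 1 \<and> av (a * nm (r s) + d + tr (r s * b)) \<le> q powi (- (k + 1)) \<and>
        nr (\<iota> a * star (r s) + b - qj powi m) < q powi (- m)"
    have b: "nr (b - qj powi m) < q powi (- m)" using b'[OF s] * by blast
    have "av (s * \<pi> powi k) \<le> q powi (- k)"
      using mult_right_mono[OF resys_integral[OF s], of "q powi (- k)"] by (simp add: av_mult av_pi_powi)
    moreover have "av (rest s a b) < q powi (- k)" using small[OF s _ b] * by blast
    ultimately have "av (s * \<pi> powi k + rest s a b) \<le> q powi (- k)"
      using av_ultra[of "s * \<pi> powi k" "rest s a b"] by simp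
    moreover have "av (d + (s * \<pi> powi k + rest s a b)) \<le> q powi (- k)"
    proof -
      have "q powi (- (k + 1)) \<le> q powi (- k)" by (simp only: powi_q_le_iff)
      then show ?thesis using * unfolding d' by (simp add: add.assoc)
    qed
    ultimately have "av d \<le> q powi (- k)"
      using av_diff[of "d + (s * \<pi> powi k + rest s a b)" "s * \<pi> powi k + rest s a b"] by simp
    then show "av a < 1 \<and> av d \<le> q powi (- k) \<and> nr (b - qj powi m) < q powi (- m)" using * b by blast
  qed
qed

lemma emeasure_hyp_cell_Suc:
  "m = 0 \<or> m = 1 \<Longrightarrow> m \<le> k \<Longrightarrow> emeasure \<mu> (hyp_cell m k) = of_nat (card resys) * emeasure \<mu> (hyp_cell m (k + 1))"
  unfolding emeasure_hyp_cell by (subst emeasure_hyp_cell'_Suc) (auto simp: mult.left_commute)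

text \<open>The diagonal matrix with entries 1, \<open>qj\<close> links even and odd size, so that
  the odd classes inherit their volume from a cell inside the unit class.\<close>

lemma emeasure_hyp_cell_scale: "emeasure \<mu> (hyp_cell 0 1) = emeasure \<mu> (hyp_cell 1 2)"
proof -
  have "emeasure \<mu> (hyp_cell 0 1) = of_nat (card {()}) * emeasure \<mu> (hyp_cell 1 2)"
    unfolding hyp_cell_def
  proof (rule hset_translates[where g = "\<lambda>_. mm 1 0 0 qj" and \<alpha> = "\<lambda>_ a b d. a" and \<beta> = "\<lambda>_ a b d. b * star qj"
      and \<delta> = "\<lambda>_ a b d. d * nm qj", OF _ loc3_hyp_cell(1)])
    have iff: "av (d * nm qj) \<le> q powi (- 2) \<longleftrightarrow> av d \<le> q powi (- 1)" "nr (b * star qj) = q powi (- 1) \<longleftrightarrow> nr b = q powi (- 0)" for b d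
      by (simp_all add: av_mult nr_mult power_int_minus field_simps power2_eq_square)
    { fix a b d assume "av a < 1 \<and> av d \<le> q powi (- 1) \<and> nr b = q powi (- 0)"
      then show "\<exists>!t. t \<in> {()} \<and> av a < 1 \<and> av (d * nm qj) \<le> q powi (- 2) \<and> nr (b * star qj) = q powi (- 1)"
        unfolding iff by auto }
    { fix a b d assume "av a < 1 \<and> av (d * nm qj) \<le> q powi (- 2) \<and> nr (b * star qj) = q powi (- 1)"
      then show "av a < 1 \<and> av d \<le> q powi (- 1) \<and> nr b = q powi (- 0)" unfolding iff . }
  qed (auto simp: act_diag intro!: invertible_diag)
  then show ?thesis by simp
qed

section \<open>Volumes of the invariant classes\<close>

lemma inv_class_hset:
  "inv_class m n = hset (\<lambda>a b d. max (max ((av a)\<^sup>2) (nr b)) ((av d)\<^sup>2) = q powi (- m) \<and> av (a * d - nm b) = q powi (- n))"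
  by (rule hset_eqI) (auto simp: inv_class_def msize_hm herm_hm_iff)

lemma hset_cong: "(\<And>a b d. a * d - nm b \<noteq> 0 \<Longrightarrow> P a b d \<longleftrightarrow> Q a b d) \<Longrightarrow> hset P = hset Q"
  by (rule hset_eqI[OF hset_herm]) (simp add: hm_in_hset)

text \<open>The size condition is rewritten with square roots, because the locally constant
  predicates compare \<open>av a\<close> itself and not its square with a radius.\<close>

lemma ropen_inv_class: "ropen (inv_class m n)"
proof -
  have sq: "q powi (- m) = (sqrt (q powi (- m)))\<^sup>2" by simp
  have "loc3 (\<lambda>a b d. (\<not> (av a < sqrt (q powi (- m)) \<and> nr b < q powi (- m) \<and> av d < sqrt (q powi (- m)))) \<and>
     (av a \<le> sqrt (q powi (- m)) \<and> nr b \<le> q powi (- m) \<and> av d \<le> sqrt (q powi (- m)) \<and> av (a * d - nm b) = q powi (- n)))"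
    by (intro loc3_conj[OF loc3_not] loc3_intros) simp_all
  moreover have "inv_class m n = hset (\<lambda>a b d. (\<not> (av a < sqrt (q powi (- m)) \<and> nr b < q powi (- m) \<and> av d < sqrt (q powi (- m)))) \<and>
     (av a \<le> sqrt (q powi (- m)) \<and> nr b \<le> q powi (- m) \<and> av d \<le> sqrt (q powi (- m)) \<and> av (a * d - nm b) = q powi (- n)))"
    unfolding inv_class_hset
  proof (rule hset_cong)
    fix a b d
    have 1: "av x < sqrt (q powi (- m)) \<longleftrightarrow> (av x)\<^sup>2 < q powi (- m)" "av x \<le> sqrt (q powi (- m)) \<longleftrightarrow> (av x)\<^sup>2 \<le> q powi (- m)" for x
      by (metis av_nonneg less_imp_le powi_q_pos real_sqrt_less_iff real_sqrt_le_iff real_sqrt_abs abs_of_nonneg)+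
    have gen: "max (max x y) z = r \<longleftrightarrow> \<not> (x < r \<and> y < r \<and> z < r) \<and> (x \<le> r \<and> y \<le> r \<and> z \<le> r)" for x y z r :: real
      by (auto simp: max_def)
    show "(max (max ((av a)\<^sup>2) (nr b)) ((av d)\<^sup>2) = q powi (- m) \<and> av (a * d - nm b) = q powi (- n)) \<longleftrightarrow>
      (\<not> (av a < sqrt (q powi (- m)) \<and> nr b < q powi (- m) \<and> av d < sqrt (q powi (- m)))) \<and>
     (av a \<le> sqrt (q powi (- m)) \<and> nr b \<le> q powi (- m) \<and> av d \<le> sqrt (q powi (- m)) \<and> av (a * d - nm b) = q powi (- n))"
      unfolding 1 gen by auto
  qed
  ultimately show ?thesis by (simp add: ropen_hset)
qed

text \<open>The scalar matrix with entry \<open>qj\<close> divides size and determinant by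
  \<open>q\<^sup>2\<close>; only size orders 0 and 1 remain to be measured.\<close>

lemma inv_class_shift: "emeasure \<mu> (inv_class (m + 2) (n + 2)) = emeasure \<mu> (inv_class m n)"
proof -
  have "emeasure \<mu> (inv_class m n) = of_nat (card {()}) * emeasure \<mu> (inv_class (m + 2) (n + 2))"
  proof (rule mu_translates[where g = "\<lambda>_. mm qj 0 0 qj"])
    have iff: "act star (mm qj 0 0 qj) A \<in> inv_class (m + 2) (n + 2) \<longleftrightarrow> A \<in> inv_class m n" if A: "A \<in> herm star" for A
    proof -
      obtain a b d where A': "A = hm a b d" "a * d - nm b \<noteq> 0" using herm_exists[OF A] .
      have q2: "q powi (- (z + 2)) = q powi (- z) / q\<^sup>2" for z
        by (simp add: power_int_diff power2_eq_square)
      have "act star (mm qj 0 0 qj) A \<in> herm star" using A by (intro act_herm invertible_diag) auto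
      moreover have "msize (act star (mm qj 0 0 qj) A) = msize A / q\<^sup>2"
        unfolding A' act_diag msize_hm
        by (simp add: av_mult nr_mult power_divide max_divide_distrib_right power2_eq_square)
      moreover have "a * nm qj * (d * nm qj) - nm (qj * b * star qj) = (a * d - nm b) * (nm qj * nm qj)"
        by (simp add: nm_mult algebra_simps)
      then have "av (hdet (act star (mm qj 0 0 qj) A)) = av (hdet A) / q\<^sup>2"
        unfolding A' act_diag hdet_hm by (simp add: av_mult power2_eq_square)
      ultimately show ?thesis using A unfolding inv_class_def q2 by simp
    qed
    show "\<exists>!t. t \<in> {()} \<and> act star (mm qj 0 0 qj) A \<in> inv_class (m + 2) (n + 2)" if "A \<in> inv_class m n" for A
      using iff[of A] that by (auto simp: inv_class_def)
    show "A \<in> inv_class m n" if "A \<in> herm star" "t \<in> {()}" "act star (mm qj 0 0 qj) A \<in> inv_class (m + 2) (n + 2)" for A t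
      using iff that by blast
    show "inv_class m n \<subseteq> herm star" by (auto simp: inv_class_def)
  qed (auto intro!: invertible_diag ropen_inv_class)
  then show ?thesis by simp
qed

lemma inv_class_shift': "emeasure \<mu> (inv_class (m + 2 * k) (n + 2 * k)) = emeasure \<mu> (inv_class m n)"
proof (induction k rule: int_induct[where k = 0])
  case (step1 i)
  then show ?case using inv_class_shift[of "m + 2 * i" "n + 2 * i"] by (simp add: algebra_simps)
next
  case (step2 i)
  then show ?case using inv_class_shift[of "m + 2 * (i - 1)" "n + 2 * (i - 1)"] by (simp add: algebra_simps)
qed simp

lemma emeasure_two: "A \<inter> B = {} \<Longrightarrow> ropen A \<Longrightarrow> ropen B \<Longrightarrow> emeasure \<mu> (A \<union> B) = emeasure \<mu> A + emeasure \<mu> B"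
  by (intro plus_emeasure[symmetric] ropen_measurable)

lemma hset_disjoint: "(\<And>a b d. P a b d \<Longrightarrow> \<not> Q a b d) \<Longrightarrow> hset P \<inter> hset Q = {}"
  by (auto simp: hset_def hm_eq_iff)

lemma hset_Un: "(\<And>a b d. a * d - nm b \<noteq> 0 \<Longrightarrow> R a b d \<longleftrightarrow> P a b d \<or> Q a b d) \<Longrightarrow> hset R = hset P \<union> hset Q"
  by (rule hset_eqI[symmetric]) (use hset_herm in \<open>auto simp: hm_in_hset\<close>)

lemma powi_m1: "q powi (- 1) = 1 / q"
  by (simp add: power_int_minus inverse_eq_divide)

lemma av_le_inv_q_iff: "av x \<le> q powi (- 1) \<longleftrightarrow> av x < 1"
  using av_less_iff[of x 0] by simp

lemma max3_eq_1_iff: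
  "max (max ((av a)\<^sup>2) r) ((av d)\<^sup>2) = 1 \<longleftrightarrow> av a \<le> 1 \<and> r \<le> 1 \<and> av d \<le> 1 \<and> (av a = 1 \<or> r = 1 \<or> av d = 1)"
proof -
  have "(av x)\<^sup>2 \<le> 1 \<longleftrightarrow> av x \<le> 1" "(av x)\<^sup>2 = 1 \<longleftrightarrow> av x = 1" for x
    using abs_square_le_1[of "av x"] power2_eq_1_iff[of "av x"] av_nonneg[of x] by (auto simp: less_le)
  moreover have "max (max x y) z = 1 \<longleftrightarrow> x \<le> 1 \<and> y \<le> 1 \<and> z \<le> 1 \<and> (x = 1 \<or> y = 1 \<or> z = 1)" for x y z :: real
    by (auto simp: max_def)
  ultimately show ?thesis by simp
qed

lemma corner_integral:
  assumes "av a = 1" "nr b \<le> 1" "av (a * d - nm b) \<le> 1" shows "av d \<le> 1"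
proof -
  have "av (a * d) \<le> 1" using av_ultra[of "a * d - nm b" "nm b"] assms by (simp add: nr_def)
  then show ?thesis using assms by (simp add: av_mult)
qed

text \<open>If \<open>a\<close> is a nonunit, a unit determinant forces \<open>b\<close> to be a
  unit. This part is split by whether \<open>d\<close> is a unit; with unit \<open>d\<close> it is
  the mirror image of the cell in \<open>emeasure_unit_nonunit\<close>.\<close>

lemma emeasure_inv_class_0_0:
  "emeasure \<mu> (inv_class 0 0) = of_nat (card resysD) * emeasure \<mu> (vol_cell 0) +
     (emeasure \<mu> (hset (\<lambda>a b d. av a = 1 \<and> av d < 1 \<and> nr b = 1)) + emeasure \<mu> (hyp_cell 0 1))"
proof -
  define P1 where "P1 a b d \<longleftrightarrow> av a = 1 \<and> nr b \<le> 1 \<and> av (a * d - nm b) = q powi (- 0)" for a b d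
  define P2 where "P2 a b d \<longleftrightarrow> av a < 1 \<and> av d = 1 \<and> nr b = 1" for a b d
  define P3 where "P3 a b d \<longleftrightarrow> av a < 1 \<and> av d \<le> q powi (- 1) \<and> nr b = q powi (- 0)" for a b d
  have l: "loc3 P1" "loc3 P2" "loc3 P3" unfolding P1_def[abs_def] P2_def[abs_def] P3_def[abs_def]
    by (intro loc3_intros; simp)+
  have "inv_class 0 0 = hset P1 \<union> (hset P2 \<union> hset P3)"
  proof (subst hset_Un[of "\<lambda>a b d. P2 a b d \<or> P3 a b d" P2 P3, symmetric])
    show "inv_class 0 0 = hset P1 \<union> hset (\<lambda>a b d. P2 a b d \<or> P3 a b d)"
      unfolding inv_class_hset
    proof (rule hset_Un)
      fix a b d
      have small: "av (a * d) < 1" if "av a < 1" "av d \<le> 1"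
        using mult_le_one[of "av d" "av a"] that mult_right_mono[of "av d" 1 "av a"] by (simp add: av_mult) (simp add: mult.commute)
      have "(max (max ((av a)\<^sup>2) (nr b)) ((av d)\<^sup>2) = 1 \<and> av (a * d - nm b) = 1) \<longleftrightarrow>
        (av a = 1 \<and> nr b \<le> 1 \<and> av (a * d - nm b) = 1) \<or> (av a < 1 \<and> av d \<le> 1 \<and> nr b = 1)" (is "?L \<longleftrightarrow> ?R")
      proof
        assume L: ?L
        then have h: "av a \<le> 1" "nr b \<le> 1" "av d \<le> 1" "av (a * d - nm b) = 1" unfolding max3_eq_1_iff by auto
        show ?R
        proof (cases "av a = 1")
          case False
          then have "av a < 1" using h by simp
          then have "av (nm b) = 1" using av_close_eq[of "nm b" "nm b - a * d"] small h by (simp add: av_commute)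
          then show ?thesis using h \<open>av a < 1\<close> by (simp add: nr_def)
        qed (use h in simp)
      next
        assume R: ?R
        then show ?L
        proof (elim disjE)
          assume "av a = 1 \<and> nr b \<le> 1 \<and> av (a * d - nm b) = 1"
          then show ?L unfolding max3_eq_1_iff using corner_integral[of a b d] by simp
        next
          assume h: "av a < 1 \<and> av d \<le> 1 \<and> nr b = 1"
          then have "av (a * d - nm b) = 1" using av_diff_eq(1)[of "a * d" "nm b"] small by (simp add: nr_def)
          then show ?L unfolding max3_eq_1_iff using h by simp
        qed
      qed
      then show "(max (max ((av a)\<^sup>2) (nr b)) ((av d)\<^sup>2) = q powi (- 0) \<and> av (a * d - nm b) = q powi (- 0)) \<longleftrightarrow>
          P1 a b d \<or> P2 a b d \<or> P3 a b d"
        unfolding P1_def P2_def P3_def av_le_inv_q_iff by auto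
    qed
  qed simp
  also have "emeasure \<mu> \<dots> = emeasure \<mu> (hset P1) + emeasure \<mu> (hset P2 \<union> hset P3)"
    by (intro plus_emeasure[symmetric] sets.Un ropen_measurable ropen_hset l)
      (auto simp: P1_def P2_def P3_def hset_def hm_eq_iff)
  also have "emeasure \<mu> (hset P2 \<union> hset P3) = emeasure \<mu> (hset P2) + emeasure \<mu> (hset P3)"
    by (rule emeasure_two[OF hset_disjoint ropen_hset[OF l(2)] ropen_hset[OF l(3)]]) (unfold P2_def P3_def av_le_inv_q_iff, simp)
  also have "emeasure \<mu> (hset P2) = emeasure \<mu> (hset (\<lambda>a b d. av a = 1 \<and> av d < 1 \<and> nr b = 1))"
    by (rule emeasure_swap) (auto simp: P2_def intro!: loc3_intros)
  finally show ?thesis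
    using emeasure_unit_corner[of 0] by (simp add: P1_def[abs_def] P3_def[abs_def] hyp_cell_def)
qed

text \<open>The determinant is now a nonunit, so for nonunit \<open>a\<close> also \<open>b\<close>
  is a nonunit and \<open>d\<close> must be a unit. Swapping the corners gives one more cell. The
  total \<open>q\<^sup>2 + 1\<close> is the number of points of the projective line over the residue
  field of the algebra.\<close>

lemma emeasure_inv_class_0:
  assumes "\<delta> \<ge> 1"
  shows "emeasure \<mu> (inv_class 0 \<delta>) = of_nat (card resysD) * emeasure \<mu> (vol_cell \<delta>) + emeasure \<mu> (vol_cell \<delta>)"
proof -
  define P1 where "P1 a b d \<longleftrightarrow> av a = 1 \<and> nr b \<le> 1 \<and> av (a * d - nm b) = q powi (- \<delta>)" for a b d
  define P2 where "P2 a b d \<longleftrightarrow> (av a < 1 \<and> av d = 1) \<and> nr b < 1 \<and> av (a * d - nm b) = q powi (- \<delta>)" for a b d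
  have qd: "q powi (- \<delta>) < 1" using powi_q_less_iff[of "- \<delta>" 0] assms by simp
  have l: "loc3 P1" "loc3 P2" unfolding P1_def[abs_def] P2_def[abs_def] by (intro loc3_intros; simp)+
  have "inv_class 0 \<delta> = hset P1 \<union> hset P2"
    unfolding inv_class_hset
  proof (rule hset_Un)
    fix a b d
    have "(max (max ((av a)\<^sup>2) (nr b)) ((av d)\<^sup>2) = 1 \<and> av (a * d - nm b) = q powi (- \<delta>)) \<longleftrightarrow> P1 a b d \<or> P2 a b d" (is "?L \<longleftrightarrow> ?R")
    proof
      assume L: ?L
      then have h: "av a \<le> 1" "nr b \<le> 1" "av d \<le> 1" "av (a * d - nm b) = q powi (- \<delta>)" "av a = 1 \<or> nr b = 1 \<or> av d = 1"
        unfolding max3_eq_1_iff by auto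
      show ?R
      proof (cases "av a = 1")
        case False
        then have a: "av a < 1" using h by simp
        have "av a * av d \<le> av a * 1" using h by (intro mult_left_mono) auto
        then have "av (a * d) < 1" using a by (simp add: av_mult)
        then have "av (nm b) < 1" using av_diff[of "a * d" "a * d - nm b"] h(4) qd by simp
        then have "nr b < 1" by (simp add: nr_def)
        then show ?thesis using h a by (auto simp: P2_def)
      qed (use h in \<open>simp add: P1_def\<close>)
    next
      assume ?R
      then show ?L using qd corner_integral[of a b d] by (auto simp: P1_def P2_def max3_eq_1_iff)
    qed
    then show "(max (max ((av a)\<^sup>2) (nr b)) ((av d)\<^sup>2) = q powi (- 0) \<and> av (a * d - nm b) = q powi (- \<delta>)) \<longleftrightarrow> P1 a b d \<or> P2 a b d"
      by simp
  qed
  also have "emeasure \<mu> \<dots> = emeasure \<mu> (hset P1) + emeasure \<mu> (hset P2)"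
    by (intro plus_emeasure[symmetric] ropen_measurable ropen_hset l) (auto simp: P1_def P2_def hset_def hm_eq_iff)
  also have "emeasure \<mu> (hset P2) = emeasure \<mu> (vol_cell \<delta>)"
    unfolding vol_cell_def
  proof (rule emeasure_swap[OF loc3_vol_cell])
    fix a b d
    have "av a < 1" if "av d = 1" "nr b < 1" "av (a * d - nm b) = q powi (- \<delta>)"
    proof -
      have "av (a * d) < 1" using av_add_less[of "a * d - nm b" 1 "nm b"] that qd by (simp add: nr_def)
      then show ?thesis using that by (simp add: av_mult)
    qed
    then show "P2 a b d \<longleftrightarrow> av d = 1 \<and> nr (star b) < 1 \<and> av (d * a - nm (star b)) = q powi (- \<delta>)"
      by (auto simp: P2_def mult.commute)
  qed
  finally show ?thesis using emeasure_unit_corner[of \<delta>] by (simp add: P1_def[abs_def])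
qed

text \<open>In odd size the entry \<open>b\<close> alone determines size and determinant, so the
  class is a single cell.\<close>

lemma inv_class_odd: "inv_class 1 1 = hyp_cell 1 1"
  unfolding inv_class_hset hyp_cell_def
proof (rule hset_cong)
  fix a b d
  have lt: "(av x)\<^sup>2 < q powi (- 1)" if "av x < 1" for x
  proof -
    have "(av x)\<^sup>2 \<le> (1 / q)\<^sup>2" using av_less_1_imp[OF that] by (intro power_mono) auto
    also have "\<dots> < 1 / q" using q_gt_1 by (simp add: power2_eq_square field_simps)
    finally show ?thesis by (simp only: powi_m1)
  qed
  show "(max (max ((av a)\<^sup>2) (nr b)) ((av d)\<^sup>2) = q powi (- 1) \<and> av (a * d - nm b) = q powi (- 1)) \<longleftrightarrow>
      (av a < 1 \<and> av d \<le> q powi (- 1) \<and> nr b = q powi (- 1))" (is "?L \<longleftrightarrow> ?R")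
  proof
    assume ?L
    then have "msize (hm a b d) = q powi (- (2 * 0 + 1))" by (simp add: msize_hm)
    from odd_size_entries[OF this] have "nr b = q powi (- 1)" "av a \<le> q powi (- 1)" "av d \<le> q powi (- 1)" by simp_all
    then show ?R by (simp only: av_le_inv_q_iff)
  next
    assume R: ?R
    then have d1: "av d < 1" by (simp only: av_le_inv_q_iff)
    have mx: "max (max ((av a)\<^sup>2) (nr b)) ((av d)\<^sup>2) = q powi (- 1)" using lt[of a] lt[of d] R d1 by (auto simp: max_def)
    have "av (a * d) \<le> (1 / q) * (1 / q)" unfolding av_mult
      using R d1 by (intro mult_mono av_less_1_imp) auto
    moreover have "(1 / q) * (1 / q) < 1 / q" using q_gt_1 by (simp add: field_simps)
    ultimately have lt: "av (a * d) < 1 / q" by linarith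
    have "av (nm b) = 1 / q" using R unfolding powi_m1 nr_def by blast
    then have "av (a * d - nm b) = 1 / q" using av_diff_eq(1)[of "a * d" "nm b"] lt by simp
    then show ?L using mx unfolding powi_m1 by blast
  qed
qed

lemma orbit_inv_class:
  assumes "A \<in> inv_class m n" shows "orbit star {x. nr x \<le> 1} A = inv_class m n"
  using assms orbit_eq[of A] by (auto simp: inv_class_def)

lemma unit_in_inv_class: "mat 1 \<in> inv_class 0 0"
  by (simp add: mat_1_hm inv_class_def herm_hm_iff msize_hm)

lemma emeasure_to_measure: "emeasure \<mu> A = of_nat n * emeasure \<mu> B \<Longrightarrow> measure \<mu> A = real n * measure \<mu> B"
  by (simp add: measure_def enn2real_mult)

lemma emeasure_unit_class: "emeasure \<mu> (inv_class 0 0) = 1"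
  using mu_unit orbit_inv_class[OF unit_in_inv_class] by simp

text \<open>The volumes \<open>v\<close>, \<open>y\<close>, \<open>h\<close> of the unit-corner
  cell, the mixed cell and the hyperbolic cell satisfy three linear relations with a unique
  solution; one of the relations is the normalization of the measure.\<close>

lemma vol_cell_0: "measure \<mu> (vol_cell 0) = (q - 1) / (q * (q\<^sup>2 + 1))"
  and measure_hyp_cell_0_1: "measure \<mu> (hyp_cell 0 1) = (q + 1) / (q * (q\<^sup>2 + 1))"
  and vol_cell_0_finite: "emeasure \<mu> (vol_cell 0) \<noteq> \<infinity>"
  and hyp_cell_0_1_finite: "emeasure \<mu> (hyp_cell 0 1) \<noteq> \<infinity>"
proof -
  define Y where "Y = hset (\<lambda>a b d. av a = 1 \<and> av d < 1 \<and> nr b = 1)"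
  define Ys where "Ys = hset (\<lambda>a b d. av a < 1 \<and> av d = 1 \<and> nr b = 1)"
  have cards: "card resysD > 0" "card resys > 0"
    using finite_resysD zero_in_resysD finite_resys zero_in_resys card_gt_0_iff by blast+
  have sum1: "1 = of_nat (card resysD) * emeasure \<mu> (vol_cell 0) + (emeasure \<mu> Y + emeasure \<mu> (hyp_cell 0 1))"
    using emeasure_inv_class_0_0 emeasure_unit_class by (simp add: Y_def)
  \<comment> \<open>Finiteness comes first: the three volumes occur with positive coefficients in a
    sum equal to 1.\<close>
  have fin: "emeasure \<mu> (vol_cell 0) \<noteq> \<infinity>" "emeasure \<mu> Y \<noteq> \<infinity>" "emeasure \<mu> (hyp_cell 0 1) \<noteq> \<infinity>"
    using sum1 cards by (auto simp: ennreal_mult_top)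
  then show "emeasure \<mu> (vol_cell 0) \<noteq> \<infinity>" "emeasure \<mu> (hyp_cell 0 1) \<noteq> \<infinity>" by auto
  define v y h where "v = measure \<mu> (vol_cell 0)" and "y = measure \<mu> Y" and "h = measure \<mu> (hyp_cell 0 1)"
  have "ennreal 1 = ennreal (real (card resysD) * v + (y + h))"
    unfolding v_def y_def h_def using sum1 fin
    by (simp add: emeasure_eq_ennreal_measure ennreal_plus ennreal_mult ennreal_of_nat_eq_real_of_nat)
  then have e1: "1 = q\<^sup>2 * v + (y + h)"
    by (subst (asm) ennreal_inj) (auto simp: card_resysD v_def y_def h_def)
  have e2: "(q - 1) * y = (q\<^sup>2 - 1) * v"
  proof -
    have "enn2real (of_nat (card (resys - {0})) * emeasure \<mu> Y) = enn2real (of_nat (card (resysD - {0})) * emeasure \<mu> (vol_cell 0))"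
      using emeasure_unit_nonunit by (simp add: Y_def)
    then show ?thesis
      by (simp only: enn2real_mult enn2real_of_nat card_resys_nonzero card_resysD_nonzero v_def y_def measure_def)
  qed
  \<comment> \<open>The cell with \<open>d\<close> merely integral is counted twice: as
    \<open>q\<close> copies of \<open>hyp_cell 0 1\<close>, and split by whether \<open>d\<close> is
    a unit.\<close>
  have e3: "q * h = y + h"
  proof -
    have "hyp_cell 0 0 = Ys \<union> hyp_cell 0 1"
      unfolding hyp_cell_def Ys_def av_le_inv_q_iff by (rule hset_Un) auto
    moreover have "emeasure \<mu> (Ys \<union> hyp_cell 0 1) = emeasure \<mu> Ys + emeasure \<mu> (hyp_cell 0 1)"
      unfolding hyp_cell_def Ys_def av_le_inv_q_iff
      by (intro plus_emeasure[symmetric] ropen_measurable ropen_hset loc3_intros) (auto simp: hset_def hm_eq_iff)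
    moreover have "emeasure \<mu> Ys = emeasure \<mu> Y"
      unfolding Ys_def Y_def by (rule emeasure_swap) (auto intro!: loc3_intros)
    moreover have "measure \<mu> (hyp_cell 0 0) = real (card resys) * h"
      unfolding h_def by (rule emeasure_to_measure) (use emeasure_hyp_cell_Suc[of 0 0] in simp)
    ultimately have "real (card resys) * h = enn2real (emeasure \<mu> Y + emeasure \<mu> (hyp_cell 0 1))"
      by (simp add: measure_def)
    also have "\<dots> = y + h" using fin by (simp add: y_def h_def measure_def enn2real_plus less_top)
    finally show ?thesis by (simp add: card_resys q_def)
  qed
  have "y = (q + 1) * v"
  proof -
    have "(q - 1) * (y - (q + 1) * v) = 0" using e2 by (simp add: algebra_simps power2_eq_square)
    then show ?thesis using q_gt_1 by simp
  qed
  moreover have "(q - 1) * h = (q + 1) * v" using e3 calculation by (simp add: algebra_simps)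
  moreover have "(q - 1) = (q - 1) * (q\<^sup>2 * v + (y + h))" using e1 by simp
  ultimately have v1: "q - 1 = (q * (q\<^sup>2 + 1)) * v"
    by (simp add: algebra_simps power2_eq_square)
  have pos: "q * (q\<^sup>2 + 1) > 0" by (simp add: add_pos_pos)
  show "measure \<mu> (vol_cell 0) = (q - 1) / (q * (q\<^sup>2 + 1))" using v1 pos by (simp add: v_def[symmetric] field_simps)
  then have "(q - 1) * h = (q - 1) * ((q + 1) / (q * (q\<^sup>2 + 1)))"
    using \<open>(q - 1) * h = (q + 1) * v\<close> by (simp add: v_def)
  moreover have "q - 1 \<noteq> 0" using q_gt_1 by simp
  ultimately show "measure \<mu> (hyp_cell 0 1) = (q + 1) / (q * (q\<^sup>2 + 1))" unfolding h_def by (metis mult_left_cancel)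
qed

lemma measure_vol_cell:
  "emeasure \<mu> (vol_cell (int \<delta>)) \<noteq> \<infinity> \<and> measure \<mu> (vol_cell (int \<delta>)) = q ^ (2 * \<delta>) * ((q - 1) / (q * (q\<^sup>2 + 1)))"
proof (induction \<delta>)
  case 0 then show ?case using vol_cell_0 vol_cell_0_finite by simp
next
  case (Suc \<delta>)
  have eq: "emeasure \<mu> (vol_cell (int (Suc \<delta>))) = of_nat (card resysD) * emeasure \<mu> (vol_cell (int \<delta>))"
    using emeasure_vol_cell_Suc[of "int \<delta>"] by (simp add: add.commute)
  then have "emeasure \<mu> (vol_cell (int (Suc \<delta>))) \<noteq> \<infinity>"
    using Suc by (simp add: ennreal_mult_eq_top_iff)
  moreover have "measure \<mu> (vol_cell (int (Suc \<delta>))) = q\<^sup>2 * measure \<mu> (vol_cell (int \<delta>))"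
    using emeasure_to_measure[OF eq] by (simp add: card_resysD)
  ultimately show ?case using Suc by (simp add: power2_eq_square)
qed

text \<open>After a shift to size 1 and for positive \<open>\<delta>\<close> the class has the
  volume of \<open>q\<^sup>2 + 1\<close> cells, which cancels the denominator of the cell
  volume.\<close>

lemma measure_inv_class_even:
  "emeasure \<mu> (inv_class (2 * k) (2 * k + int \<delta>)) \<noteq> \<infinity>"
  "measure \<mu> (inv_class (2 * k) (2 * k + int \<delta>)) = (if \<delta> = 0 then 1 else q ^ (2 * \<delta>) * (1 - 1 / q))"
proof -
  have sh: "emeasure \<mu> (inv_class (2 * k) (2 * k + int \<delta>)) = emeasure \<mu> (inv_class 0 (int \<delta>))"
    using inv_class_shift'[of 0 k "int \<delta>"] by (simp add: add.commute)
  have "emeasure \<mu> (inv_class 0 (int \<delta>)) \<noteq> \<infinity> \<and>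
      measure \<mu> (inv_class 0 (int \<delta>)) = (if \<delta> = 0 then 1 else q ^ (2 * \<delta>) * (1 - 1 / q))"
  proof (cases "\<delta> = 0")
    case True
    then show ?thesis using emeasure_unit_class by (simp add: measure_def)
  next
    case False
    have fin: "emeasure \<mu> (vol_cell (int \<delta>)) \<noteq> \<infinity>" and m: "measure \<mu> (vol_cell (int \<delta>)) = q ^ (2 * \<delta>) * ((q - 1) / (q * (q\<^sup>2 + 1)))"
      using measure_vol_cell by auto
    have eq: "emeasure \<mu> (inv_class 0 (int \<delta>)) = of_nat (card resysD + 1) * emeasure \<mu> (vol_cell (int \<delta>))"
      using emeasure_inv_class_0[of "int \<delta>"] False by (simp add: distrib_right add.commute)
    have "q\<^sup>2 + 1 > 0" by (simp add: add_pos_pos)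
    then have "q\<^sup>2 + 1 \<noteq> 0" by linarith
    then have "(q\<^sup>2 + 1) * ((q - 1) / (q * (q\<^sup>2 + 1))) = (q - 1) / q"
      unfolding times_divide_eq_right mult.commute[of "q\<^sup>2 + 1" "q - 1"] by (rule nonzero_mult_divide_mult_cancel_right)
    then have key: "(q\<^sup>2 + 1) * ((q - 1) / (q * (q\<^sup>2 + 1))) = 1 - 1 / q" by (simp add: diff_divide_distrib)
    have "measure \<mu> (inv_class 0 (int \<delta>)) = (q\<^sup>2 + 1) * (q ^ (2 * \<delta>) * ((q - 1) / (q * (q\<^sup>2 + 1))))"
      using emeasure_to_measure[OF eq] by (simp only: card_resysD m of_nat_add of_nat_1)
    also have "\<dots> = q ^ (2 * \<delta>) * (1 - 1 / q)" by (simp only: mult.left_commute[of "q\<^sup>2 + 1"] key)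
    finally have "measure \<mu> (inv_class 0 (int \<delta>)) = q ^ (2 * \<delta>) * (1 - 1 / q)" .
    moreover have "emeasure \<mu> (inv_class 0 (int \<delta>)) \<noteq> \<infinity>" unfolding eq using fin by (simp add: ennreal_mult_eq_top_iff)
    ultimately show ?thesis using False by simp
  qed
  then show "emeasure \<mu> (inv_class (2 * k) (2 * k + int \<delta>)) \<noteq> \<infinity>"
    "measure \<mu> (inv_class (2 * k) (2 * k + int \<delta>)) = (if \<delta> = 0 then 1 else q ^ (2 * \<delta>) * (1 - 1 / q))"
    using sh by (auto simp: measure_def)
qed

text \<open>The class has the volume of \<open>q\<close> copies of the hyperbolic cell inside the
  unit class.\<close>

lemma measure_inv_class_odd:
  "emeasure \<mu> (inv_class (2 * k + 1) (2 * k + 1)) \<noteq> \<infinity>"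
  "measure \<mu> (inv_class (2 * k + 1) (2 * k + 1)) = (q + 1) / (q\<^sup>2 + 1)"
proof -
  have sh: "emeasure \<mu> (inv_class (2 * k + 1) (2 * k + 1)) = emeasure \<mu> (inv_class 1 1)"
    using inv_class_shift'[of 1 k 1] by (simp add: add.commute)
  have eq: "emeasure \<mu> (inv_class 1 1) = of_nat (card resys) * emeasure \<mu> (hyp_cell 0 1)"
    using emeasure_hyp_cell_Suc[of 1 1] emeasure_hyp_cell_scale by (simp add: inv_class_odd)
  show "emeasure \<mu> (inv_class (2 * k + 1) (2 * k + 1)) \<noteq> \<infinity>"
    unfolding sh eq using hyp_cell_0_1_finite by (simp add: ennreal_mult_eq_top_iff)
  have "measure \<mu> (inv_class 1 1) = (q + 1) / (q\<^sup>2 + 1)"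
    using emeasure_to_measure[OF eq] by (simp add: measure_hyp_cell_0_1 card_resys flip: q_def)
  then show "measure \<mu> (inv_class (2 * k + 1) (2 * k + 1)) = (q + 1) / (q\<^sup>2 + 1)" using sh by (simp add: measure_def)
qed

end

section \<open>Spherical functions\<close>

lemma powi_minus_nat:
  fixes u :: "'a::field" assumes "u \<noteq> 0" shows "u powi (- (a + int i)) = u powi (- a) * inverse u ^ i"
proof -
  have "- (a + int i) = - a + - int i" by simp
  then show ?thesis using assms by (simp only: power_int_add[OF disjI1[OF assms]]) (simp add: power_int_minus power_inverse)
qed

locale haar_quaternion = metric_quaternion av \<pi> \<iota> star
  for av :: "'k::field_char_0 \<Rightarrow> real" and \<pi> :: 'k
    and \<iota> :: "'k \<Rightarrow> 'd::{division_ring, metric_space}" and star :: "'d \<Rightarrow> 'd" +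
  fixes \<kappa> :: "('d ^ 2 ^ 2) measure"
  assumes haar: "normalized_haar {x. nr x \<le> 1} \<kappa>"
begin

lemma sets_haar: "sets \<kappa> = sets (restrict_space borel Omat)"
  and haar_total: "emeasure \<kappa> Omat = 1"
  and haar_left: "g \<in> Omat \<Longrightarrow> S \<in> sets \<kappa> \<Longrightarrow> emeasure \<kappa> ((\<lambda>h. g ** h) ` S) = emeasure \<kappa> S"
  using haar by (auto simp: normalized_haar_def Omat_def)

lemma space_haar: "space \<kappa> = Omat"
  using sets_eq_imp_space_eq[OF sets_haar] by (simp add: space_restrict_space)

lemma finite_measure_haar: "finite_measure \<kappa>"
  by (rule finite_measureI) (simp add: space_haar haar_total)

section \<open>Congruence cosets and right invariance\<close>

lemma q_powi_Suc: "q powi (- int (Suc n)) = (1 / q) * q powi (- int n)"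
  by (simp add: power_int_minus field_simps del: of_nat_Suc)

text \<open>Digit expansion: subtract a residue representative, divide by \<open>qj\<close>, and
  repeat.\<close>

lemma finite_approximation:
  "\<exists>F. finite F \<and> (\<forall>x. nr x \<le> 1 \<longrightarrow> (\<exists>f\<in>F. nr (x - f) \<le> q powi (- int m)))"
proof (induction m)
  case 0
  show ?case by (rule exI[of _ "{0}"]) simp
next
  case (Suc m)
  then obtain F where F: "finite F" "\<And>x. nr x \<le> 1 \<Longrightarrow> \<exists>f\<in>F. nr (x - f) \<le> q powi (- int m)" by blast
  show ?case
  proof (intro exI[of _ "(\<lambda>(t, f). t + qj * f) ` (resysD \<times> F)"] conjI allI impI)
    show "finite ((\<lambda>(t, f). t + qj * f) ` (resysD \<times> F))" using finite_resysD F by simp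
    fix x assume "nr x \<le> 1"
    then obtain t where t: "t \<in> resysD" "nr (x - t) < 1" using resysD_ex1 by blast
    define y where "y = inverse qj * (x - t)"
    have "nr y = q * nr (x - t)" by (simp add: y_def nr_mult nr_inverse)
    then have "nr y \<le> 1" using t(2) nr_less_1_iff[of "x - t"] by (simp add: field_simps)
    then obtain f where f: "f \<in> F" "nr (y - f) \<le> q powi (- int m)" using F(2) by blast
    have "x - (t + qj * f) = qj * (y - f)" by (simp add: y_def right_diff_distrib flip: mult.assoc)
    then have "nr (x - (t + qj * f)) = nr (y - f) / q" by (simp add: nr_mult)
    also have "\<dots> \<le> q powi (- int m) / q" using f by (intro divide_right_mono) auto
    also have "\<dots> = q powi (- int (Suc m))" unfolding q_powi_Suc by simp
    finally show "\<exists>f\<in>(\<lambda>(t, f). t + qj * f) ` (resysD \<times> F). nr (x - f) \<le> q powi (- int (Suc m))"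
      using t f by force
  qed
qed

definition coset :: "nat \<Rightarrow> 'd ^ 2 ^ 2 \<Rightarrow> ('d ^ 2 ^ 2) set" where
  "coset m g = {h \<in> Omat. msize (h - g) \<le> q powi (- int m)}"

lemma msize_commute: "msize (A - B) = msize (B - A)"
  by (simp add: msize_def nr_commute)

lemma msize_close: "msize (A - B) \<le> r \<Longrightarrow> msize (B - C) \<le> r \<Longrightarrow> msize (A - C) \<le> r"
  using msize_add_le[of "A - B" r "B - C"] by simp

lemma coset_eq: "msize (g - h) \<le> q powi (- int m) \<Longrightarrow> coset m g = coset m h"
  unfolding coset_def using msize_close msize_commute by (metis (no_types, lifting))

lemma finite_cosets: "finite (coset m ` Omat)"
proof -
  obtain F where F: "finite F" "\<And>x. nr x \<le> 1 \<Longrightarrow> \<exists>f\<in>F. nr (x - f) \<le> q powi (- int m)" using finite_approximation by blast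
  have "coset m ` Omat \<subseteq> (\<lambda>(a, b, c, d). coset m (mm a b c d)) ` (F \<times> F \<times> F \<times> F)"
  proof
    fix C assume "C \<in> coset m ` Omat"
    then obtain g where g: "g \<in> Omat" "C = coset m g" by auto
    obtain a b c d where f: "a \<in> F" "b \<in> F" "c \<in> F" "d \<in> F" "nr (g $ 1 $ 1 - a) \<le> q powi (- int m)"
      "nr (g $ 1 $ 2 - b) \<le> q powi (- int m)" "nr (g $ 2 $ 1 - c) \<le> q powi (- int m)" "nr (g $ 2 $ 2 - d) \<le> q powi (- int m)"
      using F(2) Omat_entry[OF g(1)] by metis
    then have "msize (g - mm a b c d) \<le> q powi (- int m)" by (simp add: msize_def)
    then have "C = coset m (mm a b c d)" using g coset_eq by blast
    then show "C \<in> (\<lambda>(a, b, c, d). coset m (mm a b c d)) ` (F \<times> F \<times> F \<times> F)" using f by force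
  qed
  then show ?thesis using F(1) by (meson finite_SigmaI finite_imageI finite_subset)
qed

lemma coset_measurable: "coset m g \<in> sets \<kappa>"
  unfolding sets_haar
proof (rule relatively_open_measurable)
  show "coset m g \<subseteq> Omat" by (auto simp: coset_def)
  fix A assume A: "A \<in> coset m g"
  show "\<exists>e>0. \<forall>B\<in>Omat. (\<forall>i j. nr (B $ i $ j - A $ i $ j) < e) \<longrightarrow> B \<in> coset m g"
  proof (intro exI[of _ "q powi (- int m)"] conjI ballI impI)
    fix B assume B: "B \<in> Omat" "\<forall>i j. nr (B $ i $ j - A $ i $ j) < q powi (- int m)"
    then have "msize (B - A) \<le> q powi (- int m)" by (simp add: msize_le_iff less_imp_le)
    then show "B \<in> coset m g" using A B msize_close by (auto simp: coset_def)
  qed simp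
qed

lemma msize_mult_left: "g \<in> Omat \<Longrightarrow> msize (g ** A) = msize A"
  and msize_mult_right: "g \<in> Omat \<Longrightarrow> msize (A ** g) = msize A"
proof -
  have le: "msize (x ** A) \<le> msize A" "msize (A ** x) \<le> msize A" if "x \<in> Omat" for x A
  proof -
    have "msize x * msize A \<le> 1 * msize A" "msize A * msize x \<le> msize A * 1"
      using Omat_msize[OF that] by (intro mult_right_mono mult_left_mono; simp)+
    then show "msize (x ** A) \<le> msize A" "msize (A ** x) \<le> msize A"
      using msize_mult[of x A] msize_mult[of A x] by simp_all
  qed
  assume g: "g \<in> Omat"
  then obtain h where h: "h \<in> Omat" "g ** h = mat 1" "h ** g = mat 1" by (rule Omat_inverse)
  have "msize A \<le> msize (g ** A)" using le(1)[OF h(1), of "g ** A"] by (simp add: matrix_mul_assoc h)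
  then show "msize (g ** A) = msize A" using le(1)[OF g, of A] by simp
  have "msize A \<le> msize (A ** g)" using le(2)[OF h(1), of "A ** g"] by (simp add: h flip: matrix_mul_assoc)
  then show "msize (A ** g) = msize A" using le(2)[OF g, of A] by simp
qed

lemma matrix_diff_mult: fixes A B C :: "'d ^ 2 ^ 2" shows "A ** (B - C) = A ** B - A ** C" "(B - C) ** A = B ** A - C ** A"
  by (simp_all add: matrix_2_eq_iff matrix_2_mult_entries algebra_simps)

lemma emeasure_coset: assumes g: "g \<in> Omat" shows "emeasure \<kappa> (coset m g) = emeasure \<kappa> (coset m (mat 1))"
proof -
  obtain h where h: "h \<in> Omat" "g ** h = mat 1" "h ** g = mat 1" using Omat_inverse[OF g] .
  have "coset m g = (\<lambda>x. g ** x) ` coset m (mat 1)"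
  proof (intro equalityI subsetI)
    fix x assume x: "x \<in> coset m g"
    have "msize (h ** x - mat 1) = msize (g ** (h ** x - mat 1))" by (simp add: msize_mult_left g)
    also have "g ** (h ** x - mat 1) = x - g" by (simp add: matrix_diff_mult matrix_mul_assoc h)
    finally have "h ** x \<in> coset m (mat 1)" using x Omat_mult h by (auto simp: coset_def)
    moreover have "x = g ** (h ** x)" by (simp add: matrix_mul_assoc h)
    ultimately show "x \<in> (\<lambda>x. g ** x) ` coset m (mat 1)" by blast
  next
    fix x assume "x \<in> (\<lambda>x. g ** x) ` coset m (mat 1)"
    then obtain y where y: "x = g ** y" "y \<in> coset m (mat 1)" by auto
    have "msize (x - g) = msize (g ** (y - mat 1))" by (simp add: y matrix_diff_mult)
    then show "x \<in> coset m g" using y Omat_mult g by (simp add: coset_def msize_mult_left)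
  qed
  then show ?thesis using haar_left[OF g coset_measurable] by simp
qed

definition level :: "('d ^ 2 ^ 2) set \<Rightarrow> bool" where
  "level S \<longleftrightarrow> S \<subseteq> Omat \<and> (\<exists>m. \<forall>g\<in>S. coset m g \<subseteq> S)"

lemma coset_self: "g \<in> Omat \<Longrightarrow> g \<in> coset m g"
  by (simp add: coset_def msize_def)

lemma level_union:
  assumes "S \<subseteq> Omat" "\<forall>g\<in>S. coset m g \<subseteq> S"
  shows "S \<in> sets \<kappa>" "emeasure \<kappa> S = of_nat (card (coset m ` S)) * emeasure \<kappa> (coset m (mat 1))"
proof -
  have fin: "finite (coset m ` S)" using finite_cosets assms(1) by (meson finite_subset image_mono)
  have un: "S = (\<Union>C\<in>coset m ` S. C)" using assms coset_self by blast
  show "S \<in> sets \<kappa>" by (subst un) (intro sets.finite_UN fin, auto simp: coset_measurable)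
  have "emeasure \<kappa> (\<Union>C\<in>coset m ` S. C) = of_nat (card (coset m ` S)) * emeasure \<kappa> (coset m (mat 1))"
  proof (rule emeasure_equal_partition[OF fin])
    show "disjoint_family_on (\<lambda>C. C) (coset m ` S)"
      unfolding disjoint_family_on_def
    proof (intro ballI impI)
      fix C D assume "C \<in> coset m ` S" "D \<in> coset m ` S" "C \<noteq> D"
      then obtain g h where gh: "C = coset m g" "D = coset m h" by auto
      show "C \<inter> D = {}"
      proof (rule ccontr)
        assume "C \<inter> D \<noteq> {}"
        then obtain x where "msize (x - g) \<le> q powi (- int m)" "msize (x - h) \<le> q powi (- int m)" by (auto simp: gh coset_def)
        then have "coset m x = coset m g" "coset m x = coset m h" using coset_eq by blast+
        then show False using \<open>C \<noteq> D\<close> gh by simp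
      qed
    qed
  qed (use assms emeasure_coset in \<open>auto simp: coset_measurable\<close>)
  then show "emeasure \<kappa> S = of_nat (card (coset m ` S)) * emeasure \<kappa> (coset m (mat 1))" using un by simp
qed

text \<open>On unions of cosets of a congruence subgroup the left Haar measure counts cosets; these
  subgroups are normal, hence right invariance.\<close>

lemma haar_right:
  assumes k: "k \<in> Omat" and S: "level S"
  shows "level {h \<in> Omat. h ** k \<in> S}" "emeasure \<kappa> {h \<in> Omat. h ** k \<in> S} = emeasure \<kappa> S"
proof -
  obtain m where SO: "S \<subseteq> Omat" and m: "\<forall>g\<in>S. coset m g \<subseteq> S" using S by (auto simp: level_def)
  obtain k' where k': "k' \<in> Omat" "k ** k' = mat 1" "k' ** k = mat 1" using Omat_inverse[OF k] .
  define pre where "pre A = {h \<in> Omat. h ** k \<in> A}" for A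
  have pre_coset: "pre (coset m g) = coset m (g ** k')" for g
  proof -
    have "msize (h ** k - g) = msize (h - g ** k')" for h
      using msize_mult_right[OF k, of "h - g ** k'"] k' by (simp add: matrix_diff_mult flip: matrix_mul_assoc)
    then show ?thesis using Omat_mult k by (auto simp: pre_def coset_def)
  qed
  have preS: "pre S = (\<lambda>g. g ** k') ` S"
  proof (intro equalityI subsetI)
    fix h assume "h \<in> pre S"
    moreover have "h = h ** k ** k'" using k' by (simp flip: matrix_mul_assoc)
    ultimately show "h \<in> (\<lambda>g. g ** k') ` S" by (auto simp: pre_def)
  next
    fix h assume "h \<in> (\<lambda>g. g ** k') ` S"
    then obtain g where "g \<in> S" "h = g ** k'" by blast
    then show "h \<in> pre S" using k' SO Omat_mult by (auto simp: pre_def simp flip: matrix_mul_assoc)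
  qed
  have sub: "pre S \<subseteq> Omat" by (auto simp: pre_def)
  have lev: "\<forall>g\<in>pre S. coset m g \<subseteq> pre S"
  proof
    fix g assume "g \<in> pre S"
    then obtain g0 where "g0 \<in> S" "g = g0 ** k'" using preS by blast
    then have "coset m g = pre (coset m g0)" "coset m g0 \<subseteq> S" using pre_coset m by auto
    then show "coset m g \<subseteq> pre S" by (auto simp: pre_def)
  qed
  show "level {h \<in> Omat. h ** k \<in> S}" using sub lev unfolding level_def pre_def[symmetric] by blast
  have img: "coset m ` pre S = pre ` (coset m ` S)"
    unfolding preS by (auto simp: pre_coset image_image)
  have inj: "inj_on pre (coset m ` S)"
  proof (rule inj_onI)
    have back_eq: "C = (\<lambda>h. h ** k) ` pre C" if "C \<subseteq> Omat" for C
    proof (intro equalityI subsetI)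
      fix x assume "x \<in> C"
      moreover have "x = (x ** k') ** k" using k' by (simp flip: matrix_mul_assoc)
      ultimately show "x \<in> (\<lambda>h. h ** k) ` pre C"
        using that k' Omat_mult[of x k'] by (intro image_eqI[of _ _ "x ** k'"]) (auto simp: pre_def)
    qed (auto simp: pre_def)
    fix C D assume "C \<in> coset m ` S" "D \<in> coset m ` S" "pre C = pre D"
    moreover from this have "C \<subseteq> Omat" "D \<subseteq> Omat" by (auto simp: coset_def)
    ultimately show "C = D" using back_eq by metis
  qed
  show "emeasure \<kappa> {h \<in> Omat. h ** k \<in> S} = emeasure \<kappa> S"
    using level_union(2)[OF sub lev] level_union(2)[OF SO m] card_image[OF inj] unfolding img pre_def[symmetric] by simp
qed

lemma level_measurable: "level S \<Longrightarrow> S \<in> sets \<kappa>"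
  using level_union(1) by (auto simp: level_def)

text \<open>Counterpart of \<open>mu_translates\<close> on \<open>K\<close>, with right translations
  in place of the action.\<close>

lemma haar_translates:
  assumes I: "finite I" and S0: "level S0" and g: "\<And>t. t \<in> I \<Longrightarrow> g t \<in> Omat"
    and SX: "S \<subseteq> Omat" and ex1: "\<And>h. h \<in> S \<Longrightarrow> \<exists>!t. t \<in> I \<and> h ** g t \<in> S0"
    and bk: "\<And>h t. h \<in> Omat \<Longrightarrow> t \<in> I \<Longrightarrow> h ** g t \<in> S0 \<Longrightarrow> h \<in> S"
  shows "measure \<kappa> S = real (card I) * measure \<kappa> S0"
proof -
  define f where "f t = {h \<in> Omat. h ** g t \<in> S0}" for t
  have "S = (\<Union>t\<in>I. f t)" using SX ex1 bk by (fastforce simp: f_def)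
  moreover have "disjoint_family_on f I"
    using ex1 bk unfolding disjoint_family_on_def f_def by blast
  ultimately have "emeasure \<kappa> S = of_nat (card I) * emeasure \<kappa> S0"
    using emeasure_equal_partition[OF I, of f \<kappa> "emeasure \<kappa> S0"] level_measurable[OF haar_right(1)[OF g S0]] haar_right(2)[OF g S0]
    by (simp add: f_def)
  then show ?thesis by (simp add: measure_def enn2real_mult)
qed

section \<open>Predicates determined by finitely many digits\<close>

definition lvl :: "('d ^ 2 ^ 2 \<Rightarrow> bool) \<Rightarrow> bool" where
  "lvl P \<longleftrightarrow> (\<exists>m::nat. \<forall>g\<in>Omat. \<forall>h\<in>Omat. msize (h - g) \<le> q powi (- int m) \<longrightarrow> (P g \<longleftrightarrow> P h))"

lemma level_lvl: "lvl P \<Longrightarrow> level {g \<in> Omat. P g}"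
  unfolding lvl_def level_def coset_def by blast

lemma lvl_conj: assumes "lvl P" "lvl Q" shows "lvl (\<lambda>g. P g \<and> Q g)"
proof -
  obtain m n where m: "\<And>g h. g \<in> Omat \<Longrightarrow> h \<in> Omat \<Longrightarrow> msize (h - g) \<le> q powi (- int m) \<Longrightarrow> (P g \<longleftrightarrow> P h)"
    and n: "\<And>g h. g \<in> Omat \<Longrightarrow> h \<in> Omat \<Longrightarrow> msize (h - g) \<le> q powi (- int n) \<Longrightarrow> (Q g \<longleftrightarrow> Q h)"
    using assms unfolding lvl_def by blast
  have le: "q powi (- int (max m n)) \<le> q powi (- int m)" "q powi (- int (max m n)) \<le> q powi (- int n)"
    by (simp_all add: powi_q_le_iff)
  show ?thesis unfolding lvl_def
  proof (intro exI[of _ "max m n"] ballI impI)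
    fix g h assume "g \<in> Omat" "h \<in> Omat" "msize (h - g) \<le> q powi (- int (max m n))"
    then show "P g \<and> Q g \<longleftrightarrow> P h \<and> Q h" using m[of g h] n[of g h] le by linarith
  qed
qed

lemma lvl_not: "lvl P \<Longrightarrow> lvl (\<lambda>g. \<not> P g)"
  unfolding lvl_def by blast

text \<open>On small cosets a Lipschitz function changes by less than \<open>r\<close>, and in an
  ultrametric such a change does not affect a comparison with \<open>r\<close>.\<close>

lemma lvl_nr:
  assumes lip: "\<And>g h. g \<in> Omat \<Longrightarrow> h \<in> Omat \<Longrightarrow> nr (F h - F g) \<le> C * msize (h - g)" and r: "r > 0"
  shows "lvl (\<lambda>g. nr (F g) \<le> r)" "lvl (\<lambda>g. nr (F g) < r)" "lvl (\<lambda>g. nr (F g) = r)"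
proof -
  have "\<exists>n::nat. max C 1 / r < q ^ n" using real_arch_pow[OF q_gt_1] .
  then obtain n where n: "max C 1 / r < q ^ n" ..
  then have n': "max C 1 * q powi (- int n) < r" using r by (simp add: power_int_minus field_simps)
  have close: "nr (F h - F g) < r" if "g \<in> Omat" "h \<in> Omat" "msize (h - g) \<le> q powi (- int n)" for g h
  proof -
    have "nr (F h - F g) \<le> max C 1 * msize (h - g)"
      using lip[OF that(1,2)] by (rule order_trans) (simp add: mult_right_mono)
    also have "\<dots> \<le> max C 1 * q powi (- int n)" using that(3) by (intro mult_left_mono) auto
    finally show ?thesis using n' by simp
  qed
  have "nr x \<le> r \<longleftrightarrow> nr y \<le> r" "nr x < r \<longleftrightarrow> nr y < r" if "nr (x - y) < r" for x y
    using nr_ultra[of "x - y" y] nr_ultra[of "y - x" x] that by (auto simp: nr_commute)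
  then have eqv: "(nr (F g) \<le> r \<longleftrightarrow> nr (F h) \<le> r) \<and> (nr (F g) < r \<longleftrightarrow> nr (F h) < r)"
    if "g \<in> Omat" "h \<in> Omat" "msize (h - g) \<le> q powi (- int n)" for g h
    using close[OF that] by blast
  show 1: "lvl (\<lambda>g. nr (F g) \<le> r)"
    unfolding lvl_def by (rule exI[of _ n]) (use eqv in blast)
  show 2: "lvl (\<lambda>g. nr (F g) < r)"
    unfolding lvl_def by (rule exI[of _ n]) (use eqv in blast)
  have "lvl (\<lambda>g. nr (F g) \<le> r \<and> \<not> nr (F g) < r)" by (intro lvl_conj lvl_not 1 2)
  moreover have "(\<lambda>g. nr (F g) = r) = (\<lambda>g. nr (F g) \<le> r \<and> \<not> nr (F g) < r)" by (intro ext) auto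
  ultimately show "lvl (\<lambda>g. nr (F g) = r)" by (simp only:)
qed

lemma entry_lipschitz: "nr (h $ i $ j - g $ i $ j) \<le> 1 * msize (h - g)"
  using nr_entry_le[of "h - g" i j] by simp

text \<open>The difference splits into two terms, each with one factor \<open>h - g\<close> or its
  adjoint; the factors from \<open>K\<close> do not increase the size.\<close>

lemma act_lipschitz:
  assumes "g \<in> Omat" "h \<in> Omat"
  shows "nr (act star h x $ 1 $ 1 - act star g x $ 1 $ 1) \<le> msize x * msize (h - g)"
proof -
  have eq: "act star h x - act star g x = (h - g) ** x ** adj star h + g ** x ** adj star (h - g)"
    by (simp add: act_def adj_def matrix_2_eq_iff matrix_2_mult_entries star_diff algebra_simps)
  have 1: "msize ((h - g) ** x ** adj star h) \<le> msize (h - g) * msize x"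
  proof -
    have "msize ((h - g) ** x ** adj star h) \<le> msize ((h - g) ** x) * msize h"
      using msize_mult[of "(h - g) ** x" "adj star h"] by simp
    also have "\<dots> \<le> msize ((h - g) ** x) * 1" using Omat_msize[OF assms(2)] by (intro mult_left_mono) auto
    finally show ?thesis using msize_mult[of "h - g" x] by simp
  qed
  have 2: "msize (g ** x ** adj star (h - g)) \<le> msize x * msize (h - g)"
  proof -
    have "msize (g ** (x ** adj star (h - g))) = msize (x ** adj star (h - g))" by (rule msize_mult_left[OF assms(1)])
    then show ?thesis using msize_mult[of x "adj star (h - g)"] by (simp add: matrix_mul_assoc)
  qed
  have "msize (act star h x - act star g x) \<le> msize x * msize (h - g)"
    unfolding eq using 1 2 by (intro msize_add_le) (auto simp: mult.commute)
  then show ?thesis using nr_entry_le[of "act star h x - act star g x" 1 1] by simp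
qed

section \<open>Distribution of the top row\<close>

definition primitive :: "'d \<Rightarrow> 'd \<Rightarrow> bool" where
  "primitive v w \<longleftrightarrow> nr v \<le> 1 \<and> nr w \<le> 1 \<and> (nr v = 1 \<or> nr w = 1)"

text \<open>Otherwise the upper left entry of the product with the inverse matrix would be a nonunit
  instead of 1.\<close>

lemma row_primitive: assumes "g \<in> Omat" shows "primitive (g $ 1 $ 1) (g $ 1 $ 2)"
proof -
  obtain h where h: "h \<in> Omat" "g ** h = mat 1" using Omat_inverse[OF assms] by blast
  have eq: "g $ 1 $ 1 * h $ 1 $ 1 + g $ 1 $ 2 * h $ 2 $ 1 = 1"
    using arg_cong[OF h(2), of "\<lambda>A. A $ 1 $ 1"] by (simp add: matrix_2_mult_entries mat_2_entries)
  have "nr (g $ 1 $ 1) = 1 \<or> nr (g $ 1 $ 2) = 1"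
  proof (rule ccontr)
    assume "\<not> ?thesis"
    then have lt: "nr (g $ 1 $ 1) < 1" "nr (g $ 1 $ 2) < 1" using Omat_entry[OF assms] by (simp_all add: less_le)
    have "nr (g $ 1 $ i * h $ i $ 1) < 1" if "nr (g $ 1 $ i) < 1" for i
    proof -
      have "nr (g $ 1 $ i) * nr (h $ i $ 1) \<le> nr (g $ 1 $ i) * 1" using Omat_entry[OF h(1)] by (intro mult_left_mono) auto
      then show ?thesis using that by (simp add: nr_mult)
    qed
    from nr_add_less[OF this[OF lt(1)] this[OF lt(2)]] show False by (simp add: eq)
  qed
  then show ?thesis using Omat_entry[OF assms] by (simp add: primitive_def)
qed

definition row_prob :: "('d \<Rightarrow> 'd \<Rightarrow> bool) \<Rightarrow> real" where
  "row_prob Q = measure \<kappa> {g \<in> Omat. Q (g $ 1 $ 1) (g $ 1 $ 2)}"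

text \<open>Right multiplication acts linearly on the top row, so relations between distributions of
  rows reduce to statements about primitive pairs.\<close>

lemma row_translates:
  assumes I: "finite I" and Q0: "lvl (\<lambda>g. Q0 (g $ 1 $ 1) (g $ 1 $ 2))" and g: "\<And>t. t \<in> I \<Longrightarrow> mm (a t) (b t) (c t) (d t) \<in> Omat"
    and ex1: "\<And>v w. primitive v w \<Longrightarrow> Q v w \<Longrightarrow> \<exists>!t. t \<in> I \<and> Q0 (v * a t + w * c t) (v * b t + w * d t)"
    and bk: "\<And>v w t. primitive v w \<Longrightarrow> t \<in> I \<Longrightarrow> Q0 (v * a t + w * c t) (v * b t + w * d t) \<Longrightarrow> Q v w"
  shows "row_prob Q = real (card I) * row_prob Q0"
  unfolding row_prob_def
proof (rule haar_translates[OF I level_lvl[OF Q0] g])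
  have mem: "h ** mm (a t) (b t) (c t) (d t) \<in> {g \<in> Omat. Q0 (g $ 1 $ 1) (g $ 1 $ 2)} \<longleftrightarrow>
      Q0 (h $ 1 $ 1 * a t + h $ 1 $ 2 * c t) (h $ 1 $ 1 * b t + h $ 1 $ 2 * d t)" if "h \<in> Omat" "t \<in> I" for h t
    using Omat_mult[OF that(1) g[OF that(2)]] by (simp add: matrix_2_mult_entries)
  show "\<exists>!t. t \<in> I \<and> h ** mm (a t) (b t) (c t) (d t) \<in> {g \<in> Omat. Q0 (g $ 1 $ 1) (g $ 1 $ 2)}"
    if "h \<in> {g \<in> Omat. Q (g $ 1 $ 1) (g $ 1 $ 2)}" for h
  proof -
    have h: "h \<in> Omat" "Q (h $ 1 $ 1) (h $ 1 $ 2)" using that by auto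
    show ?thesis using ex1[OF row_primitive[OF h(1)] h(2)] mem[OF h(1)] by (metis (no_types, lifting))
  qed
  show "h \<in> {g \<in> Omat. Q (g $ 1 $ 1) (g $ 1 $ 2)}"
    if "h \<in> Omat" "t \<in> I" "h ** mm (a t) (b t) (c t) (d t) \<in> {g \<in> Omat. Q0 (g $ 1 $ 1) (g $ 1 $ 2)}" for h t
    using bk[OF row_primitive[OF that(1)] that(2)] mem[OF that(1,2)] that by simp
qed auto

lemma row_prob_cong: "(\<And>v w. primitive v w \<Longrightarrow> P v w \<longleftrightarrow> Q v w) \<Longrightarrow> row_prob P = row_prob Q"
  unfolding row_prob_def using row_primitive by (metis (no_types, lifting) Collect_cong)

lemma row_prob_total: "row_prob (\<lambda>_ _. True) = 1"
  using haar_total by (simp add: row_prob_def measure_def)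

lemma row_prob_split:
  assumes "lvl (\<lambda>g. P (g $ 1 $ 1) (g $ 1 $ 2))" "lvl (\<lambda>g. Q (g $ 1 $ 1) (g $ 1 $ 2))"
    "\<And>v w. primitive v w \<Longrightarrow> R v w \<longleftrightarrow> P v w \<or> Q v w" "\<And>v w. primitive v w \<Longrightarrow> P v w \<Longrightarrow> \<not> Q v w"
  shows "row_prob R = row_prob P + row_prob Q"
proof -
  interpret finite_measure \<kappa> by (rule finite_measure_haar)
  have "{g \<in> Omat. R (g $ 1 $ 1) (g $ 1 $ 2)} = {g \<in> Omat. P (g $ 1 $ 1) (g $ 1 $ 2)} \<union> {g \<in> Omat. Q (g $ 1 $ 1) (g $ 1 $ 2)}"
    using assms(3) row_primitive by blast
  moreover have "{g \<in> Omat. P (g $ 1 $ 1) (g $ 1 $ 2)} \<inter> {g \<in> Omat. Q (g $ 1 $ 1) (g $ 1 $ 2)} = {}"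
    using assms(4) row_primitive by blast
  ultimately show ?thesis unfolding row_prob_def
    by (simp add: finite_measure_Union level_measurable[OF level_lvl] assms(1,2))
qed

lemma lvl_fst: "r > 0 \<Longrightarrow> lvl (\<lambda>g. nr (g $ 1 $ 1) \<le> r)" "r > 0 \<Longrightarrow> lvl (\<lambda>g. nr (g $ 1 $ 1) < r)" "r > 0 \<Longrightarrow> lvl (\<lambda>g. nr (g $ 1 $ 1) = r)"
  and lvl_snd: "r > 0 \<Longrightarrow> lvl (\<lambda>g. nr (g $ 1 $ 2) \<le> r)" "r > 0 \<Longrightarrow> lvl (\<lambda>g. nr (g $ 1 $ 2) < r)" "r > 0 \<Longrightarrow> lvl (\<lambda>g. nr (g $ 1 $ 2) = r)"
  using lvl_nr[of "\<lambda>g. g $ 1 $ 1", OF entry_lipschitz] lvl_nr[of "\<lambda>g. g $ 1 $ 2", OF entry_lipschitz] by blast+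

definition unit_tail :: "nat \<Rightarrow> real" where
  "unit_tail j = row_prob (\<lambda>v w. nr v \<le> q powi (- int j) \<and> nr w = 1)"

lemma lvl_unit_tail: "lvl (\<lambda>g. nr (g $ 1 $ 1) \<le> q powi (- int j) \<and> nr (g $ 1 $ 2) = 1)"
  by (intro lvl_conj lvl_fst lvl_snd) auto

text \<open>Adding \<open>w * (t * qj ^ j)\<close> to \<open>v\<close> changes the digit of order
  \<open>j\<close>; since \<open>w\<close> is a unit, exactly one of the \<open>q\<^sup>2\<close>
  residues \<open>t\<close> removes that digit.\<close>

lemma unit_tail_Suc: "unit_tail j = q\<^sup>2 * unit_tail (Suc j)"
proof -
  have "unit_tail j = real (card resysD) * unit_tail (Suc j)"
    unfolding unit_tail_def
  proof (rule row_translates[where a = "\<lambda>t. 1" and b = "\<lambda>t. 0" and c = "\<lambda>t. t * qj ^ j" and d = "\<lambda>t. 1", OF finite_resysD lvl_unit_tail[of "Suc j"]])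
    have njj: "nr (qj ^ j) = q powi (- int j)" by (simp add: nr_power power_int_minus power_one_over inverse_eq_divide)
    have nc: "nr (t * qj ^ j) \<le> 1" if "t \<in> resysD" for t
    proof -
      have "q powi (- int j) \<le> q powi 0" unfolding powi_q_le_iff by simp
      then have "q powi (- int j) \<le> 1" by simp
      then show ?thesis using resysD_integral[OF that] by (simp only: nr_mult njj) (rule mult_le_one, auto)
    qed
    show "mm 1 0 (t * qj ^ j) 1 \<in> Omat" if "t \<in> resysD" for t using Omat_lower nc[OF that] .
    fix v w assume "nr v \<le> q powi (- int j) \<and> nr w = 1"
    then have v: "nr v \<le> q powi (- int j)" and w: "nr w = 1" "w \<noteq> 0" by auto
    define x where "x = - (inverse w * v * inverse (qj ^ j))"
    have "nr x = nr v / q powi (- int j)" using w by (simp add: x_def nr_mult nr_inverse njj divide_inverse del: powi_q_pos)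
    then have "nr x \<le> 1" using v by (simp only: divide_le_eq_1_pos[OF powi_q_pos])
    moreover have "nr (v * 1 + w * (t * qj ^ j)) \<le> q powi (- int (Suc j)) \<longleftrightarrow> nr (x - t) < 1" for t
    proof -
      have "v * 1 + w * (t * qj ^ j) = - (w * (x - t) * qj ^ j)"
      proof -
        have "w * x * qj ^ j = - v" using w by (simp add: x_def mult.assoc) (simp flip: mult.assoc)
        then show ?thesis by (simp add: right_diff_distrib left_diff_distrib mult.assoc)
      qed
      then have n: "nr (v * 1 + w * (t * qj ^ j)) = nr (x - t) * q powi (- int j)" using w by (simp only: nr_minus nr_mult njj)
      show ?thesis unfolding n nr_less_1_iff q_powi_Suc by (simp only: mult_le_cancel_right_pos[OF powi_q_pos])
    qed
    ultimately show "\<exists>!t. t \<in> resysD \<and> nr (v * 1 + w * (t * qj ^ j)) \<le> q powi (- int (Suc j)) \<and> nr (v * 0 + w * 1) = 1"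
      using resysD_ex1[of x] w by simp
  next
    fix v w t assume t: "t \<in> resysD" and *: "nr (v * 1 + w * (t * qj ^ j)) \<le> q powi (- int (Suc j)) \<and> nr (v * 0 + w * 1) = 1"
    have njj: "nr (qj ^ j) = q powi (- int j)" by (simp add: nr_power power_int_minus power_one_over inverse_eq_divide)
    have "nr (w * (t * qj ^ j)) \<le> q powi (- int j)"
      using * resysD_integral[OF t] mult_right_mono[of "nr t" 1 "q powi (- int j)"] by (simp add: nr_mult njj)
    moreover have "q powi (- int (Suc j)) \<le> q powi (- int j)" unfolding powi_q_le_iff by simp
    ultimately have "nr ((v * 1 + w * (t * qj ^ j)) - w * (t * qj ^ j)) \<le> q powi (- int j)"
      using * by (intro nr_diff_le) linarith+
    then show "nr v \<le> q powi (- int j) \<and> nr w = 1" using * by simp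
  qed
  then show ?thesis by (simp add: card_resysD)
qed

lemma nr_le_inv_q_iff: "nr x \<le> q powi (- 1) \<longleftrightarrow> nr x < 1"
  using nr_less_iff[of x 0] by simp

text \<open>Exchanging the columns shows that \<open>w\<close> is a nonunit with probability
  \<open>unit_tail 1\<close>, hence \<open>unit_tail 0 + unit_tail 1 = 1\<close>. This reflects the
  equidistribution of the row over the \<open>q\<^sup>2 + 1\<close> points of a projective
  line.\<close>

lemma unit_tail_eq: "unit_tail j = q\<^sup>2 / (q\<^sup>2) ^ j / (q\<^sup>2 + 1)"
proof -
  have swap: "row_prob (\<lambda>v w. nr w < 1) = real (card {()}) * row_prob (\<lambda>v w. nr v < 1)"
    by (rule row_translates[where a = "\<lambda>t. 0" and b = "\<lambda>t. 1" and c = "\<lambda>t. 1" and d = "\<lambda>t. 0"])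
      (auto simp: lvl_fst Omat_swap)
  have "row_prob (\<lambda>v w. nr v < 1) = unit_tail 1"
    unfolding unit_tail_def of_nat_1 nr_le_inv_q_iff by (rule row_prob_cong) (auto simp: primitive_def)
  moreover have "unit_tail 0 = row_prob (\<lambda>v w. nr w = 1)"
    unfolding unit_tail_def by (rule row_prob_cong) (auto simp: primitive_def)
  moreover have "row_prob (\<lambda>_ _. True) = row_prob (\<lambda>v w. nr w = 1) + row_prob (\<lambda>v w. nr w < 1)"
    by (rule row_prob_split) (auto simp: lvl_snd primitive_def)
  ultimately have "1 = unit_tail 0 + unit_tail 1" using swap row_prob_total by simp
  then have 1: "(q\<^sup>2 + 1) * unit_tail 1 = 1" using unit_tail_Suc[of 0] by (simp add: algebra_simps)
  have pos: "q\<^sup>2 + 1 > 0" by (simp add: add_pos_pos)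
  have z: "unit_tail 0 = q\<^sup>2 / (q\<^sup>2 + 1)" using 1 unit_tail_Suc[of 0] pos by (simp add: field_simps)
  show ?thesis
  proof (induction j)
    case 0 then show ?case using z by simp
  next
    case (Suc j)
    have "q\<^sup>2 * unit_tail (Suc j) = q\<^sup>2 * (q\<^sup>2 / (q\<^sup>2) ^ Suc j / (q\<^sup>2 + 1))" using Suc unit_tail_Suc[of j] by simp
    then show ?case using mult_left_cancel[of "q\<^sup>2"] by (metis power_not_zero q_pos(2))
  qed
qed

section \<open>Distribution of the upper left entry on an orbit\<close>

definition diag_form :: "nat \<Rightarrow> 'd \<Rightarrow> 'd \<Rightarrow> 'k" where
  "diag_form \<delta> v w = nm v + \<pi> ^ \<delta> * nm w"

definition hyp_form :: "'d \<Rightarrow> 'd \<Rightarrow> 'k" where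
  "hyp_form v w = tr (v * qj * star w)"

lemma av_pi_power: "av (\<pi> ^ n) = q powi (- int n)"
  using av_pi_powi[of "int n"] by simp

lemma lvl_av_act:
  assumes x: "adj star x = x" and f: "\<And>g. g \<in> Omat \<Longrightarrow> act star g x $ 1 $ 1 = \<iota> (f g)" and r: "r > 0"
  shows "lvl (\<lambda>g. av (f g) \<le> r)"
proof -
  have "lvl (\<lambda>g. nr (act star g x $ 1 $ 1) \<le> r\<^sup>2)"
    by (rule lvl_nr(1)[of _ "msize x"]) (use act_lipschitz r in auto)
  moreover have "nr (act star g x $ 1 $ 1) \<le> r\<^sup>2 \<longleftrightarrow> av (f g) \<le> r" if "g \<in> Omat" for g
    using r by (simp add: f[OF that] nr_iota)
  ultimately show ?thesis unfolding lvl_def by metis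
qed

lemma act_top: "act star g (hm a b d) $ 1 $ 1 = \<iota> (a * nm (g $ 1 $ 1) + d * nm (g $ 1 $ 2) + tr (g $ 1 $ 1 * b * star (g $ 1 $ 2)))"
proof -
  have "g = mm (g $ 1 $ 1) (g $ 1 $ 2) (g $ 2 $ 1) (g $ 2 $ 2)" by (simp add: matrix_2_eq_iff)
  then show ?thesis by (metis act_mm_hm hm_entries(1))
qed

lemma lvl_diag_form: "r > 0 \<Longrightarrow> lvl (\<lambda>g. av (diag_form \<delta> (g $ 1 $ 1) (g $ 1 $ 2)) \<le> r)"
  by (rule lvl_av_act[of "hm 1 0 (\<pi> ^ \<delta>)"]) (auto simp: act_top diag_form_def)

lemma lvl_hyp_form: "r > 0 \<Longrightarrow> lvl (\<lambda>g. av (hyp_form (g $ 1 $ 1) (g $ 1 $ 2)) \<le> r)"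
  by (rule lvl_av_act[of "hm 0 qj 0"]) (auto simp: act_top hyp_form_def)

definition diag_tail :: "nat \<Rightarrow> nat \<Rightarrow> real" where
  "diag_tail \<delta> i = row_prob (\<lambda>v w. av (diag_form \<delta> v w) \<le> q powi (- int i))"

lemma diag_tail_0: "diag_tail \<delta> 0 = 1"
proof -
  have "diag_tail \<delta> 0 = row_prob (\<lambda>_ _. True)"
    unfolding diag_tail_def
  proof (rule row_prob_cong)
    fix v w assume "primitive v w"
    then have "av (nm v) \<le> 1" "av (nm w) \<le> 1" by (auto simp: primitive_def nr_def)
    moreover have "av (\<pi> ^ \<delta>) \<le> 1" unfolding av_pi_power using powi_q_le_iff[of "- int \<delta>" 0] by simp
    ultimately have "av (diag_form \<delta> v w) \<le> 1"
      using av_ultra[of "nm v" "\<pi> ^ \<delta> * nm w"] mult_le_one[of "av (\<pi> ^ \<delta>)" "av (nm w)"] by (simp add: diag_form_def av_mult)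
    then show "av (diag_form \<delta> v w) \<le> q powi (- int 0) \<longleftrightarrow> True" by simp
  qed
  then show ?thesis by (simp add: row_prob_total)
qed

text \<open>The summand with \<open>\<pi> ^ \<delta>\<close> is too small to matter, so the
  condition concerns \<open>v\<close> only; as \<open>i\<close> is positive, \<open>v\<close> is
  then a nonunit and \<open>w\<close> a unit.\<close>

lemma diag_tail_le:
  assumes "1 \<le> i" "i \<le> \<delta>" shows "diag_tail \<delta> i = unit_tail i"
  unfolding diag_tail_def unit_tail_def
proof (rule row_prob_cong)
  fix v w assume p: "primitive v w"
  have "av (\<pi> ^ \<delta> * nm w) \<le> q powi (- int \<delta>) * 1"
    unfolding av_mult av_pi_power using p by (intro mult_left_mono) (auto simp: primitive_def nr_def)
  also have "\<dots> \<le> q powi (- int i)" using assms by (simp add: powi_q_le_iff)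
  finally have le: "av (\<pi> ^ \<delta> * nm w) \<le> q powi (- int i)" .
  then have "av (diag_form \<delta> v w) \<le> q powi (- int i) \<longleftrightarrow> nr v \<le> q powi (- int i)"
    using av_ultra[of "nm v" "\<pi> ^ \<delta> * nm w"] av_diff[of "nm v + \<pi> ^ \<delta> * nm w" "\<pi> ^ \<delta> * nm w"]
    by (auto simp: diag_form_def nr_def)
  moreover have "nr w = 1" if "nr v \<le> q powi (- int i)"
  proof -
    have "q powi (- int i) < q powi 0" unfolding powi_q_less_iff using assms by simp
    then have "nr v < 1" using that by simp
    then show ?thesis using p by (simp add: primitive_def)
  qed
  ultimately show "av (diag_form \<delta> v w) \<le> q powi (- int i) \<longleftrightarrow> nr v \<le> q powi (- int i) \<and> nr w = 1" by blast
qed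

text \<open>An order beyond \<open>\<delta>\<close> requires cancellation between the two summands,
  so both have order exactly \<open>\<delta>\<close>.\<close>

lemma diag_form_small:
  assumes p: "primitive v w" and i: "i \<ge> 1" and s: "av (diag_form \<delta> v w) \<le> q powi (- int (\<delta> + i))"
  shows "nr w = 1" "nr v = q powi (- int \<delta>)"
proof -
  have lt: "av (diag_form \<delta> v w) < q powi (- int \<delta>)"
    using s powi_q_less_iff[of "- int (\<delta> + i)" "- int \<delta>"] i by linarith
  show w: "nr w = 1"
  proof (rule ccontr)
    assume "nr w \<noteq> 1"
    then have nw: "nr w < 1" and nv: "av (nm v) = 1" using p by (auto simp: primitive_def nr_def)
    have "av (\<pi> ^ \<delta> * nm w) < q powi (- int \<delta>) * 1"
      unfolding av_mult av_pi_power using nw by (intro mult_strict_left_mono) (auto simp: nr_def)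
    then have l: "av (\<pi> ^ \<delta> * nm w) < q powi (- int \<delta>)" by simp
    have "av (nm v) < q powi (- int \<delta>)"
      using av_diff[of "diag_form \<delta> v w" "\<pi> ^ \<delta> * nm w"] lt l by (simp add: diag_form_def)
    moreover have "q powi (- int \<delta>) \<le> q powi 0" unfolding powi_q_le_iff by simp
    ultimately show False using nv by simp
  qed
  have "av (- (\<pi> ^ \<delta> * nm w)) = q powi (- int \<delta>)" using w by (simp add: av_mult av_pi_power nr_def)
  moreover have "av (nm v - (- (\<pi> ^ \<delta> * nm w))) < q powi (- int \<delta>)" using lt by (simp add: diag_form_def)
  ultimately show "nr v = q powi (- int \<delta>)" using av_close_eq unfolding nr_def by metis
qed

text \<open>Multiplying \<open>w\<close> by elements of norm \<open>s\<close> scales the second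
  summand by all nonzero residues, and exactly one of them cancels the leading digit of
  \<open>nm v\<close>.\<close>

lemma diag_tail_Suc: "(q - 1) * diag_tail \<delta> (Suc \<delta>) = unit_tail \<delta> - unit_tail (Suc \<delta>)"
proof -
  define C where "C v w \<longleftrightarrow> nr v = q powi (- int \<delta>) \<and> nr w = 1" for v w
  have "unit_tail \<delta> = row_prob C + unit_tail (Suc \<delta>)"
    unfolding unit_tail_def
  proof (rule row_prob_split)
    show "lvl (\<lambda>g. C (g $ 1 $ 1) (g $ 1 $ 2))" unfolding C_def by (intro lvl_conj lvl_fst lvl_snd) auto
    fix v w
    have "nr v \<le> q powi (- int \<delta>) \<longleftrightarrow> nr v = q powi (- int \<delta>) \<or> nr v < q powi (- int \<delta>)" by auto
    also have "nr v < q powi (- int \<delta>) \<longleftrightarrow> nr v \<le> q powi (- int (Suc \<delta>))" 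
    proof -
      have "- int \<delta> - 1 = - int (Suc \<delta>)" by simp
      then show ?thesis using nr_less_iff[of v "- int \<delta>"] by (simp only:)
    qed
    finally show "nr v \<le> q powi (- int \<delta>) \<and> nr w = 1 \<longleftrightarrow> C v w \<or> nr v \<le> q powi (- int (Suc \<delta>)) \<and> nr w = 1"
      by (auto simp: C_def)
    have "q powi (- int (Suc \<delta>)) < q powi (- int \<delta>)" unfolding powi_q_less_iff by simp
    then show "\<not> (nr v \<le> q powi (- int (Suc \<delta>)) \<and> nr w = 1)" if "C v w" using that by (auto simp: C_def)
  qed (rule lvl_unit_tail)
  moreover have "row_prob C = real (card (resys - {0})) * diag_tail \<delta> (Suc \<delta>)"
  proof -
    have "\<exists>c. nm c = s \<and> nr c = 1" if "s \<in> resys - {0}" for s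
      using nm_unit_surj[of s] resys_unit that by auto
    then obtain c where c: "\<And>s. s \<in> resys - {0} \<Longrightarrow> nm (c s) = s \<and> nr (c s) = 1" by metis
    have df: "diag_form \<delta> (v * 1 + w * 0) (v * 0 + w * c s) = nm v + \<pi> ^ \<delta> * nm w * s" if "s \<in> resys - {0}" for v w s
      using c[OF that] by (simp add: diag_form_def nm_mult)
    have scaled: "av (nm v + \<pi> ^ \<delta> * nm w * s) \<le> q powi (- int (Suc \<delta>)) \<longleftrightarrow> av (- (nm v / (\<pi> ^ \<delta> * nm w)) - s) < 1"
      if w: "nr w = 1" for v w s
    proof -
      have "\<pi> ^ \<delta> * nm w \<noteq> 0" using w by (auto simp: nr_def)
      then have "nm v + \<pi> ^ \<delta> * nm w * s = - ((\<pi> ^ \<delta> * nm w) * (- (nm v / (\<pi> ^ \<delta> * nm w)) - s))"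
        by (simp add: right_diff_distrib)
      then have "av (nm v + \<pi> ^ \<delta> * nm w * s) = av (- (nm v / (\<pi> ^ \<delta> * nm w)) - s) * q powi (- int \<delta>)"
        using w by (simp only: av_minus av_mult av_pi_power nr_def) simp
      then show ?thesis
        unfolding q_powi_Suc by (simp only: mult_le_cancel_right_pos[OF powi_q_pos] nr_def)
          (use av_less_1_imp q_gt_1 in \<open>auto intro: le_less_trans\<close>)
    qed
    show ?thesis unfolding diag_tail_def
    proof (rule row_translates[where a = "\<lambda>s. 1" and b = "\<lambda>s. 0" and c = "\<lambda>s. 0" and d = c])
      show "mm 1 0 0 (c s) \<in> Omat" if "s \<in> resys - {0}" for s using c[OF that] by (intro Omat_diag) auto
      show "lvl (\<lambda>g. av (diag_form \<delta> (g $ 1 $ 1) (g $ 1 $ 2)) \<le> q powi (- int (Suc \<delta>)))" by (rule lvl_diag_form) simp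
      show "finite (resys - {0})" using finite_resys by simp
    next
      fix v w assume "C v w"
      then have vw: "nr v = q powi (- int \<delta>)" "nr w = 1" by (auto simp: C_def)
      define x where "x = - (nm v / (\<pi> ^ \<delta> * nm w))"
      have x: "av x = 1" using vw by (simp add: x_def av_divide av_mult av_pi_power nr_def)
      obtain s where s: "s \<in> resys" "av (x - s) < 1" "\<And>s'. s' \<in> resys \<Longrightarrow> av (x - s') < 1 \<Longrightarrow> s' = s"
        using resys_ex1[of x] x by auto
      have "s \<noteq> 0"
      proof
        assume "s = 0" then show False using s(2) x by simp
      qed
      show "\<exists>!s. s \<in> resys - {0} \<and> av (diag_form \<delta> (v * 1 + w * 0) (v * 0 + w * c s)) \<le> q powi (- int (Suc \<delta>))"
      proof (rule ex1I[of _ s])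
        show "s \<in> resys - {0} \<and> av (diag_form \<delta> (v * 1 + w * 0) (v * 0 + w * c s)) \<le> q powi (- int (Suc \<delta>))"
          using s(1,2) \<open>s \<noteq> 0\<close> df[of s v w] scaled[OF vw(2), of v s] by (simp add: x_def)
        fix s' assume "s' \<in> resys - {0} \<and> av (diag_form \<delta> (v * 1 + w * 0) (v * 0 + w * c s')) \<le> q powi (- int (Suc \<delta>))"
        then show "s' = s" using s(3)[of s'] df[of s' v w] scaled[OF vw(2), of v s'] by (simp add: x_def)
      qed
    next
      fix v w s assume p: "primitive v w" and s: "s \<in> resys - {0}"
        and *: "av (diag_form \<delta> (v * 1 + w * 0) (v * 0 + w * c s)) \<le> q powi (- int (Suc \<delta>))"
      have "primitive v (w * c s)" using p c[OF s] by (simp add: primitive_def nr_mult)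
      from diag_form_small[OF this, of 1 \<delta>] show "C v w" using * c[OF s] by (simp add: C_def nr_mult)
    qed
  qed
  ultimately show ?thesis by (simp add: card_resys_nonzero)
qed

text \<open>Multiplying \<open>w\<close> by a square root of \<open>1 + s * \<pi> ^ i\<close> shifts
  the form by \<open>\<pi> ^ (\<delta> + i) * nm w * s\<close>, so the next digit is
  equidistributed.\<close>

lemma diag_tail_geometric: "diag_tail \<delta> (\<delta> + Suc i) = diag_tail \<delta> (Suc \<delta>) / q ^ i"
proof -
  have step: "diag_tail \<delta> (\<delta> + i) = q * diag_tail \<delta> (Suc (\<delta> + i))" if i: "i \<ge> 1" for i
  proof -
    have "\<exists>z. z\<^sup>2 = 1 + s * \<pi> ^ i \<and> av z = 1" if "s \<in> resys" for s
    proof -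
      have "q powi (- int i) < q powi 0" unfolding powi_q_less_iff using i by simp
      moreover have "av (s * \<pi> ^ i) \<le> 1 * q powi (- int i)"
        unfolding av_mult av_pi_power by (intro mult_right_mono) (use resys_integral[OF that] in auto)
      ultimately have "av (s * \<pi> ^ i) < 1" by simp
      then show ?thesis using sqrt_one_plus by metis
    qed
    then obtain z where z: "\<And>s. s \<in> resys \<Longrightarrow> (z s)\<^sup>2 = 1 + s * \<pi> ^ i \<and> av (z s) = 1" by metis
    have df: "diag_form \<delta> (v * 1 + w * 0) (v * 0 + w * \<iota> (z s)) = diag_form \<delta> v w + \<pi> ^ (\<delta> + i) * nm w * s" if "s \<in> resys" for v w s
      using z[OF that] by (simp add: diag_form_def nm_mult power_add algebra_simps)
    have "diag_tail \<delta> (\<delta> + i) = real (card resys) * diag_tail \<delta> (Suc (\<delta> + i))"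
      unfolding diag_tail_def
    proof (rule row_translates[where a = "\<lambda>s. 1" and b = "\<lambda>s. 0" and c = "\<lambda>s. 0" and d = "\<lambda>s. \<iota> (z s)", OF finite_resys])
      show "mm 1 0 0 (\<iota> (z s)) \<in> Omat" if "s \<in> resys" for s using z[OF that] by (intro Omat_diag) (auto simp: nr_iota)
      show "lvl (\<lambda>g. av (diag_form \<delta> (g $ 1 $ 1) (g $ 1 $ 2)) \<le> q powi (- int (Suc (\<delta> + i))))" by (rule lvl_diag_form) simp
    next
      fix v w assume p: "primitive v w" and s: "av (diag_form \<delta> v w) \<le> q powi (- int (\<delta> + i))"
      have w: "nr w = 1" using diag_form_small[OF p i s] by simp
      define x where "x = - (diag_form \<delta> v w / (\<pi> ^ (\<delta> + i) * nm w))"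
      have nz: "\<pi> ^ (\<delta> + i) * nm w \<noteq> 0" using w by (auto simp: nr_def)
      have avd: "av (\<pi> ^ (\<delta> + i) * nm w) = q powi (- int (\<delta> + i))" using w by (simp add: av_mult av_pi_power nr_def)
      have "av x \<le> 1" unfolding x_def av_minus av_divide avd using s by (simp only: divide_le_eq_1_pos[OF powi_q_pos])
      moreover have "av (diag_form \<delta> (v * 1 + w * 0) (v * 0 + w * \<iota> (z s))) \<le> q powi (- int (Suc (\<delta> + i))) \<longleftrightarrow> av (x - s) < 1"
        if "s \<in> resys" for s
      proof -
        have "diag_form \<delta> v w + \<pi> ^ (\<delta> + i) * nm w * s = - ((\<pi> ^ (\<delta> + i) * nm w) * (x - s))"
          using nz by (simp add: x_def right_diff_distrib)
        then have "av (diag_form \<delta> (v * 1 + w * 0) (v * 0 + w * \<iota> (z s))) = av (- ((\<pi> ^ (\<delta> + i) * nm w) * (x - s)))"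
          by (simp only: df[OF that])
        also have "\<dots> = av (x - s) * q powi (- int (\<delta> + i))"
          unfolding av_minus av_mult[of "\<pi> ^ (\<delta> + i) * nm w"] avd by (rule mult.commute)
        finally show ?thesis
          unfolding q_powi_Suc by (simp only: mult_le_cancel_right_pos[OF powi_q_pos])
            (use av_less_1_imp q_gt_1 in \<open>auto intro: le_less_trans\<close>)
      qed
      ultimately show "\<exists>!s. s \<in> resys \<and> av (diag_form \<delta> (v * 1 + w * 0) (v * 0 + w * \<iota> (z s))) \<le> q powi (- int (Suc (\<delta> + i)))"
        using resys_ex1[of x] by (metis (no_types, lifting))
    next
      fix v w s assume p: "primitive v w" and s: "s \<in> resys"
        and *: "av (diag_form \<delta> (v * 1 + w * 0) (v * 0 + w * \<iota> (z s))) \<le> q powi (- int (Suc (\<delta> + i)))"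
      have "av (\<pi> ^ (\<delta> + i) * nm w * s) \<le> q powi (- int (\<delta> + i)) * 1 * 1"
        unfolding av_mult av_pi_power using p resys_integral[OF s] by (intro mult_mono) (auto simp: primitive_def nr_def)
      moreover have "q powi (- int (Suc (\<delta> + i))) \<le> q powi (- int (\<delta> + i))" unfolding powi_q_le_iff by simp
      ultimately show "av (diag_form \<delta> v w) \<le> q powi (- int (\<delta> + i))"
        using * av_diff[of "diag_form \<delta> v w + \<pi> ^ (\<delta> + i) * nm w * s" "\<pi> ^ (\<delta> + i) * nm w * s"] unfolding df[OF s] by simp
    qed
    then show ?thesis by (simp add: card_resys flip: q_def)
  qed
  show ?thesis
  proof (induction i)
    case (Suc i)
    have "diag_tail \<delta> (\<delta> + Suc (Suc i)) = diag_tail \<delta> (\<delta> + Suc i) / q"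
      using step[of "Suc i"] by (simp add: field_simps)
    then show ?case using Suc by simp
  qed simp
qed

text \<open>The index is shifted by one because the form takes values in the maximal ideal
  only.\<close>

definition hyp_tail :: "nat \<Rightarrow> real" where
  "hyp_tail i = row_prob (\<lambda>v w. av (hyp_form v w) \<le> q powi (- int (Suc i)))"

lemma av_hyp_form: assumes "primitive v w" shows "av (hyp_form v w) \<le> q powi (- 1)"
proof -
  have "(av (hyp_form v w))\<^sup>2 \<le> nr v * (1 / q) * nr w"
    using av_tr_le[of "v * qj * star w"] by (simp add: hyp_form_def nr_mult)
  also have "\<dots> \<le> 1 * (1 / q) * 1" using assms by (intro mult_mono) (auto simp: primitive_def)
  also have "\<dots> < 1\<^sup>2" using q_gt_1 by simp
  finally have "av (hyp_form v w) < 1" by (rule power_less_imp_less_base) simp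
  then show ?thesis using av_less_iff[of _ 0] by simp
qed

lemma hyp_tail_0: "hyp_tail 0 = 1"
proof -
  have "hyp_tail 0 = row_prob (\<lambda>_ _. True)"
    unfolding hyp_tail_def by (rule row_prob_cong) (use av_hyp_form in auto)
  then show ?thesis by (simp add: row_prob_total)
qed

lemma hyp_shift_ex1:
  assumes x: "av H \<le> q powi (- int n)" and u: "av u = 1"
  shows "\<exists>!s. s \<in> resys \<and> av (H + u * (s * \<pi> ^ n)) \<le> q powi (- int (Suc n))"
proof -
  define x where "x = - (H / (u * \<pi> ^ n))"
  have nz: "u * \<pi> ^ n \<noteq> 0" using u by auto
  have "av x \<le> 1" unfolding x_def av_minus av_divide av_mult u av_pi_power using x by (simp add: divide_le_eq_1_pos)
  moreover have "av (H + u * (s * \<pi> ^ n)) \<le> q powi (- int (Suc n)) \<longleftrightarrow> av (x - s) < 1" for s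
  proof -
    have "H + u * (s * \<pi> ^ n) = - ((u * \<pi> ^ n) * (x - s))" using nz by (simp add: x_def right_diff_distrib)
    then have "av (H + u * (s * \<pi> ^ n)) = av (x - s) * q powi (- int n)"
      by (simp only: av_minus av_mult u av_pi_power) simp
    then show ?thesis
      unfolding q_powi_Suc by (simp only: mult_le_cancel_right_pos[OF powi_q_pos])
        (use av_less_1_imp q_gt_1 in \<open>auto intro: le_less_trans\<close>)
  qed
  ultimately show ?thesis using resys_ex1[of x] by simp
qed

text \<open>The form is additive in each variable, so a shear that adds a multiple of one entry to
  the other shifts the next digit. The entry that is multiplied must be a unit, which separates the
  parts A and B.\<close>

lemma hyp_tail_Suc: "hyp_tail i = q * hyp_tail (Suc i)"
proof -
  define n where "n = Suc i"
  define Q where "Q n v w \<longleftrightarrow> av (hyp_form v w) \<le> q powi (- int n)" for n v w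
  have lvlQ: "lvl (\<lambda>g. Q n (g $ 1 $ 1) (g $ 1 $ 2))" for n unfolding Q_def by (rule lvl_hyp_form) simp
  \<comment> \<open>Chosen so that \<open>tr (r s * qj)\<close> is
    \<open>s * \<pi> ^ n\<close>.\<close>
  define r where "r s = \<iota> (s * \<pi> ^ n / 2) * inverse qj" for s
  have nrr: "nr (r s) < 1" if "s \<in> resys" for s
  proof -
    have "(av s)\<^sup>2 \<le> 1" using resys_integral[OF that] by (simp add: power_le_one)
    then have "nr (r s) \<le> 1 * (q powi (- int n))\<^sup>2 * q"
      unfolding r_def nr_mult nr_iota nr_inverse nr_qj av_divide av_mult av_2 av_pi_power power_mult_distrib
      by (intro mult_mono) (auto simp: power_mult_distrib)
    also have "\<dots> = q powi (1 - 2 * int n)"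
      by (simp add: power2_eq_square power_int_diff field_simps flip: power_int_add)
    also have "\<dots> < q powi 0" unfolding powi_q_less_iff by (simp add: n_def)
    finally show ?thesis by simp
  qed
  have trr: "tr (r s * qj) = s * \<pi> ^ n" for s
  proof -
    have "r s * qj = \<iota> (s * \<pi> ^ n / 2)" by (simp add: r_def mult.assoc)
    then show ?thesis by simp
  qed
  have h1: "hyp_form (v * 1 + w * r s) (v * 0 + w * 1) = hyp_form v w + nm w * (s * \<pi> ^ n)" for v w s
  proof -
    have "hyp_form (v * 1 + w * r s) (v * 0 + w * 1) = hyp_form v w + tr (w * (r s * qj) * star w)"
      by (simp add: hyp_form_def distrib_right tr_add mult.assoc)
    then show ?thesis by (simp only: tr_conj trr)
  qed
  have h2: "hyp_form (v * 1 + w * 0) (v * - r s + w * 1) = hyp_form v w + nm v * (s * \<pi> ^ n)" for v w s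
  proof -
    have "qj * star (r s) = \<iota> (- (s * \<pi> ^ n / 2))"
    proof -
      have "star (r s * qj) = \<iota> (s * \<pi> ^ n / 2)" by (simp add: r_def mult.assoc)
      moreover have "star (r s * qj) = - (qj * star (r s))" by (simp add: star_mult)
      ultimately show ?thesis by (metis iota_minus minus_minus)
    qed
    then have t: "tr (qj * - star (r s)) = s * \<pi> ^ n" by (simp add: tr_minus)
    have "hyp_form (v * 1 + w * 0) (v * - r s + w * 1) = hyp_form v w + tr (v * (qj * - star (r s)) * star v)"
      by (simp add: hyp_form_def star_add star_diff star_mult star_minus distrib_left tr_add mult.assoc right_diff_distrib flip: tr_add)
    then show ?thesis by (simp only: tr_conj t)
  qed
  have mono: "av H \<le> q powi (- int n)" if "av (H + u * (s * \<pi> ^ n)) \<le> q powi (- int (Suc n))" "s \<in> resys" "av u \<le> 1" for H u s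
  proof -
    have "av (u * (s * \<pi> ^ n)) \<le> 1 * (1 * q powi (- int n))"
      unfolding av_mult av_pi_power using that resys_integral by (intro mult_mono) auto
    moreover have "q powi (- int (Suc n)) \<le> q powi (- int n)" unfolding powi_q_le_iff by simp
    ultimately show ?thesis using av_diff[of "H + u * (s * \<pi> ^ n)" "u * (s * \<pi> ^ n)"] that(1) by simp
  qed
  have A: "row_prob (\<lambda>v w. Q n v w \<and> nr w = 1) = real (card resys) * row_prob (\<lambda>v w. Q (Suc n) v w \<and> nr w = 1)"
  proof (rule row_translates[where a = "\<lambda>s. 1" and b = "\<lambda>s. 0" and c = r and d = "\<lambda>s. 1", OF finite_resys])
    show "lvl (\<lambda>g. Q (Suc n) (g $ 1 $ 1) (g $ 1 $ 2) \<and> nr (g $ 1 $ 2) = 1)" by (intro lvl_conj lvlQ lvl_snd) simp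
    show "mm 1 0 (r s) 1 \<in> Omat" if "s \<in> resys" for s using nrr[OF that] by (intro Omat_lower) simp
    show "\<exists>!s. s \<in> resys \<and> Q (Suc n) (v * 1 + w * r s) (v * 0 + w * 1) \<and> nr (v * 0 + w * 1) = 1" if "Q n v w \<and> nr w = 1" for v w
      using hyp_shift_ex1[of "hyp_form v w" n "nm w"] that unfolding Q_def h1 by (simp add: nr_def del: of_nat_Suc)
    show "Q n v w \<and> nr w = 1" if "primitive v w" "s \<in> resys" "Q (Suc n) (v * 1 + w * r s) (v * 0 + w * 1) \<and> nr (v * 0 + w * 1) = 1" for v w s
      using mono[of "hyp_form v w" "nm w" s] that unfolding Q_def h1 by (simp add: nr_def primitive_def del: of_nat_Suc)
  qed
  have B: "row_prob (\<lambda>v w. Q n v w \<and> nr w < 1) = real (card resys) * row_prob (\<lambda>v w. Q (Suc n) v w \<and> nr w < 1)"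
  proof (rule row_translates[where a = "\<lambda>s. 1" and b = "\<lambda>s. - r s" and c = "\<lambda>s. 0" and d = "\<lambda>s. 1", OF finite_resys])
    show "lvl (\<lambda>g. Q (Suc n) (g $ 1 $ 1) (g $ 1 $ 2) \<and> nr (g $ 1 $ 2) < 1)" by (intro lvl_conj lvlQ lvl_snd) simp
    show "mm 1 (- r s) 0 1 \<in> Omat" if "s \<in> resys" for s using nrr[OF that] by (intro Omat_upper) simp
    have small: "nr (v * - r s + w * 1) < 1 \<longleftrightarrow> nr w < 1" if "s \<in> resys" "nr v \<le> 1" for v w s
    proof -
      have "nr (v * - r s) < 1"
        using nrr[OF that(1)] mult_right_mono[OF that(2), of "nr (r s)"] by (simp add: nr_mult)
      then show ?thesis using nr_add_less[of "v * - r s" 1 w] nr_diff_less[of "v * - r s + w" 1 "v * - r s"] by auto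
    qed
    { fix v w assume p: "primitive v w" and Q: "Q n v w \<and> nr w < 1"
      then have v: "nr v = 1" by (simp add: primitive_def)
      have "\<exists>!s. s \<in> resys \<and> av (hyp_form v w + nm v * (s * \<pi> ^ n)) \<le> q powi (- int (Suc n))"
        using hyp_shift_ex1[of "hyp_form v w" n "nm v"] Q v by (simp add: Q_def nr_def)
      then show "\<exists>!s. s \<in> resys \<and> Q (Suc n) (v * 1 + w * 0) (v * - r s + w * 1) \<and> nr (v * - r s + w * 1) < 1"
        unfolding Q_def h2 using small v Q by (metis order_refl) }
    show "Q n v w \<and> nr w < 1" if "primitive v w" "s \<in> resys" "Q (Suc n) (v * 1 + w * 0) (v * - r s + w * 1) \<and> nr (v * - r s + w * 1) < 1" for v w s
      using mono[of "hyp_form v w" "nm v" s] that small[of s v w] unfolding Q_def h2 by (simp add: nr_def primitive_def del: of_nat_Suc)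
  qed
  have split: "row_prob (Q n) = row_prob (\<lambda>v w. Q n v w \<and> nr w = 1) + row_prob (\<lambda>v w. Q n v w \<and> nr w < 1)" for n
    by (rule row_prob_split) (auto simp: primitive_def intro!: lvl_conj lvlQ lvl_snd)
  have "row_prob (Q n) = real (card resys) * row_prob (Q (Suc n))"
    using split[of n] split[of "Suc n"] A B by (simp add: distrib_left)
  then show ?thesis by (simp add: hyp_tail_def Q_def[abs_def] n_def card_resys flip: q_def)
qed

lemma hyp_tail_eq: "hyp_tail i = 1 / q ^ i"
proof (induction i)
  case (Suc i)
  then show ?case using hyp_tail_Suc[of i] by (simp add: field_simps)
qed (simp add: hyp_tail_0)

text \<open>\<open>d1\<close> is an arbitrary square root; two square roots differ by a sign, which
  the absolute value ignores.\<close>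

lemma av_d1: assumes "y $ 1 $ 1 = \<iota> a" shows "av (d1 \<iota> y) = av a"
proof -
  have "nrd \<iota> ((\<chi> i j. y $ 1 $ 1) :: 'd ^ 1 ^ 1) = a\<^sup>2" using assms by (simp add: nrd_1)
  then have "(d1 \<iota> y)\<^sup>2 = a\<^sup>2" unfolding d1_def by (simp only:) (rule someI[of _ a], simp)
  then show ?thesis by (metis power2_eq_iff av_minus)
qed

lemma av_d2: assumes "adj star y = y" shows "av (d2 \<iota> y) = av (hdet y)"
proof -
  obtain a b d where y: "y = hm a b d" using hermitian_exists assms by blast
  have "nrd \<iota> y = (hdet y)\<^sup>2" using nrd_hermitian[of y a d] by (simp add: y)
  then have "(d2 \<iota> y)\<^sup>2 = (hdet y)\<^sup>2" unfolding d2_def by (simp only:) (rule someI[of _ "hdet y"], simp)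
  then show ?thesis by (metis power2_eq_iff av_minus)
qed

lemma q_powi_powr: "complex_of_real (q powi n) powr s = (complex_of_real q powr s) powi n"
proof -
  have "q powi n = q powr of_int n" using powr_real_of_int'[of q n] by simp
  then have "ln (q powi n) = of_int n * ln q" by (simp add: ln_powr)
  then have "complex_of_real (q powi n) powr s = exp (of_int n * (s * of_real (ln q)))"
    by (simp add: powr_def Ln_of_real mult.left_commute del: of_real_power_int)
  also have "\<dots> = (exp (s * of_real (ln q))) powi n" by (simp add: exp_power_int)
  also have "exp (s * of_real (ln q)) = complex_of_real q powr s" by (simp add: powr_def Ln_of_real)
  finally show ?thesis .
qed

section \<open>The zeta integral as a series over level sets\<close>

definition top_tail :: "'d ^ 2 ^ 2 \<Rightarrow> int \<Rightarrow> real" where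
  "top_tail x n = measure \<kappa> {g \<in> Omat. av (d1 \<iota> (act star g x)) \<le> q powi (- n)}"

lemma av_d1_act: "adj star x = x \<Longrightarrow> \<exists>a. act star g x $ 1 $ 1 = \<iota> a \<and> av (d1 \<iota> (act star g x)) = av a"
  using hermitian_exists[OF adj_act[of x g]] av_d1 by (metis hm_entries(1))

lemma level_top: assumes "adj star x = x" shows "level {g \<in> Omat. av (d1 \<iota> (act star g x)) \<le> q powi (- n)}"
proof (rule level_lvl)
  obtain a where a: "\<And>g. act star g x $ 1 $ 1 = \<iota> (a g)" "\<And>g. av (d1 \<iota> (act star g x)) = av (a g)"
    using av_d1_act[OF assms] by metis
  show "lvl (\<lambda>g. av (d1 \<iota> (act star g x)) \<le> q powi (- n))"
    unfolding a(2) by (rule lvl_av_act[OF assms a(1)]) simp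
qed

text \<open>Passing to another point of the orbit is a right translation of the set in
  \<open>K\<close>, so the distribution can be computed on a representative.\<close>

lemma top_tail_act:
  assumes k: "k \<in> Omat" and x: "adj star x = x" shows "top_tail (act star k x) n = top_tail x n"
proof -
  have "{g \<in> Omat. av (d1 \<iota> (act star g (act star k x))) \<le> q powi (- n)} =
      {h \<in> Omat. h ** k \<in> {g \<in> Omat. av (d1 \<iota> (act star g x)) \<le> q powi (- n)}}"
    using Omat_mult[OF _ k] by (auto simp: act_act)
  then show ?thesis using haar_right(2)[OF k level_top[OF x]] by (simp add: top_tail_def measure_def)
qed

lemma top_tail_Oequiv: "Oequiv x y \<Longrightarrow> adj star x = x \<Longrightarrow> top_tail x n = top_tail y n"
  using top_tail_act by (auto simp: Oequiv_def)

lemma top_tail_diag: "top_tail (hm (\<pi> powi \<alpha>) 0 (\<pi> powi (\<alpha> + int \<delta>))) (\<alpha> + int i) = diag_tail \<delta> i"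
proof -
  let ?x = "hm (\<pi> powi \<alpha>) 0 (\<pi> powi (\<alpha> + int \<delta>))"
  have "av (d1 \<iota> (act star g ?x)) \<le> q powi (- (\<alpha> + int i)) \<longleftrightarrow>
      av (diag_form \<delta> (g $ 1 $ 1) (g $ 1 $ 2)) \<le> q powi (- int i)" for g
  proof -
    have "act star g ?x $ 1 $ 1 = \<iota> (\<pi> powi \<alpha> * diag_form \<delta> (g $ 1 $ 1) (g $ 1 $ 2))"
      unfolding act_top by (simp add: diag_form_def power_int_add algebra_simps)
    from av_d1[OF this] have "av (d1 \<iota> (act star g ?x)) = q powi (- \<alpha>) * av (diag_form \<delta> (g $ 1 $ 1) (g $ 1 $ 2))"
      by (simp add: av_mult av_pi_powi)
    moreover have "q powi (- (\<alpha> + int i)) = q powi (- \<alpha>) * q powi (- int i)" by (simp flip: power_int_add)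
    ultimately show ?thesis by (simp only: mult_le_cancel_left_pos[OF powi_q_pos])
  qed
  then show ?thesis by (simp add: top_tail_def diag_tail_def row_prob_def)
qed

lemma top_tail_hyp: "top_tail (hm 0 (\<iota> (\<pi> powi e) * qj) 0) (e + 1 + int i) = hyp_tail i"
proof -
  let ?x = "hm 0 (\<iota> (\<pi> powi e) * qj) 0"
  have "av (d1 \<iota> (act star g ?x)) \<le> q powi (- (e + 1 + int i)) \<longleftrightarrow>
      av (hyp_form (g $ 1 $ 1) (g $ 1 $ 2)) \<le> q powi (- int (Suc i))" for g
  proof -
    have "act star g ?x $ 1 $ 1 = \<iota> (tr (\<iota> (\<pi> powi e) * (g $ 1 $ 1 * qj * star (g $ 1 $ 2))))"
      unfolding act_top by (simp add: mult.assoc iota_left_comm[of "g $ 1 $ 1"])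
    then have "act star g ?x $ 1 $ 1 = \<iota> (\<pi> powi e * hyp_form (g $ 1 $ 1) (g $ 1 $ 2))"
      by (simp only: tr_iota_mult hyp_form_def)
    from av_d1[OF this] have "av (d1 \<iota> (act star g ?x)) = q powi (- e) * av (hyp_form (g $ 1 $ 1) (g $ 1 $ 2))"
      by (simp add: av_mult av_pi_powi)
    moreover have "- (e + 1 + int i) = - e + - int (Suc i)" by simp
    then have "q powi (- (e + 1 + int i)) = q powi (- e) * q powi (- int (Suc i))"
      by (simp only: power_int_add[OF disjI1[OF q_pos(2)]])
    ultimately show ?thesis by (simp only: mult_le_cancel_left_pos[OF powi_q_pos])
  qed
  then show ?thesis by (simp add: top_tail_def hyp_tail_def row_prob_def)
qed

text \<open>Summation over the level sets of \<open>\<bar>d\<^sub>1\<bar>\<close>; the set where \<open>d\<^sub>1\<close> vanishes contributes nothing,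
  because the integrand is declared to be 0 there.\<close>

lemma omega_int_sums:
  assumes x: "x \<in> herm star" and n: "av (hdet x) = q powi (- n)" and full: "\<And>g. g \<in> Omat \<Longrightarrow> av (d1 \<iota> (act star g x)) \<le> q powi (- a0)"
    and s1: "Re s1 \<ge> 0" and sm: "summable (\<lambda>i. top_tail x (a0 + int i) - top_tail x (a0 + int (Suc i)))"
    and u: "u = complex_of_real q powr s1" and v: "v = complex_of_real q powr s2"
  shows "(\<lambda>i. u powi (- (a0 + int i)) * v powi (- n) * of_real (top_tail x (a0 + int i) - top_tail x (a0 + int (Suc i))))
    sums omega_int av \<iota> star \<kappa> x s1 s2"
proof -
  interpret finite_measure \<kappa> by (rule finite_measure_haar)
  have ax: "adj star x = x" using x by (simp add: herm_iff)
  define F where "F g = av (d1 \<iota> (act star g x))" for g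
  define S where "S k = {g \<in> Omat. F g \<le> q powi (- k)}" for k
  define L where "L k = S k - S (k + 1)" for k
  have Sm: "S k \<in> sets \<kappa>" for k unfolding S_def F_def by (rule level_measurable[OF level_top[OF ax]])
  have Ssub: "S (k + 1) \<subseteq> S k" for k
  proof -
    have "q powi (- (k + 1)) \<le> q powi (- k)" unfolding powi_q_le_iff by simp
    then show ?thesis by (auto simp: S_def)
  qed
  have St: "measure \<kappa> (S k) = top_tail x k" for k by (simp add: S_def F_def top_tail_def)
  have mL: "measure \<kappa> (L (a0 + int i)) = top_tail x (a0 + int i) - top_tail x (a0 + int (Suc i))" for i
    using finite_measure_Diff[OF Sm Sm Ssub, of "a0 + int i"] unfolding L_def St by (simp add: algebra_simps)
  have mem: "g \<in> L k \<longleftrightarrow> F g = q powi (- k)" if g: "g \<in> Omat" for g k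
  proof -
    obtain a where a: "F g = av a" using av_d1_act[OF ax, of g] by (auto simp: F_def)
    have "- k - 1 = - (k + 1)" by simp
    then have "av a < q powi (- k) \<longleftrightarrow> av a \<le> q powi (- (k + 1))" using av_less_iff[of a "- k"] by (simp only:)
    then show ?thesis using g by (auto simp: L_def S_def a)
  qed
  define w where "w k = u powi (- k) * v powi (- n)" for k
  have val: "dpow av \<iota> (act star g x) s1 s2 = (if F g = 0 then 0 else of_real (F g) powr s1 * v powi (- n))" if g: "g \<in> Omat" for g
  proof -
    have "av (d2 \<iota> (act star g x)) = q powi (- n)"
      using av_d2[OF adj_act[OF ax]] av_hdet_act_Omat[OF g x] n by simp
    then show ?thesis
      unfolding dpow_def F_def v q_powi_powr[symmetric] by (metis av_eq_0_iff less_irrefl powi_q_pos)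
  qed
  have U: "u \<noteq> 0" "norm u \<ge> 1"
    using s1 q_gt_1 by (auto simp: u norm_powr_real_powr ge_one_powr_ge_zero)
  define f where "f i g = indicator (L (a0 + int i)) g *\<^sub>R w (a0 + int i)" for i g
  have pow: "of_real (F g) powr s1 = u powi (- k)" if "F g = q powi (- k)" for g k
    unfolding that u by (rule q_powi_powr)
  have fint: "integrable \<kappa> (f i)" and fI: "(\<integral>g. f i g \<partial>\<kappa>) = of_real (measure \<kappa> (L (a0 + int i))) * w (a0 + int i)" for i
  proof -
    have Lm: "L (a0 + int i) \<in> sets \<kappa>" using Sm by (simp add: L_def)
    then show "integrable \<kappa> (f i)" unfolding f_def by (intro integrable_scaleR_left integrable_real_indicator) (auto simp: emeasure_finite less_top[symmetric])
    show "(\<integral>g. f i g \<partial>\<kappa>) = of_real (measure \<kappa> (L (a0 + int i))) * w (a0 + int i)"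
      unfolding f_def using Lm sets.sets_into_space[OF Lm]
      by (subst integral_scaleR_left) (auto simp: scaleR_conv_of_real emeasure_finite less_top[symmetric] Int_absorb2)
  qed
  have fnorm: "(\<integral>g. norm (f i g) \<partial>\<kappa>) = norm (w (a0 + int i)) * measure \<kappa> (L (a0 + int i))" for i
  proof -
    have Lm: "L (a0 + int i) \<in> sets \<kappa>" using Sm by (simp add: L_def)
    have "norm (f i g) = indicator (L (a0 + int i)) g * norm (w (a0 + int i))" for g by (simp add: f_def indicator_def)
    then show ?thesis using Lm sets.sets_into_space[OF Lm] by (simp add: emeasure_finite less_top[symmetric] Int_absorb2)
  qed
  have wb: "norm (w (a0 + int i)) \<le> norm (w a0)" for i
  proof -
    have "norm (u powi (- (a0 + int i))) = norm (u powi (- a0)) * inverse (norm u) ^ i"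
      by (simp only: powi_minus_nat[OF U(1)] norm_mult norm_power norm_inverse)
    also have "\<dots> \<le> norm (u powi (- a0)) * 1"
      using U by (intro mult_left_mono power_le_one) (auto simp: inverse_le_1_iff)
    finally show ?thesis by (simp add: w_def norm_mult mult_right_mono)
  qed
  have pt: "(\<lambda>i. f i g) sums dpow av \<iota> (act star g x) s1 s2 \<and> summable (\<lambda>i. norm (f i g))" if g: "g \<in> Omat" for g
  proof (cases "F g = 0")
    case True
    then have "f i g = 0" for i using mem[OF g, of "a0 + int i"] by (auto simp: f_def)
    then show ?thesis using val[OF g] True by simp
  next
    case False
    obtain a where a: "F g = av a" using av_d1_act[OF ax, of g] by (auto simp: F_def)
    then obtain k where k: "F g = q powi (- k)" using False av_discrete[of a] by auto
    have "q powi (- k) \<le> q powi (- a0)" using full[OF g] k by (simp add: F_def)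
    then have "k \<ge> a0" by (simp add: powi_q_le_iff)
    then obtain j where j: "k = a0 + int j" by (metis zle_iff_zadd)
    have fi: "f i g = (if i = j then w (a0 + int j) else 0)" for i
      using mem[OF g, of "a0 + int i"] by (auto simp: f_def k j powi_q_eq_iff)
    have "dpow av \<iota> (act star g x) s1 s2 = w (a0 + int j)"
      unfolding val[OF g] w_def pow[OF k] j using False by simp
    then show ?thesis unfolding fi
      using sums_single[of j "\<lambda>_. w (a0 + int j)"] summable_finite[of "{j}" "\<lambda>i. norm (if i = j then w (a0 + int j) else 0)"]
      by auto
  qed
  have "(\<lambda>i. \<integral>g. f i g \<partial>\<kappa>) sums (\<integral>g. suminf (\<lambda>i. f i g) \<partial>\<kappa>)"
  proof (rule sums_integral[OF fint])
    show "AE g in \<kappa>. summable (\<lambda>i. norm (f i g))" using pt by (intro AE_I2) (simp add: space_haar)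
    have "norm (\<integral>g. norm (f i g) \<partial>\<kappa>) \<le> norm (w a0) * (top_tail x (a0 + int i) - top_tail x (a0 + int (Suc i)))" for i
      unfolding fnorm mL[symmetric] using wb by (simp add: mult_right_mono)
    then show "summable (\<lambda>i. \<integral>g. norm (f i g) \<partial>\<kappa>)"
      by (intro summable_comparison_test'[OF summable_mult[OF sm, of "norm (w a0)"], of 0]) auto
  qed
  moreover have "(\<integral>g. suminf (\<lambda>i. f i g) \<partial>\<kappa>) = omega_int av \<iota> star \<kappa> x s1 s2"
    unfolding omega_int_def using pt by (intro Bochner_Integration.integral_cong) (auto simp: space_haar sums_iff)
  ultimately show ?thesis unfolding fI mL w_def by (simp add: mult.commute)
qed

section \<open>Closed form of the spherical integrals\<close>

lemma top_even:
  assumes x: "x \<in> inv_class (2 * \<alpha>) n" and g: "g \<in> Omat"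
  shows "av (d1 \<iota> (act star g x)) \<le> q powi (- \<alpha>)"
proof -
  have ax: "adj star x = x" using x by (simp add: inv_class_def herm_iff)
  obtain a where a: "act star g x $ 1 $ 1 = \<iota> a" "av (d1 \<iota> (act star g x)) = av a" using av_d1_act[OF ax] by blast
  have "(av a)\<^sup>2 \<le> q powi (- (2 * \<alpha>))"
    using nr_entry_le[of "act star g x" 1 1] x msize_act_Omat[OF g, of x] by (simp add: a nr_iota inv_class_def)
  also have "\<dots> = (q powi (- \<alpha>))\<^sup>2" by (simp add: power2_eq_square flip: power_int_add)
  finally show ?thesis unfolding a(2) by (rule power2_le_imp_le) simp
qed

lemma top_odd:
  assumes x: "x \<in> inv_class (2 * e + 1) n" and g: "g \<in> Omat"
  shows "av (d1 \<iota> (act star g x)) \<le> q powi (- (e + 1))"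
proof -
  have x': "x \<in> herm star" "msize x = q powi (- (2 * e + 1))" using x by (auto simp: inv_class_def)
  obtain a b d where y: "act star g x = hm a b d" using herm_exists[OF act_herm[OF Omat_invertible[OF g] x'(1)]] by blast
  have "msize (hm a b d) = q powi (- (2 * e + 1))" using msize_act_Omat[OF g, of x] x' by (simp add: y)
  then show ?thesis using odd_size_entries(2) av_d1[of "hm a b d" a] by (simp add: y)
qed

text \<open>Up to the factor \<open>1 / (q\<^sup>2 + 1)\<close> this is the numerator of the
  generating series of the jumps of \<open>diag_tail\<close>. The recursive form is the one to be
  matched with \<open>macp\<close>, the closed form \<open>diag_poly_Suc\<close> the one that arises
  from the series.\<close>

fun diag_poly :: "nat \<Rightarrow> complex \<Rightarrow> complex" where
  "diag_poly 0 w = of_real q * (of_real q - 1) * (1 + w)"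
| "diag_poly (Suc 0) w = (1 - of_real q * w) * ((of_real q)\<^sup>2 + ((of_real q)\<^sup>2 - of_real q - 1) * w) + of_real q * ((of_real q)\<^sup>2 - 1) * w\<^sup>2"
| "diag_poly (Suc (Suc n)) w = (1 + w) * diag_poly (Suc n) w - w * diag_poly n w"

lemma diag_poly_Suc:
  "diag_poly (Suc n) w = (1 - of_real q * w) * ((of_real q)\<^sup>2 + ((of_real q)\<^sup>2 - 1) * (\<Sum>i<n. w ^ Suc i)
     + ((of_real q)\<^sup>2 - of_real q - 1) * w ^ Suc n) + of_real q * ((of_real q)\<^sup>2 - 1) * w ^ (n + 2)"
proof (induction n rule: less_induct)
  case (less n)
  consider "n = 0" | "n = 1" | m where "n = Suc (Suc m)" by (metis One_nat_def old.nat.exhaust)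
  then show ?case
  proof cases
    case 1 then show ?thesis by (simp add: numeral_2_eq_2)
  next
    case 2 then show ?thesis by (simp add: algebra_simps power2_eq_square numeral_2_eq_2)
  next
    case 3
    define P where "P = (\<Sum>i<m. w ^ Suc i)"
    have IH: "diag_poly (Suc m) w = (1 - of_real q * w) * ((of_real q)\<^sup>2 + ((of_real q)\<^sup>2 - 1) * P
       + ((of_real q)\<^sup>2 - of_real q - 1) * w ^ Suc m) + of_real q * ((of_real q)\<^sup>2 - 1) * w ^ (m + 2)"
      "diag_poly (Suc (Suc m)) w = (1 - of_real q * w) * ((of_real q)\<^sup>2 + ((of_real q)\<^sup>2 - 1) * (P + w ^ Suc m)
       + ((of_real q)\<^sup>2 - of_real q - 1) * w ^ Suc (Suc m)) + of_real q * ((of_real q)\<^sup>2 - 1) * w ^ (Suc m + 2)"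
      using less.IH[of m] less.IH[of "Suc m"] 3 by (simp_all add: P_def)
    have S: "(\<Sum>i<n. w ^ Suc i) = P + w ^ Suc m + w ^ Suc (Suc m)" by (simp add: 3 P_def)
    have "diag_poly (Suc n) w = (1 + w) * diag_poly (Suc (Suc m)) w - w * diag_poly (Suc m) w"
      by (simp add: 3)
    also have "\<dots> = (1 - of_real q * w) * ((of_real q)\<^sup>2 + ((of_real q)\<^sup>2 - 1) * (P + w ^ Suc m + w ^ Suc (Suc m))
       + ((of_real q)\<^sup>2 - of_real q - 1) * w ^ Suc n) + of_real q * ((of_real q)\<^sup>2 - 1) * w ^ (n + 2)"
      unfolding IH by (simp add: 3 algebra_simps)
    finally show ?thesis unfolding S .
  qed
qed

lemma diag_tail_values:
  "1 \<le> i \<Longrightarrow> i \<le> \<delta> \<Longrightarrow> diag_tail \<delta> i = q\<^sup>2 / (q\<^sup>2) ^ i / (q\<^sup>2 + 1)"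
  "diag_tail \<delta> (\<delta> + Suc i) = (q + 1) / (q\<^sup>2) ^ \<delta> / (q\<^sup>2 + 1) / q ^ i"
proof -
  show "1 \<le> i \<Longrightarrow> i \<le> \<delta> \<Longrightarrow> diag_tail \<delta> i = q\<^sup>2 / (q\<^sup>2) ^ i / (q\<^sup>2 + 1)"
    by (simp add: diag_tail_le unit_tail_eq)
  have "(q - 1) * diag_tail \<delta> (Suc \<delta>) = (q\<^sup>2 - 1) / (q\<^sup>2) ^ \<delta> / (q\<^sup>2 + 1)"
    unfolding diag_tail_Suc unit_tail_eq by (simp add: diff_divide_distrib)
  also have "\<dots> = (q - 1) * ((q + 1) / (q\<^sup>2) ^ \<delta> / (q\<^sup>2 + 1))" by (simp add: power2_eq_square algebra_simps)
  finally have "diag_tail \<delta> (Suc \<delta>) = (q + 1) / (q\<^sup>2) ^ \<delta> / (q\<^sup>2 + 1)"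
    using q_gt_1 mult_left_cancel[of "q - 1"] by (metis diff_gt_0_iff_gt less_irrefl)
  then show "diag_tail \<delta> (\<delta> + Suc i) = (q + 1) / (q\<^sup>2) ^ \<delta> / (q\<^sup>2 + 1) / q ^ i" by (simp only: diag_tail_geometric)
qed

definition cq :: complex where "cq = of_real q"

lemma cq_simps [simp]: "cq \<noteq> 0" "cq\<^sup>2 + 1 \<noteq> 0"
proof -
  have "q\<^sup>2 + 1 > 0" by (simp add: add_pos_pos)
  then have "complex_of_real (q\<^sup>2 + 1) \<noteq> 0" unfolding of_real_eq_0_iff by linarith
  then show "cq\<^sup>2 + 1 \<noteq> 0" by (simp add: cq_def)
qed (simp add: cq_def)

text \<open>The jumps are the probabilities of the single orders. Their shape changes at 0 and at
  \<open>\<delta>\<close>, and they are geometric beyond \<open>\<delta>\<close>, so each range has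
  its own formula; for \<open>\<delta> = 0\<close> the first two exceptions coincide.\<close>

lemma diag_tail_diff:
  "0 < \<delta> \<Longrightarrow> complex_of_real (diag_tail \<delta> 0 - diag_tail \<delta> 1) = cq\<^sup>2 / (cq\<^sup>2 + 1)"
  "Suc i < \<delta> \<Longrightarrow> complex_of_real (diag_tail \<delta> (Suc i) - diag_tail \<delta> (Suc (Suc i))) = (cq\<^sup>2 - 1) / (cq\<^sup>2) ^ Suc i / (cq\<^sup>2 + 1)"
  "0 < \<delta> \<Longrightarrow> complex_of_real (diag_tail \<delta> \<delta> - diag_tail \<delta> (Suc \<delta>)) = (cq\<^sup>2 - cq - 1) / (cq\<^sup>2) ^ \<delta> / (cq\<^sup>2 + 1)"
  "complex_of_real (diag_tail 0 0 - diag_tail 0 1) = (cq\<^sup>2 - cq) / (cq\<^sup>2 + 1)"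
  "complex_of_real (diag_tail \<delta> (\<delta> + Suc j) - diag_tail \<delta> (\<delta> + Suc (Suc j))) = (cq + 1) * (1 - 1 / cq) / (cq\<^sup>2) ^ \<delta> / (cq\<^sup>2 + 1) * (1 / cq) ^ j"
proof -
  have ne: "cq\<^sup>2 + 1 \<noteq> 0" by simp
  have one: "1 = (cq\<^sup>2 + 1) / (cq\<^sup>2 + 1)" by simp
  have t0: "complex_of_real (diag_tail \<delta> 0) = (cq\<^sup>2 + 1) / (cq\<^sup>2 + 1)" for \<delta> by (simp add: diag_tail_0)
  have t1: "complex_of_real (diag_tail \<delta> i) = cq\<^sup>2 / (cq\<^sup>2) ^ i / (cq\<^sup>2 + 1)" if "1 \<le> i" "i \<le> \<delta>" for i \<delta>
    using diag_tail_values(1)[OF that] by (simp add: cq_def)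
  have t2: "complex_of_real (diag_tail \<delta> (\<delta> + Suc j)) = (cq + 1) / (cq\<^sup>2) ^ \<delta> / (cq\<^sup>2 + 1) / cq ^ j" for j \<delta>
    using diag_tail_values(2)[of \<delta> j] by (simp add: cq_def)
  show "0 < \<delta> \<Longrightarrow> complex_of_real (diag_tail \<delta> 0 - diag_tail \<delta> 1) = cq\<^sup>2 / (cq\<^sup>2 + 1)"
    unfolding of_real_diff using t1[of 1 \<delta>] by (simp add: diag_tail_0 diff_divide_eq_iff)
  show "Suc i < \<delta> \<Longrightarrow> complex_of_real (diag_tail \<delta> (Suc i) - diag_tail \<delta> (Suc (Suc i))) = (cq\<^sup>2 - 1) / (cq\<^sup>2) ^ Suc i / (cq\<^sup>2 + 1)"
  proof -
    assume "Suc i < \<delta>"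
    moreover have "cq\<^sup>2 / (cq\<^sup>2) ^ Suc (Suc i) = 1 / (cq\<^sup>2) ^ Suc i"
      by (subst power_Suc) (rule nonzero_divide_mult_cancel_left, simp)
    ultimately show ?thesis
      using t1[of "Suc i" \<delta>] t1[of "Suc (Suc i)" \<delta>] by (simp only: of_real_diff diff_divide_distrib)
  qed
  show "0 < \<delta> \<Longrightarrow> complex_of_real (diag_tail \<delta> \<delta> - diag_tail \<delta> (Suc \<delta>)) = (cq\<^sup>2 - cq - 1) / (cq\<^sup>2) ^ \<delta> / (cq\<^sup>2 + 1)"
    unfolding of_real_diff using t1[of \<delta> \<delta>] t2[of \<delta> 0] by (simp add: diff_divide_distrib[symmetric])
  show "complex_of_real (diag_tail 0 0 - diag_tail 0 1) = (cq\<^sup>2 - cq) / (cq\<^sup>2 + 1)"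
    unfolding of_real_diff using t2[of 0 0] by (simp add: diag_tail_0 diff_divide_eq_iff)
  show "complex_of_real (diag_tail \<delta> (\<delta> + Suc j) - diag_tail \<delta> (\<delta> + Suc (Suc j))) = (cq + 1) * (1 - 1 / cq) / (cq\<^sup>2) ^ \<delta> / (cq\<^sup>2 + 1) * (1 / cq) ^ j"
  proof -
    have g: "x / cq ^ j - x / cq ^ Suc j = x * (1 - 1 / cq) * (1 / cq) ^ j" for x by (simp add: power_one_over field_simps)
    show ?thesis unfolding of_real_diff t2 g by (simp only: times_divide_eq_left mult.assoc)
  qed
qed

text \<open>The variable \<open>w = t / cq\<^sup>2\<close> absorbs the powers in the denominators of
  the jumps, and the factor \<open>1 - t / cq\<close> clears the geometric tail.\<close>

lemma diag_series_value:
  assumes t: "t / cq \<noteq> 1"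
    and G_def: "G = (\<Sum>i<Suc \<delta>. t ^ i * complex_of_real (diag_tail \<delta> i - diag_tail \<delta> (Suc i)))
     + t ^ Suc \<delta> * ((cq + 1) * (1 - 1 / cq) / (cq\<^sup>2) ^ \<delta> / (cq\<^sup>2 + 1)) / (1 - t / cq)"
  shows "(1 - t / cq) * G = diag_poly \<delta> (t / cq\<^sup>2) / (cq\<^sup>2 + 1)"
proof -
  define w where "w = t / cq\<^sup>2"
  have tw: "t = cq\<^sup>2 * w" "t / cq = cq * w" by (simp_all add: w_def power2_eq_square)
  have tp: "t ^ i * (x / (cq\<^sup>2) ^ i / (cq\<^sup>2 + 1)) = x * w ^ i / (cq\<^sup>2 + 1)" for i x
    by (simp add: tw power_mult_distrib)
  have "t ^ Suc \<delta> * ((cq + 1) * (1 - 1 / cq) / (cq\<^sup>2) ^ \<delta> / (cq\<^sup>2 + 1)) = t * (t ^ \<delta> * ((cq + 1) * (1 - 1 / cq) / (cq\<^sup>2) ^ \<delta> / (cq\<^sup>2 + 1)))"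
    by (simp add: mult.assoc)
  also have "\<dots> = cq * (cq\<^sup>2 - 1) * w ^ Suc \<delta> / (cq\<^sup>2 + 1)"
  proof -
    have e: "cq\<^sup>2 * ((cq + 1) * (1 - 1 / cq)) = cq * (cq\<^sup>2 - 1)" by (simp add: field_simps power2_eq_square)
    have "t * ((cq + 1) * (1 - 1 / cq) * w ^ \<delta> / (cq\<^sup>2 + 1)) = (cq\<^sup>2 * ((cq + 1) * (1 - 1 / cq))) * w ^ Suc \<delta> / (cq\<^sup>2 + 1)"
      unfolding tw(1) by (simp only: times_divide_eq_right power_Suc ac_simps)
    then show ?thesis unfolding tp e .
  qed
  finally have tail: "t ^ Suc \<delta> * ((cq + 1) * (1 - 1 / cq) / (cq\<^sup>2) ^ \<delta> / (cq\<^sup>2 + 1)) = cq * (cq\<^sup>2 - 1) * w ^ Suc \<delta> / (cq\<^sup>2 + 1)" .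
  define H where "H = (\<Sum>i<Suc \<delta>. t ^ i * complex_of_real (diag_tail \<delta> i - diag_tail \<delta> (Suc i)))"
  have G: "(1 - t / cq) * G = (1 - cq * w) * H + cq * (cq\<^sup>2 - 1) * w ^ Suc \<delta> / (cq\<^sup>2 + 1)"
    using t unfolding G_def tail H_def[symmetric] by (simp add: distrib_left tw(2))
  have "(1 - cq * w) * H + cq * (cq\<^sup>2 - 1) * w ^ Suc \<delta> / (cq\<^sup>2 + 1) = diag_poly \<delta> w / (cq\<^sup>2 + 1)"
  proof (cases \<delta>)
    case 0
    have "H = (cq\<^sup>2 - cq) / (cq\<^sup>2 + 1)" unfolding H_def 0 using diag_tail_diff(4) by simp
    then have "(1 - cq * w) * H + cq * (cq\<^sup>2 - 1) * w ^ Suc \<delta> / (cq\<^sup>2 + 1)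
        = ((1 - cq * w) * (cq\<^sup>2 - cq) + cq * (cq\<^sup>2 - 1) * w) / (cq\<^sup>2 + 1)" by (simp add: 0 add_divide_distrib)
    also have "(1 - cq * w) * (cq\<^sup>2 - cq) + cq * (cq\<^sup>2 - 1) * w = diag_poly 0 w"
      by (simp add: algebra_simps power2_eq_square flip: cq_def)
    finally show ?thesis by (simp add: 0)
  next
    case (Suc n)
    have "H = complex_of_real (diag_tail \<delta> 0 - diag_tail \<delta> 1) + (\<Sum>i<n. t ^ Suc i * complex_of_real (diag_tail \<delta> (Suc i) - diag_tail \<delta> (Suc (Suc i))))
        + t ^ \<delta> * complex_of_real (diag_tail \<delta> \<delta> - diag_tail \<delta> (Suc \<delta>))"
      unfolding H_def Suc by (subst sum.lessThan_Suc_shift) simp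
    also have "(\<Sum>i<n. t ^ Suc i * complex_of_real (diag_tail \<delta> (Suc i) - diag_tail \<delta> (Suc (Suc i))))
        = (\<Sum>i<n. (cq\<^sup>2 - 1) * w ^ Suc i / (cq\<^sup>2 + 1))"
      by (intro sum.cong refl) (simp only: tp diag_tail_diff(2) Suc lessThan_iff Suc_less_eq)
    also have "\<dots> = (cq\<^sup>2 - 1) * (\<Sum>i<n. w ^ Suc i) / (cq\<^sup>2 + 1)" by (simp only: sum_distrib_left sum_divide_distrib)
    also have "complex_of_real (diag_tail \<delta> 0 - diag_tail \<delta> 1) = cq\<^sup>2 / (cq\<^sup>2 + 1)" using diag_tail_diff(1)[of \<delta>] Suc by simp
    also have "t ^ \<delta> * complex_of_real (diag_tail \<delta> \<delta> - diag_tail \<delta> (Suc \<delta>)) = (cq\<^sup>2 - cq - 1) * w ^ \<delta> / (cq\<^sup>2 + 1)"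
      using diag_tail_diff(3)[of \<delta>] Suc by (simp only: tp)
    finally have H: "H = (cq\<^sup>2 + (cq\<^sup>2 - 1) * (\<Sum>i<n. w ^ Suc i) + (cq\<^sup>2 - cq - 1) * w ^ \<delta>) / (cq\<^sup>2 + 1)"
      by (simp add: add_divide_distrib)
    show ?thesis
      unfolding H Suc diag_poly_Suc cq_def[symmetric]
      by (simp only: times_divide_eq_right add_divide_distrib[symmetric] add_2_eq_Suc')
  qed
  then show ?thesis unfolding G w_def .
qed

lemma norm_inverse_powr_le: "Re s \<ge> 0 \<Longrightarrow> norm (inverse (complex_of_real q powr s)) \<le> 1"
  using q_gt_1 by (simp add: norm_inverse norm_powr_real_powr ge_one_powr_ge_zero inverse_le_1_iff)

lemma inverse_powr_div_q_less: "Re s \<ge> 0 \<Longrightarrow> norm (inverse (complex_of_real q powr s) / cq) < 1"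
  using norm_inverse_powr_le[of s] q_gt_1 by (simp add: norm_divide cq_def)

text \<open>The series of \<open>omega_int_sums\<close> for the diagonal representative consists of
  finitely many terms and a geometric tail with ratio \<open>t / cq\<close>.\<close>

lemma omega_int_even:
  assumes x: "x \<in> inv_class (2 * \<alpha>) (2 * \<alpha> + int \<delta>)" and s1: "Re s1 \<ge> 0"
    and u: "u = complex_of_real q powr s1" and v: "v = complex_of_real q powr s2"
  shows "(1 - inverse u / cq) * omega_int av \<iota> star \<kappa> x s1 s2
    = u powi (- \<alpha>) * v powi (- (2 * \<alpha> + int \<delta>)) * (diag_poly \<delta> (inverse u / cq\<^sup>2) / (cq\<^sup>2 + 1))"
proof -
  define t where "t = inverse u"
  have tn: "norm t \<le> 1" "norm (t / cq) < 1"
    using norm_inverse_powr_le[OF s1] inverse_powr_div_q_less[OF s1] by (simp_all add: t_def u)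
  have u0: "u \<noteq> 0" by (simp add: u)
  have xh: "x \<in> herm star" "msize x = q powi (- (2 * \<alpha>))" "av (hdet x) = q powi (- (2 * \<alpha> + int \<delta>))"
    using x by (auto simp: inv_class_def)
  have "Oequiv x (hm (\<pi> powi \<alpha>) 0 (\<pi> powi (\<alpha> + int \<delta>)))"
    by (rule Oequiv_diag) (use xh in \<open>auto simp: algebra_simps\<close>)
  then have T: "top_tail x (\<alpha> + int i) = diag_tail \<delta> i" for i
    using top_tail_Oequiv[of x] xh(1) top_tail_diag by (simp add: herm_iff)
  define A where "A = (cq + 1) * (1 - 1 / cq) / (cq\<^sup>2) ^ \<delta> / (cq\<^sup>2 + 1)"
  define f where "f i = t ^ i * complex_of_real (diag_tail \<delta> i - diag_tail \<delta> (Suc i))" for i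
  have shift: "f (j + Suc \<delta>) = t ^ Suc \<delta> * A * (t / cq) ^ j" for j
  proof -
    have "complex_of_real (diag_tail \<delta> (j + Suc \<delta>) - diag_tail \<delta> (Suc (j + Suc \<delta>))) = A * (1 / cq) ^ j"
      using diag_tail_diff(5)[of \<delta> j] by (simp add: A_def add.commute)
    then show ?thesis by (simp add: f_def power_add power_divide)
  qed
  have "(\<lambda>j. f (j + Suc \<delta>)) sums (t ^ Suc \<delta> * A * (1 / (1 - t / cq)))"
    unfolding shift by (intro sums_mult geometric_sums tn)
  then have "f sums (t ^ Suc \<delta> * A * (1 / (1 - t / cq)) + (\<Sum>i<Suc \<delta>. f i))"
    by (simp only: sums_iff_shift)
  moreover define G where "G = (\<Sum>i<Suc \<delta>. t ^ i * complex_of_real (diag_tail \<delta> i - diag_tail \<delta> (Suc i)))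
     + t ^ Suc \<delta> * A / (1 - t / cq)"
  ultimately have fG: "f sums G" by (simp add: f_def add.commute)
  have sm: "summable (\<lambda>i. top_tail x (\<alpha> + int i) - top_tail x (\<alpha> + int (Suc i)))"
  proof -
    have "summable (\<lambda>j. complex_of_real (diag_tail \<delta> (j + Suc \<delta>) - diag_tail \<delta> (Suc (j + Suc \<delta>))))"
    proof -
      have eq: "complex_of_real (diag_tail \<delta> (j + Suc \<delta>) - diag_tail \<delta> (Suc (j + Suc \<delta>))) = A * (1 / cq) ^ j" for j
        using diag_tail_diff(5)[of \<delta> j] by (simp add: A_def add.commute)
      have "norm (1 / cq) < 1" using q_gt_1 by (simp add: norm_divide cq_def)
      then show ?thesis unfolding eq by (intro summable_mult summable_geometric)
    qed
    then have "summable (\<lambda>j. diag_tail \<delta> (j + Suc \<delta>) - diag_tail \<delta> (Suc (j + Suc \<delta>)))"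
      by (simp only: summable_complex_of_real)
    then have "summable (\<lambda>i. diag_tail \<delta> i - diag_tail \<delta> (Suc i))"
      using summable_iff_shift[of "\<lambda>i. diag_tail \<delta> i - diag_tail \<delta> (Suc i)" "Suc \<delta>"] by simp
    then show ?thesis unfolding T .
  qed
  have "(\<lambda>i. u powi (- (\<alpha> + int i)) * v powi (- (2 * \<alpha> + int \<delta>)) * of_real (top_tail x (\<alpha> + int i) - top_tail x (\<alpha> + int (Suc i))))
    sums omega_int av \<iota> star \<kappa> x s1 s2"
    by (rule omega_int_sums[OF xh(1) xh(3) top_even[OF x] s1 sm u v])
  moreover have "u powi (- (\<alpha> + int i)) * v powi (- (2 * \<alpha> + int \<delta>)) * of_real (top_tail x (\<alpha> + int i) - top_tail x (\<alpha> + int (Suc i)))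
     = u powi (- \<alpha>) * v powi (- (2 * \<alpha> + int \<delta>)) * f i" for i
  proof -
    have "u powi (- (\<alpha> + int i)) = u powi (- \<alpha>) * t ^ i"
      unfolding t_def by (rule powi_minus_nat[OF u0])
    then show ?thesis unfolding T f_def by simp
  qed
  ultimately have "(\<lambda>i. u powi (- \<alpha>) * v powi (- (2 * \<alpha> + int \<delta>)) * f i) sums omega_int av \<iota> star \<kappa> x s1 s2" by (simp only:)
  moreover have "(\<lambda>i. u powi (- \<alpha>) * v powi (- (2 * \<alpha> + int \<delta>)) * f i) sums (u powi (- \<alpha>) * v powi (- (2 * \<alpha> + int \<delta>)) * G)"
    using fG by (rule sums_mult)
  ultimately have om: "omega_int av \<iota> star \<kappa> x s1 s2 = u powi (- \<alpha>) * v powi (- (2 * \<alpha> + int \<delta>)) * G"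
    by (rule sums_unique2)
  have "t / cq \<noteq> 1" using tn(2) by auto
  then have "(1 - t / cq) * G = diag_poly \<delta> (t / cq\<^sup>2) / (cq\<^sup>2 + 1)"
    by (rule diag_series_value[OF _ G_def[unfolded A_def]])
  then show ?thesis unfolding om t_def[symmetric] by (subst mult.left_commute) (simp only:)
qed

text \<open>For odd size the series is geometric from its first term on.\<close>

lemma omega_int_odd:
  assumes x: "x \<in> inv_class (2 * e + 1) (2 * e + 1)" and s1: "Re s1 \<ge> 0"
    and u: "u = complex_of_real q powr s1" and v: "v = complex_of_real q powr s2"
  shows "(1 - inverse u / cq) * omega_int av \<iota> star \<kappa> x s1 s2
    = u powi (- (e + 1)) * v powi (- (2 * e + 1)) * (1 - 1 / cq)"
proof -
  define t where "t = inverse u"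
  have tn: "norm (t / cq) < 1" using inverse_powr_div_q_less[OF s1] by (simp add: t_def u)
  have u0: "u \<noteq> 0" by (simp add: u)
  have xh: "x \<in> herm star" "msize x = q powi (- (2 * e + 1))" "av (hdet x) = q powi (- (2 * e + 1))"
    using x by (auto simp: inv_class_def)
  have T: "top_tail x (e + 1 + int i) = 1 / q ^ i" for i
    using top_tail_Oequiv[OF Oequiv_hyperbolic[OF xh(1,2)]] xh(1) top_tail_hyp[of e i] hyp_tail_eq by (simp add: herm_iff)
  have diff: "1 / q ^ i - 1 / q ^ Suc i = (1 - 1 / q) * (1 / q) ^ i" for i by (simp add: power_one_over field_simps)
  have sm: "summable (\<lambda>i. top_tail x (e + 1 + int i) - top_tail x (e + 1 + int (Suc i)))"
    unfolding T diff using q_gt_1 by (intro summable_mult summable_geometric) simp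
  have "(\<lambda>i. u powi (- (e + 1 + int i)) * v powi (- (2 * e + 1)) * of_real (top_tail x (e + 1 + int i) - top_tail x (e + 1 + int (Suc i))))
    sums omega_int av \<iota> star \<kappa> x s1 s2"
    by (rule omega_int_sums[OF xh(1) xh(3) top_odd[OF x] s1 sm u v])
  moreover have "u powi (- (e + 1 + int i)) * v powi (- (2 * e + 1)) * of_real (top_tail x (e + 1 + int i) - top_tail x (e + 1 + int (Suc i)))
     = u powi (- (e + 1)) * v powi (- (2 * e + 1)) * (1 - 1 / cq) * (t / cq) ^ i" for i
  proof -
    have "u powi (- (e + 1 + int i)) = u powi (- (e + 1)) * t ^ i"
      unfolding t_def by (rule powi_minus_nat[OF u0])
    moreover have "complex_of_real ((1 - 1 / q) * (1 / q) ^ i) = (1 - 1 / cq) * (1 / cq) ^ i" by (simp add: cq_def)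
    ultimately show ?thesis unfolding T diff by (simp add: power_divide)
  qed
  ultimately have "(\<lambda>i. u powi (- (e + 1)) * v powi (- (2 * e + 1)) * (1 - 1 / cq) * (t / cq) ^ i) sums omega_int av \<iota> star \<kappa> x s1 s2"
    by (simp only:)
  moreover have "(\<lambda>i. u powi (- (e + 1)) * v powi (- (2 * e + 1)) * (1 - 1 / cq) * (t / cq) ^ i) sums
     (u powi (- (e + 1)) * v powi (- (2 * e + 1)) * (1 - 1 / cq) * (1 / (1 - t / cq)))"
    by (intro sums_mult geometric_sums tn)
  ultimately have om: "omega_int av \<iota> star \<kappa> x s1 s2 = u powi (- (e + 1)) * v powi (- (2 * e + 1)) * (1 - 1 / cq) * (1 / (1 - t / cq))"
    by (rule sums_unique2)
  have "1 - t / cq \<noteq> 0" using tn by auto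
  then show ?thesis unfolding om t_def[symmetric] by simp
qed

end

section \<open>Laurent polynomials and the orthogonal polynomials\<close>

lemma leval_superset:
  assumes "finite S" "Poly_Mapping.keys P \<subseteq> S"
  shows "leval P u v = (\<Sum>(i, j)\<in>S. Poly_Mapping.lookup P (i, j) * u powi i * v powi j)"
  unfolding leval_def
  by (rule sum.mono_neutral_left) (use assms in \<open>auto simp: in_keys_iff\<close>)

lemma leval_add: "leval (P + Q) u v = leval P u v + leval Q u v"
proof -
  let ?S = "Poly_Mapping.keys P \<union> Poly_Mapping.keys Q"
  have "leval (P + Q) u v = (\<Sum>(i, j)\<in>?S. Poly_Mapping.lookup (P + Q) (i, j) * u powi i * v powi j)"
    by (rule leval_superset) (auto simp: Poly_Mapping.keys_add)
  also have "\<dots> = (\<Sum>(i, j)\<in>?S. Poly_Mapping.lookup P (i, j) * u powi i * v powi j)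
     + (\<Sum>(i, j)\<in>?S. Poly_Mapping.lookup Q (i, j) * u powi i * v powi j)"
    unfolding sum.distrib[symmetric] by (intro sum.cong refl) (auto simp: lookup_add algebra_simps)
  finally show ?thesis using leval_superset[of ?S P] leval_superset[of ?S Q] by simp
qed

lemma leval_0 [simp]: "leval 0 u v = 0"
  by (simp add: leval_def)

lemma leval_diff: "leval (P - Q) u v = leval P u v - leval Q u v"
  using leval_add[of "P - Q" Q u v] by simp

lemma leval_single: "leval (Poly_Mapping.single (i, j) c) u v = c * u powi i * v powi j"
  by (subst leval_superset[of "{(i, j)}"]) (auto split: if_splits)

text \<open>Equality is demanded for nonzero arguments only, where \<open>powi\<close> is additive
  in the exponent.\<close>

definition laurent :: "(complex \<Rightarrow> complex \<Rightarrow> complex) \<Rightarrow> bool" where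
  "laurent F \<longleftrightarrow> (\<exists>L. \<forall>u v. u \<noteq> 0 \<longrightarrow> v \<noteq> 0 \<longrightarrow> leval L u v = F u v)"

lemma laurent_leval: "laurent (leval L)"
  by (auto simp: laurent_def)

lemma laurent_cong: "laurent F \<Longrightarrow> (\<And>u v. u \<noteq> 0 \<Longrightarrow> v \<noteq> 0 \<Longrightarrow> F u v = G u v) \<Longrightarrow> laurent G"
  by (auto simp: laurent_def)

lemma laurent_monom: "laurent (\<lambda>u v. c * u powi i * v powi j)"
  unfolding laurent_def by (rule exI[of _ "Poly_Mapping.single (i, j) c"]) (simp add: leval_single)

lemma laurent_const: "laurent (\<lambda>u v. c)"
  using laurent_monom[of c 0 0] by simp

lemma laurent_fst: "laurent (\<lambda>u v. u powi i)" and laurent_snd: "laurent (\<lambda>u v. v powi i)"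
  using laurent_monom[of 1 i 0] laurent_monom[of 1 0 i] by simp_all

lemma laurent_add: "laurent F \<Longrightarrow> laurent G \<Longrightarrow> laurent (\<lambda>u v. F u v + G u v)"
  unfolding laurent_def using leval_add by metis

lemma laurent_sum: "finite I \<Longrightarrow> (\<And>i. i \<in> I \<Longrightarrow> laurent (F i)) \<Longrightarrow> laurent (\<lambda>u v. \<Sum>i\<in>I. F i u v)"
  by (induction I rule: finite_induct) (auto intro: laurent_add laurent_const)

lemma laurent_mult:
  assumes "laurent F" "laurent G" shows "laurent (\<lambda>u v. F u v * G u v)"
proof -
  obtain L M where L: "\<And>u v. u \<noteq> 0 \<Longrightarrow> v \<noteq> 0 \<Longrightarrow> leval L u v = F u v" and M: "\<And>u v. u \<noteq> 0 \<Longrightarrow> v \<noteq> 0 \<Longrightarrow> leval M u v = G u v"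
    using assms unfolding laurent_def by blast
  define T where "T k l u v = (Poly_Mapping.lookup L k * Poly_Mapping.lookup M l) * u powi (fst k + fst l) * v powi (snd k + snd l)" for k l and u v :: complex
  have "laurent (\<lambda>u v. \<Sum>k\<in>Poly_Mapping.keys L. \<Sum>l\<in>Poly_Mapping.keys M. T k l u v)"
    unfolding T_def by (intro laurent_sum laurent_monom finite_keys)
  moreover have "(\<Sum>k\<in>Poly_Mapping.keys L. \<Sum>l\<in>Poly_Mapping.keys M. T k l u v) = F u v * G u v" if "u \<noteq> 0" "v \<noteq> 0" for u v
  proof -
    have "F u v * G u v = leval L u v * leval M u v" using L M that by simp
    also have "\<dots> = (\<Sum>k\<in>Poly_Mapping.keys L. \<Sum>l\<in>Poly_Mapping.keys M. T k l u v)"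
      unfolding leval_def sum_product T_def using that
      by (intro sum.cong refl) (auto simp: power_int_add split: prod.splits)
    finally show ?thesis by simp
  qed
  ultimately show ?thesis by (rule laurent_cong)
qed

text \<open>A large power of \<open>v\<close> as a factor turns the sum into a polynomial with
  infinitely many roots.\<close>

lemma powi_sum_eq_0:
  assumes J: "finite J" and B: "infinite B" "0 \<notin> B" and z: "\<And>v. v \<in> B \<Longrightarrow> (\<Sum>j\<in>J. c j * v powi j) = 0" and j: "j \<in> J"
  shows "c j = (0 :: complex)"
proof -
  obtain N :: nat where N: "\<And>j. j \<in> J \<Longrightarrow> 0 \<le> j + int N"
  proof -
    have "\<forall>j\<in>J. 0 \<le> j + int (nat (Max (insert 0 (uminus ` J))))"
    proof
      fix j assume "j \<in> J"
      then have "- j \<le> Max (insert 0 (uminus ` J))" using J by (intro Max_ge) auto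
      then show "0 \<le> j + int (nat (Max (insert 0 (uminus ` J))))" by simp
    qed
    then show ?thesis using that by blast
  qed
  define p where "p = (\<Sum>j\<in>J. Polynomial.monom (c j) (nat (j + int N)))"
  have "poly p v = 0" if v: "v \<in> B" for v
  proof -
    have v0: "v \<noteq> 0" using B(2) v by auto
    have "poly p v = (\<Sum>j\<in>J. v ^ N * (c j * v powi j))"
      unfolding p_def poly_sum Polynomial.poly_monom
    proof (intro sum.cong refl)
      fix j assume "j \<in> J"
      have "v ^ nat (j + int N) = v powi (j + int N)" using N[OF \<open>j \<in> J\<close>] by (simp add: power_int_def)
      then show "c j * v ^ nat (j + int N) = v ^ N * (c j * v powi j)" using v0 by (simp add: power_int_add)
    qed
    then show ?thesis using z[OF v] by (simp add: sum_distrib_left[symmetric])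
  qed
  then have "B \<subseteq> {v. poly p v = 0}" by auto
  then have "p = 0" using B(1) poly_roots_finite[of p] infinite_super by blast
  have "Polynomial.coeff p (nat (j + int N)) = (\<Sum>i\<in>J. if i = j then c i else 0)"
    unfolding p_def Polynomial.coeff_sum Polynomial.coeff_monom using N j by (intro sum.cong refl) (auto simp: nat_eq_iff)
  then show ?thesis using J j \<open>p = 0\<close> by simp
qed

lemma laurent_poly_eq_0:
  assumes AB: "infinite A" "0 \<notin> A" "infinite B" "0 \<notin> B" and z: "\<And>u v. u \<in> A \<Longrightarrow> v \<in> B \<Longrightarrow> leval L u v = 0"
  shows "L = 0"
proof -
  define I J where "I = fst ` Poly_Mapping.keys L" and "J = snd ` Poly_Mapping.keys L"
  have IJ: "finite I" "finite J" "Poly_Mapping.keys L \<subseteq> I \<times> J" by (auto simp: I_def J_def image_iff) force+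
  have ev: "leval L u v = (\<Sum>j\<in>J. (\<Sum>i\<in>I. Poly_Mapping.lookup L (i, j) * u powi i) * v powi j)" for u v
    by (subst leval_superset[of "I \<times> J"]) (use IJ in \<open>auto simp: sum.cartesian_product[symmetric] sum_distrib_right sum.swap[of _ J I]\<close>)
  have "Poly_Mapping.lookup L (i, j) = 0" if ij: "i \<in> I" "j \<in> J" for i j
  proof (rule powi_sum_eq_0[OF IJ(1) AB(1,2) _ ij(1)])
    fix u assume "u \<in> A"
    show "(\<Sum>i\<in>I. Poly_Mapping.lookup L (i, j) * u powi i) = 0"
      by (rule powi_sum_eq_0[OF IJ(2) AB(3,4) _ ij(2)]) (use z[OF \<open>u \<in> A\<close>] in \<open>simp add: ev\<close>)
  qed
  then have "Poly_Mapping.lookup L k = 0" if "k \<in> Poly_Mapping.keys L" for k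
    using IJ(3) that by (cases k) blast
  then show ?thesis by (intro poly_mapping_eqI) (metis in_keys_iff lookup_zero)
qed

lemma laurent_poly_unique:
  assumes AB: "infinite A" "0 \<notin> A" "infinite B" "0 \<notin> B" and z: "\<And>u v. u \<in> A \<Longrightarrow> v \<in> B \<Longrightarrow> leval L u v = leval M u v"
  shows "L = M"
  using laurent_poly_eq_0[OF AB, of "L - M"] z by (simp add: leval_diff)

text \<open>On the unit circle \<open>inverse (cnj u) = u\<close>, so there the value of
  \<open>lconj P\<close> is the complex conjugate of that of \<open>P\<close>.\<close>

lemma leval_lconj: "leval (lconj P) u v = cnj (leval P (inverse (cnj u)) (inverse (cnj v)))"
proof -
  have inj: "inj (uminus :: int \<times> int \<Rightarrow> int \<times> int)" by (rule injI) simp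
  have lk: "Poly_Mapping.lookup (lconj P) k = cnj (Poly_Mapping.lookup P (- k))" for k
    unfolding lconj_def by (simp add: Poly_Mapping.map.rep_eq map_key.rep_eq[OF inj] when_def)
  have keys: "Poly_Mapping.keys (lconj P) \<subseteq> uminus ` Poly_Mapping.keys P"
  proof
    fix k assume "k \<in> Poly_Mapping.keys (lconj P)"
    then have "- k \<in> Poly_Mapping.keys P" by (simp add: in_keys_iff lk)
    then show "k \<in> uminus ` Poly_Mapping.keys P" by (metis imageI minus_minus)
  qed
  have "leval (lconj P) u v = (\<Sum>(i, j)\<in>uminus ` Poly_Mapping.keys P. Poly_Mapping.lookup (lconj P) (i, j) * u powi i * v powi j)"
    by (rule leval_superset) (use keys in auto)
  also have "\<dots> = (\<Sum>(i, j)\<in>Poly_Mapping.keys P. cnj (Poly_Mapping.lookup P (i, j)) * u powi (- i) * v powi (- j))"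
    by (subst sum.reindex) (auto simp: lk intro!: sum.cong inj_on_subset[OF inj])
  also have "\<dots> = cnj (leval P (inverse (cnj u)) (inverse (cnj v)))"
  proof -
    have c: "cnj (inverse (cnj w) powi i) = w powi (- i)" for w i
      by (simp add: power_int_def)
    show ?thesis unfolding leval_def cnj_sum case_prod_beta prod.collapse
      by (intro sum.cong refl) (simp only: complex_cnj_mult c)
  qed
  finally show ?thesis .
qed

text \<open>The orthogonal polynomials of the weight. By \<open>macp_weyl\<close> the product of \<open>macp b n\<close> with the
  weight is \<open>y\<^sup>n\<^sup>+\<^sup>1\<close> times one half of the weight plus its image under \<open>y \<mapsto> 1/y\<close>; this is the
  source of orthogonality.\<close>

fun macp :: "complex \<Rightarrow> nat \<Rightarrow> complex \<Rightarrow> complex" where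
  "macp b 0 y = (1 - 1 / b) * (y + 1 / y)"
| "macp b (Suc 0) y = y\<^sup>2 + 1 / y\<^sup>2 + 1 - (1 / b\<^sup>2 + b) - 1 / b"
| "macp b (Suc (Suc n)) y = (y + 1 / y) * macp b (Suc n) y - macp b n y"

text \<open>Both sides obey the same three-term recursion because \<open>y * (1 / y) = 1\<close>, so
  only \<open>n = 0\<close> and \<open>n = 1\<close> are computations. The case \<open>n = 0\<close>
  is the origin of the factor \<open>1 - 1 / b\<close> in \<open>macp\<close>.\<close>

lemma macp_weyl:
  assumes y: "y \<noteq> 0" and b: "b \<noteq> 0"
  shows "(y - 1 / y) * macp b n y = y ^ (n + 2) * ((1 - 1 / (b\<^sup>2 * y\<^sup>2)) * (1 - b / y\<^sup>2))
    - (1 / y) ^ (n + 2) * ((1 - y\<^sup>2 / b\<^sup>2) * (1 - b * y\<^sup>2))"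
proof -
  define A B where "A = (1 - 1 / (b\<^sup>2 * y\<^sup>2)) * (1 - b / y\<^sup>2)" and "B = (1 - y\<^sup>2 / b\<^sup>2) * (1 - b * y\<^sup>2)"
  have yz: "y * (1 / y) = 1" using y by simp
  have "(y - 1 / y) * macp b n y = y ^ (n + 2) * A - (1 / y) ^ (n + 2) * B"
  proof (induction n rule: less_induct)
    case (less n)
    consider "n = 0" | "n = Suc 0" | k where "n = Suc (Suc k)" by (metis old.nat.exhaust)
    then show ?case
    proof cases
      case 1
      have key: "(y - z) * ((1 - c) * (y + z)) = y ^ (0 + 2) * ((1 - c\<^sup>2 * z\<^sup>2) * (1 - b * z\<^sup>2)) - z ^ (0 + 2) * ((1 - y\<^sup>2 * c\<^sup>2) * (1 - b * y\<^sup>2))"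
        if "y * z = 1" "b * c = 1" for z c :: complex
      proof -
        have "y ^ (0 + 2) * ((1 - c\<^sup>2 * z\<^sup>2) * (1 - b * z\<^sup>2)) - z ^ (0 + 2) * ((1 - y\<^sup>2 * c\<^sup>2) * (1 - b * y\<^sup>2)) = (y\<^sup>2 - z\<^sup>2) * (1 - c * (b * c) * (y * z)\<^sup>2)"
          by (simp add: algebra_simps power2_eq_square)
        then show ?thesis unfolding that by (simp add: algebra_simps power2_eq_square)
      qed
      show ?thesis using key[of "1 / y" "1 / b"] y b unfolding 1 by (simp add: A_def B_def power_one_over)
    next
      case 2
      have key: "(y - z) * (y\<^sup>2 + z\<^sup>2 + 1 - (c\<^sup>2 + b) - c) = y ^ 3 * ((1 - c\<^sup>2 * z\<^sup>2) * (1 - b * z\<^sup>2)) - z ^ 3 * ((1 - y\<^sup>2 * c\<^sup>2) * (1 - b * y\<^sup>2))"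
        if "y * z = 1" "b * c = 1" for z c :: complex
      proof -
        have "y ^ 3 * ((1 - c\<^sup>2 * z\<^sup>2) * (1 - b * z\<^sup>2)) - z ^ 3 * ((1 - y\<^sup>2 * c\<^sup>2) * (1 - b * y\<^sup>2))
          = (y - z) * (y\<^sup>2 + y * z + z\<^sup>2 - (c\<^sup>2 + b) * (y * z)\<^sup>2 - c * (b * c) * (y * z) ^ 3)"
          by (simp add: algebra_simps power2_eq_square power3_eq_cube)
        then show ?thesis unfolding that by simp
      qed
      have "Suc 0 + 2 = (3::nat)" by simp
      then show ?thesis using key[of "1 / y" "1 / b"] y b unfolding 2 by (simp add: A_def B_def power_one_over power3_eq_cube)
    next
      case 3
      have "(y - 1 / y) * macp b n y = (y + 1 / y) * ((y - 1 / y) * macp b (Suc k) y) - (y - 1 / y) * macp b k y"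
        unfolding 3 macp.simps(3) by (simp only: right_diff_distrib mult.left_commute)
      also have "\<dots> = (y + 1 / y) * (y ^ (Suc k + 2) * A - (1 / y) ^ (Suc k + 2) * B) - (y ^ (k + 2) * A - (1 / y) ^ (k + 2) * B)"
        using less[of k] less[of "Suc k"] 3 by simp
      also have "\<dots> = y ^ (n + 2) * A - (1 / y) ^ (n + 2) * B + (y * (1 / y) - 1) * (y ^ (k + 2) * A - (1 / y) ^ (k + 2) * B)"
      proof -
        have "(y + z) * (y ^ (Suc k + 2) * A - z ^ (Suc k + 2) * B) - (y ^ (k + 2) * A - z ^ (k + 2) * B) = y ^ (n + 2) * A - z ^ (n + 2) * B + (y * z - 1) * (y ^ (k + 2) * A - z ^ (k + 2) * B)" for z
          unfolding 3 by (simp add: algebra_simps)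
        then show ?thesis .
      qed
      finally show ?thesis using yz by simp
    qed
  qed
  then show ?thesis by (simp add: A_def B_def)
qed

section \<open>Degrees and leading terms of the polynomials\<close>

definition symdeg :: "nat \<Rightarrow> (complex \<Rightarrow> complex) \<Rightarrow> bool" where
  "symdeg k F \<longleftrightarrow> (\<exists>c. \<forall>y. y \<noteq> 0 \<longrightarrow> F y = (\<Sum>j\<in>{- int k..int k}. c j * y powi j))"

lemma symdeg_monom: "\<bar>j\<bar> \<le> int k \<Longrightarrow> symdeg k (\<lambda>y. c * y powi j)"
  unfolding symdeg_def
  by (rule exI[of _ "\<lambda>i. if i = j then c else 0"]) (auto simp: if_distrib if_distribR cong: if_cong)

lemma symdeg_add: assumes "symdeg k F" "symdeg k G" shows "symdeg k (\<lambda>y. F y + G y)"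
proof -
  obtain c d where "\<And>y. y \<noteq> 0 \<Longrightarrow> F y = (\<Sum>j\<in>{- int k..int k}. c j * y powi j)"
    "\<And>y. y \<noteq> 0 \<Longrightarrow> G y = (\<Sum>j\<in>{- int k..int k}. d j * y powi j)" using assms unfolding symdeg_def by blast
  then show ?thesis unfolding symdeg_def
    by (intro exI[of _ "\<lambda>j. c j + d j"]) (auto simp: distrib_right sum.distrib)
qed

lemma symdeg_sum: "finite I \<Longrightarrow> (\<And>i. i \<in> I \<Longrightarrow> symdeg k (F i)) \<Longrightarrow> symdeg k (\<lambda>y. \<Sum>i\<in>I. F i y)"
proof (induction I rule: finite_induct)
  case empty
  show ?case using symdeg_monom[of 0 k 0] by simp
qed (auto intro: symdeg_add)

lemma symdeg_cong: "symdeg k F \<Longrightarrow> (\<And>y. y \<noteq> 0 \<Longrightarrow> F y = G y) \<Longrightarrow> symdeg k G"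
  unfolding symdeg_def by (elim exE, rename_tac c, rule_tac x = c in exI) auto

text \<open>By linearity, multiplication by \<open>G\<close> has to be controlled on monomials
  only.\<close>

lemma symdeg_lift:
  assumes "symdeg k F" "\<And>j. \<bar>j\<bar> \<le> int k \<Longrightarrow> symdeg l (\<lambda>y. G y * y powi j)" "\<And>y. y \<noteq> 0 \<Longrightarrow> H y = G y * F y"
  shows "symdeg l H"
proof -
  obtain c where c: "\<And>y. y \<noteq> 0 \<Longrightarrow> F y = (\<Sum>j\<in>{- int k..int k}. c j * y powi j)" using assms(1) unfolding symdeg_def by blast
  have scale: "symdeg l (\<lambda>y. t * f y)" if "symdeg l f" for t f
  proof -
    obtain d where d: "\<forall>y. y \<noteq> 0 \<longrightarrow> f y = (\<Sum>j\<in>{- int l..int l}. d j * y powi j)" using \<open>symdeg l f\<close> unfolding symdeg_def by blast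
    then show ?thesis unfolding symdeg_def
      by (intro exI[of _ "\<lambda>j. t * d j"]) (auto simp: sum_distrib_left mult.assoc)
  qed
  have "symdeg l (\<lambda>y. \<Sum>j\<in>{- int k..int k}. c j * (G y * y powi j))"
    by (intro symdeg_sum scale assms(2)) auto
  then show ?thesis by (rule symdeg_cong) (simp add: c assms(3) sum_distrib_left mult.left_commute)
qed

definition macp_lead :: "complex \<Rightarrow> nat \<Rightarrow> complex" where
  "macp_lead b n = (if n = 0 then 1 - 1 / b else 1)"

text \<open>The recursion passes on leading coefficient 1; the exceptional coefficient at
  \<open>n = 0\<close> causes a defect of lower degree only.\<close>

lemma macp_leading:
  "symdeg n (\<lambda>y. macp b n y - macp_lead b n * (y powi int (Suc n) + y powi (- int (Suc n))))"
proof (induction n rule: less_induct)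
  case (less n)
  have m: "symdeg k (\<lambda>y. c)" for k c using symdeg_monom[of 0 k c] by simp
  have step: "symdeg l (\<lambda>y. (y + 1 / y) * F y)" if F: "symdeg k F" and kl: "Suc k \<le> l" for k l F
  proof (rule symdeg_lift[OF F, where G = "\<lambda>y. y + 1 / y"])
    fix j assume "\<bar>j\<bar> \<le> int k"
    then have "symdeg l (\<lambda>y. 1 * y powi (j + 1) + 1 * y powi (j - 1))" using kl by (intro symdeg_add symdeg_monom) auto
    then show "symdeg l (\<lambda>y. (y + 1 / y) * y powi j)"
      by (rule symdeg_cong) (simp add: power_int_add power_int_diff distrib_right)
  qed auto
  have mono: "symdeg l (\<lambda>y. t * F y)" if F: "symdeg k F" and kl: "k \<le> l" for k l t F
    by (rule symdeg_lift[OF F, where G = "\<lambda>y. t"]) (use kl in \<open>auto intro: symdeg_monom\<close>)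
  consider "n = 0" | "n = 1" | k where "n = Suc (Suc k)" by (metis One_nat_def old.nat.exhaust)
  then show ?case
  proof cases
    case 1
    show ?thesis unfolding 1
      by (rule symdeg_cong[OF m[of 0 0]]) (simp add: macp_lead_def power_int_minus divide_inverse)
  next
    case 2
    show ?thesis unfolding 2
      by (rule symdeg_cong[OF m[of 1 "1 - (1 / b\<^sup>2 + b) - 1 / b"]])
        (simp add: macp_lead_def power_int_minus divide_inverse power2_eq_square)
  next
    case 3
    define R0 R1 where "R0 y = macp b k y - macp_lead b k * (y powi int (Suc k) + y powi (- int (Suc k)))"
      and "R1 y = macp b (Suc k) y - macp_lead b (Suc k) * (y powi int (Suc (Suc k)) + y powi (- int (Suc (Suc k))))" for y
    have R: "symdeg k R0" "symdeg (Suc k) R1" using less[of k] less[of "Suc k"] 3 by (simp_all add: R0_def[abs_def] R1_def[abs_def])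
    have "symdeg n (\<lambda>y. ((y + 1 / y) * R1 y + (-1) * R0 y) + ((1 - macp_lead b k) * y powi int (Suc k) + (1 - macp_lead b k) * y powi (- int (Suc k))))"
      using step[OF R(2), of n] mono[OF R(1), of n "-1"] 3 by (intro symdeg_add symdeg_monom) auto
    then show ?thesis
    proof (rule symdeg_cong)
      fix y :: complex assume y: "y \<noteq> 0"
      have p: "y powi int (Suc (Suc (Suc k))) = y * y powi int (Suc (Suc k))" "y powi int (Suc (Suc k)) = y * y powi int (Suc k)"
        "y powi (- int (Suc (Suc (Suc k)))) = y powi (- int (Suc (Suc k))) / y" "y powi (- int (Suc (Suc k))) = y powi (- int (Suc k)) / y"
        using y by (simp_all add: power_int_minus divide_simps del: of_nat_Suc)
      have m1: "macp b (Suc k) y = R1 y + (y powi int (Suc (Suc k)) + y powi (- int (Suc (Suc k))))" by (simp add: R1_def macp_lead_def)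
      have m0: "macp b k y = R0 y + macp_lead b k * (y powi int (Suc k) + y powi (- int (Suc k)))" by (simp add: R0_def)
      show "((y + 1 / y) * R1 y + (-1) * R0 y) + ((1 - macp_lead b k) * y powi int (Suc k) + (1 - macp_lead b k) * y powi (- int (Suc k)))
        = macp b n y - macp_lead b n * (y powi int (Suc n) + y powi (- int (Suc n)))"
      proof -
        have id: "((y + z) * r + (-1) * s) + ((1 - l) * a + (1 - l) * c) = (y + z) * (r + (y * a + c * z)) - (s + l * (a + c)) - (y * (y * a) + c * z * z)"
          if "y * z = 1" for z r s l a c :: complex
        proof -
          have "(y + z) * (r + (y * a + c * z)) - (s + l * (a + c)) - (y * (y * a) + c * z * z) = (y + z) * r - s + (y * z) * (a + c) - l * (a + c)"
            by (simp add: algebra_simps)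
          then show ?thesis using that by (simp add: algebra_simps)
        qed
        show ?thesis unfolding 3 macp.simps(3) m1 m0 p using y id[of "1 / y" "R1 y" "R0 y" "macp_lead b k"] by (simp add: macp_lead_def)
      qed
    qed
  qed
qed

section \<open>The contour integral\<close>

definition half_weight :: "complex \<Rightarrow> complex \<Rightarrow> complex" where
  "half_weight b y = (1 - y\<^sup>2) / ((1 - y\<^sup>2 / b\<^sup>2) * (1 - b * y\<^sup>2))"

lemma weight_eq: "weight q y = half_weight (of_nat q) y * half_weight (of_nat q) (1 / y)"
  unfolding weight_def half_weight_def by (simp add: power_int_minus divide_inverse power_inverse mult.commute)

lemma one_divide_eq_iff: "1 / y = c \<longleftrightarrow> y = 1 / (c :: complex)"
  by auto

locale weight_contour =
  fixes q :: nat
  assumes q_ge_2: "2 \<le> q"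
begin

definition b :: complex where "b = of_nat q"
definition r :: complex where "r = complex_of_real (sqrt (real q))"
text \<open>Apart from 0 the set is closed under inversion, so that both
  \<open>half_weight b y\<close> and \<open>half_weight b (1 / y)\<close> are holomorphic off
  it.\<close>

definition Sing :: "complex set" where "Sing = {0, b, - b, 1 / b, - (1 / b), r, - r, 1 / r, - (1 / r)}"

lemma r_sq: "r\<^sup>2 = b" by (simp add: r_def b_def flip: of_real_power)

lemma norm_b: "norm b = real q" and norm_r: "norm r = sqrt (real q)" by (simp_all add: b_def r_def)

lemma sqrt_q: "1 < sqrt (real q)" "sqrt (real q) < real q"
proof -
  show 1: "1 < sqrt (real q)" using q_ge_2 by simp
  have "sqrt (real q) * 1 < sqrt (real q) * sqrt (real q)" using 1 by (intro mult_strict_left_mono) auto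
  then show "sqrt (real q) < real q" by simp
qed

lemma b_nz: "b \<noteq> 0" and r_nz: "r \<noteq> 0" using q_ge_2 by (simp_all add: b_def r_def)

lemma finite_Sing: "finite Sing" by (simp add: Sing_def)

lemma open_Sing: "open (- Sing)" using finite_Sing by (simp add: finite_imp_closed open_Compl)

lemma Sing_norm: "y \<in> Sing \<Longrightarrow> norm y \<noteq> 1"
  using q_ge_2 sqrt_q unfolding Sing_def by (auto simp: norm_divide norm_b norm_r)

lemma circle_Sing: "path_image (circlepath 0 1) \<subseteq> - Sing"
  using Sing_norm by (auto simp: sphere_def)

lemma eventually_Sing: "eventually (\<lambda>y. y \<notin> Sing) (at z)"
proof -
  have "open (- (Sing - {z}))" using finite_Sing by (intro open_Compl finite_imp_closed) auto
  then have "eventually (\<lambda>y. y \<in> - (Sing - {z})) (at z)" by (rule eventually_at_in_open') auto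
  moreover have "eventually (\<lambda>y. y \<noteq> z) (at z)" by (simp add: eventually_at_filter)
  ultimately show ?thesis by eventually_elim auto
qed

lemma residue_Sing_cong: "(\<And>y. y \<notin> Sing \<Longrightarrow> f y = g y) \<Longrightarrow> residue f z = residue g z"
  using eventually_Sing[of z] by (intro residue_cong refl) (auto elim: eventually_mono)

text \<open>The circle avoids the finite set \<open>Sing\<close>, and residues depend on punctured
  neighbourhoods only, so values on \<open>Sing\<close> do not matter.\<close>

lemma U_integral_cong:
  assumes "\<And>y. y \<notin> Sing \<Longrightarrow> h y = h' y" shows "U_integral q h = U_integral q h'"
proof -
  have "contour_integral (circlepath 0 1) (\<lambda>y. h y / y) = contour_integral (circlepath 0 1) (\<lambda>y. h' y / y)"
    using circle_Sing assms by (intro contour_integral_eq) auto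
  moreover have "residue (\<lambda>y. h y / y) z = residue (\<lambda>y. h' y / y) z" for z
    using assms by (intro residue_Sing_cong) auto
  ultimately show ?thesis unfolding U_integral_def Let_def by simp
qed

lemma holo_div: "h holomorphic_on - Sing \<Longrightarrow> (\<lambda>y. h y / y) holomorphic_on - Sing"
  by (auto intro!: holomorphic_intros simp: Sing_def)

lemma residue_set:
  assumes "h holomorphic_on - Sing"
  shows "open (- (Sing - {z}))" "z \<in> - (Sing - {z})" "(\<lambda>y. h y / y) holomorphic_on - (Sing - {z}) - {z}"
proof -
  show "open (- (Sing - {z}))" using finite_Sing by (intro open_Compl finite_imp_closed) auto
  show "(\<lambda>y. h y / y) holomorphic_on - (Sing - {z}) - {z}" by (rule holomorphic_on_subset[OF holo_div[OF assms]]) auto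
qed auto

section \<open>Linearity of the deformed contour integral\<close>

lemma U_integral_add:
  assumes "h holomorphic_on - Sing" "h' holomorphic_on - Sing"
  shows "U_integral q (\<lambda>y. h y + h' y) = U_integral q h + U_integral q h'"
proof -
  have c: "contour_integral (circlepath 0 1) (\<lambda>y. (h y + h' y) / y)
      = contour_integral (circlepath 0 1) (\<lambda>y. h y / y) + contour_integral (circlepath 0 1) (\<lambda>y. h' y / y)"
    unfolding add_divide_distrib
    by (intro contour_integral_add contour_integrable_holomorphic_simple[OF holo_div open_Sing _ circle_Sing] assms) auto
  have "residue (\<lambda>y. (h y + h' y) / y) z = residue (\<lambda>y. h y / y) z + residue (\<lambda>y. h' y / y) z" for z
    unfolding add_divide_distrib by (rule residue_add[OF residue_set(1,2)[OF assms(1)] residue_set(3)[OF assms(1)] residue_set(3)[OF assms(2)]])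
  then show ?thesis unfolding U_integral_def Let_def c by (simp add: algebra_simps)
qed

lemma U_integral_cmult:
  assumes "h holomorphic_on - Sing"
  shows "U_integral q (\<lambda>y. c * h y) = c * U_integral q h"
proof -
  have i: "contour_integral (circlepath 0 1) (\<lambda>y. c * h y / y) = c * contour_integral (circlepath 0 1) (\<lambda>y. h y / y)"
    unfolding times_divide_eq_right[symmetric]
    by (intro contour_integral_lmul contour_integrable_holomorphic_simple[OF holo_div open_Sing _ circle_Sing] assms) auto
  have "residue (\<lambda>y. c * h y / y) z = c * residue (\<lambda>y. h y / y) z" for z
    unfolding times_divide_eq_right[symmetric] by (rule residue_lmul[OF residue_set[OF assms]])
  then show ?thesis unfolding U_integral_def Let_def i by (simp add: algebra_simps)
qed

lemma U_integral_0: "U_integral q (\<lambda>y. 0) = 0"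
  using U_integral_cmult[of "\<lambda>y. 0" 0] by (simp add: holomorphic_on_const)

lemma U_integral_sum:
  assumes "finite I" "\<And>i. i \<in> I \<Longrightarrow> h i holomorphic_on - Sing"
  shows "U_integral q (\<lambda>y. \<Sum>i\<in>I. h i y) = (\<Sum>i\<in>I. U_integral q (h i))"
  using assms
proof (induction I rule: finite_induct)
  case (insert i I)
  have "(\<lambda>y. \<Sum>i\<in>I. h i y) holomorphic_on - Sing" using insert by (intro holomorphic_on_sum) auto
  then show ?case using insert by (simp add: U_integral_add)
qed (simp add: U_integral_0)

section \<open>Residues of the half weight\<close>

lemma sq_factor: "1 - y\<^sup>2 / b\<^sup>2 = 0 \<Longrightarrow> y = b \<or> y = - b" "1 - b * y\<^sup>2 = 0 \<Longrightarrow> y = 1 / r \<or> y = - (1 / r)"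
proof -
  assume "1 - y\<^sup>2 / b\<^sup>2 = 0"
  then have "y\<^sup>2 = b\<^sup>2" using b_nz by (simp add: field_simps)
  then show "y = b \<or> y = - b" by (simp add: power2_eq_iff)
next
  assume "1 - b * y\<^sup>2 = 0"
  then have "(r * y)\<^sup>2 = 1\<^sup>2" by (simp add: power_mult_distrib r_sq)
  then have "r * y = 1 \<or> r * y = - 1" unfolding power2_eq_iff .
  then show "y = 1 / r \<or> y = - (1 / r)" using r_nz by (simp add: field_simps)
qed

lemma half_weight_holo:
  assumes "b \<notin> S" "- b \<notin> S" "1 / r \<notin> S" "- (1 / r) \<notin> S"
  shows "half_weight b holomorphic_on S"
  unfolding half_weight_def
  by (intro holomorphic_intros) (use assms sq_factor in \<open>auto simp: b_nz\<close>)

lemma half_weight_inverse_holo: "(\<lambda>y. half_weight b (1 / y)) holomorphic_on - Sing"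
proof -
  have "(half_weight b \<circ> (\<lambda>y. 1 / y)) holomorphic_on - Sing"
  proof (rule holomorphic_on_compose)
    show "(\<lambda>y. 1 / y) holomorphic_on - Sing" by (auto intro!: holomorphic_intros simp: Sing_def)
    have "1 / y \<noteq> b" "1 / y \<noteq> - b" "1 / y \<noteq> 1 / r" "1 / y \<noteq> - (1 / r)" if "y \<notin> Sing" for y
      using that by (simp_all add: Sing_def one_divide_eq_iff)
    then show "half_weight b holomorphic_on (\<lambda>y. 1 / y) ` (- Sing)" by (intro half_weight_holo) (metis ComplD imageE)+
  qed
  then show ?thesis by (simp add: o_def)
qed

lemma half_weight_holo_Sing: "half_weight b holomorphic_on - Sing"
  by (rule half_weight_holo) (auto simp: Sing_def)

lemma weight_holo: "weight q holomorphic_on - Sing"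
  unfolding weight_eq[abs_def] b_def[symmetric]
  by (intro holomorphic_intros half_weight_holo_Sing half_weight_inverse_holo)

lemma powi_holo: "(\<lambda>y. y powi j) holomorphic_on - Sing"
  by (intro holomorphic_intros) (auto simp: Sing_def)

lemma ball_points: "0 \<in> ball 0 (real q)" "1 / r \<in> ball 0 (real q)" "- (1 / r) \<in> ball 0 (real q)"
  "1 / r \<noteq> 0" "- (1 / r) \<noteq> 0" "1 / r \<noteq> - (1 / r)" "r \<noteq> - r" "norm (1 / r) < 1"
proof -
  have "norm (1 / r) < 1" using sqrt_q by (simp add: norm_divide norm_r)
  then show "norm (1 / r) < 1" "1 / r \<in> ball 0 (real q)" "- (1 / r) \<in> ball 0 (real q)" "0 \<in> ball 0 (real q)"
    using q_ge_2 by auto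
  show rr: "r \<noteq> - r" using r_nz by simp
  show "1 / r \<noteq> 0" "- (1 / r) \<noteq> 0" "1 / r \<noteq> - (1 / r)" using r_nz by (simp_all add: field_simps)
qed

text \<open>In the disc of radius \<open>q\<close> the half weight has poles at \<open>1 / r\<close>
  and \<open>- (1 / r)\<close> only, both inside the unit circle. Division by \<open>y\<close> adds
  the point 0, whose residue is nonzero for \<open>k = 0\<close> only.\<close>

lemma contour_monomial:
  "1 / (2 * of_real pi * \<i>) * contour_integral (circlepath 0 1) (\<lambda>y. y ^ k * half_weight b y / y)
    = of_bool (k = 0) + residue (\<lambda>y. y ^ k * half_weight b y / y) (1 / r) + residue (\<lambda>y. y ^ k * half_weight b y / y) (- (1 / r))"
proof -
  let ?f = "\<lambda>y. y ^ k * half_weight b y / y" and ?S = "ball 0 (real q)" and ?p = "{0, 1 / r, - (1 / r)}"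
  have hol: "?f holomorphic_on ?S - ?p"
    by (intro holomorphic_intros half_weight_holo) (auto simp: norm_b)
  have w0: "winding_number (circlepath 0 1) z = 1" if "norm z < 1" for z :: complex using that by (simp add: winding_number_circlepath)
  have "contour_integral (circlepath 0 1) ?f = 2 * pi * \<i> * (\<Sum>p\<in>?p. winding_number (circlepath 0 1) p * residue ?f p)"
  proof (rule Residue_theorem[OF _ _ _ hol])
    show "path_image (circlepath 0 1) \<subseteq> ?S - ?p" using q_ge_2 ball_points(8) by (auto simp: sphere_def)
    show "\<forall>z. z \<notin> ?S \<longrightarrow> winding_number (circlepath 0 1) z = 0"
    proof (intro allI impI)
      fix z :: complex assume "z \<notin> ?S"
      then show "winding_number (circlepath 0 1) z = 0"
        using q_ge_2 by (intro winding_number_zero_outside[of _ "cball 0 1"]) (auto simp: valid_path_imp_path)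
    qed
  qed auto
  also have "(\<Sum>p\<in>?p. winding_number (circlepath 0 1) p * residue ?f p) = residue ?f 0 + residue ?f (1 / r) + residue ?f (- (1 / r))"
    using ball_points by (simp add: w0)
  finally have c: "contour_integral (circlepath 0 1) ?f = 2 * pi * \<i> * (residue ?f 0 + residue ?f (1 / r) + residue ?f (- (1 / r)))" .
  have "residue ?f 0 = residue (\<lambda>y. y ^ k * half_weight b y / (y - 0)) 0" by simp
  also have "\<dots> = 0 ^ k * half_weight b 0"
    by (rule residue_simple[of "- {b, - b, 1 / r, - (1 / r)}"])
      (use b_nz r_nz in \<open>auto intro!: holomorphic_intros half_weight_holo open_Compl finite_imp_closed\<close>)
  also have "\<dots> = of_bool (k = 0)" by (simp add: half_weight_def power_0_left)
  finally show ?thesis unfolding c by simp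
qed

lemma residue_half_weight_regular:
  assumes "z = r \<or> z = - r" shows "residue (\<lambda>y. y ^ k * half_weight b y / y) z = 0"
proof (rule residue_holo[of "- {0, b, - b, 1 / r, - (1 / r)}"])
  show "z \<in> - {0, b, - b, 1 / r, - (1 / r)}"
  proof -
    have n: "norm z = sqrt (real q)" "z \<noteq> 0" using assms r_nz by (auto simp: norm_r)
    have "norm (1 / r) \<noteq> sqrt (real q)" "norm b \<noteq> sqrt (real q)" using sqrt_q ball_points(8) by (auto simp: norm_b)
    then show ?thesis using n by (metis Compl_iff insert_iff empty_iff norm_minus_cancel)
  qed
qed (auto intro!: holomorphic_intros half_weight_holo open_Compl finite_imp_closed)

text \<open>Passing from the unit circle to the deformed contour removes the residues at \<open>\<plusminus>1/r\<close>,
  so that only the one at \<open>0\<close> remains.\<close>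

lemma U_integral_half_weight: "U_integral q (\<lambda>y. y ^ k * half_weight b y) = of_bool (k = 0)"
  unfolding U_integral_def Let_def r_def[symmetric] contour_monomial by (simp add: residue_half_weight_regular)

text \<open>On the circle \<open>y \<mapsto> 1 / y\<close> reflects the angle, and the circle
  parametrized by angles from \<open>- 2 * pi\<close> to 0 is the same path.\<close>

lemma contour_inversion:
  "contour_integral (circlepath 0 1) (\<lambda>y. h (1 / y) / y) = contour_integral (circlepath 0 1) (\<lambda>y. h y / y)"
proof -
  have c: "circlepath 0 1 = part_circlepath 0 1 (- 2 * pi) 0"
  proof
    fix x
    have "exp (2 * of_real pi * \<i> * of_real x - 2 * of_real pi * \<i>) = exp (2 * of_real pi * \<i> * of_real x)"
      by (simp add: exp_diff)
    then show "circlepath 0 1 x = part_circlepath 0 1 (- 2 * pi) 0 x"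
      by (simp add: circlepath part_circlepath_def linepath_def algebra_simps)
  qed
  have "contour_integral (circlepath 0 1) (\<lambda>y. h (1 / y) / y) = integral {0..2 * pi} (\<lambda>t. \<i> * h (1 / cis t))"
    unfolding circlepath_def by (subst contour_integral_part_circlepath_eq) (auto simp: mult.commute)
  also have "\<dots> = integral {- (2 * pi)..- 0} (\<lambda>t. \<i> * h (1 / cis (- t)))"
    using Henstock_Kurzweil_Integration.integral_reflect_real[of "2 * pi" 0 "\<lambda>t. \<i> * h (1 / cis t)"] by simp
  also have "\<dots> = integral {- 2 * pi..0} (\<lambda>t. \<i> * h (cis t))"
    by (simp add: divide_inverse)
  also have "\<dots> = contour_integral (circlepath 0 1) (\<lambda>y. h y / y)"
    unfolding c by (subst contour_integral_part_circlepath_eq) (auto simp: mult.commute)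
  finally show ?thesis .
qed

text \<open>Inversion exchanges \<open>s\<close> and \<open>1 / s\<close> and changes the sign of
  \<open>dy / y\<close>. Both residues are computed at simple poles; \<open>G\<close> is the part of
  the integrand that is regular at \<open>1 / s\<close>.\<close>

lemma residue_half_weight_pole:
  assumes s: "s = r \<or> s = - r"
  shows "residue (\<lambda>y. (1 / y) ^ k * half_weight b (1 / y) / y) s = - residue (\<lambda>y. y ^ k * half_weight b y / y) (1 / s)"
proof -
  define G where "G y = y ^ k * (1 - y\<^sup>2) / (1 - y\<^sup>2 / b\<^sup>2)" for y
  have ss: "s\<^sup>2 = b" "s \<noteq> 0" using s r_sq r_nz by auto
  have ns: "norm s = sqrt (real q)" using s by (auto simp: norm_r)
  have n1: "norm (1 / s) < 1" using ns sqrt_q by (simp add: norm_divide)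
  have ne: "1 / s \<noteq> b" "1 / s \<noteq> - b" "s \<noteq> 1 / b" "s \<noteq> - (1 / b)"
  proof -
    have "\<not> norm b < 1" "\<not> norm (- b) < 1" using q_ge_2 by (simp_all add: norm_b)
    then show "1 / s \<noteq> b" "1 / s \<noteq> - b" using n1 by auto
    have "norm (1 / b) < 1" using q_ge_2 by (simp add: norm_divide norm_b)
    then have "\<not> 1 < norm (1 / b)" "\<not> 1 < norm (- (1 / b))" by simp_all
    then show "s \<noteq> 1 / b" "s \<noteq> - (1 / b)" using ns sqrt_q by metis+
  qed
  have G_holo: "G holomorphic_on S" if "b \<notin> S" "- b \<notin> S" for S
    unfolding G_def using sq_factor(1) that by (intro holomorphic_intros) (auto simp: b_nz)
  have ss2: "1 / s \<noteq> - (1 / s)" "s \<noteq> - s" using ss(2) by (simp_all add: field_simps)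
  have "residue (\<lambda>y. y ^ k * half_weight b y / y) (1 / s) = residue (\<lambda>y. (- G y / (y * b * (y + 1 / s))) / (y - 1 / s)) (1 / s)"
  proof (rule residue_Sing_cong)
    fix y
    have "b * (y + 1 / s) * (y - 1 / s) = b * y\<^sup>2 - 1"
      using ss by (simp add: algebra_simps power2_eq_square) (simp add: ss(1)[symmetric] power2_eq_square)
    then have e: "(1 - b * y\<^sup>2) = - (b * (y + 1 / s) * (y - 1 / s))" by simp
    show "y ^ k * half_weight b y / y = (- G y / (y * b * (y + 1 / s))) / (y - 1 / s)"
      unfolding half_weight_def e G_def by (simp add: mult_ac)
  qed
  also have "\<dots> = - G (1 / s) / (1 / s * b * (1 / s + 1 / s))"
  proof (rule residue_simple[of "- {0, b, - b, - (1 / s)}"])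
    have "y + 1 / s \<noteq> 0" if "y \<noteq> - (1 / s)" for y using that by (metis add_eq_0_iff2)
    then show "(\<lambda>y. - G y / (y * b * (y + 1 / s))) holomorphic_on - {0, b, - b, - (1 / s)}"
      by (intro holomorphic_intros G_holo) (simp_all add: b_nz)
    show "1 / s \<in> - {0, b, - b, - (1 / s)}" using ne ss2 ss(2) by simp
  qed (auto intro!: open_Compl finite_imp_closed)
  also have "\<dots> = - G (1 / s) / 2" using ss b_nz by (simp add: field_simps power2_eq_square)
  finally have 1: "residue (\<lambda>y. y ^ k * half_weight b y / y) (1 / s) = - G (1 / s) / 2" .
  have "residue (\<lambda>y. (1 / y) ^ k * half_weight b (1 / y) / y) s = residue (\<lambda>y. (G (1 / y) * y / (y + s)) / (y - s)) s"
  proof (rule residue_Sing_cong)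
    fix y assume "y \<notin> Sing"
    then have y: "y \<noteq> 0" by (auto simp: Sing_def)
    have "y\<^sup>2 * (1 - b * (1 / y)\<^sup>2) = (y + s) * (y - s)"
    proof -
      have "y\<^sup>2 * (1 - b * (1 / y)\<^sup>2) = y\<^sup>2 - b * (y * (1 / y))\<^sup>2" by (simp only: right_diff_distrib power_mult_distrib mult_1_right mult.left_commute)
      also have "\<dots> = y\<^sup>2 - s\<^sup>2" using y ss by simp
      finally show ?thesis by (simp add: algebra_simps power2_eq_square)
    qed
    then have "1 - b * (1 / y)\<^sup>2 = (y + s) * (y - s) / y\<^sup>2"
      using y by (metis nonzero_mult_div_cancel_left power_not_zero)
    then show "(1 / y) ^ k * half_weight b (1 / y) / y = (G (1 / y) * y / (y + s)) / (y - s)"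
      unfolding half_weight_def G_def using y by (simp add: power2_eq_square mult_ac)
  qed
  also have "\<dots> = G (1 / s) * s / (s + s)"
  proof (rule residue_simple[of "- {0, 1 / b, - (1 / b), - s}"])
    have "(G \<circ> (\<lambda>y. 1 / y)) holomorphic_on - {0, 1 / b, - (1 / b), - s}"
    proof (rule holomorphic_on_compose)
      show "(\<lambda>y. 1 / y) holomorphic_on - {0, 1 / b, - (1 / b), - s}" by (auto intro!: holomorphic_intros)
      have "1 / y \<noteq> b" "1 / y \<noteq> - b" if "y \<in> - {0, 1 / b, - (1 / b), - s}" for y
        using that by (simp_all add: one_divide_eq_iff)
      then show "G holomorphic_on (\<lambda>y. 1 / y) ` (- {0, 1 / b, - (1 / b), - s})" by (intro G_holo) (metis imageE)+
    qed
    then show "(\<lambda>y. G (1 / y) * y / (y + s)) holomorphic_on - {0, 1 / b, - (1 / b), - s}"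
      by (intro holomorphic_intros) (auto simp: o_def add_eq_0_iff2)
  qed (use ne ss ss2 in \<open>auto intro!: open_Compl finite_imp_closed\<close>)
  also have "\<dots> = G (1 / s) / 2" using ss(2) by (simp add: field_simps)
  finally show ?thesis using 1 by simp
qed

lemma residue_half_weight_inverse_regular:
  assumes "z = 1 / r \<or> z = - (1 / r)" shows "residue (\<lambda>y. (1 / y) ^ k * half_weight b (1 / y) / y) z = 0"
proof (rule residue_holo[of "- {0, r, - r, 1 / b, - (1 / b)}"])
  have n: "norm z < 1" "z \<noteq> 0" using assms ball_points by auto
  have "\<not> norm r < 1" using sqrt_q by (simp add: norm_r)
  moreover have "norm z = 1 / sqrt (real q)" using assms by (auto simp: norm_divide norm_r)
  moreover have "norm (1 / b) \<noteq> 1 / sqrt (real q)" using sqrt_q by (simp add: norm_divide norm_b)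
  ultimately show "z \<in> - {0, r, - r, 1 / b, - (1 / b)}" using n by (metis Compl_iff insert_iff empty_iff norm_minus_cancel)
  let ?S = "- {0, r, - r, 1 / b, - (1 / b)}"
  have "(half_weight b \<circ> (\<lambda>y. 1 / y)) holomorphic_on ?S"
  proof (rule holomorphic_on_compose)
    show "(\<lambda>y. 1 / y) holomorphic_on ?S" by (auto intro!: holomorphic_intros)
    have "1 / y \<noteq> b" "1 / y \<noteq> - b" "1 / y \<noteq> 1 / r" "1 / y \<noteq> - (1 / r)" if "y \<in> ?S" for y
      using that by (simp_all add: Sing_def one_divide_eq_iff)
    then show "half_weight b holomorphic_on (\<lambda>y. 1 / y) ` ?S" by (intro half_weight_holo) (metis imageE)+
  qed
  then show "(\<lambda>y. (1 / y) ^ k * half_weight b (1 / y) / y) holomorphic_on ?S"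
    by (intro holomorphic_intros) (auto simp: o_def)
qed (auto intro!: open_Compl finite_imp_closed)

text \<open>The circle integral equals that of the uninverted integrand, and the residues added at
  \<open>r\<close> and \<open>- r\<close> cancel the contributions of \<open>1 / r\<close> and
  \<open>- (1 / r)\<close> to it.\<close>

lemma U_integral_half_weight_inverse: "U_integral q (\<lambda>y. (1 / y) ^ k * half_weight b (1 / y)) = of_bool (k = 0)"
proof -
  have "residue (\<lambda>y. (1 / y) ^ k * half_weight b (1 / y) / y) (- r) = - residue (\<lambda>y. y ^ k * half_weight b y / y) (- (1 / r))"
    using residue_half_weight_pole[of "- r" k] by simp
  then show ?thesis
    unfolding U_integral_def Let_def r_def[symmetric] contour_inversion[of "\<lambda>y. y ^ k * half_weight b y"] contour_monomial
    using residue_half_weight_pole[of r k] by (simp add: residue_half_weight_inverse_regular)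
qed


text \<open>This is \<open>macp_weyl\<close> divided by the denominators of the weight. The factor
  \<open>y - 1 / y\<close> can be cancelled unless \<open>y\<^sup>2 = 1\<close>, and in that case
  both sides vanish.\<close>

lemma macp_weight:
  assumes "y \<notin> Sing"
  shows "macp b n y * weight q y = y ^ Suc n * half_weight b y + (1 / y) ^ Suc n * half_weight b (1 / y)"
proof (cases "y\<^sup>2 = 1")
  case True
  then show ?thesis unfolding weight_eq half_weight_def by (simp add: power_one_over)
next
  case False
  have y: "y \<noteq> 0" using assms by (auto simp: Sing_def)
  define z where "z = 1 / y"
  have yz: "y * z = 1" using y by (simp add: z_def)
  have ne: "y - z \<noteq> 0"
  proof
    assume "y - z = 0"
    then have "y * y = y * z" by simp
    then show False using False yz by (simp add: power2_eq_square)
  qed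
  define A B where "A = (1 - z\<^sup>2 / b\<^sup>2) * (1 - b * z\<^sup>2)" and "B = (1 - y\<^sup>2 / b\<^sup>2) * (1 - b * y\<^sup>2)"
  have z_Sing: "z \<notin> Sing"
  proof
    assume "z \<in> Sing"
    then have "y = 1 / z" "z \<in> Sing" by (simp_all add: z_def)
    then show False using assms unfolding Sing_def by force
  qed
  have AB: "A \<noteq> 0" "B \<noteq> 0" using sq_factor[of y] sq_factor[of z] assms z_Sing by (auto simp: A_def B_def Sing_def)
  have w: "(y - z) * macp b n y = y ^ (n + 2) * A - z ^ (n + 2) * B"
    using macp_weyl[OF y b_nz, of n] by (simp add: A_def B_def z_def power_one_over)
  have e: "1 - y\<^sup>2 = - y * (y - z)" "1 - z\<^sup>2 = z * (y - z)"
    using yz by (simp_all add: algebra_simps power2_eq_square)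
  have "(y - z) * (macp b n y * weight q y) = (y ^ (n + 2) * A - z ^ (n + 2) * B) * (((1 - y\<^sup>2) / B) * ((1 - z\<^sup>2) / A))"
    unfolding w[symmetric] unfolding weight_eq half_weight_def A_def B_def z_def b_def[symmetric] by simp
  also have "\<dots> = (1 - z\<^sup>2) * (y ^ (n + 2) * ((1 - y\<^sup>2) / B)) - (1 - y\<^sup>2) * (z ^ (n + 2) * ((1 - z\<^sup>2) / A))"
    using AB by (simp add: field_simps)
  also have "\<dots> = (y - z) * ((y * z) * (y ^ Suc n * ((1 - y\<^sup>2) / B)) + (y * z) * (z ^ Suc n * ((1 - z\<^sup>2) / A)))"
  proof -
    have "z * (y - z) * (y ^ (n + 2) * s) - - y * (y - z) * (z ^ (n + 2) * t) = (y - z) * ((y * z) * (y ^ Suc n * s) + (y * z) * (z ^ Suc n * t))" for s t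
      by (simp add: algebra_simps)
    then show ?thesis using e by metis
  qed
  finally show ?thesis using ne yz unfolding half_weight_def A_def B_def z_def by simp
qed

lemma half_weight_power_holo:
  "(\<lambda>y. y ^ k * half_weight b y) holomorphic_on - Sing"
  "(\<lambda>y. (1 / y) ^ k * half_weight b (1 / y)) holomorphic_on - Sing"
proof -
  show "(\<lambda>y. y ^ k * half_weight b y) holomorphic_on - Sing" by (intro holomorphic_intros half_weight_holo_Sing)
  show "(\<lambda>y. (1 / y) ^ k * half_weight b (1 / y)) holomorphic_on - Sing"
    by (rule holomorphic_on_mult[OF _ half_weight_inverse_holo]) (auto intro!: holomorphic_intros simp: Sing_def)
qed

lemma macp_holo: "macp b n holomorphic_on - Sing"
proof (induction n rule: less_induct)
  case (less n)
  consider "n = 0" | "n = Suc 0" | k where "n = Suc (Suc k)" by (metis old.nat.exhaust)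
  then show ?case
  proof cases
    case 1
    then show ?thesis by (auto intro!: holomorphic_intros simp: Sing_def)
  next
    case 2
    then show ?thesis by (auto intro!: holomorphic_intros simp: Sing_def)
  next
    case 3
    have "(\<lambda>y. (y + 1 / y) * macp b (Suc k) y - macp b k y) holomorphic_on - Sing"
      using less[of k] less[of "Suc k"] 3 by (auto intro!: holomorphic_intros simp: Sing_def)
    then show ?thesis by (simp add: 3 fun_eq_iff[symmetric])
  qed
qed

text \<open>By \<open>macp_weight\<close> the integral splits into two half-weight integrals with
  exponents \<open>n + 1 + j\<close> and \<open>n + 1 - j\<close>; each contributes only if its
  exponent is 0.\<close>

lemma U_integral_monomial_macp:
  assumes j: "\<bar>j\<bar> \<le> int (Suc n)"
  shows "U_integral q (\<lambda>y. y powi j * (macp b n y * weight q y)) = of_bool (\<bar>j\<bar> = int (Suc n))"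
proof -
  define k l where "k = nat (int (Suc n) + j)" and "l = nat (int (Suc n) - j)"
  have "U_integral q (\<lambda>y. y powi j * (macp b n y * weight q y))
      = U_integral q (\<lambda>y. y ^ k * half_weight b y + (1 / y) ^ l * half_weight b (1 / y))"
  proof (rule U_integral_cong)
    fix y assume y: "y \<notin> Sing"
    then have y0: "y \<noteq> 0" by (auto simp: Sing_def)
    have "y powi j * y ^ Suc n = y powi (j + int (Suc n))" using y0 by (simp add: power_int_add del: of_nat_Suc)
    also have "\<dots> = y ^ k" using j by (simp add: k_def power_int_def add.commute)
    finally have 1: "y powi j * y ^ Suc n = y ^ k" .
    have "y powi j * (1 / y) ^ Suc n = y powi (j - int (Suc n))" using y0 by (simp add: power_int_diff power_one_over divide_inverse power_inverse del: of_nat_Suc)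
    also have "\<dots> = (1 / y) ^ l"
    proof -
      have "j - int (Suc n) = - int l" using j by (simp add: l_def)
      then show ?thesis by (simp add: power_int_minus power_one_over divide_inverse power_inverse)
    qed
    finally have 2: "y powi j * (1 / y) ^ Suc n = (1 / y) ^ l" .
    show "y powi j * (macp b n y * weight q y) = y ^ k * half_weight b y + (1 / y) ^ l * half_weight b (1 / y)"
      unfolding macp_weight[OF y] distrib_left mult.assoc[symmetric] 1 2 ..
  qed
  also have "\<dots> = of_bool (k = 0) + of_bool (l = 0)"
    by (simp add: U_integral_add half_weight_power_holo U_integral_half_weight U_integral_half_weight_inverse del: of_bool_eq)
  also have "\<dots> = of_bool (\<bar>j\<bar> = int (Suc n))" using j by (auto simp: k_def l_def)
  finally show ?thesis .
qed

lemma U_integral_symdeg_macp: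
  assumes F: "symdeg n F"
  shows "U_integral q (\<lambda>y. F y * (macp b n y * weight q y)) = 0"
proof -
  obtain c where c: "\<And>y. y \<noteq> 0 \<Longrightarrow> F y = (\<Sum>j\<in>{- int n..int n}. c j * y powi j)" using F unfolding symdeg_def by blast
  have hol: "(\<lambda>y. y powi j * (macp b n y * weight q y)) holomorphic_on - Sing" for j
    by (intro holomorphic_on_mult powi_holo macp_holo weight_holo)
  have "U_integral q (\<lambda>y. F y * (macp b n y * weight q y))
    = U_integral q (\<lambda>y. \<Sum>j\<in>{- int n..int n}. c j * (y powi j * (macp b n y * weight q y)))"
    by (rule U_integral_cong) (auto simp: c Sing_def sum_distrib_right mult.assoc)
  also have "\<dots> = (\<Sum>j\<in>{- int n..int n}. c j * U_integral q (\<lambda>y. y powi j * (macp b n y * weight q y)))"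
    by (subst U_integral_sum) (auto intro: holomorphic_on_mult[OF holomorphic_on_const] hol simp: U_integral_cmult[OF hol])
  also have "\<dots> = 0" by (intro sum.neutral) (auto simp: U_integral_monomial_macp)
  finally show ?thesis .
qed

text \<open>One factor is replaced by its two extreme monomials; the rest has degree at most
  \<open>n\<close> and is orthogonal to the other factor.\<close>

lemma U_integral_macp_sq: "U_integral q (\<lambda>y. macp b n y * (macp b n y * weight q y)) = 2 * macp_lead b n"
proof -
  let ?W = "\<lambda>y. macp b n y * weight q y"
  define N where "N = int (Suc n)"
  define R where "R y = macp b n y - macp_lead b n * (y powi N + y powi (- N))" for y
  have W: "(\<lambda>y. y powi j * ?W y) holomorphic_on - Sing" for j
    by (intro holomorphic_on_mult powi_holo macp_holo weight_holo)
  have RW: "(\<lambda>y. R y * ?W y) holomorphic_on - Sing" unfolding R_def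
    by (intro holomorphic_on_mult holomorphic_on_diff holomorphic_on_add holomorphic_on_const powi_holo macp_holo weight_holo)
  have "(\<lambda>y. macp b n y * ?W y) = (\<lambda>y. R y * ?W y + (macp_lead b n * (y powi N * ?W y) + macp_lead b n * (y powi (- N) * ?W y)))"
    by (simp add: R_def algebra_simps fun_eq_iff)
  then have "U_integral q (\<lambda>y. macp b n y * ?W y) = U_integral q (\<lambda>y. R y * ?W y)
     + (macp_lead b n * U_integral q (\<lambda>y. y powi N * ?W y) + macp_lead b n * U_integral q (\<lambda>y. y powi (- N) * ?W y))"
    using U_integral_add[OF RW holomorphic_on_add[OF holomorphic_on_mult[OF holomorphic_on_const W] holomorphic_on_mult[OF holomorphic_on_const W]]]
      U_integral_add[OF holomorphic_on_mult[OF holomorphic_on_const W] holomorphic_on_mult[OF holomorphic_on_const W]] U_integral_cmult[OF W]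
    by simp
  moreover have "U_integral q (\<lambda>y. R y * ?W y) = 0"
    using U_integral_symdeg_macp[OF macp_leading[of n b]] by (simp add: R_def N_def)
  ultimately show ?thesis by (simp add: U_integral_monomial_macp N_def)
qed

text \<open>The identity is the Weyl-type formula read at \<open>n = - 1\<close>, where the
  polynomial becomes \<open>b - 1 / b ^ 3 - macp b 1 y / b\<close>. The constant is thus expressed
  through both half weights and \<open>macp b 1\<close>, which is orthogonal to it.\<close>

lemma U_integral_weight: "(b - 1 / b ^ 3) * U_integral q (weight q) = 2"
proof -
  have "U_integral q (\<lambda>y. (b - 1 / b ^ 3) * weight q y)
     = U_integral q (\<lambda>y. (y ^ 0 * half_weight b y + (1 / y) ^ 0 * half_weight b (1 / y)) + 1 / b * (macp b 1 y * weight q y))"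
  proof (rule U_integral_cong)
    fix y assume "y \<notin> Sing"
    then have y: "y \<noteq> 0" "b \<noteq> y" by (auto simp: Sing_def)
    define z where "z = 1 / y"
    have yz: "y * z = 1" using y by (simp add: z_def)
    define c where "c = 1 / b"
    have bc: "b * c = 1" using b_nz by (simp add: c_def)
    have z_Sing: "z \<notin> Sing"
    proof
      assume "z \<in> Sing"
      then have "y = 1 / z" "z \<in> Sing" by (simp_all add: z_def)
      then show False using \<open>y \<notin> Sing\<close> unfolding Sing_def by force
    qed
    define A B where "A = (1 - z\<^sup>2 / b\<^sup>2) * (1 - b * z\<^sup>2)" and "B = (1 - y\<^sup>2 / b\<^sup>2) * (1 - b * y\<^sup>2)"
    have AB: "A \<noteq> 0" "B \<noteq> 0" using sq_factor[of y] sq_factor[of z] \<open>y \<notin> Sing\<close> z_Sing by (auto simp: A_def B_def Sing_def)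
    have A: "A = 1 - (c\<^sup>2 + b) * z\<^sup>2 + c * (b * c) * z ^ 4" and B: "B = 1 - (c\<^sup>2 + b) * y\<^sup>2 + c * (b * c) * y ^ 4"
      by (simp_all add: A_def B_def c_def divide_inverse power_inverse algebra_simps power2_eq_square power4_eq_xxxx)
    have m: "macp b 1 y = y\<^sup>2 + z\<^sup>2 + 1 - (c\<^sup>2 + b) - c" by (simp add: z_def c_def power_one_over)
    \<comment> \<open>After clearing denominators this is a polynomial identity modulo the relations
      \<open>y * z = 1\<close> and \<open>b * c = 1\<close>.\<close>
    have *: "(b - c ^ 3) * ((1 - y\<^sup>2) * (1 - z\<^sup>2)) = (1 - y\<^sup>2) * A + (1 - z\<^sup>2) * B + c * (macp b 1 y * ((1 - y\<^sup>2) * (1 - z\<^sup>2)))"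
    proof -
      define s t where "s = y\<^sup>2" and "t = z\<^sup>2"
      have st: "s * t = 1" "s * (t * w) = w" for w
        using yz by (simp_all add: s_def t_def power_mult_distrib[symmetric] mult.assoc[symmetric])
      have bc': "b * (c * w) = w" "c * (b * w) = w" "c * (w * b) = w" "c * (w * (v * b)) = w * v" for v w
        using bc by (simp_all add: mult_ac)
      have p: "z ^ 4 = t * t" "y ^ 4 = s * s" by (simp_all add: s_def t_def power2_eq_square power4_eq_xxxx)
      show ?thesis unfolding A B m p s_def[symmetric] t_def[symmetric]
        by (simp add: algebra_simps st bc bc' power2_eq_square power3_eq_cube)
    qed
    then have "(b - c ^ 3) * (((1 - y\<^sup>2) / B) * ((1 - z\<^sup>2) / A)) = (1 - y\<^sup>2) / B + (1 - z\<^sup>2) / A + c * (macp b 1 y * (((1 - y\<^sup>2) / B) * ((1 - z\<^sup>2) / A)))"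
    proof -
      have "D * ((S / B) * (T / A)) = S / B + T / A + c * (M * ((S / B) * (T / A)))" if "D * (S * T) = S * A + T * B + c * (M * (S * T))" for D S T M
      proof -
        have "D * ((S / B) * (T / A)) = (D * (S * T)) / (A * B)" by simp
        also have "\<dots> = S / B + T / A + c * (M * ((S / B) * (T / A)))"
          unfolding that add_divide_distrib using AB by simp
        finally show ?thesis .
      qed
      then show ?thesis using * by blast
    qed
    then show "(b - 1 / b ^ 3) * weight q y = (y ^ 0 * half_weight b y + (1 / y) ^ 0 * half_weight b (1 / y)) + 1 / b * (macp b 1 y * weight q y)"
      unfolding weight_eq half_weight_def A_def B_def z_def c_def b_def[symmetric] by (simp add: power_one_over)
  qed
  also have "\<dots> = 2"
  proof -
    have h: "(\<lambda>y. macp b 1 y * weight q y) holomorphic_on - Sing" by (intro holomorphic_on_mult macp_holo weight_holo)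
    have "U_integral q (\<lambda>y. macp b 1 y * weight q y) = 0"
      using U_integral_monomial_macp[of 0 1] by simp
    then show ?thesis
      unfolding U_integral_add[OF holomorphic_on_add[OF half_weight_power_holo] holomorphic_on_mult[OF holomorphic_on_const h]]
        U_integral_add[OF half_weight_power_holo] U_integral_cmult[OF h] U_integral_half_weight U_integral_half_weight_inverse by simp
  qed
  finally show ?thesis by (simp add: U_integral_cmult[OF weight_holo])
qed

end

lemma symdeg_macp: "symdeg (Suc n) (macp b n)"
proof -
  obtain c where c: "\<And>y. y \<noteq> 0 \<Longrightarrow> macp b n y - macp_lead b n * (y powi int (Suc n) + y powi (- int (Suc n))) = (\<Sum>j\<in>{- int n..int n}. c j * y powi j)"
    using macp_leading[of n b] unfolding symdeg_def by blast
  have "symdeg (Suc n) (\<lambda>y. (\<Sum>j\<in>{- int n..int n}. c j * y powi j) + (macp_lead b n * y powi int (Suc n) + macp_lead b n * y powi (- int (Suc n))))"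
    by (intro symdeg_add symdeg_sum symdeg_monom) auto
  then show ?thesis
  proof (rule symdeg_cong)
    fix y :: complex assume "y \<noteq> 0"
    then show "(\<Sum>j\<in>{- int n..int n}. c j * y powi j) + (macp_lead b n * y powi int (Suc n) + macp_lead b n * y powi (- int (Suc n))) = macp b n y"
      using c[of y] by (metis distrib_left diff_add_cancel)
  qed
qed

lemma symdeg_mono: "symdeg k F \<Longrightarrow> k \<le> l \<Longrightarrow> symdeg l F"
  by (rule symdeg_lift[of k F l "\<lambda>y. 1"]) (use symdeg_monom[of _ l 1] in auto)

lemma macp_inverse: "y \<noteq> 0 \<Longrightarrow> macp b n (inverse y) = macp b n y"
proof (induction n rule: less_induct)
  case (less n)
  consider "n = 0" | "n = Suc 0" | k where "n = Suc (Suc k)" by (metis old.nat.exhaust)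
  then show ?case
    by cases (use less in \<open>simp_all add: divide_inverse power_inverse add.commute\<close>)
qed

lemma cnj_macp: "cnj (macp b n y) = macp (cnj b) n (cnj y)"
proof (induction n rule: less_induct)
  case (less n)
  consider "n = 0" | "n = Suc 0" | k where "n = Suc (Suc k)" by (metis old.nat.exhaust)
  then show ?case
    by cases (use less in simp_all)
qed

section \<open>An orthogonal basis and the inner product\<close>

context weight_contour
begin

text \<open>The shift of the index leaves 0 for the constant, which belongs to the orbits of odd
  size.\<close>

definition basis_poly :: "nat \<Rightarrow> complex \<Rightarrow> complex" where
  "basis_poly i y = (case i of 0 \<Rightarrow> 1 | Suc n \<Rightarrow> macp b n y)"

definition basis_norm :: "nat \<Rightarrow> complex" where
  "basis_norm i = (case i of 0 \<Rightarrow> 2 / (b - 1 / b ^ 3) | Suc n \<Rightarrow> 2 * macp_lead b n)"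

lemma basis_holo: "basis_poly i holomorphic_on - Sing"
  by (cases i) (simp_all add: basis_poly_def[abs_def] macp_holo)

lemma b_diff_nz: "b - 1 / b ^ 3 \<noteq> 0"
proof
  assume "b - 1 / b ^ 3 = 0"
  then have "b ^ 4 = 1" using b_nz by (simp add: field_simps power4_eq_xxxx power3_eq_cube)
  then have "q ^ 4 = 1" unfolding b_def by (metis of_nat_1 of_nat_eq_iff of_nat_power)
  then show False using q_ge_2 by (simp add: power_eq_1_iff)
qed

text \<open>By symmetry the larger index may be taken for the second factor \<open>macp b n\<close>;
  the first then has degree at most \<open>n\<close>, and \<open>U_integral_symdeg_macp\<close>
  applies.\<close>

lemma U_integral_basis:
  "U_integral q (\<lambda>y. basis_poly i y * (basis_poly j y * weight q y)) = (if i = j then basis_norm i else 0)"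
proof (induction i j rule: linorder_wlog)
  case (le i j)
  show ?case
  proof (cases j)
    case 0
    then have "i = 0" using le by simp
    then show ?thesis using 0 U_integral_weight b_diff_nz
      by (simp add: basis_poly_def basis_norm_def field_simps)
  next
    case (Suc n)
    show ?thesis
    proof (cases "i = j")
      case True
      then show ?thesis using Suc U_integral_macp_sq[of n] by (simp add: basis_poly_def basis_norm_def)
    next
      case False
      have "symdeg n (basis_poly i)"
      proof (cases i)
        case 0
        then show ?thesis using symdeg_monom[of 0 n 1] by (simp add: basis_poly_def[abs_def])
      next
        case (Suc m)
        then show ?thesis using symdeg_mono[OF symdeg_macp[of m b], of n] False le \<open>j = Suc n\<close>
          by (simp add: basis_poly_def[abs_def])
      qed
      then show ?thesis using False Suc U_integral_symdeg_macp[of n "basis_poly i"] by (simp add: basis_poly_def)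
    qed
  qed
next
  case (sym i j)
  then show ?case by (simp add: mult.left_commute[of "basis_poly j _"])
qed

text \<open>The polynomials have real coefficients and are invariant under inversion, so the
  conjugation in the inner product leaves them unchanged.\<close>

lemma basis_poly_conj: "y \<noteq> 0 \<Longrightarrow> cnj (basis_poly i (inverse (cnj y))) = basis_poly i y"
  by (cases i) (simp_all add: basis_poly_def cnj_macp b_def macp_inverse)

lemma integral_unit_character:
  "((\<lambda>t. (of_nat q powr (\<i> * of_real t)) powi m) has_integral (if m = 0 then of_real (2 * pi / ln (real q)) else 0))
     {0..2 * pi / ln (real q)}"
proof (cases "m = 0")
  case True
  have "0 \<le> 2 * pi / ln (real q)" using q_ge_2 by simp
  then show ?thesis using True has_integral_const_real[of "1 :: complex" 0 "2 * pi / ln (real q)"]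
    by (simp add: scaleR_conv_of_real)
next
  case False
  define l where "l = ln (real q)"
  have l: "l > 0" using q_ge_2 by (simp add: l_def)
  define c where "c = \<i> * of_int m * of_real l"
  have c: "c \<noteq> 0" using False l by (simp add: c_def)
  have e: "(of_nat q powr (\<i> * of_real t)) powi m = exp (c * of_real t)" for t
  proof -
    have "of_nat q powr (\<i> * of_real t) = exp (\<i> * of_real t * of_real l)"
      using q_ge_2 by (simp add: powr_def l_def Ln_of_nat)
    then show ?thesis by (simp add: exp_power_int c_def mult_ac)
  qed
  have "((\<lambda>t. exp (c * of_real t)) has_integral (exp (c * of_real (2 * pi / l)) / c - exp (c * of_real 0) / c)) {0..2 * pi / l}"
  proof (rule fundamental_theorem_of_calculus)
    show "0 \<le> 2 * pi / l" using l by simp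
    fix t assume "t \<in> {0..2 * pi / l}"
    have "((\<lambda>z. exp (c * z) / c) has_field_derivative exp (c * of_real t)) (at (of_real t))"
      by (auto intro!: derivative_eq_intros simp: c)
    then show "((\<lambda>t. exp (c * of_real t) / c) has_vector_derivative exp (c * of_real t)) (at t within {0..2 * pi / l})"
      by (rule has_vector_derivative_real_field[THEN has_vector_derivative_at_within])
  qed
  moreover have "exp (c * of_real (2 * pi / l)) = 1"
  proof -
    have "c * of_real (2 * pi / l) = 2 * of_int m * of_real pi * \<i>" using l by (simp add: c_def)
    then show ?thesis using exp_integer_2pi[of "of_int m"] by (simp add: mult.assoc)
  qed
  ultimately show ?thesis using False unfolding e l_def[symmetric] by simp
qed

text \<open>Characters of the circle separate the exponents of \<open>u\<close>, and orthogonality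
  in \<open>y\<close> separates the indices. The second argument is a single term because it will be
  the transform of one orbit.\<close>

lemma inner_product_basis:
  assumes I: "finite I"
    and f: "\<And>u y. u \<noteq> 0 \<Longrightarrow> y \<noteq> 0 \<Longrightarrow> leval f u y = (\<Sum>k\<in>I. a k * u powi e k * basis_poly (i k) y)"
    and g: "\<And>u y. u \<noteq> 0 \<Longrightarrow> y \<noteq> 0 \<Longrightarrow> leval g u y = of_real d * u powi e0 * basis_poly i0 y"
  shows "inner_product q f g = of_real ((1 + real q powi (-2))\<^sup>2 / (2 * (1 - real q powi (-1)))) * of_real d * basis_norm i0
     * (\<Sum>k\<in>I. if e k = e0 \<and> i k = i0 then a k else 0)"
proof -
  define l where "l = 2 * pi / ln (real q)"
  have l: "l > 0" using q_ge_2 by (simp add: l_def)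
  let ?u = "\<lambda>t. of_nat q powr (\<i> * of_real t) :: complex"
  have U: "U_integral q (\<lambda>y. leval f u y * leval (lconj g) u y * weight q y)
      = (\<Sum>k\<in>I. a k * of_real d * (if i k = i0 then basis_norm i0 else 0) * u powi (e k - e0))" if u: "u \<noteq> 0" for u
  proof -
    let ?c = "\<lambda>k. a k * of_real d * u powi (e k - e0)"
    have hol: "(\<lambda>y. basis_poly j y * (basis_poly i0 y * weight q y)) holomorphic_on - Sing" for j
      by (intro holomorphic_on_mult basis_holo weight_holo)
    have "U_integral q (\<lambda>y. leval f u y * leval (lconj g) u y * weight q y)
        = U_integral q (\<lambda>y. \<Sum>k\<in>I. ?c k * (basis_poly (i k) y * (basis_poly i0 y * weight q y)))"
    proof (rule U_integral_cong)
      fix y assume "y \<notin> Sing"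
      then have y: "y \<noteq> 0" by (auto simp: Sing_def)
      have c: "cnj (inverse (cnj u) powi e0) = u powi (- e0)" by (simp add: power_int_def)
      have "leval (lconj g) u y = of_real d * u powi (- e0) * basis_poly i0 y"
        using u y by (simp only: leval_lconj g inverse_nonzero_iff_nonzero complex_cnj_zero_iff not_False_eq_True complex_cnj_mult c basis_poly_conj complex_cnj_complex_of_real)
      then show "leval f u y * leval (lconj g) u y * weight q y = (\<Sum>k\<in>I. ?c k * (basis_poly (i k) y * (basis_poly i0 y * weight q y)))"
        using u y by (simp add: f sum_distrib_right sum_distrib_left power_int_diff power_int_minus divide_inverse mult_ac)
    qed
    also have "\<dots> = (\<Sum>k\<in>I. ?c k * (if i k = i0 then basis_norm (i k) else 0))"
      by (subst U_integral_sum[OF I]) (auto intro: holomorphic_on_mult[OF holomorphic_on_const] hol simp: U_integral_cmult[OF hol] U_integral_basis)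
    also have "\<dots> = (\<Sum>k\<in>I. a k * of_real d * (if i k = i0 then basis_norm i0 else 0) * u powi (e k - e0))"
      by (intro sum.cong refl) auto
    finally show ?thesis .
  qed
  have "((\<lambda>t. \<Sum>k\<in>I. a k * of_real d * (if i k = i0 then basis_norm i0 else 0) * ?u t powi (e k - e0)) has_integral
     (\<Sum>k\<in>I. a k * of_real d * (if i k = i0 then basis_norm i0 else 0) * (if e k - e0 = 0 then of_real l else 0))) {0..l}"
    unfolding l_def by (intro has_integral_sum I has_integral_mult_right integral_unit_character)
  then have "integral {0..l} (\<lambda>t. \<Sum>k\<in>I. a k * of_real d * (if i k = i0 then basis_norm i0 else 0) * ?u t powi (e k - e0))
      = (\<Sum>k\<in>I. a k * of_real d * (if i k = i0 then basis_norm i0 else 0) * (if e k - e0 = 0 then of_real l else 0))"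
    by (rule integral_unique)
  also have "\<dots> = of_real l * of_real d * basis_norm i0 * (\<Sum>k\<in>I. if e k = e0 \<and> i k = i0 then a k else 0)"
    unfolding sum_distrib_left by (intro sum.cong refl) auto
  finally have int: "integral {0..l} (\<lambda>t. \<Sum>k\<in>I. a k * of_real d * (if i k = i0 then basis_norm i0 else 0) * ?u t powi (e k - e0))
     = of_real l * of_real d * basis_norm i0 * (\<Sum>k\<in>I. if e k = e0 \<and> i k = i0 then a k else 0)" .
  have u0: "?u t \<noteq> 0" for t using q_ge_2 by simp
  \<comment> \<open>The length of the interval cancels the normalization factor of the integration
    over \<open>T\<close>.\<close>
  have ll: "of_real (ln (real q) / (2 * pi)) * of_real l = (1 :: complex)"
    using q_ge_2 unfolding of_real_mult[symmetric] l_def by simp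
  show ?thesis unfolding inner_product_def Let_def U[OF u0] l_def[symmetric] int
    using ll unfolding of_real_mult by (metis (no_types, lifting) mult.assoc mult_1)
qed

end

section \<open>The spherical transform\<close>

text \<open>The change from the variables of \<open>\<omega>\<close> to those of \<open>Psi\<close>
  is of this monomial kind.\<close>

lemma laurent_monomial_substitution:
  assumes F: "laurent F" and ab: "a \<noteq> 0" "b \<noteq> 0"
  shows "laurent (\<lambda>u v. F (a * u powi i * v powi j) (b * u powi k * v powi l))"
proof -
  obtain L where L: "\<And>u v. u \<noteq> 0 \<Longrightarrow> v \<noteq> 0 \<Longrightarrow> leval L u v = F u v"
    using F unfolding laurent_def by blast
  let ?c = "\<lambda>m. Poly_Mapping.lookup L m * a powi fst m * b powi snd m"
  have "laurent (\<lambda>u v. \<Sum>m\<in>Poly_Mapping.keys L. ?c m * u powi (i * fst m + k * snd m) * v powi (j * fst m + l * snd m))"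
    by (intro laurent_sum laurent_monom finite_keys)
  then show ?thesis
  proof (rule laurent_cong)
    fix u v :: complex assume uv: "u \<noteq> 0" "v \<noteq> 0"
    have "F (a * u powi i * v powi j) (b * u powi k * v powi l) = leval L (a * u powi i * v powi j) (b * u powi k * v powi l)"
      using L uv ab by simp
    also have "\<dots> = (\<Sum>m\<in>Poly_Mapping.keys L. ?c m * u powi (i * fst m + k * snd m) * v powi (j * fst m + l * snd m))"
      unfolding leval_def case_prod_beta prod.collapse using uv
      by (intro sum.cong refl) (simp add: power_int_add power_int_mult power_int_mult_distrib mult_ac)
    finally show "(\<Sum>m\<in>Poly_Mapping.keys L. ?c m * u powi (i * fst m + k * snd m) * v powi (j * fst m + l * snd m))
        = F (a * u powi i * v powi j) (b * u powi k * v powi l)" by simp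
  qed
qed

lemma powr_surj:
  assumes "q > (1 :: real)" "w \<noteq> 0" obtains s where "complex_of_real q powr s = w"
proof
  have "Ln (complex_of_real q) = of_real (ln q)" using assms by (simp add: Ln_of_real)
  moreover have "ln q \<noteq> 0" using assms by simp
  ultimately show "complex_of_real q powr (Ln w / Ln (complex_of_real q)) = w" using assms by (simp add: powr_def)
qed

context haar_quaternion
begin

section \<open>Uniqueness of the continued spherical function\<close>

lemma card_cq: "of_nat (residue_card av \<pi>) = cq"
  by (simp add: cq_def q_def)

lemma cq_surj: assumes "w \<noteq> 0" obtains s where "cq powr s = w"
  using powr_surj[OF q_gt_1 assms] unfolding cq_def by blast

lemma norm_cq_powr: "norm (cq powr s) = q powr Re s"
  using q_gt_1 by (simp add: cq_def norm_powr_real_powr)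

lemma cq_powr_nonzero: "cq powr s \<noteq> 0"
  by simp

lemma infinite_real_image: "infinite (complex_of_real ` {0<..})" "infinite (complex_of_real ` {..<0})" "infinite (complex_of_real ` {1..})"
  by (auto simp: finite_image_iff inj_on_def infinite_Ici infinite_Ioi infinite_Iio)

text \<open>Both fractions represent the same integral where the real parts of \<open>s1\<close> and
  \<open>s2\<close> are nonnegative; the real points \<open>u \<ge> 1\<close>,
  \<open>v \<ge> 1\<close> of this region already determine a Laurent polynomial.\<close>

lemma omega_fraction_unique:
  assumes fr: "omega_fraction av \<pi> \<iota> star \<kappa> x P Q" "omega_fraction av \<pi> \<iota> star \<kappa> x P' Q'"
    and uv: "u \<noteq> 0" "v \<noteq> 0"
  shows "leval P u v * leval Q' u v = leval P' u v * leval Q u v"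
proof -
  obtain L M where L: "\<And>u v. u \<noteq> 0 \<Longrightarrow> v \<noteq> 0 \<Longrightarrow> leval L u v = leval P u v * leval Q' u v"
    and M: "\<And>u v. u \<noteq> 0 \<Longrightarrow> v \<noteq> 0 \<Longrightarrow> leval M u v = leval P' u v * leval Q u v"
    using laurent_mult[OF laurent_leval laurent_leval, of P Q'] laurent_mult[OF laurent_leval laurent_leval, of P' Q]
    unfolding laurent_def by metis
  have "L = M"
  proof (rule laurent_poly_unique[OF infinite_real_image(3) _ infinite_real_image(3)])
    fix u v assume "u \<in> complex_of_real ` {1..}" "v \<in> complex_of_real ` {1..}"
    then obtain t t' where t: "u = of_real t" "t \<ge> 1" "v = of_real t'" "t' \<ge> 1" by auto
    then have uv: "u \<noteq> 0" "v \<noteq> 0" by auto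
    obtain s1 s2 where s: "cq powr s1 = u" "cq powr s2 = v" using cq_surj uv by metis
    have "q powr Re s1 \<ge> q powr 0" "q powr Re s2 \<ge> q powr 0"
      unfolding norm_cq_powr[symmetric] s using t q_gt_1 by simp_all
    then have "Re s1 \<ge> 0" "Re s2 \<ge> 0" using q_gt_1 by (metis powr_le_cancel_iff)+
    then have "leval Q u v * omega_int av \<iota> star \<kappa> x s1 s2 = leval P u v" "leval Q' u v * omega_int av \<iota> star \<kappa> x s1 s2 = leval P' u v"
      using fr s unfolding omega_fraction_def Let_def card_cq by auto
    then show "leval L u v = leval M u v" unfolding L[OF uv] M[OF uv] by (metis mult.assoc mult.commute)
  qed auto
  then show ?thesis using L M uv by metis
qed

text \<open>Where \<open>1 - q\<^sup>-\<^sup>1\<^sup>-\<^sup>s\<close> with \<open>s = s\<^sub>1\<close> vanishes, so does the factor \<open>q\<^bsup>z\<^sub>2\<^esup> - q\<^bsup>z\<^sub>1+1\<^esup>\<close>; if \<open>\<omega>\<close> is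
  regular at such a point, then the numerator vanishes there as well.\<close>

lemma Psi_from_numerator:
  assumes N: "laurent N"
    and om: "\<And>s1 s2. Re s1 \<ge> 0 \<Longrightarrow> (1 - inverse (cq powr s1) / cq) * omega_int av \<iota> star \<kappa> x s1 s2 = N (cq powr s1) (cq powr s2)"
    and uv: "u \<noteq> 0" "v \<noteq> 0"
  shows "leval (Psi av \<pi> \<iota> star \<kappa> x) u v = v * N (v / (u * cq\<^sup>2)) (cq / v)"
proof -
  obtain P where P: "\<And>u v. u \<noteq> 0 \<Longrightarrow> v \<noteq> 0 \<Longrightarrow> leval P u v = N u v" using N unfolding laurent_def by blast
  obtain Q where Q: "\<And>u v. u \<noteq> 0 \<Longrightarrow> v \<noteq> 0 \<Longrightarrow> leval Q u v = 1 - inverse u / cq"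
    using laurent_cong[OF laurent_add[OF laurent_const[of 1] laurent_monom[of "- (1 / cq)" "-1" 0]], of "\<lambda>u v. 1 - inverse u / cq"]
    unfolding laurent_def by (auto simp: power_int_minus divide_inverse mult.commute)
  have "leval Q (- 1) 1 = 1 + 1 / cq" using Q[of "-1" 1] by (simp add: divide_inverse)
  moreover have "1 + 1 / cq \<noteq> 0"
  proof -
    have "1 + 1 / cq = complex_of_real (1 + 1 / q)" by (simp add: cq_def)
    moreover have "1 + 1 / q > 0" using q_pos by (simp add: add_pos_pos)
    ultimately show ?thesis by (metis less_irrefl of_real_eq_0_iff)
  qed
  ultimately have Q0: "Q \<noteq> 0" by auto
  have fr: "omega_fraction av \<pi> \<iota> star \<kappa> x P Q"
    unfolding omega_fraction_def Let_def card_cq using Q0 om by (simp add: P Q)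
  obtain L where L: "\<And>u v. u \<noteq> 0 \<Longrightarrow> v \<noteq> 0 \<Longrightarrow> leval L u v = v * N (v / (u * cq\<^sup>2)) (cq / v)"
  proof -
    have "laurent (\<lambda>u v. v powi 1 * N ((1 / cq\<^sup>2) * u powi (-1) * v powi 1) (cq * u powi 0 * v powi (-1)))"
      by (intro laurent_mult laurent_snd laurent_monomial_substitution N) auto
    then have "laurent (\<lambda>u v. v * N (v / (u * cq\<^sup>2)) (cq / v))"
      by (rule laurent_cong) (simp add: power_int_minus divide_inverse mult_ac)
    then show thesis using that unfolding laurent_def by blast
  qed
  define reg where "reg z1 z2 \<longleftrightarrow> omega_regular av \<pi> \<iota> star \<kappa> x (- z1 + z2 - 2) (- z2 + 1)" for z1 z2
  define val where "val z1 z2 = (cq powr z2 - cq powr (z1 + 1)) * omega av \<pi> \<iota> star \<kappa> x (- z1 + z2 - 2) (- z2 + 1)" for z1 z2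
  have sub: "cq powr (- z1 + z2 - 2) = cq powr z2 / (cq powr z1 * cq\<^sup>2)" "cq powr (- z2 + 1) = cq / cq powr z2" for z1 z2
  proof -
    have "cq powr (2 :: complex) = cq\<^sup>2" using powr_nat[of cq 2] by simp
    then show "cq powr (- z1 + z2 - 2) = cq powr z2 / (cq powr z1 * cq\<^sup>2)"
      by (simp add: powr_add powr_diff powr_minus divide_inverse mult_ac)
    show "cq powr (- z2 + 1) = cq / cq powr z2" by (simp add: powr_add powr_minus powr_diff divide_inverse)
  qed
  have factor: "cq powr z2 - cq powr (z1 + 1) = cq powr z2 * (1 - inverse (cq powr (- z1 + z2 - 2)) / cq)" for z1 z2
    unfolding sub by (simp add: powr_add power2_eq_square divide_inverse algebra_simps)
  have regular: "reg z1 z2" if "1 - inverse (cq powr (- z1 + z2 - 2)) / cq \<noteq> 0" for z1 z2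
    unfolding reg_def omega_regular_def Let_def card_cq using fr that Q[OF cq_powr_nonzero cq_powr_nonzero] by metis
  have val: "val z1 z2 = leval L (cq powr z1) (cq powr z2)" if r: "reg z1 z2" for z1 z2
  proof -
    define u v where "u = cq powr (- z1 + z2 - 2)" and "v = cq powr (- z2 + 1)"
    have uv: "u \<noteq> 0" "v \<noteq> 0" by (simp_all add: u_def v_def)
    obtain P' Q' where PQ': "omega_fraction av \<pi> \<iota> star \<kappa> x P' Q'" "leval Q' u v \<noteq> 0"
      using r unfolding reg_def omega_regular_def Let_def card_cq u_def v_def by blast
    have om_eq: "omega av \<pi> \<iota> star \<kappa> x (- z1 + z2 - 2) (- z2 + 1) = leval P' u v / leval Q' u v"
      unfolding omega_def Let_def card_cq u_def[symmetric] v_def[symmetric]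
    proof (rule the_equality)
      fix w assume "\<exists>P Q. omega_fraction av \<pi> \<iota> star \<kappa> x P Q \<and> leval Q u v \<noteq> 0 \<and> w = leval P u v / leval Q u v"
      then obtain P2 Q2 where "omega_fraction av \<pi> \<iota> star \<kappa> x P2 Q2" "leval Q2 u v \<noteq> 0" "w = leval P2 u v / leval Q2 u v" by blast
      then show "w = leval P' u v / leval Q' u v"
        using omega_fraction_unique[OF _ PQ'(1) uv] PQ'(2) by (simp add: frac_eq_eq)
    qed (use PQ' in blast)
    have "N u v * leval Q' u v = leval P' u v * (1 - inverse u / cq)"
      using omega_fraction_unique[OF fr PQ'(1) uv] P[OF uv] Q[OF uv] by simp
    then have "(1 - inverse u / cq) * (leval P' u v / leval Q' u v) = N u v" using PQ'(2) by (simp add: field_simps)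
    then have "val z1 z2 = cq powr z2 * N u v"
      unfolding val_def factor u_def[symmetric] om_eq by (simp only: mult.assoc)
    then show ?thesis unfolding u_def v_def sub L[OF cq_powr_nonzero cq_powr_nonzero] .
  qed
  have "Psi av \<pi> \<iota> star \<kappa> x = L"
    unfolding Psi_def Let_def card_cq reg_def[symmetric] val_def[symmetric]
  proof (rule the_equality)
    show "\<forall>z1 z2. reg z1 z2 \<longrightarrow> leval L (cq powr z1) (cq powr z2) = val z1 z2" using val by simp
    fix M assume M: "\<forall>z1 z2. reg z1 z2 \<longrightarrow> leval M (cq powr z1) (cq powr z2) = val z1 z2"
    \<comment> \<open>For positive \<open>u\<close> and negative \<open>v\<close> the factor
      \<open>v - u * cq\<close> never vanishes, so all points of this infinite product set are
      regular.\<close>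
    show "M = L"
    proof (rule laurent_poly_unique[OF infinite_real_image(1) _ infinite_real_image(2)])
      fix u v assume "u \<in> complex_of_real ` {0<..}" "v \<in> complex_of_real ` {..<0}"
      then obtain s t where st: "u = of_real s" "s > 0" "v = of_real t" "t < 0" by auto
      then have "u \<noteq> 0" "v \<noteq> 0" by simp_all
      then obtain z1 z2 where z: "cq powr z1 = u" "cq powr z2 = v" using cq_surj by metis
      have "v - u * cq \<noteq> 0"
      proof -
        have "s * q > 0" using st(2) q_pos by simp
        then have "t - s * q \<noteq> 0" using st(4) by linarith
        then have "complex_of_real (t - s * q) \<noteq> 0" unfolding of_real_eq_0_iff .
        then show ?thesis by (simp add: st cq_def)
      qed
      then have "cq powr z2 - cq powr (z1 + 1) \<noteq> 0" by (simp add: powr_add z)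
      then have "reg z1 z2" unfolding factor by (intro regular) (metis mult_zero_right)
      then show "leval M u v = leval L u v" using M val z by metis
    qed auto
  qed
  then show ?thesis using L uv by simp
qed

section \<open>Explicit form of \<open>Psi\<close> on the orbits\<close>

lemma laurent_diag_poly: "laurent (\<lambda>u v. diag_poly n (inverse u / c))"
proof (induction n rule: less_induct)
  case (less n)
  have m: "laurent (\<lambda>u v. inverse u / c)"
    by (rule laurent_cong[OF laurent_monom[of "1 / c" "-1" 0]]) (simp add: power_int_minus divide_inverse)
  note I = laurent_add laurent_mult laurent_const m
  consider "n = 0" | "n = Suc 0" | k where "n = Suc (Suc k)" by (metis old.nat.exhaust)
  then show ?case
  proof cases
    case 1
    have "laurent (\<lambda>u v. of_real q * (of_real q - 1) * (1 + inverse u / c))" by (intro I)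
    then show ?thesis by (simp add: 1)
  next
    case 2
    have "laurent (\<lambda>u v. (1 + (- of_real q) * (inverse u / c)) * ((of_real q)\<^sup>2 + ((of_real q)\<^sup>2 - of_real q - 1) * (inverse u / c))
       + of_real q * ((of_real q)\<^sup>2 - 1) * ((inverse u / c) * (inverse u / c)))" by (intro I)
    then show ?thesis by (simp add: 2 power2_eq_square)
  next
    case 3
    have "laurent (\<lambda>u v. (1 + inverse u / c) * diag_poly (Suc k) (inverse u / c) + (- 1) * ((inverse u / c) * diag_poly k (inverse u / c)))"
      using less[of k] less[of "Suc k"] 3 by (intro I) auto
    then show ?thesis by (simp add: 3)
  qed
qed

text \<open>The power of \<open>y\<close> centres the exponents; after that both families satisfy
  the recursion of \<open>macp\<close> with the same initial values up to the factor
  \<open>cq\<^sup>2\<close>.\<close>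

lemma diag_poly_macp:
  assumes y: "y \<noteq> 0"
  shows "y ^ Suc n * diag_poly n (1 / y\<^sup>2) = cq\<^sup>2 * macp cq n y"
proof (induction n rule: less_induct)
  case (less n)
  define z where "z = 1 / y"
  have yz: "y * z = 1" "y * (z * t) = t" for t using y by (simp_all add: z_def)
  have cc: "cq * (1 / cq) = 1" by simp
  consider "n = 0" | "n = Suc 0" | k where "n = Suc (Suc k)" by (metis old.nat.exhaust)
  then show ?case
  proof cases
    case 1
    have "y * (cq * (cq - 1) * (1 + z\<^sup>2)) = cq\<^sup>2 * ((1 - 1 / cq) * (y + z))"
      by (simp add: algebra_simps power2_eq_square yz)
    then show ?thesis by (simp add: 1 z_def cq_def power_one_over)
  next
    case 2
    have "y * y * ((1 - cq * z\<^sup>2) * (cq\<^sup>2 + (cq\<^sup>2 - cq - 1) * z\<^sup>2) + cq * (cq\<^sup>2 - 1) * (z\<^sup>2)\<^sup>2)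
      = cq\<^sup>2 * (y\<^sup>2 + z\<^sup>2 + 1 - (1 / cq\<^sup>2 + cq) - 1 / cq)"
      by (simp add: algebra_simps power2_eq_square yz)
    then show ?thesis by (simp add: 2 z_def cq_def power_one_over)
  next
    case 3
    have "y ^ Suc n * diag_poly n w = (y + y * w) * (y ^ Suc (Suc k) * diag_poly (Suc k) w) - (y * y * w) * (y ^ Suc k * diag_poly k w)" for w
      unfolding 3 diag_poly.simps(3) by (simp add: algebra_simps)
    then have "y ^ Suc n * diag_poly n (1 / y\<^sup>2) = (y + 1 / y) * (y ^ Suc (Suc k) * diag_poly (Suc k) (1 / y\<^sup>2)) - y ^ Suc k * diag_poly k (1 / y\<^sup>2)"
      using y by (simp add: power2_eq_square del: power_Suc)
    also have "\<dots> = (y + 1 / y) * (cq\<^sup>2 * macp cq (Suc k) y) - cq\<^sup>2 * macp cq k y"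
      using less[of k] less[of "Suc k"] 3 by (simp del: power_Suc)
    finally show ?thesis by (simp add: 3 algebra_simps)
  qed
qed


text \<open>In the variables \<open>u\<close> and \<open>y\<close> the argument of
  \<open>diag_poly\<close> becomes \<open>1 / y\<^sup>2\<close>, and the remaining powers of
  \<open>y\<close> are exactly those that \<open>diag_poly_macp\<close> absorbs.\<close>

lemma Psi_even:
  assumes x: "x \<in> inv_class (n - int \<delta>) n" and n: "even (n - int \<delta>)" and uy: "u \<noteq> 0" "y \<noteq> 0"
  shows "leval (Psi av \<pi> \<iota> star \<kappa> x) (u / y) (u * y) = cq powi (2 - int \<delta>) / (cq\<^sup>2 + 1) * u powi (n + 1) * macp cq \<delta> y"
proof -
  obtain \<alpha> where \<alpha>: "n - int \<delta> = 2 * \<alpha>" using n by (elim evenE)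
  then have n_eq: "n = 2 * \<alpha> + int \<delta>" by simp
  define N where "N U V = U powi (- \<alpha>) * V powi (- n) * (diag_poly \<delta> (inverse U / cq\<^sup>2) * (1 / (cq\<^sup>2 + 1)))" for U V
  have "laurent N" unfolding N_def by (intro laurent_mult laurent_fst laurent_snd laurent_const laurent_diag_poly)
  moreover have "(1 - inverse (cq powr s1) / cq) * omega_int av \<iota> star \<kappa> x s1 s2 = N (cq powr s1) (cq powr s2)" if "Re s1 \<ge> 0" for s1 s2
    using omega_int_even[of x \<alpha> \<delta> s1 "cq powr s1" "cq powr s2" s2] x that n_eq by (simp add: N_def cq_def)
  ultimately have "leval (Psi av \<pi> \<iota> star \<kappa> x) (u / y) (u * y) = (u * y) * N ((u * y) / (u / y * cq\<^sup>2)) (cq / (u * y))"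
    using uy by (intro Psi_from_numerator) auto
  also have "(u * y) / (u / y * cq\<^sup>2) = y\<^sup>2 / cq\<^sup>2" using uy by (simp add: power2_eq_square)
  also have "(u * y) * N (y\<^sup>2 / cq\<^sup>2) (cq / (u * y)) = (u * y) * ((y\<^sup>2 / cq\<^sup>2) powi (- \<alpha>) * (cq / (u * y)) powi (- n)) * diag_poly \<delta> (1 / y\<^sup>2) / (cq\<^sup>2 + 1)"
    by (simp add: N_def)
  also have "(y\<^sup>2 / cq\<^sup>2) powi (- \<alpha>) * (cq / (u * y)) powi (- n) = u powi n * y ^ \<delta> * cq powi (- int \<delta>)"
  proof -
    have sq: "(t\<^sup>2) powi (- \<alpha>) = t powi (- 2 * \<alpha>)" for t :: complex
      using power_int_mult[of t 2 "- \<alpha>"] by simp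
    have "(y\<^sup>2 / cq\<^sup>2) powi (- \<alpha>) * (cq / (u * y)) powi (- n) = (y powi (- 2 * \<alpha>) * y powi n) * u powi n * (cq powi (- n) / cq powi (- 2 * \<alpha>))"
      unfolding power_int_divide_distrib power_int_mult_distrib sq by (simp add: power_int_minus divide_inverse mult_ac)
    also have "y powi (- 2 * \<alpha>) * y powi n = y powi int \<delta>" using uy by (simp add: n_eq flip: power_int_add)
    also have "cq powi (- n) / cq powi (- 2 * \<alpha>) = cq powi (- int \<delta>)" by (simp add: n_eq flip: power_int_diff)
    finally show ?thesis by simp
  qed
  also have "(u * y) * (u powi n * y ^ \<delta> * cq powi (- int \<delta>)) * diag_poly \<delta> (1 / y\<^sup>2) / (cq\<^sup>2 + 1)
     = u powi (n + 1) * cq powi (- int \<delta>) * (y ^ Suc \<delta> * diag_poly \<delta> (1 / y\<^sup>2)) / (cq\<^sup>2 + 1)"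
    using uy by (simp add: power_int_add mult_ac)
  also have "\<dots> = cq powi (2 - int \<delta>) / (cq\<^sup>2 + 1) * u powi (n + 1) * macp cq \<delta> y"
    unfolding diag_poly_macp[OF uy(2)] by (simp add: power_int_diff power_int_minus divide_inverse mult_ac)
  finally show ?thesis .
qed

text \<open>The same substitution; all powers of \<open>y\<close> cancel, so odd orbits give
  constants in \<open>y\<close>.\<close>

lemma Psi_odd:
  assumes x: "x \<in> inv_class n n" and n: "odd n" and uy: "u \<noteq> 0" "y \<noteq> 0"
  shows "leval (Psi av \<pi> \<iota> star \<kappa> x) (u / y) (u * y) = (cq - 1) * u powi (n + 1)"
proof -
  obtain e where n_eq: "n = 2 * e + 1" using n by (elim oddE)
  define N where "N U V = U powi (- (e + 1)) * V powi (- n) * (1 - 1 / cq)" for U V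
  have "laurent N" unfolding N_def by (intro laurent_mult laurent_fst laurent_snd laurent_const)
  moreover have "(1 - inverse (cq powr s1) / cq) * omega_int av \<iota> star \<kappa> x s1 s2 = N (cq powr s1) (cq powr s2)" if "Re s1 \<ge> 0" for s1 s2
    using omega_int_odd[of x e s1 "cq powr s1" "cq powr s2" s2] x that unfolding n_eq N_def cq_def by blast
  ultimately have "leval (Psi av \<pi> \<iota> star \<kappa> x) (u / y) (u * y) = (u * y) * N ((u * y) / (u / y * cq\<^sup>2)) (cq / (u * y))"
    using uy by (intro Psi_from_numerator) auto
  also have "(u * y) / (u / y * cq\<^sup>2) = y\<^sup>2 / cq\<^sup>2" using uy by (simp add: power2_eq_square)
  also have "(u * y) * N (y\<^sup>2 / cq\<^sup>2) (cq / (u * y)) = (u * y) * ((y\<^sup>2 / cq\<^sup>2) powi (- (e + 1)) * (cq / (u * y)) powi (- n)) * (1 - 1 / cq)"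
    by (simp only: N_def mult.assoc)
  also have "(y\<^sup>2 / cq\<^sup>2) powi (- (e + 1)) * (cq / (u * y)) powi (- n) = u powi n * cq / y"
  proof -
    have sq: "(t\<^sup>2) powi (- (e + 1)) = t powi (- 2 * (e + 1))" for t :: complex
      using power_int_mult[of t 2 "- (e + 1)"] by (simp only: power_int_numeral mult_minus_left mult_minus_right)
    have "(y\<^sup>2 / cq\<^sup>2) powi (- (e + 1)) * (cq / (u * y)) powi (- n) = (y powi (- 2 * (e + 1)) * y powi n) * u powi n * (cq powi (- n) / cq powi (- 2 * (e + 1)))"
      unfolding power_int_divide_distrib power_int_mult_distrib sq by (simp add: power_int_minus[of _ n] divide_inverse mult_ac)
    also have "y powi (- 2 * (e + 1)) * y powi n = 1 / y"
    proof -
      have *: "- 2 * (e + 1) + n = - 1" by (simp add: n_eq)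
      have "y powi (- 2 * (e + 1)) * y powi n = y powi (- 1)" using uy power_int_add[of y "- 2 * (e + 1)" n] unfolding * by simp
      then show ?thesis by (simp add: power_int_minus divide_inverse)
    qed
    also have "cq powi (- n) / cq powi (- 2 * (e + 1)) = cq"
    proof -
      have "- n - - 2 * (e + 1) = 1" by (simp add: n_eq)
      then show ?thesis using power_int_diff[of cq "- n" "- 2 * (e + 1)"] by (simp only: cq_simps simp_thms power_int_1_right)
    qed
    finally show ?thesis by simp
  qed
  also have "(u * y) * (u powi n * cq / y) * (1 - 1 / cq) = (cq - 1) * u powi (n + 1)"
    using uy by (simp add: power_int_add algebra_simps)
  finally show ?thesis .
qed

end

section \<open>Orbits, their transforms and the inversion formula\<close>

lemma matrix_inv_eqI:
  fixes A :: "'a::semiring_1 ^ 'n ^ 'n"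
  assumes "A ** B = mat 1" "B ** A = mat 1" shows "matrix_inv A = B"
proof -
  have "\<exists>B. A ** B = mat 1 \<and> B ** A = mat 1" using assms by blast
  then have "A ** matrix_inv A = mat 1 \<and> matrix_inv A ** A = mat 1"
    unfolding matrix_inv_def by (rule someI_ex)
  then show ?thesis using assms by (metis matrix_mul_assoc matrix_mul_lid matrix_mul_rid)
qed

locale spherical_inversion = invariant_measure av \<pi> \<iota> star \<mu> + haar_quaternion av \<pi> \<iota> star \<kappa>
  for av :: "'k::field_char_0 \<Rightarrow> real" and \<pi> :: 'k
    and \<iota> :: "'k \<Rightarrow> 'd::{division_ring, metric_space}" and star :: "'d \<Rightarrow> 'd"
    and \<mu> \<kappa> :: "('d ^ 2 ^ 2) measure"
begin

text \<open>The inverse is the adjugate divided by the determinant, so the size is divided by the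
  square of the absolute value of the determinant.\<close>

lemma matrix_inv_inv_class:
  assumes A: "A \<in> inv_class m n" shows "matrix_inv A \<in> inv_class (m - 2 * n) (- n)"
proof -
  have h: "A \<in> herm star" "msize A = q powi (- m)" "av (hdet A) = q powi (- n)" using A by (auto simp: inv_class_def)
  obtain a b d where abd: "A = hm a b d" "a * d - nm b \<noteq> 0" using herm_exists[OF h(1)] by blast
  define D where "D = a * d - nm b"
  define t where "t = inverse D"
  have D: "D \<noteq> 0" "av D = q powi (- n)" using abd h(3) by (simp_all add: D_def)
  have t: "t \<noteq> 0" "av t = q powi n" using D by (simp_all add: t_def av_inverse power_int_minus)
  have inv: "matrix_inv A = hm (t * d) (- \<iota> t * b) (t * a)"
    using hermitian_inverse[OF abd(2)] unfolding abd(1) t_def D_def by (rule matrix_inv_eqI)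
  have nmb: "nm (- \<iota> t * b) = t\<^sup>2 * nm b" by (simp add: nm_mult)
  have det: "t * d * (t * a) - nm (- \<iota> t * b) = t"
  proof -
    have "t * d * (t * a) - nm (- \<iota> t * b) = t * (t * D)" unfolding nmb D_def by (simp add: algebra_simps power2_eq_square)
    then show ?thesis using D(1) by (simp add: t_def)
  qed
  have "msize (matrix_inv A) = (av t)\<^sup>2 * msize A"
  proof -
    have s: "max (k * x) (k * y) = k * max x y" if "0 \<le> k" for k x y :: real using that by (simp add: max_mult_distrib_left)
    have "(av (t * d))\<^sup>2 = (av t)\<^sup>2 * (av d)\<^sup>2" "nr (- \<iota> t * b) = (av t)\<^sup>2 * nr b" "(av (t * a))\<^sup>2 = (av t)\<^sup>2 * (av a)\<^sup>2"
      by (simp_all add: av_mult power_mult_distrib nr_mult nr_iota)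
    then show ?thesis unfolding inv unfolding abd(1) msize_hm by (simp add: s max.commute max.left_commute max.assoc)
  qed
  also have "\<dots> = q powi (- (m - 2 * n))"
    unfolding t(2) h(2) by (simp add: power2_eq_square flip: power_int_add)
  finally have "msize (matrix_inv A) = q powi (- (m - 2 * n))" .
  moreover have "hdet (matrix_inv A) = t" "matrix_inv A \<in> herm star"
    unfolding inv by (simp_all only: hdet_hm herm_hm_iff det t(1) not_False_eq_True)
  ultimately show ?thesis using t(2) by (simp add: inv_class_def)
qed

text \<open>An orbit is indexed by the order \<open>n\<close> of its determinant together with \<open>0\<close> for the orbits of
  odd size, which contain no diagonal matrix, and with \<open>Suc \<delta>\<close> for the orbit of the diagonal
  matrix with entries \<open>\<pi>\<^sup>\<alpha>\<close>, \<open>\<pi>\<^sup>\<alpha>\<^sup>+\<^sup>\<delta>\<close>.\<close>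

definition class_set :: "int \<times> nat \<Rightarrow> ('d ^ 2 ^ 2) set" where
  "class_set k = (case k of (n, 0) \<Rightarrow> inv_class n n | (n, Suc \<delta>) \<Rightarrow> inv_class (n - int \<delta>) n)"

definition admissible :: "int \<times> nat \<Rightarrow> bool" where
  "admissible k \<longleftrightarrow> (case k of (n, 0) \<Rightarrow> odd n | (n, Suc \<delta>) \<Rightarrow> even (n - int \<delta>))"

definition class_coeff :: "nat \<Rightarrow> real" where
  "class_coeff i = (case i of 0 \<Rightarrow> q - 1 | Suc \<delta> \<Rightarrow> q powi (2 - int \<delta>) / (q\<^sup>2 + 1))"

definition class_volume :: "nat \<Rightarrow> real" where
  "class_volume i = (case i of 0 \<Rightarrow> (q + 1) / (q\<^sup>2 + 1) | Suc \<delta> \<Rightarrow> if \<delta> = 0 then 1 else q ^ (2 * \<delta>) * (1 - 1 / q))"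

lemma class_set_herm: "class_set k \<subseteq> herm star"
  by (auto simp: class_set_def inv_class_def split: prod.splits nat.splits)

text \<open>By \<open>av_hdet_le\<close> the orders of determinant and size differ by a natural
  number, and by \<open>odd_size_hdet\<close> the difference is 0 for odd size.\<close>

lemma class_exists: assumes A: "A \<in> herm star" obtains k where "admissible k" "A \<in> class_set k"
proof -
  obtain m where m: "msize A = q powi (- m)" using msize_discrete[OF A] by blast
  have "hdet A \<noteq> 0" "adj star A = A" using A by (auto simp: herm_iff)
  then obtain n where n: "av (hdet A) = q powi (- n)" and le: "av (hdet A) \<le> msize A" using av_discrete av_hdet_le by metis
  have mn: "m \<le> n" using le unfolding m n powi_q_le_iff by simp
  have mem: "A \<in> inv_class m n" using A m n by (simp add: inv_class_def)
  show thesis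
  proof (cases "even m")
    case True
    obtain \<delta> where "n = m + int \<delta>" using mn by (metis zle_iff_zadd)
    then show thesis using that[of "(n, Suc \<delta>)"] mem True by (simp add: admissible_def class_set_def)
  next
    case False
    then obtain e where e: "m = 2 * e + 1" by (elim oddE)
    have "q powi (- n) = q powi (- m)" using odd_size_hdet[OF A, of e] m n e by simp
    then have "n = m" unfolding powi_q_eq_iff by simp
    then show thesis using that[of "(n, 0)"] mem False by (simp add: admissible_def class_set_def)
  qed
qed

lemma class_disjoint:
  assumes "admissible k" "admissible l" "A \<in> class_set k" "A \<in> class_set l" shows "k = l"
proof -
  have "m = m' \<and> n = n'" if "A \<in> inv_class m n" "A \<in> inv_class m' n'" for m n m' n'
  proof -
    have "q powi (- m) = q powi (- m')" "q powi (- n) = q powi (- n')" using that by (auto simp: inv_class_def)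
    then show ?thesis unfolding powi_q_eq_iff by simp
  qed
  note eq = this
  show ?thesis
    using assms unfolding admissible_def class_set_def
    by (auto split: prod.splits nat.splits dest: eq)
qed

lemma class_orbit: "A \<in> class_set k \<Longrightarrow> orbit star {x. nr x \<le> 1} A = class_set k"
  by (auto simp: class_set_def orbit_inv_class split: prod.splits nat.splits)

lemma class_measurable: "class_set k \<in> sets \<mu>"
  by (auto simp: class_set_def intro: ropen_measurable ropen_inv_class split: prod.splits nat.splits)

lemma class_measure:
  assumes "admissible k" shows "emeasure \<mu> (class_set k) < \<infinity>" "measure \<mu> (class_set k) = class_volume (snd k)"
proof -
  obtain n i where k: "k = (n, i)" by (cases k)
  have "emeasure \<mu> (class_set k) \<noteq> \<infinity> \<and> measure \<mu> (class_set k) = class_volume (snd k)"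
  proof (cases i)
    case 0
    then obtain e where "n = 2 * e + 1" using assms by (auto simp: k admissible_def elim: oddE)
    then show ?thesis using measure_inv_class_odd[of e] by (simp add: k 0 class_set_def class_volume_def)
  next
    case (Suc \<delta>)
    then have "even (n - int \<delta>)" using assms by (simp add: k admissible_def)
    then obtain e where e: "n - int \<delta> = 2 * e" by (elim evenE)
    then have "n = 2 * e + int \<delta>" by simp
    then show ?thesis using measure_inv_class_even[of e \<delta>] by (simp add: k Suc class_set_def class_volume_def)
  qed
  then show "emeasure \<mu> (class_set k) < \<infinity>" "measure \<mu> (class_set k) = class_volume (snd k)" by (auto simp: less_top)
qed

sublocale contour: weight_contour "residue_card av \<pi>"
proof
  have "real (residue_card av \<pi>) > 1" using q_gt_1 by (simp add: q_def)
  then show "2 \<le> residue_card av \<pi>" by linarith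
qed

lemma contour_b: "contour.b = cq"
  by (simp add: contour.b_def card_cq)

text \<open>The transform evaluates \<open>Psi\<close> at inverses, whose determinants have order
  \<open>- n\<close>; this produces the exponent \<open>1 - n\<close>.\<close>

lemma Psi_matrix_inv:
  assumes k: "admissible k" and A: "A \<in> class_set k" and uy: "u \<noteq> 0" "y \<noteq> 0"
  shows "leval (Psi av \<pi> \<iota> star \<kappa> (matrix_inv A)) (u / y) (u * y)
    = of_real (class_coeff (snd k)) * u powi (1 - fst k) * contour.basis_poly (snd k) y"
proof -
  obtain n i where k_eq: "k = (n, i)" by (cases k)
  show ?thesis
  proof (cases i)
    case 0
    have "matrix_inv A \<in> inv_class (- n) (- n)" "odd (- n)"
      using k A matrix_inv_inv_class[of A n n] by (simp_all add: k_eq 0 admissible_def class_set_def)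
    from Psi_odd[OF this uy] show ?thesis
      by (simp add: k_eq 0 class_coeff_def contour.basis_poly_def cq_def)
  next
    case (Suc \<delta>)
    have "matrix_inv A \<in> inv_class (- n - int \<delta>) (- n)" "even (- n - int \<delta>)"
      using k A matrix_inv_inv_class[of A "n - int \<delta>" n] by (simp_all add: k_eq Suc admissible_def class_set_def)
    from Psi_even[OF this uy] have "leval (Psi av \<pi> \<iota> star \<kappa> (matrix_inv A)) (u / y) (u * y)
      = cq powi (2 - int \<delta>) / (cq\<^sup>2 + 1) * u powi (1 - n) * macp cq \<delta> y" by simp
    moreover have "of_real (class_coeff (Suc \<delta>)) = cq powi (2 - int \<delta>) / (cq\<^sup>2 + 1)"
      unfolding class_coeff_def nat.case by (simp add: cq_def)
    ultimately show ?thesis by (simp add: k_eq Suc contour.basis_poly_def contour_b)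
  qed
qed

lemma laurent_macp: "laurent (\<lambda>u y. macp b n y)"
proof -
  obtain c where "\<And>y. y \<noteq> 0 \<Longrightarrow> macp b n y = (\<Sum>j\<in>{- int (Suc n)..int (Suc n)}. c j * y powi j)"
    using symdeg_macp[of n b] unfolding symdeg_def by blast
  moreover have "laurent (\<lambda>u y. \<Sum>j\<in>{- int (Suc n)..int (Suc n)}. c j * y powi j)"
    by (intro laurent_sum laurent_mult laurent_const laurent_snd) auto
  ultimately show ?thesis by (auto intro: laurent_cong)
qed

lemma laurent_basis: "laurent (\<lambda>u y. contour.basis_poly i y)"
  by (cases i) (simp_all add: contour.basis_poly_def laurent_macp laurent_const)

text \<open>On each orbit the integrand is constant, so the integral reduces to volumes. The
  description defining the transform is resolved because powers of \<open>q\<close> reach every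
  nonzero complex number.\<close>

lemma transform_finite_combination:
  assumes I: "finite I" "\<And>k. k \<in> I \<Longrightarrow> admissible k"
    and \<phi>: "\<And>A. A \<in> herm star \<Longrightarrow> \<phi> A = (\<Sum>k\<in>I. c k * indicator (class_set k) A)"
    and uy: "u \<noteq> 0" "y \<noteq> 0"
  shows "leval (spherical_transform av \<pi> \<iota> star \<kappa> \<mu> \<phi>) u y
    = (\<Sum>k\<in>I. c k * of_real (class_volume (snd k) * class_coeff (snd k)) * u powi (1 - fst k) * contour.basis_poly (snd k) y)"
proof -
  define R where "R u y = (\<Sum>k\<in>I. c k * of_real (class_volume (snd k) * class_coeff (snd k)) * u powi (1 - fst k) * contour.basis_poly (snd k) y)" for u y
  have int: "spherical_integral av \<pi> \<iota> star \<kappa> \<mu> \<phi> (x - z) (x + z) = R (cq powr x) (cq powr z)" for x z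
  proof -
    let ?v = "\<lambda>k. of_real (class_coeff (snd k)) * (cq powr x) powi (1 - fst k) * contour.basis_poly (snd k) (cq powr z)"
    have "spherical_integral av \<pi> \<iota> star \<kappa> \<mu> \<phi> (x - z) (x + z)
      = (\<integral>A. (\<Sum>k\<in>I. indicator (class_set k) A *\<^sub>R (c k * ?v k)) \<partial>\<mu>)"
      unfolding spherical_integral_def Let_def card_cq
    proof (rule Bochner_Integration.integral_cong[OF refl])
      fix A assume "A \<in> space \<mu>"
      then have A: "A \<in> herm star" by (simp add: space_mu)
      have "indicator (class_set k) A * (c k * leval (Psi av \<pi> \<iota> star \<kappa> (matrix_inv A)) (cq powr (x - z)) (cq powr (x + z)))
          = indicator (class_set k) A *\<^sub>R (c k * ?v k)" if "k \<in> I" for k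
        using Psi_matrix_inv[OF I(2)[OF that], of A "cq powr x" "cq powr z"]
        by (auto simp: indicator_def powr_diff powr_add)
      then show "\<phi> A * leval (Psi av \<pi> \<iota> star \<kappa> (matrix_inv A)) (cq powr (x - z)) (cq powr (x + z))
          = (\<Sum>k\<in>I. indicator (class_set k) A *\<^sub>R (c k * ?v k))"
        unfolding \<phi>[OF A] sum_distrib_right by (intro sum.cong refl) (simp add: mult_ac)
    qed
    also have "\<dots> = (\<Sum>k\<in>I. measure \<mu> (class_set k) *\<^sub>R (c k * ?v k))"
      by (intro has_bochner_integral_integral_eq has_bochner_integral_sum has_bochner_integral_indicator class_measurable class_measure I)
    also have "\<dots> = R (cq powr x) (cq powr z)"
      unfolding R_def by (intro sum.cong refl) (simp add: class_measure(2) I(2) scaleR_conv_of_real mult_ac)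
    finally show ?thesis .
  qed
  obtain L where L: "\<And>u y. u \<noteq> 0 \<Longrightarrow> y \<noteq> 0 \<Longrightarrow> leval L u y = R u y"
  proof -
    have "laurent R" unfolding R_def
      by (intro laurent_sum I(1) laurent_mult laurent_const laurent_fst laurent_basis)
    then show thesis using that unfolding laurent_def by blast
  qed
  have "spherical_transform av \<pi> \<iota> star \<kappa> \<mu> \<phi> = L"
    unfolding spherical_transform_def Let_def card_cq int
  proof (rule the_equality)
    show "\<forall>x y. leval L (cq powr x) (cq powr y) = R (cq powr x) (cq powr y)" using L by simp
    fix M assume M: "\<forall>x y. leval M (cq powr x) (cq powr y) = R (cq powr x) (cq powr y)"
    show "M = L"
    proof (rule laurent_poly_unique[OF infinite_real_image(1) _ infinite_real_image(1)])
      fix u v assume "u \<in> complex_of_real ` {0<..}" "v \<in> complex_of_real ` {0<..}"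
      then have "u \<noteq> 0" "v \<noteq> 0" by auto
      then show "leval M u v = leval L u v" using M L cq_surj by metis
    qed auto
  qed
  then show ?thesis using L[OF uy] by (simp add: R_def)
qed

text \<open>The numerical fact behind the theorem: the prefactor of the inner product, the squared
  coefficient and the norm of the polynomial multiply to the reciprocal of the volume.\<close>

lemma norm_constant:
  "((1 + q powi (- 2))\<^sup>2 / (2 * (1 - q powi (- 1)))) * (class_volume i * (class_coeff i)\<^sup>2) * (case i of 0 \<Rightarrow> 2 / (q - 1 / q ^ 3) | Suc n \<Rightarrow> 2 * (if n = 0 then 1 - 1 / q else 1)) = 1"
proof -
  have q0: "q \<noteq> 0" "q - 1 \<noteq> 0" "q + 1 \<noteq> 0" "q\<^sup>2 + 1 \<noteq> 0"
  proof -
    have "q\<^sup>2 + 1 > 0" by (simp add: add_pos_pos)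
    then show "q \<noteq> 0" "q - 1 \<noteq> 0" "q + 1 \<noteq> 0" "q\<^sup>2 + 1 \<noteq> 0" using q_gt_1 by linarith+
  qed
  have s: "1 + q powi (- 2) = (q\<^sup>2 + 1) / q\<^sup>2" "1 - q powi (- 1) = (q - 1) / q" "1 - 1 / q = (q - 1) / q"
    using q0 by (simp_all add: power_int_minus divide_simps)
  show ?thesis
  proof (cases i)
    case 0
    have "q - 1 / q ^ 3 = (q - 1) * (q + 1) * (q\<^sup>2 + 1) / q ^ 3"
      using q0(1) by (simp add: field_simps power2_eq_square power3_eq_cube)
    then show ?thesis unfolding s using q0 by (simp add: 0 class_volume_def class_coeff_def s power2_eq_square power3_eq_cube)
  next
    case (Suc \<delta>)
    define r where "r = q ^ \<delta>"
    have r: "r \<noteq> 0" "q powi (2 - int \<delta>) = q\<^sup>2 / r" "q ^ (2 * \<delta>) = r\<^sup>2"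
      using q0 by (simp_all add: r_def power_int_diff mult.commute[of 2] flip: power_mult)
    show ?thesis unfolding s using q0 r(1)
      by (simp add: Suc class_volume_def class_coeff_def s r r_def power2_eq_square)
  qed
qed

text \<open>Orbits are relatively open, so finitely many of them cover the compact support, and
  \<open>\<phi>\<close> is constant on each.\<close>

lemma schwartz_finite_combination:
  assumes \<phi>: "\<phi> \<in> schwartz_functions star {x. nr x \<le> 1}"
  obtains I c where "finite I" "\<forall>k\<in>I. admissible k"
    "\<forall>A\<in>herm star. \<phi> A = (\<Sum>k\<in>I. c k * indicator (class_set k) A)"
    "\<forall>k. \<forall>A\<in>class_set k. admissible k \<longrightarrow> \<phi> A = (if k \<in> I then c k else 0)"
proof -
  define K where "K = herm star \<inter> closure {x \<in> herm star. \<phi> x \<noteq> 0}"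
  have K: "compact K" using \<phi> by (simp add: schwartz_functions_def K_def)
  have "\<exists>T. open T \<and> class_set k = herm star \<inter> T" for k
  proof (rule relatively_open_exists[OF class_set_herm])
    have "ropen (class_set k)" by (auto simp: class_set_def ropen_inv_class split: prod.splits nat.splits)
    then show "\<And>A. A \<in> class_set k \<Longrightarrow> \<exists>e>0. \<forall>B\<in>herm star. (\<forall>i j. nr (B $ i $ j - A $ i $ j) < e) \<longrightarrow> B \<in> class_set k"
      by (simp add: ropen_def)
  qed
  then obtain T where T: "\<And>k. open (T k)" "\<And>k. class_set k = herm star \<inter> T k" by metis
  have "K \<subseteq> (\<Union>k\<in>Collect admissible. T k)"
  proof
    fix A assume "A \<in> K"
    then have "A \<in> herm star" by (simp add: K_def)
    then obtain k where "admissible k" "A \<in> class_set k" using class_exists by blast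
    then show "A \<in> (\<Union>k\<in>Collect admissible. T k)" using T(2) by blast
  qed
  then obtain I where I: "I \<subseteq> Collect admissible" "finite I" "K \<subseteq> (\<Union>k\<in>I. T k)"
    using compactE_image[OF K, of "Collect admissible" T] T(1) by metis
  define c where "c k = \<phi> (SOME A. A \<in> class_set k)" for k
  have const: "\<phi> A = c k" if A: "A \<in> class_set k" for A k
  proof -
    define B where "B = (SOME A. A \<in> class_set k)"
    have B: "B \<in> class_set k" unfolding B_def using A by (rule someI)
    then have "A \<in> orbit star {x. nr x \<le> 1} B" using A class_orbit by blast
    then obtain g where "g \<in> GL2 {x. nr x \<le> 1}" "A = act star g B" by (auto simp: orbit_def)
    moreover have "B \<in> herm star" using B class_set_herm by blast
    ultimately show ?thesis using \<phi> by (simp add: schwartz_functions_def c_def B_def)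
  qed
  have val: "\<phi> A = (if k \<in> I then c k else 0)" if A: "A \<in> class_set k" and k: "admissible k" for A k
  proof (cases "k \<in> I")
    case False
    have "\<phi> A = 0"
    proof (rule ccontr)
      assume nz: "\<phi> A \<noteq> 0"
      have h: "A \<in> herm star" using A class_set_herm by blast
      then have "A \<in> K" using nz closure_subset by (force simp: K_def)
      then obtain l where "l \<in> I" "A \<in> T l" using I(3) by blast
      then have "A \<in> class_set l" "admissible l" using T(2) h I(1) by auto
      then show False using class_disjoint[OF k _ A] \<open>l \<in> I\<close> False by blast
    qed
    then show ?thesis using False by simp
  qed (use const A in simp)
  show thesis
  proof (rule that[OF I(2)]; intro ballI allI impI)
    fix A assume "A \<in> herm star"
    then obtain k where k: "admissible k" "A \<in> class_set k" using class_exists by blast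
    have "indicator (class_set l) A = (if l = k then 1 else 0 :: complex)" if "l \<in> I" for l
    proof (cases "l = k")
      case False
      have "admissible l" using that I(1) by blast
      then have "A \<notin> class_set l" using class_disjoint[OF _ k(1) _ k(2)] False by blast
      then show ?thesis using False by simp
    qed (simp add: k)
    then have "(\<Sum>l\<in>I. c l * indicator (class_set l) A) = (\<Sum>l\<in>I. if l = k then c l else 0)"
      by (intro sum.cong refl) simp
    then show "\<phi> A = (\<Sum>l\<in>I. c l * indicator (class_set l) A)" using val[OF k(2,1)] I(2) by simp
  qed (use I(1) val in auto)
qed

text \<open>Only the term of the orbit of \<open>x\<close> survives. It carries the square of volume
  times coefficient, and \<open>norm_constant\<close> cancels everything except one factor of the
  volume.\<close>

lemma inversion_formula:
  assumes \<phi>: "\<phi> \<in> schwartz_functions star {x. nr x \<le> 1}" and x: "x \<in> herm star"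
  shows "\<phi> x = 1 / of_real (measure \<mu> (orbit star {x. nr x \<le> 1} x)) *
    inner_product (residue_card av \<pi>) (spherical_transform av \<pi> \<iota> star \<kappa> \<mu> \<phi>)
      (spherical_transform av \<pi> \<iota> star \<kappa> \<mu> (indicator (orbit star {x. nr x \<le> 1} x)))"
proof -
  obtain I c where I': "finite I" "\<forall>k\<in>I. admissible k"
    and comb': "\<forall>A\<in>herm star. \<phi> A = (\<Sum>k\<in>I. c k * indicator (class_set k) A)"
    and val': "\<forall>k. \<forall>A\<in>class_set k. admissible k \<longrightarrow> \<phi> A = (if k \<in> I then c k else 0)"
    using schwartz_finite_combination[OF \<phi>] by blast
  note I = I'(1) I'(2)[rule_format] and comb = comb'[rule_format] and val = val'[rule_format]
  obtain k where k: "admissible k" "x \<in> class_set k" using class_exists[OF x] by blast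
  define V where "V = class_volume (snd k)"
  define C where "C = class_coeff (snd k)"
  have orb: "orbit star {x. nr x \<le> 1} x = class_set k" by (rule class_orbit[OF k(2)])
  let ?w = "\<lambda>i. class_volume i * class_coeff i"
  have g: "leval (spherical_transform av \<pi> \<iota> star \<kappa> \<mu> (indicator (class_set k))) u y
      = of_real (V * C) * u powi (1 - fst k) * contour.basis_poly (snd k) y" if "u \<noteq> 0" "y \<noteq> 0" for u y
    using transform_finite_combination[of "{k}" "indicator (class_set k)" "\<lambda>_. 1" u y] k(1) that by (simp add: V_def C_def)
  have "inner_product (residue_card av \<pi>) (spherical_transform av \<pi> \<iota> star \<kappa> \<mu> \<phi>) (spherical_transform av \<pi> \<iota> star \<kappa> \<mu> (indicator (class_set k)))
      = of_real ((1 + q powi (- 2))\<^sup>2 / (2 * (1 - q powi (- 1)))) * of_real (V * C) * contour.basis_norm (snd k)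
         * (\<Sum>l\<in>I. if 1 - fst l = 1 - fst k \<and> snd l = snd k then c l * of_real (?w (snd l)) else 0)"
    unfolding q_def by (rule contour.inner_product_basis[OF I(1) transform_finite_combination[OF I comb] g])
  also have "(\<Sum>l\<in>I. if 1 - fst l = 1 - fst k \<and> snd l = snd k then c l * of_real (?w (snd l)) else 0) = (\<Sum>l\<in>I. if l = k then c l * of_real (V * C) else 0)"
    by (intro sum.cong refl) (auto simp: prod_eq_iff V_def C_def)
  also have "\<dots> = \<phi> x * of_real (V * C)" using I(1) val[OF k(2,1)] by simp
  also have "contour.basis_norm (snd k) = of_real (case snd k of 0 \<Rightarrow> 2 / (q - 1 / q ^ 3) | Suc n \<Rightarrow> 2 * (if n = 0 then 1 - 1 / q else 1))"
    by (simp add: contour.basis_norm_def contour_b cq_def macp_lead_def split: nat.splits)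
  finally have ip: "inner_product (residue_card av \<pi>) (spherical_transform av \<pi> \<iota> star \<kappa> \<mu> \<phi>) (spherical_transform av \<pi> \<iota> star \<kappa> \<mu> (indicator (class_set k)))
      = \<phi> x * of_real V * of_real (((1 + q powi (- 2))\<^sup>2 / (2 * (1 - q powi (- 1)))) * (V * C\<^sup>2) * (case snd k of 0 \<Rightarrow> 2 / (q - 1 / q ^ 3) | Suc n \<Rightarrow> 2 * (if n = 0 then 1 - 1 / q else 1)))"
    by (simp only: of_real_mult power2_eq_square[of C] mult_ac)
  \<comment> \<open>A product equal to 1 has no vanishing factor.\<close>
  have "V \<noteq> 0"
    using norm_constant[of "snd k"] by (auto simp: V_def)
  moreover have "measure \<mu> (class_set k) = V" using class_measure(2)[OF k(1)] by (simp add: V_def)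
  ultimately show ?thesis unfolding orb ip norm_constant[of "snd k", folded V_def C_def] by simp
qed

end

theorem corollary5p11:
  fixes av :: "'k::field_char_0 \<Rightarrow> real" and \<pi> :: 'k
    and \<iota> :: "'k \<Rightarrow> 'd::{division_ring, metric_space}" and star :: "'d \<Rightarrow> 'd" and Ord :: "'d set"
    and \<kappa> \<mu> :: "('d ^ 2 ^ 2) measure"
    and \<phi> :: "'d ^ 2 ^ 2 \<Rightarrow> complex" and x :: "'d ^ 2 ^ 2"
  assumes "padic_field av \<pi>"
    and "odd (residue_char av)"
    and "division_quaternion_algebra \<iota>"
    and "nrd_metric av \<iota>"
    and "canonical_involution \<iota> star"
    and "maximal_order av \<iota> Ord"
    and "normalized_haar Ord \<kappa>"
    and "normalized_invariant star Ord \<mu>"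
    and "\<phi> \<in> schwartz_functions star Ord"
    and "x \<in> herm star"
  shows "\<phi> x =
    1 / of_real (measure \<mu> (orbit star Ord x)) *
    inner_product (residue_card av \<pi>)
      (spherical_transform av \<pi> \<iota> star \<kappa> \<mu> \<phi>)
      (spherical_transform av \<pi> \<iota> star \<kappa> \<mu> (indicator (orbit star Ord x)))"
proof -
  interpret q: quaternion av \<pi> \<iota> star
    using assms by unfold_locales
  have Ord: "Ord = {y. q.nr y \<le> 1}" using assms(6) by (rule q.maximal_order_eq)
  interpret spherical_inversion av \<pi> \<iota> star \<mu> \<kappa>
    using assms unfolding Ord by unfold_locales
  show ?thesis using assms(9,10) unfolding Ord by (rule inversion_formula)
qed

end
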